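(* Let $\Omega=\{\omega_k\}_{k\in\mathbb{Z}}$ be an arbitrary family of intervals in $\mathbb{R}$ with $\sum_{k}\mathbf 1_{\omega_k}(x)\le B$ for all $x\in\mathbb{R}$, and let $T$ be the associated Littlewood--Paley square function. Then for every $2<p<\infty$ there is a constant $C$, depending only on $p$ and $B$, such that for every weight $w\in A_{p/2}$ $$ \|T\|_{L^p(w)\to L^p(w)}\le C\,[w]_{A_{p/2}}^{\max\left(\frac1{p-2},1\right)} . $$ In particular, for $3\le p<\infty$ one has $\max\big(\frac1{p-2},1\big)=1$, and this exponent is sharp: for $3\le p<\infty$ and any $\beta<1$, the estimate $\|T\|_{L^p(w)\to L^p(w)}\le C'[w]_{A_{p/2}}^{\beta}$ does not hold in general, i.e. with a constant $C'$ uniform over all $w\in A_{p/2}$ and all such families $\Omega$.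
   Context: $\mathbf 1_E$ is the characteristic function of $E$, and $\check h(x)=\int_{\mathbb{R}}h(\xi)e^{2\pi i x\xi}\,d\xi$ is the inverse Fourier transform. The Littlewood--Paley square function associated with $\Omega$ is $$Tf(x):=\Big(\sum_{k\in\mathbb{Z}}|f*\check{\mathbf 1}_{\omega_k}(x)|^2\Big)^{1/2},$$ initially defined on test functions, which are dense in $L^p(w)$. A weight is a nonnegative locally integrable function on $\mathbb{R}$. For $1<q<\infty$, $A_q$ is the class of weights $w$ with $$[w]_{A_q}:=\sup_Q\langle w\rangle_Q\big(\langle w^{1-q'}\rangle_Q\big)^{q-1}<\infty,$$ the supremum being over all intervals $Q\subset\mathbb{R}$, where $\langle w\rangle_Q=\frac1{|Q|}\int_Q w$ and $\frac1q+\frac1{q'}=1$. *)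

theory Defs
  imports "HOL-Analysis.Analysis"
begin

text \<open>Powers on \<open>[0,\<infinity>]\<close>. The library's real \<open>powr\<close> satisfies \<open>0 powr a = 0\<close> for every \<open>a\<close>;
  for the dual weight \<open>w\<close> to the power \<open>1 - q'\<close> it is essential that a zero of \<open>w\<close>
  contributes \<open>\<infinity>\<close>. The conventions here are \<open>x^0 = 1\<close>, \<open>0^a = \<infinity>\<close> and \<open>\<infinity>^a = 0\<close> for \<open>a < 0\<close>,
  and \<open>0^a = 0\<close> and \<open>\<infinity>^a = \<infinity>\<close> for \<open>a > 0\<close>.\<close>

definition epowr :: "ennreal \<Rightarrow> real \<Rightarrow> ennreal"  (infixr \<open>epowr\<close> 80) where
  "x epowr a =
     (if a = 0 then 1
      else if x = 0 then (if a < 0 then \<infinity> else 0)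
      else if x = \<infinity> then (if a < 0 then 0 else \<infinity>)
      else ennreal (enn2real x powr a))"


subsection \<open>Weights\<close>

definition is_weight :: "(real \<Rightarrow> real) \<Rightarrow> bool" where
  "is_weight w \<longleftrightarrow> (\<forall>x. 0 \<le> w x) \<and> (\<forall>a b. w absolutely_integrable_on {a..b})"

definition average :: "real set \<Rightarrow> (real \<Rightarrow> ennreal) \<Rightarrow> ennreal" where
  "average Q v = (\<integral>\<^sup>+x\<in>Q. v x \<partial>lebesgue) / emeasure lebesgue Q"

definition conj_exponent :: "real \<Rightarrow> real" where
  "conj_exponent q = q / (q - 1)"

lemma conj_exponent: "1 / q + 1 / conj_exponent q = 1" if "1 < q"
  using that by (simp add: conj_exponent_def field_simps)

text \<open>The averages are taken over the intervals of positive finite length. As \<open>0 * \<infinity> = 0\<close> in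
  \<^typ>\<open>ennreal\<close>, a weight vanishing almost everywhere has characteristic \<open>0\<close>; its \<open>L\<^sup>p\<close>
  space is trivial. A weight that vanishes on a set of positive measure, but not almost
  everywhere, has characteristic \<open>\<infinity>\<close>.\<close>

definition Aq_const :: "real \<Rightarrow> (real \<Rightarrow> real) \<Rightarrow> ennreal" where
  "Aq_const q w =
     (SUP Q \<in> {Q. is_interval Q \<and> 0 < emeasure lebesgue Q \<and> emeasure lebesgue Q < \<infinity>}.
        average Q (\<lambda>x. ennreal (w x)) *
        average Q (\<lambda>x. ennreal (w x) epowr (1 - conj_exponent q)) epowr (q - 1))"

definition A_class :: "real \<Rightarrow> (real \<Rightarrow> real) set" where
  "A_class q = {w. is_weight w \<and> Aq_const q w < \<infinity>}"

definition wnorm :: "real \<Rightarrow> (real \<Rightarrow> real) \<Rightarrow> (real \<Rightarrow> ennreal) \<Rightarrow> ennreal" where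
  "wnorm p w g = (\<integral>\<^sup>+x. g x epowr p * ennreal (w x) \<partial>lebesgue) epowr (1 / p)"


subsection \<open>The square function\<close>

definition test_function :: "(real \<Rightarrow> complex) \<Rightarrow> bool" where
  "test_function f \<longleftrightarrow>
     (\<exists>D :: nat \<Rightarrow> real \<Rightarrow> complex. D 0 = f \<and>
        (\<forall>n x. (D n has_vector_derivative D (Suc n) x) (at x))) \<and>
     bounded {x. f x \<noteq> 0}"

definition inv_fourier :: "(real \<Rightarrow> complex) \<Rightarrow> real \<Rightarrow> complex" where
  "inv_fourier h x = (LINT \<xi>|lborel. h \<xi> * exp (2 * of_real pi * \<i> * of_real x * of_real \<xi>))"

definition fconv :: "(real \<Rightarrow> complex) \<Rightarrow> (real \<Rightarrow> complex) \<Rightarrow> real \<Rightarrow> complex" where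
  "fconv f g x = (LINT y|lborel. f (x - y) * g y)"

text \<open>The convolution of \<open>f\<close> with the inverse Fourier transform of the indicator of \<open>\<omega>\<close>. For
  unbounded \<open>\<omega>\<close> the latter is only a tempered distribution, namely the distributional limit of
  the inverse transforms of the truncations of \<open>\<omega>\<close>, whence the limit below. For bounded \<open>\<omega>\<close>
  the sequence is eventually constant.\<close>

definition freq_piece :: "real set \<Rightarrow> (real \<Rightarrow> complex) \<Rightarrow> real \<Rightarrow> complex" where
  "freq_piece \<omega> f x =
     lim (\<lambda>n. fconv f (inv_fourier (indicator (\<omega> \<inter> {- real n..real n}))) x)"

lemma freq_piece_bounded:
  assumes "bounded \<omega>"
  shows "freq_piece \<omega> f x = fconv f (inv_fourier (indicator \<omega>)) x"
proof -
  obtain R where R: "\<And>\<xi>. \<xi> \<in> \<omega> \<Longrightarrow> \<bar>\<xi>\<bar> \<le> R"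
    using assms by (auto simp: bounded_real)
  obtain N :: nat where N: "R \<le> real N"
    using real_arch_simple by blast
  have "\<omega> \<inter> {- real n..real n} = \<omega>" if "N \<le> n" for n
    using R N that by (force simp: abs_le_iff)
  then have "\<forall>\<^sub>F n in sequentially.
      fconv f (inv_fourier (indicator (\<omega> \<inter> {- real n..real n}))) x =
      fconv f (inv_fourier (indicator \<omega>)) x"
    unfolding eventually_sequentially by (metis (no_types, lifting))
  then show ?thesis
    unfolding freq_piece_def by (intro limI tendsto_eventually)
qed

definition interval_family :: "(int \<Rightarrow> real set) \<Rightarrow> bool" where
  "interval_family \<Omega> \<longleftrightarrow> (\<forall>k. is_interval (\<Omega> k))"

definition overlap_le :: "real \<Rightarrow> (int \<Rightarrow> real set) \<Rightarrow> bool" where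
  "overlap_le B \<Omega> \<longleftrightarrow> (\<forall>x. (\<Sum>\<^sub>\<infinity>k\<in>UNIV. indicator (\<Omega> k) x :: ennreal) \<le> ennreal B)"

definition square_function :: "(int \<Rightarrow> real set) \<Rightarrow> (real \<Rightarrow> complex) \<Rightarrow> real \<Rightarrow> ennreal" where
  "square_function \<Omega> f x =
     (\<Sum>\<^sub>\<infinity>k\<in>UNIV. ennreal ((cmod (freq_piece (\<Omega> k) f x))\<^sup>2)) epowr (1 / 2)"

text \<open>The norm of an operator on \<open>L\<^sup>p(w)\<close> that is initially defined on test functions: since these
  are dense, it is the least constant in the norm inequality on test functions.\<close>

definition op_norm ::
  "real \<Rightarrow> (real \<Rightarrow> real) \<Rightarrow> ((real \<Rightarrow> complex) \<Rightarrow> real \<Rightarrow> ennreal) \<Rightarrow> ennreal" where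
  "op_norm p w T =
     Inf {K. \<forall>f. test_function f \<longrightarrow>
            wnorm p w (T f) \<le> K * wnorm p w (\<lambda>x. ennreal (cmod (f x)))}"

end

theory Submission
  imports Defs "HOL-Probability.Probability"
begin

text \<open>The indicator of an interval is the sum of two linear ramps, and a ramp on \<open>[a, b]\<close> becomes,
  after modulation by its endpoint \<open>a\<close>, convolution with a kernel that decays like \<open>1 / y\<close>. For
  the resulting \<open>\<ell>\<^sup>2\<close>-valued operator, the oscillation on an interval of a function supported away
  from it is bounded by a weighted \<open>L\<^sup>2\<close> mean. Frequency intervals shorter than the
  reciprocal scale are treated by integration by parts and Bessel's inequality, longer ones by the
  large sieve at their endpoints; bounded overlap is all that is needed. A stopping time argument
  then dominates the square function by a sparse sum of quadratic averages, and these satisfy the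
  stated weighted bound.

  For the sharpness it suffices to take the single interval \<open>[0, 1]\<close> and \<open>w x = \<bar>x\<bar> powr (\<delta> - 1)\<close>, whose
  characteristic is of size \<open>1 / \<delta>\<close>: the transform of a bump on \<open>[0, exp (1 / \<delta>)]\<close> is at least of
  order \<open>1 / \<delta>\<close> on a long interval to the left of the origin.\<close>

section \<open>Covering lemmas and Carleson embedding\<close>

text \<open>A sharp cutoff on \<open>[a, b]\<close> has a kernel with two terms of order
  \<open>1/z\<close>, oscillating at the frequencies \<open>a\<close> and \<open>b\<close>. No
  single modulation removes both, so at scales above \<open>1 / (b - a)\<close> such a kernel is not
  smooth. A ramp jumps at one endpoint only. Modulating that endpoint to frequency 0 leaves the
  smooth term \<open>\<i> / (2 * pi * z)\<close>, and the other endpoint enters only at order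
  \<open>1 / ((b - a) * z\<^sup>2)\<close>. The modulations differ from interval to interval, but
  they do not change moduli, which is all that a square function sees.

  The estimates for arbitrary frequency intervals rest on L2 information, Bessel's inequality and
  its pointwise form, the large sieve. This is why the sparse averages are quadratic and the class
  has index \<open>p / 2\<close>.

  The exponent comes from comparing, on each sparse interval, the masses of \<open>w\<close> and of
  its dual weight on the tripled interval with those on the disjoint portion. With \<open>X\<close>
  and \<open>Y\<close> the two ratios and \<open>q = p / 2\<close>, only
  \<open>X * Y powr (q - 1)\<close> is controlled by the characteristic, whereas
  \<open>X powr (1 - 1/p) * Y powr (1/p)\<close> has to be bounded. The two factors compete, and
  each yields one entry of the maximum.\<close>

lemma interval_redundant:
  fixes J1 J2 J3 :: "real set"
  assumes "is_interval J1" "is_interval J2" "is_interval J3" "x \<in> J1" "x \<in> J2" "x \<in> J3"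
  shows "J1 \<subseteq> J2 \<union> J3 \<or> J2 \<subseteq> J1 \<union> J3 \<or> J3 \<subseteq> J1 \<union> J2"
proof (rule ccontr)
  assume "\<not> ?thesis"
  then obtain y1 y2 y3 where y: "y1 \<in> J1" "y1 \<notin> J2" "y1 \<notin> J3" "y2 \<in> J2" "y2 \<notin> J1" "y2 \<notin> J3"
    "y3 \<in> J3" "y3 \<notin> J1" "y3 \<notin> J2" by blast
  \<comment> \<open>Two intervals through \<open>x\<close> that reach out on the same side are
    comparable there: the nearer of \<open>a\<close> and \<open>b\<close> lies in both. Of three
    witnesses, two lie on the same side of \<open>x\<close>.\<close>
  have up: False if "is_interval J" "is_interval J'" "x \<in> J" "x \<in> J'" "a \<in> J" "a \<notin> J'"
    "b \<in> J'" "b \<notin> J" "x \<le> a \<and> x \<le> b \<or> a \<le> x \<and> b \<le> x" for a b J J'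
    using that unfolding is_interval_1 by (metis linear)
  consider "x \<le> y1 \<and> x \<le> y2 \<or> y1 \<le> x \<and> y2 \<le> x" | "x \<le> y1 \<and> x \<le> y3 \<or> y1 \<le> x \<and> y3 \<le> x"
    | "x \<le> y2 \<and> x \<le> y3 \<or> y2 \<le> x \<and> y3 \<le> x"
    by linarith
  then show False
  proof cases
    case 1 show ?thesis by (rule up[OF assms(1,2,4,5) y(1,2,4,5) 1])
  next
    case 2 show ?thesis by (rule up[OF assms(1,3,4,6) y(1,3,7,8) 2])
  next
    case 3 show ?thesis by (rule up[OF assms(2,3,5,6) y(4,6,7,9) 3])
  qed
qed

text \<open>A subcover of least cardinality works: if three of its members met at a point, one would
  lie in the union of the other two and could be dropped.\<close>

lemma finite_interval_subcover:
  fixes J :: "'i \<Rightarrow> real set"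
  assumes "finite I" "\<And>i. i \<in> I \<Longrightarrow> is_interval (J i)"
  obtains I' where "I' \<subseteq> I" "(\<Union>i\<in>I'. J i) = (\<Union>i\<in>I. J i)" "\<And>x. card {i\<in>I'. x \<in> J i} \<le> 2"
proof -
  define P where "P K \<longleftrightarrow> K \<subseteq> I \<and> (\<Union>i\<in>K. J i) = (\<Union>i\<in>I. J i)" for K
  have "P I" by (simp add: P_def)
  then obtain K where K: "P K" "\<And>K'. P K' \<Longrightarrow> card K \<le> card K'"
    using ex_has_least_nat[of P I card] by blast
  have fK: "finite K" using K(1) assms(1) finite_subset P_def by blast
  have irr: False if "i \<in> K" "J i \<subseteq> (\<Union>j\<in>K - {i}. J j)" for i
  proof -
    have "P (K - {i})" using K(1) that unfolding P_def by blast
    then have "card K \<le> card (K - {i})" by (rule K(2))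
    then show False using that(1) fK by (metis card_Diff1_less not_le)
  qed
  have "card {i\<in>K. x \<in> J i} \<le> 2" for x
  proof (rule ccontr)
    assume "\<not> ?thesis"
    then have "3 \<le> card {i\<in>K. x \<in> J i}" by simp
    then obtain S where "S \<subseteq> {i\<in>K. x \<in> J i}" "card S = 3"
      by (meson obtain_subset_with_card_n)
    then obtain a b c where abc: "a \<in> K" "b \<in> K" "c \<in> K" "x \<in> J a" "x \<in> J b" "x \<in> J c"
      "a \<noteq> b" "a \<noteq> c" "b \<noteq> c"
      by (auto simp: card_3_iff)
    have "is_interval (J a)" "is_interval (J b)" "is_interval (J c)"
      using abc K(1) assms(2) unfolding P_def by auto
    from interval_redundant[OF this abc(4-6)]
    consider "J a \<subseteq> J b \<union> J c" | "J b \<subseteq> J a \<union> J c" | "J c \<subseteq> J a \<union> J b" by argo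
    then show False
    proof cases
      case 1 moreover have "b \<in> K - {a}" "c \<in> K - {a}" using abc by auto
      ultimately show ?thesis using irr[OF abc(1)] by blast
    next
      case 2 moreover have "a \<in> K - {b}" "c \<in> K - {b}" using abc by auto
      ultimately show ?thesis using irr[OF abc(2)] by blast
    next
      case 3 moreover have "a \<in> K - {c}" "b \<in> K - {c}" using abc by auto
      ultimately show ?thesis using irr[OF abc(3)] by blast
    qed
  qed
  with that K(1) show ?thesis unfolding P_def by blast
qed

text \<open>Selecting a subcover of overlap two enlarges no interval, so the bound holds for every
  measure with the same constant. This is what keeps the constants below independent of the
  weight.\<close>

lemma weak_type_finite_intervals:
  fixes J :: "'i \<Rightarrow> real set" and g :: "real \<Rightarrow> ennreal"
  assumes "finite I" "\<And>i. i \<in> I \<Longrightarrow> is_interval (J i)" "\<And>i. i \<in> I \<Longrightarrow> J i \<in> sets M"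
    and g: "g \<in> borel_measurable M"
    and le: "\<And>i. i \<in> I \<Longrightarrow> c * emeasure M (J i) \<le> (\<integral>\<^sup>+x\<in>J i. g x \<partial>M)"
  shows "c * emeasure M (\<Union>i\<in>I. J i) \<le> 2 * (\<integral>\<^sup>+x. g x \<partial>M)"
proof -
  obtain I' where I': "I' \<subseteq> I" "(\<Union>i\<in>I'. J i) = (\<Union>i\<in>I. J i)" "\<And>x. card {i\<in>I'. x \<in> J i} \<le> 2"
    by (rule finite_interval_subcover[OF assms(1,2)]) auto
  have fin: "finite I'" using I'(1) assms(1) finite_subset by blast
  have sm: "J i \<in> sets M" if "i \<in> I'" for i using that I'(1) assms(3) by auto
  have "c * emeasure M (\<Union>i\<in>I. J i) \<le> c * (\<Sum>i\<in>I'. emeasure M (J i))"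
    unfolding I'(2)[symmetric] using fin sm
    by (intro mult_left_mono emeasure_subadditive_finite) auto
  also have "\<dots> \<le> (\<Sum>i\<in>I'. \<integral>\<^sup>+x\<in>J i. g x \<partial>M)"
    unfolding sum_distrib_left using I'(1) le by (intro sum_mono) auto
  also have "\<dots> = (\<integral>\<^sup>+x. (\<Sum>i\<in>I'. g x * indicator (J i) x) \<partial>M)"
    using sm g by (intro nn_integral_sum[symmetric]) auto
  also have "\<dots> \<le> (\<integral>\<^sup>+x. 2 * g x \<partial>M)"
  proof (intro nn_integral_mono)
    fix x
    have "(\<Sum>i\<in>I'. g x * indicator (J i) x) = g x * of_nat (card {i\<in>I'. x \<in> J i})"
      unfolding sum_distrib_left[symmetric]
      using fin by (simp add: sum.If_cases indicator_def Int_def)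
    also have "\<dots> \<le> g x * 2"
      using I'(3)[of x] by (intro mult_left_mono) (metis of_nat_le_iff of_nat_numeral, simp)
    finally show "(\<Sum>i\<in>I'. g x * indicator (J i) x) \<le> 2 * g x" by (simp add: mult.commute)
  qed
  also have "\<dots> = 2 * (\<integral>\<^sup>+x. g x \<partial>M)" using g by (intro nn_integral_cmult)
  finally show ?thesis .
qed

text \<open>The union is a superlevel set of a noncentred maximal function. Lindelof's theorem
  reduces it to countably many intervals, and its finite partial unions increase to the
  whole.\<close>

lemma weak_type_open_intervals:
  fixes g :: "real \<Rightarrow> ennreal"
  assumes g: "g \<in> borel_measurable lborel"
  shows "c * emeasure lborel (\<Union>{{u<..<v} |u v::real. u < v \<and> c * ennreal (v - u) \<le> (\<integral>\<^sup>+x\<in>{u<..<v}. g x \<partial>lborel)})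
    \<le> 2 * (\<integral>\<^sup>+x. g x \<partial>lborel)"
proof -
  define F where "F = {{u<..<v} |u v::real. u < v \<and> c * ennreal (v - u) \<le> (\<integral>\<^sup>+x\<in>{u<..<v}. g x \<partial>lborel)}"
  obtain F' where F': "F' \<subseteq> F" "countable F'" "\<Union>F' = \<Union>F"
    using Lindelof[of F] unfolding F_def by (smt (verit) mem_Collect_eq open_greaterThanLessThan)
  have FF: "is_interval J \<and> J \<in> sets lborel \<and> c * emeasure lborel J \<le> (\<integral>\<^sup>+x\<in>J. g x \<partial>lborel)" if "J \<in> F" for J
    using that unfolding F_def by (auto simp: is_interval_oo)
  show ?thesis
  proof (cases "F' = {}")
    case True then have "\<Union>F = {}" using F'(3) by simp
    then show ?thesis unfolding F_def[symmetric] by (simp only: emeasure_empty) simp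
  next
    case False
    define A where "A n = (\<Union>i\<in>{..n}. from_nat_into F' i)" for n
    have inF: "from_nat_into F' i \<in> F" for i using from_nat_into[OF False, of i] F'(1) by auto
    have UA: "(\<Union>n. A n) = \<Union>F"
    proof -
      have "(\<Union>n. A n) = \<Union>(range (from_nat_into F'))" unfolding A_def by force
      then show ?thesis using F' False by (simp add: range_from_nat_into)
    qed
    have inc: "incseq A" unfolding A_def incseq_def by fastforce
    have mA: "A n \<in> sets lborel" for n unfolding A_def using FF[OF inF] by (intro sets.finite_UN) auto
    have bd: "c * emeasure lborel (A n) \<le> 2 * (\<integral>\<^sup>+x. g x \<partial>lborel)" for n
      unfolding A_def using FF[OF inF] by (intro weak_type_finite_intervals g) auto
    have "c * emeasure lborel (\<Union>F) = c * (SUP n. emeasure lborel (A n))"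
      using inc mA unfolding UA[symmetric] by (subst SUP_emeasure_incseq) auto
    also have "\<dots> = (SUP n. c * emeasure lborel (A n))" by (simp add: SUP_mult_left_ennreal)
    also have "\<dots> \<le> 2 * (\<integral>\<^sup>+x. g x \<partial>lborel)" using bd by (intro SUP_least) auto
    finally show ?thesis unfolding F_def .
  qed
qed

section \<open>Carleson embedding for an arbitrary sigma-finite measure\<close>

lemma nn_integral_powr_from_0:
  fixes c s :: real
  assumes "0 \<le> c" "-1 < s"
  shows "(\<integral>\<^sup>+x\<in>{0..c}. ennreal (x powr s) \<partial>lborel) = ennreal (c powr (s + 1) / (s + 1))"
proof -
  have "((\<lambda>x. x powr s * indicator {0..c} x) has_integral (c powr (s + 1) / (s + 1))) UNIV"
    using has_integral_powr_from_0[OF assms(2,1)]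
    by (subst (asm) has_integral_restrict_UNIV[symmetric])
      (auto simp: indicator_def of_bool_def cong: if_cong elim!: has_integral_eq[rotated])
  then have "(\<integral>\<^sup>+x. ennreal (x powr s * indicator {0..c} x) \<partial>lborel) = ennreal (c powr (s + 1) / (s + 1))"
    by (intro nn_integral_has_integral_lborel) auto
  then show ?thesis
    by (subst (asm) ennreal_mult) (auto simp: ennreal_indicator)
qed

text \<open>Layer cake in the coefficients. At height \<open>t\<close> the disjoint sets
  \<open>E i\<close> with \<open>t \<le> a i\<close> have total mass at most that of the union of
  the \<open>J i\<close>, to which the weak type bound applies. Only the part of \<open>h\<close>
  above \<open>t/2\<close> is charged, so integrating \<open>t powr (q - 2)\<close> up to
  \<open>2 * h x\<close> produces \<open>h x powr q\<close> and the factor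
  \<open>2 powr (q - 1) / (q - 1)\<close>.\<close>

lemma carleson_embedding:
  fixes J E :: "'i \<Rightarrow> real set" and a :: "'i \<Rightarrow> real" and h :: "real \<Rightarrow> real"
  assumes M: "sigma_finite_measure M" and fin: "finite I" and q: "1 < q"
    and J: "\<And>i. i \<in> I \<Longrightarrow> is_interval (J i)" "\<And>i. i \<in> I \<Longrightarrow> J i \<in> sets M"
      "\<And>i. i \<in> I \<Longrightarrow> emeasure M (J i) < \<infinity>"
    and E: "\<And>i. i \<in> I \<Longrightarrow> E i \<in> sets M" "\<And>i. i \<in> I \<Longrightarrow> E i \<subseteq> J i" "disjoint_family_on E I"
    and h[measurable]: "h \<in> borel_measurable M" and h0: "\<And>x. 0 \<le> h x"
    and a: "\<And>i. i \<in> I \<Longrightarrow> 0 \<le> a i"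
      "\<And>i. i \<in> I \<Longrightarrow> ennreal (a i) * emeasure M (J i) \<le> (\<integral>\<^sup>+x\<in>J i. ennreal (h x) \<partial>M)"
  shows "(\<Sum>i\<in>I. ennreal (a i powr q) * emeasure M (E i))
    \<le> ennreal (4 * q * 2 powr (q - 1) / (q - 1)) * (\<integral>\<^sup>+x. ennreal (h x powr q) \<partial>M)"
proof -
  interpret M: sigma_finite_measure M by (rule M)
  interpret P: pair_sigma_finite lborel M by unfold_locales
  \<comment> \<open>Total mass of the \<open>E i\<close> whose coefficient reaches \<open>t\<close>,
    written with indicators so that it is measurable in \<open>t\<close> and can be integrated
    termwise.\<close>
  define S where "S t = (\<Sum>i\<in>I. emeasure M (E i) * indicator {0..a i} t)" for t :: real
  define g where "g t x = ennreal (h x) * indicator {x. t < 2 * h x} x" for t x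
  have [measurable]: "S \<in> borel_measurable borel" unfolding S_def by measurable
  have weak: "ennreal t * S t \<le> 4 * (\<integral>\<^sup>+x. g t x \<partial>M)" if "0 < t" for t
  proof -
    define K where "K = {i\<in>I. t \<le> a i}"
    have K: "finite K" "K \<subseteq> I" using fin by (auto simp: K_def)
    have gm: "g t \<in> borel_measurable M" unfolding g_def by measurable
    have "S t = (\<Sum>i\<in>K. emeasure M (E i))"
      unfolding S_def K_def using fin that
      by (simp add: sum.inter_filter[symmetric] indicator_def of_bool_def if_distrib cong: if_cong)
    also have "\<dots> = emeasure M (\<Union>i\<in>K. E i)"
      using K E by (intro sum_emeasure) (auto intro: disjoint_family_on_mono)
    also have "\<dots> \<le> emeasure M (\<Union>i\<in>K. J i)"
      using K E(2) J(2) by (intro emeasure_mono sets.finite_UN) auto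
    finally have 1: "S t \<le> emeasure M (\<Union>i\<in>K. J i)" .
    have 2: "ennreal (t/2) * emeasure M (\<Union>i\<in>K. J i) \<le> 2 * (\<integral>\<^sup>+x. g t x \<partial>M)"
    proof (intro weak_type_finite_intervals gm)
      fix i assume i: "i \<in> K"
      then have iI: "i \<in> I" and ta: "t \<le> a i" by (auto simp: K_def)
      note [measurable] = J(2)[OF iI]
      obtain m where m: "emeasure M (J i) = ennreal m" "0 \<le> m"
        using J(3)[OF iI] by (cases "emeasure M (J i)") auto
      have "ennreal (t/2) * emeasure M (J i) + ennreal (t/2) * emeasure M (J i) = ennreal t * emeasure M (J i)"
        using that m by (simp add: ennreal_mult[symmetric] ennreal_plus[symmetric] del: ennreal_plus)
      also have "\<dots> \<le> ennreal (a i) * emeasure M (J i)"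
        using ta by (intro mult_right_mono ennreal_leI) auto
      also have "\<dots> \<le> (\<integral>\<^sup>+x\<in>J i. ennreal (h x) \<partial>M)" by (rule a(2)[OF iI])
      \<comment> \<open>On \<open>J i\<close> the function \<open>h\<close> is at most
        \<open>t/2\<close> plus its large part \<open>g t\<close>. The first summand uses up half of
        the lower bound \<open>t\<close>, so the other half is left for \<open>g t\<close>.\<close>
      also have "\<dots> \<le> (\<integral>\<^sup>+x. ennreal (t/2) * indicator (J i) x + g t x * indicator (J i) x \<partial>M)"
        using that by (intro nn_integral_mono) (auto simp: g_def indicator_def intro!: ennreal_leI)
      also have "\<dots> = ennreal (t/2) * emeasure M (J i) + (\<integral>\<^sup>+x\<in>J i. g t x \<partial>M)"
        using gm by (subst nn_integral_add) (auto simp: nn_integral_cmult_indicator)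
      finally show "ennreal (t/2) * emeasure M (J i) \<le> (\<integral>\<^sup>+x\<in>J i. g t x \<partial>M)"
        using m by (simp add: ennreal_add_left_cancel_le ennreal_mult_eq_top_iff)
    qed (use K J in auto)
    have "ennreal t * S t \<le> 2 * (ennreal (t/2) * emeasure M (\<Union>i\<in>K. J i))"
    proof -
      have "ennreal t = 2 * ennreal (t/2)" using that
        using ennreal_mult[of 2 "t/2"] by simp
      then show ?thesis using 1 by (simp add: mult.assoc mult_left_mono)
    qed
    also have "\<dots> \<le> 2 * (2 * (\<integral>\<^sup>+x. g t x \<partial>M))" by (intro mult_left_mono 2) auto
    finally show ?thesis by (simp add: mult.assoc[symmetric])
  qed
  have "(\<Sum>i\<in>I. ennreal (a i powr q) * emeasure M (E i))
    = (\<Sum>i\<in>I. \<integral>\<^sup>+t. ennreal q * (ennreal (t powr (q-1)) * (emeasure M (E i) * indicator {0..a i} t)) \<partial>lborel)"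
  proof (intro sum.cong refl)
    fix i assume i: "i \<in> I"
    have "ennreal (a i powr q) = ennreal q * ennreal (a i powr q / q)"
      using q by (simp add: ennreal_mult[symmetric])
    also have "ennreal (a i powr q / q) = (\<integral>\<^sup>+t\<in>{0..a i}. ennreal (t powr (q-1)) \<partial>lborel)"
      using nn_integral_powr_from_0[of "a i" "q - 1"] q a(1)[OF i] by simp
    finally have 1: "ennreal (a i powr q) = ennreal q * (\<integral>\<^sup>+t\<in>{0..a i}. ennreal (t powr (q-1)) \<partial>lborel)" .
    have "(\<integral>\<^sup>+t. ennreal q * (ennreal (t powr (q-1)) * (emeasure M (E i) * indicator {0..a i} t)) \<partial>lborel)
      = (\<integral>\<^sup>+t. (ennreal q * emeasure M (E i)) * (ennreal (t powr (q-1)) * indicator {0..a i} t) \<partial>lborel)"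
      by (simp only: mult_ac)
    also have "\<dots> = (ennreal q * emeasure M (E i)) * (\<integral>\<^sup>+t\<in>{0..a i}. ennreal (t powr (q-1)) \<partial>lborel)"
      by (intro nn_integral_cmult) measurable
    finally show "ennreal (a i powr q) * emeasure M (E i)
      = (\<integral>\<^sup>+t. ennreal q * (ennreal (t powr (q-1)) * (emeasure M (E i) * indicator {0..a i} t)) \<partial>lborel)"
      unfolding 1 by (simp only: mult_ac)
  qed
  also have "\<dots> = ennreal q * (\<integral>\<^sup>+t. ennreal (t powr (q-1)) * S t \<partial>lborel)"
  proof -
    have pt: "(\<Sum>i\<in>I. ennreal q * (ennreal (t powr (q-1)) * (emeasure M (E i) * indicator {0..a i} t)))
      = ennreal q * (ennreal (t powr (q-1)) * S t)" for t
      by (simp only: S_def sum_distrib_left)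
    show ?thesis
      by (subst nn_integral_sum[symmetric], measurable) (simp only: pt, rule nn_integral_cmult, measurable)
  qed
  also have "(\<integral>\<^sup>+t. ennreal (t powr (q-1)) * S t \<partial>lborel)
    \<le> (\<integral>\<^sup>+t. ennreal (t powr (q-2)) * indicator {0..} t * (4 * (\<integral>\<^sup>+x. g t x \<partial>M)) \<partial>lborel)"
  proof (intro nn_integral_mono)
    fix t :: real
    consider "t < 0" | "t = 0" | "0 < t" by linarith
    then show "ennreal (t powr (q-1)) * S t \<le> ennreal (t powr (q-2)) * indicator {0..} t * (4 * (\<integral>\<^sup>+x. g t x \<partial>M))"
    proof cases
      case 1 then show ?thesis by (simp add: S_def)
    next
      case 2 then show ?thesis by simp
    next
      case 3
      have "ennreal (t powr (q-1)) * S t = ennreal (t powr (q-2)) * (ennreal t * S t)"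
        using 3 powr_add[of t "q-2" 1] by (simp add: ennreal_mult[symmetric] mult.assoc[symmetric])
      also have "\<dots> \<le> ennreal (t powr (q-2)) * (4 * (\<integral>\<^sup>+x. g t x \<partial>M))"
        by (intro mult_left_mono weak 3) auto
      finally show ?thesis using 3 by simp
    qed
  qed
  also have "\<dots> = (\<integral>\<^sup>+t. \<integral>\<^sup>+x. 4 * (ennreal (t powr (q-2)) * indicator {0..} t * g t x) \<partial>M \<partial>lborel)"
    unfolding g_def by (simp add: nn_integral_cmult[symmetric] mult_ac)
  also have "\<dots> = (\<integral>\<^sup>+x. \<integral>\<^sup>+t. 4 * (ennreal (t powr (q-2)) * indicator {0..} t * g t x) \<partial>lborel \<partial>M)"
    using P.Fubini'[of "\<lambda>t x. 4 * (ennreal (t powr (q-2)) * indicator {0..} t * g t x)"]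
    unfolding g_def by simp
  also have "\<dots> \<le> (\<integral>\<^sup>+x. ennreal (4 * 2 powr (q-1) / (q-1)) * ennreal (h x powr q) \<partial>M)"
  proof (intro nn_integral_mono)
    fix x
    have "(\<integral>\<^sup>+t. 4 * (ennreal (t powr (q-2)) * indicator {0..} t * g t x) \<partial>lborel)
      \<le> (\<integral>\<^sup>+t. ennreal (4 * h x) * (ennreal (t powr (q-2)) * indicator {0..2 * h x} t) \<partial>lborel)"
    proof (intro nn_integral_mono)
      fix t :: real
      have "ennreal (4 * h x) = 4 * ennreal (h x)" using h0[of x] by (simp add: ennreal_mult)
      then show "4 * (ennreal (t powr (q-2)) * indicator {0..} t * g t x)
        \<le> ennreal (4 * h x) * (ennreal (t powr (q-2)) * indicator {0..2 * h x} t)"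
        by (cases "0 \<le> t \<and> t < 2 * h x") (auto simp: g_def mult_ac)
    qed
    also have "\<dots> = ennreal (4 * h x) * ennreal ((2 * h x) powr (q - 1) / (q - 1))"
    proof -
      have "(\<integral>\<^sup>+t\<in>{0..2 * h x}. ennreal (t powr (q-2)) \<partial>lborel) = ennreal ((2 * h x) powr (q - 1) / (q - 1))"
        using nn_integral_powr_from_0[of "2 * h x" "q - 2"] q h0[of x] by simp
      then show ?thesis by (subst nn_integral_cmult) simp_all
    qed
    also have "\<dots> = ennreal (4 * 2 powr (q-1) / (q-1)) * ennreal (h x powr q)"
    proof -
      have "h x powr q = h x * h x powr (q-1)"
        using h0[of x] powr_add[of "h x" 1 "q-1"] q by (cases "h x = 0") auto
      then have "4 * h x * ((2 * h x) powr (q - 1) / (q - 1)) = 4 * 2 powr (q-1) / (q-1) * (h x powr q)"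
        using h0[of x] by (simp add: powr_mult)
      then show ?thesis using h0[of x] q
        by (subst (1 2) ennreal_mult[symmetric]) auto
    qed
    finally show "(\<integral>\<^sup>+t. 4 * (ennreal (t powr (q-2)) * indicator {0..} t * g t x) \<partial>lborel)
      \<le> ennreal (4 * 2 powr (q-1) / (q-1)) * ennreal (h x powr q)" .
  qed
  also have "\<dots> = ennreal (4 * 2 powr (q-1) / (q-1)) * (\<integral>\<^sup>+x. ennreal (h x powr q) \<partial>M)"
    by (intro nn_integral_cmult) auto
  finally have "(\<Sum>i\<in>I. ennreal (a i powr q) * emeasure M (E i))
    \<le> ennreal q * (ennreal (4 * 2 powr (q-1) / (q-1)) * (\<integral>\<^sup>+x. ennreal (h x powr q) \<partial>M))"
    by (metis mult_left_mono zero_le)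
  also have "\<dots> = ennreal (4 * q * 2 powr (q - 1) / (q - 1)) * (\<integral>\<^sup>+x. ennreal (h x powr q) \<partial>M)"
  proof -
    have "ennreal q * ennreal (4 * 2 powr (q-1) / (q-1)) = ennreal (4 * q * 2 powr (q - 1) / (q - 1))"
      using q by (simp add: ennreal_mult[symmetric] mult.commute mult.left_commute)
    then show ?thesis by (simp only: mult.assoc[symmetric])
  qed
  finally show ?thesis .
qed

section \<open>The weighted bound for sparse sums\<close>

text \<open>The exponent of the theorem originates here. With \<open>\<mu> = X * \<mu>E\<close> and
  \<open>\<nu> = Y * \<nu>E\<close> the left side costs \<open>A powr (1/p)\<close> and the factor
  \<open>X powr (1 - 1/p) * Y powr (1/p)\<close>, while \<open>A\<close> and \<open>D\<close> bound
  only the product \<open>X * Y powr (q - 1)\<close>. As \<open>X\<close> and \<open>Y\<close> are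
  at least 1, the power \<open>r\<close> of this product dominates as soon as \<open>r\<close> is at
  least \<open>1 - 1/p\<close> and \<open>r * (q - 1)\<close> at least \<open>1/p\<close>.\<close>

lemma sparse_exponent_inequality:
  fixes m \<mu> \<nu> \<mu>E \<nu>E A D q p :: real
  assumes pos: "0 < m" "0 < \<mu>" "0 < \<nu>" "0 < \<mu>E" "0 < \<nu>E" "\<mu>E \<le> \<mu>" "\<nu>E \<le> \<nu>"
    and q: "1 < q" and p: "p = 2 * q"
    and A: "\<mu> * \<nu> powr (q - 1) \<le> A * m powr q"
    and D: "m powr q \<le> D * (\<mu>E * \<nu>E powr (q - 1))"
  shows "sqrt (\<nu> / m) * \<mu> \<le> A powr (1/p) * (A * D) powr (max (1 - 1/p) (1 / (p * (q - 1))))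
    * (\<nu>E powr (1/p) * \<mu>E powr (1 - 1/p))"
proof -
  define r where "r = max (1 - 1/p) (1 / (p * (q - 1)))"
  define X Y where "X = \<mu> / \<mu>E" and "Y = \<nu> / \<nu>E"
  have p0: "0 < p" "2 < p" using p q by auto
  have mq: "0 < m powr q" using pos by simp
  have X1: "1 \<le> X" "1 \<le> Y" using pos by (auto simp: X_def Y_def)
  have A0: "0 < A"
  proof -
    have "0 < A * m powr q" using A pos by (smt (verit) mult_pos_pos powr_gt_zero)
    then show ?thesis using mq by (simp add: zero_less_mult_iff)
  qed
  have D0: "0 < D"
  proof -
    have "0 < D * (\<mu>E * \<nu>E powr (q - 1))" using D mq by linarith
    then show ?thesis using pos by (intro zero_less_mult_pos2[of D "\<mu>E * \<nu>E powr (q - 1)"]) auto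
  qed
  have XY: "X * Y powr (q - 1) \<le> A * D"
  proof -
    have "X * Y powr (q-1) = \<mu> * \<nu> powr (q - 1) / (\<mu>E * \<nu>E powr (q - 1))"
      using pos by (simp add: X_def Y_def powr_divide)
    also have "\<dots> \<le> A * m powr q / (\<mu>E * \<nu>E powr (q - 1))"
      using A pos by (intro divide_right_mono) auto
    also have "\<dots> \<le> A * (D * (\<mu>E * \<nu>E powr (q - 1))) / (\<mu>E * \<nu>E powr (q - 1))"
      using D A0 pos by (intro divide_right_mono mult_left_mono) auto
    finally show ?thesis using pos by simp
  qed
  have r0: "0 \<le> r" using p0 by (simp add: r_def le_max_iff_disj)
  have "X powr (1 - 1/p) * Y powr (1/p) \<le> X powr r * Y powr (r * (q - 1))"
  proof (intro mult_mono powr_mono)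
    have "1/p = 1 / (p * (q-1)) * (q-1)" using q by simp
    also have "\<dots> \<le> r * (q - 1)" using q by (intro mult_right_mono) (auto simp: r_def)
    finally show "1/p \<le> r * (q-1)" .
  qed (use X1 in \<open>auto simp: r_def\<close>)
  also have "\<dots> = (X * Y powr (q - 1)) powr r"
    using X1 by (simp add: powr_mult powr_powr mult.commute)
  also have "\<dots> \<le> (A * D) powr r" using XY r0 X1 by (intro powr_mono2) auto
  finally have 1: "X powr (1 - 1/p) * Y powr (1/p) \<le> (A * D) powr r" .
  \<comment> \<open>The powers balance because \<open>(q - 1)/p + 1/p\<close> and \<open>q/p\<close>
    are both \<open>1/2\<close> when \<open>p = 2 * q\<close>.\<close>
  have "sqrt (\<nu> / m) * \<mu> = ((\<mu> * \<nu> powr (q - 1)) / m powr q) powr (1/p) * (\<nu> powr (1/p) * \<mu> powr (1 - 1/p))"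
  proof -
    have "((\<mu> * \<nu> powr (q - 1)) / m powr q) powr (1/p) * (\<nu> powr (1/p) * \<mu> powr (1 - 1/p))
      = (\<mu> powr (1/p) * \<mu> powr (1 - 1/p)) * (\<nu> powr ((q - 1)/p) * \<nu> powr (1/p)) / m powr (q/p)"
      using pos by (simp add: powr_mult powr_divide powr_powr)
    also have "\<dots> = \<mu> * \<nu> powr (1/2) / m powr (1/2)"
    proof -
      have "(q - 1)/p + 1/p = 1/2" "q/p = 1/2" using p0 p by (auto simp: field_simps)
      then have "\<nu> powr ((q - 1)/p) * \<nu> powr (1/p) = \<nu> powr (1/2)" "m powr (q/p) = m powr (1/2)"
        by (simp_all only: powr_add[symmetric])
      moreover have "\<mu> powr (1/p) * \<mu> powr (1 - 1/p) = \<mu>"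
        using pos by (simp add: powr_add[symmetric])
      ultimately show ?thesis by (simp only:)
    qed
    also have "\<dots> = sqrt (\<nu> / m) * \<mu>" using pos by (simp add: powr_half_sqrt real_sqrt_divide)
    finally show ?thesis by simp
  qed
  also have "\<dots> \<le> A powr (1/p) * (\<nu> powr (1/p) * \<mu> powr (1 - 1/p))"
    using A mq pos p0 by (intro mult_right_mono powr_mono2) (auto simp: divide_simps mult.commute)
  also have "\<dots> = A powr (1/p) * ((X powr (1 - 1/p) * Y powr (1/p)) * (\<nu>E powr (1/p) * \<mu>E powr (1 - 1/p)))"
  proof -
    have "\<mu> = X * \<mu>E" "\<nu> = Y * \<nu>E" using pos by (auto simp: X_def Y_def)
    then show ?thesis using X1 pos by (simp add: powr_mult)
  qed
  also have "\<dots> \<le> A powr (1/p) * ((A * D) powr r * (\<nu>E powr (1/p) * \<mu>E powr (1 - 1/p)))"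
    using 1 by (intro mult_left_mono mult_right_mono) auto
  finally show ?thesis by (simp add: r_def mult.assoc)
qed

text \<open>Young's inequality stripped of its numerical weights: depending on whether
  \<open>t\<close> or \<open>s powr (p - 1)\<close> is larger, a single term on the right already
  dominates.\<close>

lemma mult_le_powr_conj:
  fixes s t p :: real
  assumes "0 \<le> s" "0 \<le> t" "1 < p"
  shows "s * t \<le> s powr p + t powr (p / (p - 1))"
proof (cases "t \<le> s powr (p - 1)")
  case True
  have "s * t \<le> s * s powr (p - 1)" using True assms by (intro mult_left_mono) auto
  also have "\<dots> = s powr p" using assms powr_add[of s 1 "p-1"] by (cases "s = 0") auto
  also have "\<dots> \<le> s powr p + t powr (p / (p - 1))" by simp
  finally show ?thesis .
next
  case False
  then have t: "0 < t" by (smt (verit) powr_ge_zero)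
  have "s = (s powr (p - 1)) powr (1 / (p - 1))" using assms by (simp add: powr_powr)
  also have "\<dots> \<le> t powr (1 / (p - 1))" using False assms by (intro powr_mono2) auto
  finally have "s * t \<le> t powr (1 / (p - 1)) * t" using t by (intro mult_right_mono) auto
  also have "\<dots> = t powr (p / (p - 1))"
  proof -
    have "p / (p - 1) = 1 / (p - 1) + 1" using assms by (simp add: field_simps)
    then show ?thesis using t by (simp add: powr_add)
  qed
  also have "\<dots> \<le> s powr p + t powr (p / (p - 1))" by simp
  finally show ?thesis .
qed

text \<open>The converse of the \<open>A_q\<close> condition on a set, valid for every positive
  weight as an instance of Hoelder's inequality. It is obtained by integrating
  \<open>1 \<le> t * w + (t * w) powr (-1/(q-1))\<close> over \<open>E\<close>; one of the two terms
  is at least 1 whatever the size of \<open>t * w\<close>.\<close>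

lemma measure_le_weight_dual:
  fixes w :: "real \<Rightarrow> real" and e \<mu>E \<nu>E q :: real
  assumes w[measurable]: "w \<in> borel_measurable borel" and w0: "\<And>x. 0 < w x" and q: "1 < q"
    and E[measurable]: "E \<in> sets borel" and e: "emeasure lborel E = ennreal e" "0 < e"
    and \<mu>: "(\<integral>\<^sup>+x\<in>E. ennreal (w x) \<partial>lborel) = ennreal \<mu>E" "0 \<le> \<mu>E"
    and \<nu>: "(\<integral>\<^sup>+x\<in>E. ennreal (w x powr (-1/(q-1))) \<partial>lborel) = ennreal \<nu>E" "0 \<le> \<nu>E"
  shows "0 < \<mu>E" "0 < \<nu>E" "e powr q \<le> 2 powr q * (\<mu>E * \<nu>E powr (q - 1))"
proof -
  have pos: "0 < (\<integral>\<^sup>+x\<in>E. ennreal (v x) \<partial>lborel)"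
    if "v \<in> borel_measurable borel" "\<And>x. 0 < v x" for v :: "real \<Rightarrow> real"
  proof (rule ccontr)
    assume "\<not> ?thesis"
    then have "(\<integral>\<^sup>+x\<in>E. ennreal (v x) \<partial>lborel) = 0" by simp
    then have "AE x in lborel. ennreal (v x) * indicator E x = 0"
      using that(1) by (subst (asm) nn_integral_0_iff_AE) auto
    then have "AE x in lborel. x \<notin> E"
    proof eventually_elim
      case (elim x)
      moreover have "ennreal (v x) \<noteq> 0" using that(2)[of x] by (simp add: ennreal_eq_0_iff not_le)
      ultimately show ?case by (auto simp: indicator_def split: if_splits)
    qed
    then have "emeasure lborel E = 0" by (subst (asm) AE_iff_measurable[of E]) auto
    then show False using e by simp
  qed
  show m0: "0 < \<mu>E" using pos[of w] w0 \<mu> by simp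
  show n0: "0 < \<nu>E" using pos[of "\<lambda>x. w x powr (-1/(q-1))"] less_imp_neq[OF w0] \<nu> by force
  \<comment> \<open>With this \<open>t\<close> the first term integrates to exactly
    \<open>e/2\<close>, so the second has to supply the other half. The loss against Hoelder's
    inequality is the factor \<open>2 powr q\<close>.\<close>
  define t where "t = e / (2 * \<mu>E)"
  have t0: "0 < t" using e m0 by (simp add: t_def)
  have "ennreal e = (\<integral>\<^sup>+x. indicator E x \<partial>lborel)" using e by simp
  also have "\<dots> \<le> (\<integral>\<^sup>+x. ennreal t * (ennreal (w x) * indicator E x)
      + ennreal (t powr (-1/(q-1))) * (ennreal (w x powr (-1/(q-1))) * indicator E x) \<partial>lborel)"
  proof (intro nn_integral_mono)
    fix x
    have "1 \<le> t * w x + t powr (-1/(q-1)) * w x powr (-1/(q-1))"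
    proof (cases "1 \<le> t * w x")
      case True
      then show ?thesis by (smt (verit) mult_nonneg_nonneg powr_ge_zero)
    next
      case False
      have "1 \<le> (t * w x) powr (-1/(q-1))"
        using False t0 w0[of x] q powr_mono2'[of "-1/(q-1)" "t * w x" 1] by auto
      then show ?thesis using t0 w0[of x] by (simp add: powr_mult add_nonneg_pos add.commute[of "t * w x"] add_increasing2)
    qed
    then have "1 \<le> ennreal (t * w x + t powr (-1/(q-1)) * w x powr (-1/(q-1)))" by simp
    also have "\<dots> = ennreal t * ennreal (w x) + ennreal (t powr (-1/(q-1))) * ennreal (w x powr (-1/(q-1)))"
      using t0 w0[of x] by (simp add: ennreal_plus ennreal_mult)
    finally show "indicator E x \<le> ennreal t * (ennreal (w x) * indicator E x)
      + ennreal (t powr (-1/(q-1))) * (ennreal (w x powr (-1/(q-1))) * indicator E x)"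
      by (auto simp: indicator_def)
  qed
  also have "\<dots> = ennreal t * ennreal \<mu>E + ennreal (t powr (-1/(q-1))) * ennreal \<nu>E"
    unfolding \<mu>(1)[symmetric] \<nu>(1)[symmetric]
    by (subst nn_integral_add) (auto simp: nn_integral_cmult)
  also have "\<dots> = ennreal (t * \<mu>E + t powr (-1/(q-1)) * \<nu>E)"
    using t0 m0 n0 by (simp add: ennreal_mult ennreal_plus)
  finally have "e \<le> t * \<mu>E + t powr (-1/(q-1)) * \<nu>E"
    using t0 m0 n0 by (subst (asm) ennreal_le_iff) auto
  also have "t * \<mu>E = e/2" using m0 by (simp add: t_def)
  finally have "e/2 \<le> t powr (-1/(q-1)) * \<nu>E" by simp
  then have "(e/2) powr (q-1) \<le> (t powr (-1/(q-1)) * \<nu>E) powr (q-1)"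
    using e q by (intro powr_mono2) auto
  also have "\<dots> = 1/t * \<nu>E powr (q-1)"
    using t0 n0 q by (simp add: powr_mult powr_divide powr_powr powr_minus_divide)
  finally have "(e/2) * (e/2) powr (q-1) \<le> (e/2) * (1/t * \<nu>E powr (q-1))"
    using e by (intro mult_left_mono) auto
  also have "\<dots> = \<mu>E * \<nu>E powr (q-1)" using e m0 by (simp add: t_def)
  also have "(e/2) * (e/2) powr (q-1) = (e/2) powr q"
    using e powr_add[of "e/2" 1 "q-1"] by simp
  also have "\<dots> = e powr q / 2 powr q" using e by (simp add: powr_divide)
  finally show "e powr q \<le> 2 powr q * (\<mu>E * \<nu>E powr (q - 1))" by (simp add: divide_simps mult.commute)
qed

text \<open>The sparse sum \<open>S\<close> is tested against its own power
  \<open>S powr (p - 1)\<close> in place of a general dual function. The quantity \<open>X\<close>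
  to be bounded is finite, since the family is, so the half of \<open>X\<close> returned by the dual
  side can be absorbed. Each summand is split by Young's inequality into a term for Carleson
  embedding against the dual weight and one against \<open>w\<close>, and both are summed over the
  disjoint sets \<open>E i\<close>.\<close>

lemma weighted_sparse_bound:
  fixes q p :: real
  assumes q: "1 < q" and p: "p = 2 * q"
  shows "\<exists>C\<ge>0. \<forall>(w::real\<Rightarrow>real) (f::real\<Rightarrow>real) (I::'i set) a l v E A.
     w \<in> borel_measurable borel \<longrightarrow> (\<forall>x. 0 < w x) \<longrightarrow> f \<in> borel_measurable borel \<longrightarrow> (\<forall>x. 0 \<le> f x) \<longrightarrow>
     (\<forall>u v. u < v \<longrightarrow> (\<exists>\<mu> \<nu>. 0 \<le> \<mu> \<and> 0 \<le> \<nu> \<and> (\<integral>\<^sup>+x\<in>{u..v}. ennreal (w x) \<partial>lborel) = ennreal \<mu> \<and>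
        (\<integral>\<^sup>+x\<in>{u..v}. ennreal (w x powr (-1/(q-1))) \<partial>lborel) = ennreal \<nu> \<and>
        \<mu> * \<nu> powr (q-1) \<le> A * (v - u) powr q)) \<longrightarrow>
     finite I \<longrightarrow> disjoint_family_on E I \<longrightarrow>
     (\<forall>i\<in>I. 0 < l i \<and> E i \<in> sets borel \<and> E i \<subseteq> {a i..<a i + l i} \<and> ennreal (l i / 2) \<le> emeasure lborel (E i)
        \<and> 0 \<le> v i \<and> ennreal ((v i)\<^sup>2 * (3 * l i)) = (\<integral>\<^sup>+x\<in>{a i - l i..a i + 2 * l i}. ennreal ((f x)\<^sup>2) \<partial>lborel)) \<longrightarrow>
     (\<integral>\<^sup>+x. ennreal ((\<Sum>i\<in>I. v i * indicator {a i..<a i + l i} x) powr p) * ennreal (w x) \<partial>lborel)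
       \<le> ennreal (C * A powr (p * max (1 / (p - 2)) 1)) * (\<integral>\<^sup>+x. ennreal (f x powr p) * ennreal (w x) \<partial>lborel)"
proof -
  define p' where "p' = p / (p - 1)"
  define r where "r = max (1 - 1/p) (1 / (p * (q - 1)))"
  \<comment> \<open>\<open>E i\<close> fills at least a sixth of the tripled interval, which costs
    \<open>6 powr q\<close>; \<open>measure_le_weight_dual\<close> costs another
    \<open>2 powr q\<close>.\<close>
  define D where "D = (12::real) powr q"
  define C1 where "C1 = 4 * q * 2 powr (q - 1) / (q - 1)"
  define C2 where "C2 = 4 * p' * 2 powr (p' - 1) / (p' - 1)"
  \<comment> \<open>The scale in Young's inequality, chosen so that the dual term carries the
    coefficient \<open>1 / (2 * C2)\<close>; Carleson embedding then turns it into half of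
    \<open>X\<close>.\<close>
  define \<tau> where "\<tau> = (2 * C2) powr (1 / p')"
  define C where "C = 2 * (D powr (p * r) * \<tau> powr p * C1)"
  have p2: "2 < p" using p q by simp
  have p': "1 < p'" using p2 by (simp add: p'_def field_simps)
  have C2: "0 < C2" using p' by (simp add: C2_def)
  have C1: "0 < C1" using q by (simp add: C1_def)
  have D0: "0 < D" by (simp add: D_def)
  have \<tau>: "0 < \<tau>" using C2 by (simp add: \<tau>_def)
  have \<tau>p': "\<tau> powr p' = 2 * C2" using C2 p' by (simp add: \<tau>_def powr_powr)
  \<comment> \<open>The 1 stems from \<open>A powr (1/p)\<close>, the rest from comparing
    \<open>J i\<close> with \<open>E i\<close>. The product \<open>p * r\<close> is the maximum of
    \<open>p - 1\<close> and \<open>2 / (p - 2)\<close>; adding 1 turns the entries into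
    \<open>p\<close> and \<open>p / (p - 2)\<close>.\<close>
  have rp: "1 + p * r = p * max (1 / (p - 2)) 1"
  proof -
    have q2: "q = p / 2" using p by simp
    have e: "p * (1 - 1/p) = p - 1" "p * (1 / (p * (q - 1))) = 2 / (p - 2)"
      using p2 by (auto simp: q2 field_simps)
    have "p * r = max (p - 1) (2 / (p - 2))"
      unfolding r_def using p2 e by (subst max_mult_distrib_left) simp
    then have "1 + p * r = max p (1 + 2 / (p - 2))" by simp
    also have "1 + 2 / (p - 2) = p * (1 / (p - 2))" using p2 by (simp add: field_simps)
    finally show ?thesis using p2 by (simp add: max_mult_distrib_left max.commute)
  qed
  have C0: "0 \<le> C" using D0 \<tau> C1 by (simp add: C_def)
  have main: "(\<integral>\<^sup>+x. ennreal ((\<Sum>i\<in>I. v i * indicator {a i..<a i + l i} x) powr p) * ennreal (w x) \<partial>lborel)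
       \<le> ennreal (C * A powr (p * max (1 / (p - 2)) 1)) * (\<integral>\<^sup>+x. ennreal (f x powr p) * ennreal (w x) \<partial>lborel)"
    if w[measurable]: "w \<in> borel_measurable borel" and w0: "\<And>x. 0 < w x"
      and f[measurable]: "f \<in> borel_measurable borel" and f0: "\<And>x. 0 \<le> f x"
      and Aq: "\<And>u v. u < v \<Longrightarrow> (\<exists>\<mu> \<nu>. 0 \<le> \<mu> \<and> 0 \<le> \<nu> \<and> (\<integral>\<^sup>+x\<in>{u..v}. ennreal (w x) \<partial>lborel) = ennreal \<mu> \<and>
        (\<integral>\<^sup>+x\<in>{u..v}. ennreal (w x powr (-1/(q-1))) \<partial>lborel) = ennreal \<nu> \<and>
        \<mu> * \<nu> powr (q-1) \<le> A * (v - u) powr q)"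
      and fin: "finite I" and disj: "disjoint_family_on E I"
      and I: "\<And>i. i \<in> I \<Longrightarrow> 0 < l i" "\<And>i. i \<in> I \<Longrightarrow> E i \<in> sets borel" "\<And>i. i \<in> I \<Longrightarrow> E i \<subseteq> {a i..<a i + l i}"
       "\<And>i. i \<in> I \<Longrightarrow> ennreal (l i / 2) \<le> emeasure lborel (E i)" "\<And>i. i \<in> I \<Longrightarrow> 0 \<le> v i"
       "\<And>i. i \<in> I \<Longrightarrow> ennreal ((v i)\<^sup>2 * (3 * l i)) = (\<integral>\<^sup>+x\<in>{a i - l i..a i + 2 * l i}. ennreal ((f x)\<^sup>2) \<partial>lborel)"
    for w f :: "real \<Rightarrow> real" and I :: "'i set" and a l v E A
  proof (cases "I = {}")
    case True then show ?thesis by simp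
  next
    case False
    define s where "s x = w x powr (-1/(q-1))" for x
    have s[measurable]: "s \<in> borel_measurable borel" unfolding s_def by measurable
    have s0: "0 < s x" for x using w0[of x] by (simp add: s_def)
    define M1 M2 where "M1 = density lborel (\<lambda>x. ennreal (w x))" and "M2 = density lborel (\<lambda>x. ennreal (s x))"
    have sets [measurable_cong]: "sets M1 = sets borel" "sets M2 = sets borel" by (simp_all add: M1_def M2_def)
    have sf: "sigma_finite_measure M1" "sigma_finite_measure M2"
      unfolding M1_def M2_def by (subst sigma_finite_measure.sigma_finite_iff_density_finite[OF sigma_finite_lborel]; simp)+
    define J where "J i = {a i - l i..a i + 2 * l i}" for i
    define Q where "Q i = {a i..<a i + l i}" for i
    define m where "m i = 3 * l i" for i
    have EJ: "E i \<subseteq> J i" "Q i \<subseteq> J i" if "i \<in> I" for i using I(1,3)[OF that] by (auto simp: J_def Q_def)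
    have m0: "0 < m i" if "i \<in> I" for i using I(1)[OF that] by (simp add: m_def)
    have em: "emeasure M1 S = (\<integral>\<^sup>+x\<in>S. ennreal (w x) \<partial>lborel)" "emeasure M2 S = (\<integral>\<^sup>+x\<in>S. ennreal (s x) \<partial>lborel)"
      if "S \<in> sets borel" for S
      using that by (simp_all add: M1_def M2_def emeasure_density)
    define \<mu> \<nu> \<mu>E \<nu>E where "\<mu> i = measure M1 (J i)" and "\<nu> i = measure M2 (J i)"
      and "\<mu>E i = measure M1 (E i)" and "\<nu>E i = measure M2 (E i)" for i
    have JJ: "J i \<in> sets borel" for i by (simp add: J_def)
    have mn: "emeasure M1 (J i) = ennreal (\<mu> i)" "emeasure M2 (J i) = ennreal (\<nu> i)"
      "\<mu> i * \<nu> i powr (q-1) \<le> A * m i powr q" if i: "i \<in> I" for i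
    proof -
      have "a i - l i < a i + 2 * l i" using I(1)[OF i] by simp
      from Aq[OF this] obtain \<mu>' \<nu>' where 1: "0 \<le> \<mu>'" "0 \<le> \<nu>'" "emeasure M1 (J i) = ennreal \<mu>'"
        "emeasure M2 (J i) = ennreal \<nu>'" "\<mu>' * \<nu>' powr (q-1) \<le> A * m i powr q"
        using em[OF JJ[of i]] unfolding J_def s_def m_def by auto
      then have "\<mu> i = \<mu>'" "\<nu> i = \<nu>'" by (simp_all add: \<mu>_def \<nu>_def measure_def)
      with 1 show "emeasure M1 (J i) = ennreal (\<mu> i)" "emeasure M2 (J i) = ennreal (\<nu> i)"
        "\<mu> i * \<nu> i powr (q-1) \<le> A * m i powr q" by auto
    qed
    have mnE: "emeasure M1 (E i) = ennreal (\<mu>E i)" "emeasure M2 (E i) = ennreal (\<nu>E i)"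
      "\<mu>E i \<le> \<mu> i" "\<nu>E i \<le> \<nu> i" if i: "i \<in> I" for i
    proof -
      have le: "emeasure M1 (E i) \<le> ennreal (\<mu> i)" "emeasure M2 (E i) \<le> ennreal (\<nu> i)"
        unfolding mn(1,2)[OF i, symmetric] using EJ(1)[OF i] by (auto intro!: emeasure_mono simp: J_def sets)
      then show 1: "emeasure M1 (E i) = ennreal (\<mu>E i)" "emeasure M2 (E i) = ennreal (\<nu>E i)"
        unfolding \<mu>E_def \<nu>E_def by (auto intro!: emeasure_eq_ennreal_measure simp: top_unique)
      show "\<mu>E i \<le> \<mu> i" "\<nu>E i \<le> \<nu> i"
        using le unfolding 1 by (auto simp: \<mu>_def \<nu>_def ennreal_le_iff)
    qed
    have pos: "0 < \<mu>E i" "0 < \<nu>E i" "m i powr q \<le> D * (\<mu>E i * \<nu>E i powr (q-1))" if i: "i \<in> I" for i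
    proof -
      have "emeasure lborel (E i) \<le> emeasure lborel (J i)" using EJ[OF i] JJ by (intro emeasure_mono) auto
      also have "\<dots> < \<infinity>" by (simp add: J_def emeasure_lborel_Icc_eq)
      finally obtain e where e: "emeasure lborel (E i) = ennreal e" "0 \<le> e"
        by (cases "emeasure lborel (E i)") auto
      have le: "l i / 2 \<le> e" using I(4)[OF i] e by simp
      then have e0: "0 < e" using I(1)[OF i] by simp
      have 1: "(\<integral>\<^sup>+x\<in>E i. ennreal (w x) \<partial>lborel) = ennreal (\<mu>E i)" "0 \<le> \<mu>E i"
          "(\<integral>\<^sup>+x\<in>E i. ennreal (w x powr (-1/(q-1))) \<partial>lborel) = ennreal (\<nu>E i)" "0 \<le> \<nu>E i"
        using mnE(1,2)[OF i] em[OF I(2)[OF i]] by (simp_all add: s_def \<mu>E_def \<nu>E_def)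
      note X = measure_le_weight_dual[OF w w0 q I(2)[OF i] e(1) e0 1]
      show "0 < \<mu>E i" "0 < \<nu>E i" by (rule X)+
      have "(m i / 6) powr q \<le> e powr q" using le m0[OF i] q by (intro powr_mono2) (auto simp: m_def)
      also have "\<dots> \<le> 2 powr q * (\<mu>E i * \<nu>E i powr (q-1))" by (rule X)
      finally have "(m i / 6) powr q * 6 powr q \<le> 2 powr q * (\<mu>E i * \<nu>E i powr (q-1)) * 6 powr q"
        by (rule mult_right_mono) simp
      moreover have "(m i / 6) powr q * 6 powr q = m i powr q"
        using m0[OF i] by (simp add: powr_mult[symmetric])
      moreover have "2 powr q * (\<mu>E i * \<nu>E i powr (q-1)) * 6 powr q = D * (\<mu>E i * \<nu>E i powr (q-1))"
      proof -
        have "2 powr q * 6 powr q = D" by (simp add: D_def powr_mult[symmetric])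
        then show ?thesis by (metis mult.assoc mult.commute)
      qed
      ultimately show "m i powr q \<le> D * (\<mu>E i * \<nu>E i powr (q-1))" by simp
    qed
    have pos': "0 < \<mu> i" "0 < \<nu> i" if "i \<in> I" for i using pos[OF that] mnE[OF that] by auto
    define K where "K = A powr (1/p) * (A * D) powr r"
    have key: "sqrt (\<nu> i / m i) * \<mu> i \<le> K * (\<nu>E i powr (1/p) * \<mu>E i powr (1 - 1/p))" if i: "i \<in> I" for i
      unfolding K_def r_def
      by (rule sparse_exponent_inequality[OF m0[OF i] pos'[OF i] pos(1,2)[OF i] mnE(3,4)[OF i] q p mn(3)[OF i] pos(3)[OF i]])
    define S where "S x = (\<Sum>i\<in>I. v i * indicator (Q i) x)" for x
    have [measurable]: "S \<in> borel_measurable borel" unfolding S_def Q_def by measurable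
    have S0: "0 \<le> S x" for x unfolding S_def using I(5) by (intro sum_nonneg) auto
    define V where "V = (\<Sum>i\<in>I. v i)"
    have SV: "S x \<le> V" for x unfolding S_def V_def using I(5) by (intro sum_mono) (auto simp: indicator_def)
    define g where "g x = S x powr (p - 1)" for x
    have [measurable]: "g \<in> borel_measurable borel" unfolding g_def by measurable
    have g0: "0 \<le> g x" for x by (simp add: g_def)
    define X where "X = (\<integral>\<^sup>+x. ennreal (S x powr p) \<partial>M1)"
    define N where "N = (\<integral>\<^sup>+x. ennreal (f x powr p) * ennreal (w x) \<partial>lborel)"
    have finQ: "(\<integral>\<^sup>+x\<in>Q i. ennreal (g x) \<partial>M1) < \<infinity>" if i: "i \<in> I" for i
    proof -
      have "(\<integral>\<^sup>+x\<in>Q i. ennreal (g x) \<partial>M1) \<le> (\<integral>\<^sup>+x. ennreal (V powr (p-1)) * indicator (J i) x \<partial>M1)"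
        using EJ(2)[OF i] SV S0 p2
        by (intro nn_integral_mono) (auto simp: g_def indicator_def intro!: ennreal_leI powr_mono2)
      also have "\<dots> = ennreal (V powr (p-1)) * emeasure M1 (J i)"
        by (intro nn_integral_cmult_indicator) (simp add: J_def sets)
      also have "\<dots> < \<infinity>" by (simp add: mn(1)[OF i] ennreal_mult_less_top)
      finally show ?thesis .
    qed
    have XX: "X = (\<Sum>i\<in>I. ennreal (v i) * (\<integral>\<^sup>+x\<in>Q i. ennreal (g x) \<partial>M1))"
    proof -
      have "X = (\<integral>\<^sup>+x. (\<Sum>i\<in>I. ennreal (v i) * (ennreal (g x) * indicator (Q i) x)) \<partial>M1)"
        unfolding X_def
      proof (intro nn_integral_cong)
        fix x
        have "S x powr p = S x * g x" using powr_add[of "S x" 1 "p-1"] S0[of x]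
          by (cases "S x = 0") (auto simp: g_def)
        also have "\<dots> = (\<Sum>i\<in>I. v i * (g x * indicator (Q i) x))"
          unfolding S_def sum_distrib_right by (simp only: mult_ac)
        also have "ennreal \<dots> = (\<Sum>i\<in>I. ennreal (v i * (g x * indicator (Q i) x)))"
          using I(5) by (intro sum_ennreal[symmetric]) (auto simp: g_def)
        also have "\<dots> = (\<Sum>i\<in>I. ennreal (v i) * (ennreal (g x) * indicator (Q i) x))"
          using I(5) g0 by (intro sum.cong refl) (auto simp: ennreal_mult indicator_def)
        finally show "ennreal (S x powr p) = (\<Sum>i\<in>I. ennreal (v i) * (ennreal (g x) * indicator (Q i) x))" .
      qed
      also have "\<dots> = (\<Sum>i\<in>I. ennreal (v i) * (\<integral>\<^sup>+x\<in>Q i. ennreal (g x) \<partial>M1))"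
        by (subst nn_integral_sum) (auto simp: nn_integral_cmult sets Q_def)
      finally show ?thesis .
    qed
    have Xfin: "X < \<infinity>" unfolding XX using finQ by (auto intro!: ennreal_mult_less_top[THEN iffD2] simp: fin)
    \<comment> \<open>\<open>c i\<close> is the mean of \<open>(f x)\<^sup>2 / s x\<close> over
      \<open>J i\<close> for the measure with density \<open>s\<close>, and \<open>b i\<close> is at
      most the mean of \<open>g\<close> over \<open>J i\<close> for the measure with density
      \<open>w\<close>. They are the coefficients for Carleson embedding with the exponents
      \<open>q\<close> and \<open>p'\<close>.\<close>
    define b where "b i = enn2real (\<integral>\<^sup>+x\<in>Q i. ennreal (g x) \<partial>M1) / \<mu> i" for i
    define c where "c i = (v i)\<^sup>2 * m i / \<nu> i" for i
    have b: "ennreal (b i * \<mu> i) = (\<integral>\<^sup>+x\<in>Q i. ennreal (g x) \<partial>M1)" "0 \<le> b i" if i: "i \<in> I" for i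
      using finQ[OF i] pos'[OF i] by (simp_all add: b_def)
    have c0: "0 \<le> c i" if "i \<in> I" for i using pos'[OF that] m0[OF that] by (simp add: c_def)
    have car1: "(\<Sum>i\<in>I. ennreal (c i powr q) * emeasure M2 (E i)) \<le> ennreal C1 * N"
    proof -
      define h where "h x = (f x)\<^sup>2 / s x" for x
      have [measurable]: "h \<in> borel_measurable borel" unfolding h_def by measurable
      have "(\<Sum>i\<in>I. ennreal (c i powr q) * emeasure M2 (E i)) \<le> ennreal C1 * (\<integral>\<^sup>+x. ennreal (h x powr q) \<partial>M2)"
        unfolding C1_def
      proof (rule carleson_embedding[OF sf(2) fin q])
        fix i assume i: "i \<in> I"
        show "is_interval (J i)" by (simp add: J_def is_interval_cc)
        show "emeasure M2 (J i) < \<infinity>" by (simp add: mn(2)[OF i])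
        have "ennreal (c i) * emeasure M2 (J i) = ennreal ((v i)\<^sup>2 * m i)"
          using c0[OF i] pos'[OF i] by (simp add: mn(2)[OF i] ennreal_mult[symmetric] c_def)
        also have "\<dots> = (\<integral>\<^sup>+x\<in>J i. ennreal ((f x)\<^sup>2) \<partial>lborel)" using I(6)[OF i] by (simp add: J_def m_def)
        also have "\<dots> = (\<integral>\<^sup>+x\<in>J i. ennreal (h x) \<partial>M2)"
        proof -
          have "ennreal ((f x)\<^sup>2) = ennreal (s x) * ennreal (h x)" for x
            using s0[of x] by (simp add: h_def ennreal_mult[symmetric])
          note [measurable] = JJ
          show ?thesis
            unfolding M2_def using \<open>\<And>x. ennreal ((f x)\<^sup>2) = ennreal (s x) * ennreal (h x)\<close>
            by (subst nn_integral_density; (measurable; fail)?) (simp add: mult.assoc)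
        qed
        finally show "ennreal (c i) * emeasure M2 (J i) \<le> (\<integral>\<^sup>+x\<in>J i. ennreal (h x) \<partial>M2)" by simp
      next
        fix x show "0 \<le> h x" using s0[of x] by (simp add: h_def)
      qed (use EJ c0 I disj JJ in \<open>auto simp: sets\<close>)
      \<comment> \<open>The dual weight is made for this: \<open>s x powr (1 - q) = w x\<close>, so
        the \<open>q\<close>-th power integral of \<open>h\<close> against \<open>s\<close> is the
        \<open>p\<close>-th power integral of \<open>f\<close> against \<open>w\<close>.\<close>
      also have "(\<integral>\<^sup>+x. ennreal (h x powr q) \<partial>M2) = N"
        unfolding M2_def N_def
      proof (subst nn_integral_density, measurable, intro nn_integral_cong)
        fix x
        have "s x * h x powr q = f x powr p * w x"
        proof (cases "f x = 0")
          case True then show ?thesis using q by (simp add: h_def)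
        next
          case False
          have "h x powr q = f x powr p / s x powr q"
            using s0[of x] f0[of x] False p by (simp add: h_def powr_divide powr_powr flip: powr_numeral)
          moreover have "s x / s x powr q = w x"
          proof -
            have "s x / s x powr q = s x powr (1 - q)" using s0[of x] by (simp add: powr_diff)
            also have "\<dots> = w x powr ((-1/(q-1)) * (1 - q))" by (simp add: s_def powr_powr)
            also have "(-1/(q-1)) * (1 - q) = 1" using q by (simp add: field_simps)
            finally show ?thesis using w0[of x] by simp
          qed
          ultimately show ?thesis by (metis mult.commute times_divide_eq_right)
        qed
        then show "ennreal (s x) * ennreal (h x powr q) = ennreal (f x powr p) * ennreal (w x)"
          using s0[of x] w0[of x] by (simp add: ennreal_mult[symmetric] less_imp_le)
      qed
      finally show ?thesis .
    qed
    have car2: "(\<Sum>i\<in>I. ennreal (b i powr p') * emeasure M1 (E i)) \<le> ennreal C2 * X"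
    proof -
      have "(\<Sum>i\<in>I. ennreal (b i powr p') * emeasure M1 (E i)) \<le> ennreal C2 * (\<integral>\<^sup>+x. ennreal (g x powr p') \<partial>M1)"
        unfolding C2_def
      proof (rule carleson_embedding[OF sf(1) fin p'])
        fix i assume i: "i \<in> I"
        show "is_interval (J i)" by (simp add: J_def is_interval_cc)
        show "emeasure M1 (J i) < \<infinity>" by (simp add: mn(1)[OF i])
        have "ennreal (b i) * emeasure M1 (J i) = (\<integral>\<^sup>+x\<in>Q i. ennreal (g x) \<partial>M1)"
          using b[OF i] pos'[OF i] by (simp add: mn(1)[OF i] ennreal_mult[symmetric])
        also have "\<dots> \<le> (\<integral>\<^sup>+x\<in>J i. ennreal (g x) \<partial>M1)"
          using EJ(2)[OF i] by (intro nn_integral_mono) (auto simp: indicator_def)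
        finally show "ennreal (b i) * emeasure M1 (J i) \<le> (\<integral>\<^sup>+x\<in>J i. ennreal (g x) \<partial>M1)" .
      next
        fix x show "0 \<le> g x" by (simp add: g_def)
      qed (use EJ b I disj JJ in \<open>auto simp: sets\<close>)
      also have "(\<integral>\<^sup>+x. ennreal (g x powr p') \<partial>M1) = X"
        unfolding X_def using p2 by (simp add: g_def powr_powr p'_def)
      finally show ?thesis .
    qed
    have summand: "ennreal (v i) * (\<integral>\<^sup>+x\<in>Q i. ennreal (g x) \<partial>M1)
      \<le> ennreal ((K * \<tau>) powr p) * (ennreal (c i powr q) * emeasure M2 (E i))
        + ennreal (1 / (2 * C2)) * (ennreal (b i powr p') * emeasure M1 (E i))" if i: "i \<in> I" for i
    proof -
      have K0: "0 \<le> K" by (simp add: K_def)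
      \<comment> \<open>The quadratic mean of \<open>f\<close> is factored into its mean against the
        dual weight and the ratio \<open>\<nu> i / m i\<close>. Together with \<open>\<mu> i\<close>
        that ratio forms the left side of \<open>sparse_exponent_inequality\<close>.\<close>
      have vv: "v i = sqrt (c i) * sqrt (\<nu> i / m i)"
        using pos'[OF i] m0[OF i] I(5)[OF i] by (simp add: c_def real_sqrt_mult real_sqrt_divide)
      have "v i * (b i * \<mu> i) = sqrt (c i) * b i * (sqrt (\<nu> i / m i) * \<mu> i)" by (simp add: vv)
      also have "\<dots> \<le> sqrt (c i) * b i * (K * (\<nu>E i powr (1/p) * \<mu>E i powr (1 - 1/p)))"
        using c0[OF i] b(2)[OF i] by (intro mult_left_mono key i) auto
      also have "\<dots> = (K * \<tau> * (sqrt (c i) * \<nu>E i powr (1/p))) * ((b i * \<mu>E i powr (1 - 1/p)) / \<tau>)"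
        using \<tau> by simp
      also have "\<dots> \<le> (K * \<tau> * (sqrt (c i) * \<nu>E i powr (1/p))) powr p + ((b i * \<mu>E i powr (1 - 1/p)) / \<tau>) powr p'"
        unfolding p'_def using K0 \<tau> c0[OF i] b(2)[OF i] p2 by (intro mult_le_powr_conj) auto
      also have "(K * \<tau> * (sqrt (c i) * \<nu>E i powr (1/p))) powr p = (K * \<tau>) powr p * (c i powr q * \<nu>E i)"
        using K0 \<tau> c0[OF i] pos[OF i] p2 p by (simp add: powr_mult powr_powr powr_half_sqrt[symmetric])
      also have "((b i * \<mu>E i powr (1 - 1/p)) / \<tau>) powr p' = 1 / (2 * C2) * (b i powr p' * \<mu>E i)"
      proof -
        have "(1 - 1/p) * p' = 1" using p2 by (simp add: p'_def field_simps)
        then show ?thesis using b(2)[OF i] \<tau> pos[OF i]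
          by (simp add: powr_mult powr_divide powr_powr \<tau>p')
      qed
      finally have "ennreal (v i * (b i * \<mu> i))
        \<le> ennreal ((K * \<tau>) powr p * (c i powr q * \<nu>E i) + 1 / (2 * C2) * (b i powr p' * \<mu>E i))"
        by (rule ennreal_leI)
      then show ?thesis
        unfolding b(1)[OF i, symmetric] mnE(1,2)[OF i]
        using I(5)[OF i] b(2)[OF i] pos[OF i] pos'[OF i] C2
        by (simp add: ennreal_mult[symmetric] ennreal_plus[symmetric] del: ennreal_plus)
    qed
    have "X \<le> (\<Sum>i\<in>I. ennreal ((K * \<tau>) powr p) * (ennreal (c i powr q) * emeasure M2 (E i))
        + ennreal (1 / (2 * C2)) * (ennreal (b i powr p') * emeasure M1 (E i)))"
      unfolding XX by (intro sum_mono summand)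
    also have "\<dots> = ennreal ((K * \<tau>) powr p) * (\<Sum>i\<in>I. ennreal (c i powr q) * emeasure M2 (E i))
        + ennreal (1 / (2 * C2)) * (\<Sum>i\<in>I. ennreal (b i powr p') * emeasure M1 (E i))"
      by (simp add: sum.distrib sum_distrib_left)
    also have "\<dots> \<le> ennreal ((K * \<tau>) powr p) * (ennreal C1 * N) + ennreal (1 / (2 * C2)) * (ennreal C2 * X)"
      by (intro add_mono mult_left_mono car1 car2) auto
    also have "ennreal (1 / (2 * C2)) * (ennreal C2 * X) = ennreal (1/2) * X"
      using C2 by (simp add: mult.assoc[symmetric] ennreal_mult[symmetric])
    finally have 1: "X \<le> ennreal ((K * \<tau>) powr p) * (ennreal C1 * N) + ennreal (1/2) * X" .
    obtain x where x: "X = ennreal x" "0 \<le> x" using Xfin by (cases X) auto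
    have half: "ennreal (1/2) * ennreal x = ennreal (x/2)"
      by (subst ennreal_mult[symmetric]) (use x(2) in auto)
    have "ennreal (1/2) * X + ennreal (1/2) * X = X"
      unfolding x(1) half by (subst ennreal_plus[symmetric]) (use x(2) in auto)
    then have "ennreal (1/2) * X + ennreal (1/2) * X \<le> ennreal (1/2) * X + ennreal ((K * \<tau>) powr p) * (ennreal C1 * N)"
      using 1 by (simp add: add.commute)
    then have 2: "ennreal (1/2) * X \<le> ennreal ((K * \<tau>) powr p) * (ennreal C1 * N)"
      using Xfin by (subst (asm) ennreal_add_left_cancel_le) (auto simp: ennreal_mult_eq_top_iff)
    have "X = 2 * (ennreal (1/2) * X)"
      unfolding x(1) half using x(2) ennreal_mult[of 2 "x/2"] by simp
    also have "\<dots> \<le> 2 * (ennreal ((K * \<tau>) powr p) * (ennreal C1 * N))" by (intro mult_left_mono 2) auto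
    also have "\<dots> = ennreal (2 * ((K * \<tau>) powr p * C1)) * N"
      using C1 by (simp add: ennreal_mult mult.assoc)
    also have "2 * ((K * \<tau>) powr p * C1) = C * A powr (p * max (1 / (p - 2)) 1)"
    proof -
      obtain i where i: "i \<in> I" using False by auto
      have A0: "0 < A"
      proof -
        have "0 < A * m i powr q" using mn(3)[OF i] pos'[OF i] by (smt (verit) mult_pos_pos powr_gt_zero)
        then show ?thesis using m0[OF i] by (simp add: zero_less_mult_iff)
      qed
      have "(K * \<tau>) powr p = K powr p * \<tau> powr p" using \<tau> by (simp add: powr_mult K_def)
      also have "K powr p = A powr (1 + p * r) * D powr (p * r)"
        using A0 D0 p2 by (simp add: K_def powr_mult powr_powr powr_add mult_ac)
      finally show ?thesis unfolding rp C_def by (simp add: mult_ac)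
    qed
    finally show ?thesis
      unfolding X_def N_def M1_def by (subst (asm) nn_integral_density) (auto simp: S_def Q_def mult.commute)
  qed
  then show ?thesis using C0 by (intro exI[of _ C]) blast
qed

section \<open>Sparse domination by quadratic averages\<close>

text \<open>A class closed under restriction to intervals and under multiplication by kernels that
  are bounded on the support. All Fourier integrals of its members converge absolutely, and unlike
  smooth functions its members can be cut off sharply during the recursion.\<close>

definition nice_fun :: "(real \<Rightarrow> complex) \<Rightarrow> bool" where
  "nice_fun F \<longleftrightarrow> F \<in> borel_measurable borel \<and> (\<exists>R\<ge>0. \<forall>x. cmod (F x) \<le> R \<and> (R < \<bar>x\<bar> \<longrightarrow> F x = 0))"

lemma nice_fun_measurable: "nice_fun F \<Longrightarrow> F \<in> borel_measurable borel"
  by (simp add: nice_fun_def)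

lemma nice_funE:
  assumes "nice_fun F"
  obtains R where "0 \<le> R" "\<And>x. cmod (F x) \<le> R" "\<And>x. R < \<bar>x\<bar> \<Longrightarrow> F x = 0"
  using assms unfolding nice_fun_def by blast

lemma nice_fun_mult:
  assumes F: "nice_fun F" and [measurable]: "g \<in> borel_measurable borel"
    and g: "\<And>x. F x \<noteq> 0 \<Longrightarrow> cmod (g x) \<le> c"
  shows "nice_fun (\<lambda>x. F x * g x)"
proof -
  note [measurable] = nice_fun_measurable[OF F]
  obtain R where R: "0 \<le> R" "\<And>x. cmod (F x) \<le> R" "\<And>x. R < \<bar>x\<bar> \<Longrightarrow> F x = 0" using nice_funE[OF F] by blast
  define c' where "c' = max c 0"
  have "cmod (F x * g x) \<le> max R (R * c')" for x
  proof (cases "F x = 0")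
    case False
    have "cmod (g x) \<le> c'" using g[OF False] by (simp add: c'_def)
    then have "cmod (F x) * cmod (g x) \<le> R * c'" using R by (intro mult_mono) auto
    then show ?thesis by (simp add: norm_mult)
  qed (use R in auto)
  then show ?thesis unfolding nice_fun_def using R
    by (intro conjI exI[of _ "max R (R * c')"]) auto
qed

lemma nice_fun_indicator: "nice_fun F \<Longrightarrow> A \<in> sets borel \<Longrightarrow> nice_fun (\<lambda>x. F x * indicator A x)"
  by (rule nice_fun_mult[where c=1]) (auto simp: indicator_def)

lemma nice_fun_nn_integral:
  assumes F: "nice_fun F" "0 < p"
  shows "(\<integral>\<^sup>+x. ennreal (cmod (F x) powr p) \<partial>lborel) < \<infinity>"
proof -
  obtain R where R: "0 \<le> R" "\<And>x. cmod (F x) \<le> R" "\<And>x. R < \<bar>x\<bar> \<Longrightarrow> F x = 0" using nice_funE[OF F(1)] by blast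
  have "(\<integral>\<^sup>+x. ennreal (cmod (F x) powr p) \<partial>lborel) \<le> (\<integral>\<^sup>+x. ennreal (R powr p) * indicator {-R..R} x \<partial>lborel)"
  proof (intro nn_integral_mono)
    fix x
    show "ennreal (cmod (F x) powr p) \<le> ennreal (R powr p) * indicator {-R..R} x"
    proof (cases "R < \<bar>x\<bar>")
      case True then show ?thesis using R(3)[of x] assms by simp
    next
      case False
      then have "x \<in> {-R..R}" by auto
      then show ?thesis using R assms by (auto intro!: ennreal_leI powr_mono2)
    qed
  qed
  also have "\<dots> = ennreal (R powr p) * emeasure lborel {-R..R}" by (simp add: nn_integral_cmult_indicator)
  also have "\<dots> < \<infinity>" using R(1) by (simp add: ennreal_mult_less_top)
  finally show ?thesis .
qed

lemma nice_fun_nn_integral_sq: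
  assumes F: "nice_fun F"
  shows "(\<integral>\<^sup>+x. ennreal ((cmod (F x))\<^sup>2) \<partial>lborel) < \<infinity>"
  using nice_fun_nn_integral[OF F, of 2] by simp

text \<open>Dyadic shells around \<open>x\<close>: at distance between \<open>2^j * l\<close> and
  \<open>2^(j+1) * l\<close> the factor is at most \<open>1 / (2^j * l)\<^sup>2\<close> and the mass
  at most \<open>c * (4 * 2^j * l)\<close>. The terms \<open>4 * c / l * (1/2)^j\<close> sum to at
  most \<open>8 * c / l\<close>.\<close>

lemma inverse_square_tail:
  fixes g :: "real \<Rightarrow> real"
  assumes [measurable]: "g \<in> borel_measurable borel" and g0: "\<And>y. 0 \<le> g y" and l: "0 < l" and c: "0 \<le> c"
    and near: "\<And>y. \<bar>y - x\<bar> < l \<Longrightarrow> g y = 0" and far: "\<And>y. R < \<bar>y\<bar> \<Longrightarrow> g y = 0"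
    and avg: "\<And>r. 0 < r \<Longrightarrow> (\<integral>\<^sup>+y\<in>{x-r<..<x+r}. ennreal (g y) \<partial>lborel) \<le> ennreal (c * (2 * r))"
  shows "(\<integral>\<^sup>+y. ennreal (g y / (y - x)\<^sup>2) \<partial>lborel) \<le> ennreal (8 * c / l)"
proof -
  \<comment> \<open>The support is bounded, so finitely many shells exhaust it.\<close>
  obtain n where n: "(\<bar>R\<bar> + \<bar>x\<bar>) / l < 2 ^ n" using real_arch_pow[of 2] by auto
  define k where "k j = 1 / (2 ^ j * l)\<^sup>2" for j :: nat
  have "(\<integral>\<^sup>+y. ennreal (g y / (y - x)\<^sup>2) \<partial>lborel)
    \<le> (\<integral>\<^sup>+y. (\<Sum>j<n. ennreal (k j) * (ennreal (g y) * indicator {x-2^(j+1)*l<..<x+2^(j+1)*l} y)) \<partial>lborel)"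
  proof (intro nn_integral_mono)
    fix y
    show "ennreal (g y / (y - x)\<^sup>2)
      \<le> (\<Sum>j<n. ennreal (k j) * (ennreal (g y) * indicator {x-2^(j+1)*l<..<x+2^(j+1)*l} y))"
    proof (cases "g y = 0")
      case False
      then have ly: "l \<le> \<bar>y - x\<bar>" and Ry: "\<bar>y\<bar> \<le> R" using near far not_le by blast+
      define P where "P j \<longleftrightarrow> \<bar>y - x\<bar> < 2^j * l" for j :: nat
      have "\<bar>y - x\<bar> \<le> \<bar>R\<bar> + \<bar>x\<bar>" using Ry by linarith
      also have "\<dots> < 2 ^ n * l" using n l by (simp add: divide_simps)
      finally have Pn: "P n" by (simp add: P_def)
      have P0: "\<not> P 0" using ly by (simp add: P_def)
      obtain m where m: "P m" "\<And>i. i < m \<Longrightarrow> \<not> P i" using Pn exists_least_iff[of P] by blast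
      have "m \<noteq> 0" using m(1) P0 by metis
      then obtain j where j: "m = Suc j" using not0_implies_Suc by blast
      have "m \<le> n" using m(2) Pn not_le by blast
      then have jn: "j < n" using j by simp
      have "\<not> P j" using m(2) j by simp
      then have j1: "2^j * l \<le> \<bar>y - x\<bar>" by (simp add: P_def)
      have j2: "y \<in> {x-2^(j+1)*l<..<x+2^(j+1)*l}" using m(1) j by (auto simp: P_def abs_less_iff)
      have "(2^j * l)\<^sup>2 \<le> (y - x)\<^sup>2" using j1 l by (metis abs_le_square_iff abs_of_nonneg less_imp_le mult_nonneg_nonneg zero_le_numeral zero_le_power)
      then have "g y / (y - x)\<^sup>2 \<le> k j * g y"
        unfolding k_def using g0[of y] l by (simp add: frac_le)
      then have "ennreal (g y / (y - x)\<^sup>2) \<le> ennreal (k j) * (ennreal (g y) * indicator {x-2^(j+1)*l<..<x+2^(j+1)*l} y)"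
        using j2 g0[of y] by (simp add: ennreal_mult[symmetric] k_def ennreal_leI)
      also have "\<dots> \<le> (\<Sum>j<n. ennreal (k j) * (ennreal (g y) * indicator {x-2^(j+1)*l<..<x+2^(j+1)*l} y))"
        using jn by (intro member_le_sum) auto
      finally show ?thesis .
    qed auto
  qed
  also have "\<dots> = (\<Sum>j<n. ennreal (k j) * (\<integral>\<^sup>+y\<in>{x-2^(j+1)*l<..<x+2^(j+1)*l}. ennreal (g y) \<partial>lborel))"
    by (subst nn_integral_sum) (auto simp: nn_integral_cmult)
  also have "\<dots> \<le> (\<Sum>j<n. ennreal (k j) * ennreal (c * (2 * (2^(j+1) * l))))"
    by (intro sum_mono mult_left_mono avg) (use l in auto)
  also have "\<dots> = (\<Sum>j<n. ennreal (4 * c / l * (1/2)^j))"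
  proof (intro sum.cong refl)
    fix j
    have "k j * (c * (2 * (2^(j+1) * l))) = 4 * c / l * (1/2)^j"
      unfolding k_def using l by (simp add: power2_eq_square field_simps)
    then show "ennreal (k j) * ennreal (c * (2 * (2^(j+1) * l))) = ennreal (4 * c / l * (1/2)^j)"
      using c l by (subst ennreal_mult[symmetric]) (auto simp: k_def)
  qed
  also have "\<dots> = ennreal (\<Sum>j<n. 4 * c / l * (1/2)^j)" using c l by (intro sum_ennreal) auto
  also have "(\<Sum>j<n. 4 * c / l * (1/2)^j) \<le> 8 * c / l"
  proof -
    have "(\<Sum>j<n. (1/2::real)^j) \<le> 2" by (subst geometric_sum) (auto simp: field_simps)
    then have "4 * c / l * (\<Sum>j<n. (1/2)^j) \<le> 4 * c / l * 2" using c l by (intro mult_left_mono) auto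
    then show ?thesis by (simp add: sum_distrib_left)
  qed
  finally show ?thesis by (simp add: ennreal_leI)
qed

lemma fmeasurable_Ico: "{a..<b::real} \<in> fmeasurable lborel"
  by (cases "a \<le> b") (auto intro!: fmeasurableI)

section \<open>Stopping intervals by bisection\<close>

text \<open>Bisection, stopped at the first halves in which \<open>E\<close> has density above
  \<open>1/4\<close>. Since the parent has density at most \<open>1/4\<close>, a selected half has
  density at most \<open>1/2\<close>, so it still contains many points outside \<open>E\<close>.
  Breaking off after \<open>n\<close> generations keeps the family finite; a point never selected
  retains an interval of length \<open>l/2^n\<close> in which \<open>E\<close> is not dense.\<close>

lemma stopping_intervals:
  fixes E :: "real set"
  assumes [measurable]: "E \<in> sets borel"
  shows "0 < l \<Longrightarrow> measure lborel ({a..<a+l} \<inter> E) \<le> l / 4 \<Longrightarrow>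
    \<exists>P :: (real \<times> real) set. finite P \<and> disjoint_family_on (\<lambda>(b,h). {b..<b+h}) P \<and>
      (\<forall>(b,h)\<in>P. 0 < h \<and> h \<le> l/2 \<and> {b..<b+h} \<subseteq> {a..<a+l} \<and>
          h/4 < measure lborel ({b..<b+h} \<inter> E) \<and> measure lborel ({b..<b+h} \<inter> E) \<le> h/2) \<and>
      (\<forall>x\<in>{a..<a+l}. x \<in> (\<Union>(b,h)\<in>P. {b..<b+h}) \<or>
          (\<exists>b. x \<in> {b..<b + l/2^n} \<and> {b..<b + l/2^n} \<subseteq> {a..<a+l} \<and>
             measure lborel ({b..<b + l/2^n} \<inter> E) \<le> (l/2^n)/2))"
proof (induction n arbitrary: a l)
  case 0
  then show ?case by (intro exI[of _ "{}"]) (auto simp: disjoint_family_on_def)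
next
  case (Suc n)
  define good where "good b P \<longleftrightarrow> finite P \<and> disjoint_family_on (\<lambda>(b,h). {b..<b+h}) P \<and>
      (\<forall>(c,h)\<in>P. 0 < h \<and> h \<le> l/2 \<and> {c..<c+h} \<subseteq> {b..<b+l/2} \<and>
          h/4 < measure lborel ({c..<c+h} \<inter> E) \<and> measure lborel ({c..<c+h} \<inter> E) \<le> h/2) \<and>
      (\<forall>x\<in>{b..<b+l/2}. x \<in> (\<Union>(c,h)\<in>P. {c..<c+h}) \<or>
          (\<exists>c. x \<in> {c..<c + l/2^Suc n} \<and> {c..<c + l/2^Suc n} \<subseteq> {b..<b+l/2} \<and>
             measure lborel ({c..<c + l/2^Suc n} \<inter> E) \<le> (l/2^Suc n)/2))"
    for b and P :: "(real \<times> real) set"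
  \<comment> \<open>A half that is not dense is bisected further by the induction hypothesis, a
    dense one is selected as a whole.\<close>
  have half: "\<exists>P. good b P" if b: "{b..<b+l/2} \<subseteq> {a..<a+l}" for b
  proof (cases "measure lborel ({b..<b+l/2} \<inter> E) \<le> (l/2)/4")
    case True
    have "0 < l/2" using Suc.prems by simp
    from Suc.IH[OF this True] obtain P where P: "finite P" "disjoint_family_on (\<lambda>(b,h). {b..<b+h}) P"
      "\<forall>(c,h)\<in>P. 0 < h \<and> h \<le> l/2/2 \<and> {c..<c+h} \<subseteq> {b..<b+l/2} \<and>
          h/4 < measure lborel ({c..<c+h} \<inter> E) \<and> measure lborel ({c..<c+h} \<inter> E) \<le> h/2"
      "\<forall>x\<in>{b..<b+l/2}. x \<in> (\<Union>(c,h)\<in>P. {c..<c+h}) \<or>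
          (\<exists>c. x \<in> {c..<c + l/2/2^n} \<and> {c..<c + l/2/2^n} \<subseteq> {b..<b+l/2} \<and>
             measure lborel ({c..<c + l/2/2^n} \<inter> E) \<le> (l/2/2^n)/2)"
      by blast
    have e: "l/2/2^n = l/2^Suc n" by simp
    have "good b P" unfolding good_def e[symmetric] using P Suc.prems(1) by fastforce
    then show ?thesis by blast
  next
    case False
    have "measure lborel ({b..<b+l/2} \<inter> E) \<le> measure lborel ({a..<a+l} \<inter> E)"
      using b by (intro measure_mono_fmeasurable) (auto intro!: fmeasurable_Int_fmeasurable fmeasurable_Ico)
    then have "good b {(b, l/2)}" unfolding good_def using Suc.prems False
      by (auto simp: disjoint_family_on_def)
    then show ?thesis by blast
  qed
  have ab: "{a..<a+l/2} \<subseteq> {a..<a+l}" "{a+l/2..<a+l/2+l/2} \<subseteq> {a..<a+l}" using Suc.prems(1) by auto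
  obtain P1 P2 where P: "good a P1" "good (a+l/2) P2" using half[OF ab(1)] half[OF ab(2)] by blast
  have dj: "disjoint_family_on (\<lambda>(b,h). {b..<b+h}) (P1 \<union> P2)"
    unfolding disjoint_family_on_def
  proof (intro ballI impI)
    fix x y assume xy: "x \<in> P1 \<union> P2" "y \<in> P1 \<union> P2" "x \<noteq> y"
    define I where "I = (\<lambda>(b::real,h). {b..<b+h})"
    have s1: "I z \<subseteq> {a..<a+l/2}" if "z \<in> P1" for z using P(1) that unfolding good_def I_def by fastforce
    have s2: "I z \<subseteq> {a+l/2..<a+l/2+l/2}" if "z \<in> P2" for z using P(2) that unfolding good_def I_def by fastforce
    have d: "{a..<a+l/2} \<inter> {a+l/2..<a+l/2+l/2} = {}" by auto
    have dd: "disjoint_family_on I P1" "disjoint_family_on I P2" using P unfolding good_def I_def by auto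
    have "I x \<inter> I y = {}"
      using xy s1[of x] s1[of y] s2[of x] s2[of y] d dd
      unfolding disjoint_family_on_def by blast
    then show "(case x of (b, h) \<Rightarrow> {b..<b + h}) \<inter> (case y of (b, h) \<Rightarrow> {b..<b + h}) = {}"
      by (simp add: I_def)
  qed
  show ?case
  proof (intro exI[of _ "P1 \<union> P2"] conjI dj)
    show "finite (P1 \<union> P2)" using P by (auto simp: good_def)
    show "\<forall>(b,h)\<in>P1 \<union> P2. 0 < h \<and> h \<le> l/2 \<and> {b..<b+h} \<subseteq> {a..<a+l} \<and>
          h/4 < measure lborel ({b..<b+h} \<inter> E) \<and> measure lborel ({b..<b+h} \<inter> E) \<le> h/2"
      using P ab unfolding good_def by blast
    show "\<forall>x\<in>{a..<a+l}. x \<in> (\<Union>(b,h)\<in>P1 \<union> P2. {b..<b+h}) \<or>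
          (\<exists>b. x \<in> {b..<b + l/2^Suc n} \<and> {b..<b + l/2^Suc n} \<subseteq> {a..<a+l} \<and>
             measure lborel ({b..<b + l/2^Suc n} \<inter> E) \<le> (l/2^Suc n)/2)"
    proof
      fix x assume "x \<in> {a..<a+l}"
      then consider "x \<in> {a..<a+l/2}" | "x \<in> {a+l/2..<a+l/2+l/2}" by fastforce
      then show "x \<in> (\<Union>(b,h)\<in>P1 \<union> P2. {b..<b+h}) \<or>
          (\<exists>b. x \<in> {b..<b + l/2^Suc n} \<and> {b..<b + l/2^Suc n} \<subseteq> {a..<a+l} \<and>
             measure lborel ({b..<b + l/2^Suc n} \<inter> E) \<le> (l/2^Suc n)/2)"
      proof cases
        case 1
        then have "x \<in> (\<Union>(c,h)\<in>P1. {c..<c+h}) \<or>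
          (\<exists>c. x \<in> {c..<c + l/2^Suc n} \<and> {c..<c + l/2^Suc n} \<subseteq> {a..<a+l/2} \<and>
             measure lborel ({c..<c + l/2^Suc n} \<inter> E) \<le> (l/2^Suc n)/2)" using P(1) unfolding good_def by blast
        then show ?thesis using ab(1) by blast
      next
        case 2
        then have "x \<in> (\<Union>(c,h)\<in>P2. {c..<c+h}) \<or>
          (\<exists>c. x \<in> {c..<c + l/2^Suc n} \<and> {c..<c + l/2^Suc n} \<subseteq> {a+l/2..<a+l/2+l/2} \<and>
             measure lborel ({c..<c + l/2^Suc n} \<inter> E) \<le> (l/2^Suc n)/2)" using P(2) unfolding good_def by blast
        then show ?thesis using ab(2) by blast
      qed
    qed
  qed
qed

section \<open>Sparse domination for an abstract sublinear operator\<close>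

text \<open>The quantitative hypotheses are the L2 bound, which yields weak type, and the
  oscillation bound for functions that vanish on the tripled interval, in terms of their inverse
  square tail \<open>T\<close> about the centre. The crude bound \<open>N_bound\<close> only ends
  the recursion at small scales, so \<open>\<kappa>\<close> does not enter the final
  constant.\<close>

locale sparse_operator =
  fixes N :: "(real \<Rightarrow> complex) \<Rightarrow> real \<Rightarrow> real" and A \<kappa> :: real
  assumes A0: "0 < A" and \<kappa>0: "0 \<le> \<kappa>"
    and N_measurable: "nice_fun F \<Longrightarrow> N F \<in> borel_measurable borel"
    and N_nonneg: "0 \<le> N F x"
    and N_bound: "nice_fun F \<Longrightarrow> (\<integral>\<^sup>+y. ennreal (cmod (F y)) \<partial>lborel) \<le> ennreal T \<Longrightarrow> 0 \<le> T \<Longrightarrow> N F x \<le> \<kappa> * T"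
    and N_add: "nice_fun F \<Longrightarrow> nice_fun G \<Longrightarrow> N (\<lambda>y. F y + G y) x \<le> N F x + N G x"
    and N_diff: "nice_fun F \<Longrightarrow> nice_fun G \<Longrightarrow> N (\<lambda>y. F y - G y) x \<le> N F x + N G x"
    and N_L2: "nice_fun F \<Longrightarrow> (\<integral>\<^sup>+x. ennreal ((N F x)\<^sup>2) \<partial>lborel) \<le> ennreal A * (\<integral>\<^sup>+y. ennreal ((cmod (F y))\<^sup>2) \<partial>lborel)"
    and N_osc: "nice_fun F \<Longrightarrow> 0 < l \<Longrightarrow> (\<And>y. y \<in> {a-l..<a+2*l} \<Longrightarrow> F y = 0) \<Longrightarrow> x \<in> {a..<a+l} \<Longrightarrow> x' \<in> {a..<a+l} \<Longrightarrow>
       0 \<le> T \<Longrightarrow> (\<integral>\<^sup>+y. ennreal ((cmod (F y))\<^sup>2 / (y - (a + l/2))\<^sup>2) \<partial>lborel) \<le> ennreal T \<Longrightarrow>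
       N F x \<le> N F x' + sqrt (A * l * T)"
begin

text \<open>Chebyshev's inequality for \<open>N\<close> asks for \<open>16 * A\<close>, and the weak
  type bound with constant 2 for the quadratic maximal function asks for 32. Each then leaves an
  exceptional set of measure at most \<open>l/16\<close>.\<close>

definition \<Lambda> :: real where "\<Lambda> = 16 * (A + 2)"

definition loc :: "(real \<Rightarrow> complex) \<Rightarrow> real \<Rightarrow> real \<Rightarrow> real \<Rightarrow> complex" where
  "loc f a l y = f y * indicator {a-l..<a+2*l} y"

text \<open>Three times the mean square over the tripled interval, since the integral over length
  \<open>3 * l\<close> is divided by \<open>l\<close>. The surplus reappears as
  \<open>sqrt 3\<close> in the weighted bound.\<close>

definition sqavg :: "(real \<Rightarrow> complex) \<Rightarrow> real \<Rightarrow> real \<Rightarrow> real" where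
  "sqavg f a l = enn2real (\<integral>\<^sup>+y. ennreal ((cmod (loc f a l y))\<^sup>2) \<partial>lborel) / l"

lemma \<Lambda>: "32 \<le> \<Lambda>" "16 * A \<le> \<Lambda>" "0 < \<Lambda>" using A0 by (auto simp: \<Lambda>_def)

lemma nice_loc: "nice_fun f \<Longrightarrow> nice_fun (loc f a l)"
  unfolding loc_def by (intro nice_fun_indicator) auto

lemma sqavg: "nice_fun f \<Longrightarrow> 0 < l \<Longrightarrow> (\<integral>\<^sup>+y. ennreal ((cmod (loc f a l y))\<^sup>2) \<partial>lborel) = ennreal (sqavg f a l * l)"
  and sqavg_nonneg: "0 < l \<Longrightarrow> 0 \<le> sqavg f a l"
  using nice_fun_nn_integral_sq[OF nice_loc, of f a l] by (auto simp: sqavg_def)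

lemma N_zero:
  assumes f: "nice_fun f" and l: "0 < l" and "sqavg f a l = 0"
  shows "N (loc f a l) x = 0"
proof -
  note [measurable] = nice_fun_measurable[OF nice_loc[OF f]]
  have "AE y in lborel. ennreal ((cmod (loc f a l y))\<^sup>2) = 0"
    using sqavg[OF f l, of a] assms(3) by (subst nn_integral_0_iff_AE[symmetric]) auto
  then have "(\<integral>\<^sup>+y. ennreal (cmod (loc f a l y)) \<partial>lborel) = (\<integral>\<^sup>+y. 0 \<partial>(lborel::real measure))"
    by (intro nn_integral_cong_AE) auto
  then show ?thesis using N_bound[OF nice_loc[OF f], of a l 0 x] N_nonneg[of "loc f a l" x] by simp
qed

lemma weak_type_N:
  assumes f: "nice_fun f" and l: "0 < l"
  shows "emeasure lborel {x. \<Lambda> * sqavg f a l < (N (loc f a l) x)\<^sup>2} \<le> ennreal (l / 16)"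
proof (cases "sqavg f a l = 0")
  case True
  then show ?thesis using N_zero[OF f l True] by simp
next
  case False
  define V where "V = sqavg f a l"
  have V: "0 < V" using False sqavg_nonneg[OF l, of f a] by (simp add: V_def)
  note [measurable] = N_measurable[OF nice_loc[OF f]]
  define S where "S = {x. \<Lambda> * V < (N (loc f a l) x)\<^sup>2}"
  have [measurable]: "S \<in> sets borel" unfolding S_def by measurable
  have "ennreal (\<Lambda> * V) * emeasure lborel S = (\<integral>\<^sup>+x. ennreal (\<Lambda> * V) * indicator S x \<partial>lborel)"
    by (simp add: nn_integral_cmult_indicator)
  also have "\<dots> \<le> (\<integral>\<^sup>+x. ennreal ((N (loc f a l) x)\<^sup>2) \<partial>lborel)"
    by (intro nn_integral_mono) (auto simp: S_def indicator_def intro!: ennreal_leI)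
  also have "\<dots> \<le> ennreal A * ennreal (V * l)"
    using N_L2[OF nice_loc[OF f], of a l] sqavg[OF f l, of a] by (simp add: V_def)
  also have "\<dots> = ennreal (A * V * l)" using A0 V l by (subst ennreal_mult[symmetric]) (auto simp: mult.assoc)
  finally have 1: "ennreal (\<Lambda> * V) * emeasure lborel S \<le> ennreal (A * V * l)" .
  then obtain e where e: "emeasure lborel S = ennreal e" "0 \<le> e"
    using \<Lambda> V by (cases "emeasure lborel S") (auto simp: ennreal_mult_top top_unique)
  have "\<Lambda> * V * e \<le> A * V * l"
    using 1 e \<Lambda> V A0 l by (simp add: e ennreal_mult[symmetric])
  then have "\<Lambda> * e \<le> A * l" using V by (simp add: mult_ac)
  moreover have "16 * A * e \<le> \<Lambda> * e" using \<Lambda> e by (intro mult_right_mono) auto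
  ultimately have "A * (16 * e) \<le> A * l" by simp
  then have "e \<le> l / 16" using A0 by simp
  then show ?thesis using e unfolding S_def V_def by (simp add: ennreal_leI)
qed

text \<open>The union of two sets: one where \<open>N\<close> of the localized function is large,
  and one where the noncentred maximal function of its square is large. The second bound, available
  for all windows around a good point, later controls the tail of whatever part of \<open>f\<close>
  is removed.\<close>

lemma exceptional_set:
  assumes f: "nice_fun f" and l: "0 < l"
  obtains E where "E \<in> sets borel" "emeasure lborel E \<le> ennreal (l / 8)"
    "\<And>x. x \<notin> E \<Longrightarrow> N (loc f a l) x \<le> sqrt (\<Lambda> * sqavg f a l)"
    "\<And>x u v. x \<notin> E \<Longrightarrow> u < x \<Longrightarrow> x < v \<Longrightarrow>
       (\<integral>\<^sup>+y\<in>{u<..<v}. ennreal ((cmod (loc f a l y))\<^sup>2) \<partial>lborel) \<le> ennreal (\<Lambda> * sqavg f a l * (v - u))"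
\<comment> \<open>With mean square zero there is nothing to divide by, but then the localized
  function vanishes almost everywhere, and so does \<open>N\<close> of it at every point.\<close>
proof (cases "sqavg f a l = 0")
  case True
  have "(\<integral>\<^sup>+y\<in>{u<..<v}. ennreal ((cmod (loc f a l y))\<^sup>2) \<partial>lborel) \<le> (\<integral>\<^sup>+y. ennreal ((cmod (loc f a l y))\<^sup>2) \<partial>lborel)" for u v
    by (intro nn_integral_mono) (auto simp: indicator_def)
  then have "(\<integral>\<^sup>+y\<in>{u<..<v}. ennreal ((cmod (loc f a l y))\<^sup>2) \<partial>lborel) = 0" for u v
    using sqavg[OF f l, of a] True by simp
  then show ?thesis using N_zero[OF f l True] True by (intro that[of "{}"]) auto
next
  case False
  define V where "V = sqavg f a l"
  have V: "0 < V" using False sqavg_nonneg[OF l, of f a] by (simp add: V_def)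
  note [measurable] = N_measurable[OF nice_loc[OF f]] nice_fun_measurable[OF nice_loc[OF f]]
  define g where "g y = ennreal ((cmod (loc f a l y))\<^sup>2)" for y
  have [measurable]: "g \<in> borel_measurable borel" unfolding g_def by measurable
  define E1 where "E1 = {x. \<Lambda> * V < (N (loc f a l) x)\<^sup>2}"
  have [measurable]: "E1 \<in> sets borel" unfolding E1_def by measurable
  define E2 where "E2 = \<Union>{{u<..<v} |u v::real. u < v \<and> ennreal (\<Lambda> * V) * ennreal (v - u) \<le> (\<integral>\<^sup>+x\<in>{u<..<v}. g x \<partial>lborel)}"
  have "open E2" unfolding E2_def by (intro open_Union) auto
  then have [measurable]: "E2 \<in> sets borel" by simp
  have e1: "emeasure lborel E1 \<le> ennreal (l/16)" using weak_type_N[OF f l, of a] by (simp add: E1_def V_def)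
  have "ennreal (\<Lambda> * V) * emeasure lborel E2 \<le> 2 * (\<integral>\<^sup>+y. g y \<partial>lborel)"
    unfolding E2_def by (intro weak_type_open_intervals) measurable
  also have "\<dots> = ennreal (2 * (V * l))"
    using sqavg[OF f l, of a] V l by (simp add: g_def V_def ennreal_mult)
  finally have 1: "ennreal (\<Lambda> * V) * emeasure lborel E2 \<le> ennreal (2 * (V * l))" .
  then obtain e where e: "emeasure lborel E2 = ennreal e" "0 \<le> e"
    using \<Lambda> V by (cases "emeasure lborel E2") (auto simp: ennreal_mult_top top_unique)
  have "\<Lambda> * V * e \<le> 2 * (V * l)"
    using 1 e \<Lambda> V l by (simp add: e ennreal_mult[symmetric])
  then have "V * (\<Lambda> * e) \<le> V * (2 * l)" by (simp add: mult_ac)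
  then have "\<Lambda> * e \<le> 2 * l" using V by simp
  moreover have "32 * e \<le> \<Lambda> * e" using \<Lambda> e by (intro mult_right_mono) auto
  ultimately have "e \<le> l / 16" by simp
  then have e2: "emeasure lborel E2 \<le> ennreal (l/16)" using e by (simp add: ennreal_leI)
  show ?thesis
  proof (rule that[of "E1 \<union> E2"])
    have "emeasure lborel (E1 \<union> E2) \<le> emeasure lborel E1 + emeasure lborel E2" by (intro emeasure_subadditive) auto
    also have "\<dots> \<le> ennreal (l/16) + ennreal (l/16)" by (intro add_mono e1 e2)
    also have "\<dots> \<le> ennreal (l / 8)" using l by (subst ennreal_plus[symmetric]) (auto intro!: ennreal_leI)
    finally show "emeasure lborel (E1 \<union> E2) \<le> ennreal (l / 8)" .
    show "N (loc f a l) x \<le> sqrt (\<Lambda> * sqavg f a l)" if "x \<notin> E1 \<union> E2" for x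
      using that by (intro real_le_rsqrt) (auto simp: E1_def V_def)
    show "(\<integral>\<^sup>+y\<in>{u<..<v}. ennreal ((cmod (loc f a l y))\<^sup>2) \<partial>lborel) \<le> ennreal (\<Lambda> * sqavg f a l * (v - u))"
      if x: "x \<notin> E1 \<union> E2" "u < x" "x < v" for x u v
    proof (rule ccontr)
      assume "\<not> ?thesis"
      then have "ennreal (\<Lambda> * V) * ennreal (v - u) \<le> (\<integral>\<^sup>+x\<in>{u<..<v}. g x \<partial>lborel)"
        using x \<Lambda> V by (subst ennreal_mult[symmetric]) (auto simp: g_def V_def)
      then have "x \<in> E2" unfolding E2_def by (intro UnionI[of "{u<..<v}"] CollectI exI[of _ u] exI[of _ v]) (use x in auto)
      then show False using x by simp
    qed
  qed measurable
qed

text \<open>Everything is compared through one good point \<open>x'\<close> of the smaller interval.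
  The removed part \<open>G\<close> vanishes on the triple of that interval, so passing from
  \<open>x\<close> to \<open>x'\<close> costs only the oscillation, and at \<open>x'\<close>
  sublinearity bounds \<open>N G\<close> by the two localizations, both under control there. The 7
  is composed of 4 for the oscillation, 1 for the large and 2 for the small localization.\<close>

lemma descend:
  assumes f: "nice_fun f" and l: "0 < l" and E: "E \<in> sets borel"
    and E1: "\<And>x. x \<notin> E \<Longrightarrow> N (loc f a l) x \<le> sqrt (\<Lambda> * sqavg f a l)"
    and E2: "\<And>x u v. x \<notin> E \<Longrightarrow> u < x \<Longrightarrow> x < v \<Longrightarrow>
       (\<integral>\<^sup>+y\<in>{u<..<v}. ennreal ((cmod (loc f a l y))\<^sup>2) \<partial>lborel) \<le> ennreal (\<Lambda> * sqavg f a l * (v - u))"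
    and h: "0 < h" and sub: "{b..<b+h} \<subseteq> {a..<a+l}" and Eb: "measure lborel ({b..<b+h} \<inter> E) \<le> h / 2"
    and x: "x \<in> {b..<b+h}"
  shows "N (loc f a l) x \<le> N (loc f b h) x + 7 * \<Lambda> * sqrt (sqavg f a l)"
proof -
  define V where "V = sqavg f a l"
  define W where "W = sqavg f b h"
  have V0: "0 \<le> V" and W0: "0 \<le> W" using sqavg_nonneg l h by (auto simp: V_def W_def)
  note [measurable] = N_measurable[OF nice_loc[OF f]] nice_fun_measurable[OF nice_loc[OF f]] E
  have ab: "a \<le> b" "b + h \<le> a + l" using sub h by auto
  have nested: "{b-h..<b+2*h} \<subseteq> {a-l..<a+2*l}" using ab by auto
  have locle: "cmod (loc f b h y) \<le> cmod (loc f a l y)" for y using nested by (auto simp: loc_def indicator_def)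
  define E3 where "E3 = {x. \<Lambda> * W < (N (loc f b h) x)\<^sup>2}"
  have [measurable]: "E3 \<in> sets borel" unfolding E3_def by measurable
  \<comment> \<open>The set \<open>E\<close> takes at most \<open>h/2\<close> of the interval and
    the weak type set of the small localization at most \<open>h/16\<close>, so something is
    left.\<close>
  have "\<exists>x'\<in>{b..<b+h}. x' \<notin> E \<and> x' \<notin> E3"
  proof (rule ccontr)
    assume "\<not> ?thesis"
    then have "{b..<b+h} \<subseteq> ({b..<b+h} \<inter> E) \<union> E3" by auto
    then have "emeasure lborel {b..<b+h} \<le> emeasure lborel (({b..<b+h} \<inter> E) \<union> E3)" by (intro emeasure_mono) auto
    also have "\<dots> \<le> emeasure lborel ({b..<b+h} \<inter> E) + emeasure lborel E3" by (intro emeasure_subadditive) auto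
    also have "emeasure lborel ({b..<b+h} \<inter> E) = ennreal (measure lborel ({b..<b+h} \<inter> E))"
      using fmeasurable_Int_fmeasurable[OF fmeasurable_Ico, of E b "b+h"] by (simp add: emeasure_eq_measure2)
    also have "\<dots> + emeasure lborel E3 \<le> ennreal (h/2) + ennreal (h/16)"
      using weak_type_N[OF f h, of b] Eb by (intro add_mono) (auto simp: E3_def W_def intro!: ennreal_leI)
    also have "\<dots> = ennreal (h/2 + h/16)" using h by (subst ennreal_plus) auto
    finally show False using h by (simp add: ennreal_le_iff del: ennreal_plus)
  qed
  then obtain x' where x': "x' \<in> {b..<b+h}" "x' \<notin> E" "x' \<notin> E3" by blast
  \<comment> \<open>The window of radius \<open>2 * h\<close> about \<open>x'\<close> contains the
    triple of the small interval, and its mass is bounded because \<open>x'\<close> lies outside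
    \<open>E\<close>. Its length \<open>4 * h\<close> is the source of the 4.\<close>
  have WV: "W \<le> 4 * \<Lambda> * V"
  proof -
    have "ennreal (W * h) = (\<integral>\<^sup>+y. ennreal ((cmod (loc f b h y))\<^sup>2) \<partial>lborel)"
      unfolding W_def by (rule sqavg[OF f h, symmetric])
    also have "\<dots> \<le> (\<integral>\<^sup>+y\<in>{x'-2*h<..<x'+2*h}. ennreal ((cmod (loc f a l y))\<^sup>2) \<partial>lborel)"
    proof (intro nn_integral_mono)
      fix y
      show "ennreal ((cmod (loc f b h y))\<^sup>2) \<le> ennreal ((cmod (loc f a l y))\<^sup>2) * indicator {x'-2*h<..<x'+2*h} y"
      proof (cases "y \<in> {b-h..<b+2*h}")
        case True
        then have "y \<in> {x'-2*h<..<x'+2*h}" using x'(1) by auto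
        then show ?thesis using locle[of y] by (simp add: ennreal_leI power_mono)
      qed (auto simp: loc_def)
    qed
    also have "\<dots> \<le> ennreal (\<Lambda> * V * ((x' + 2*h) - (x' - 2*h)))"
      unfolding V_def using x'(2) h by (intro E2) auto
    also have "(x' + 2*h) - (x' - 2*h) = 4 * h" by simp
    finally have "W * h \<le> \<Lambda> * V * (4 * h)" using \<Lambda> V0 h by (simp add: ennreal_le_iff)
    then have "W * h \<le> (4 * \<Lambda> * V) * h" by simp
    then show ?thesis using h by (simp only: mult_le_cancel_right_pos)
  qed
  define G where "G y = loc f a l y - loc f b h y" for y
  have Gdef: "G y = loc f a l y * indicator (- {b-h..<b+2*h}) y" for y
    using nested by (auto simp: G_def loc_def indicator_def)
  have G: "nice_fun G" unfolding Gdef by (intro nice_fun_indicator nice_loc f) auto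
  note [measurable] = nice_fun_measurable[OF G]
  obtain R where "0 \<le> R" "\<And>x. cmod (G x) \<le> R" and R: "\<And>x. R < \<bar>x\<bar> \<Longrightarrow> G x = 0" by (rule nice_funE[OF G]) (rule that; assumption)
  define g where "g y = (cmod (G y))\<^sup>2" for y
  have [measurable]: "g \<in> borel_measurable borel" unfolding g_def by measurable
  have T: "(\<integral>\<^sup>+y. ennreal (g y / (y - x')\<^sup>2) \<partial>lborel) \<le> ennreal (8 * (\<Lambda> * V) / h)"
  proof (rule inverse_square_tail[where R=R])
    show "g y = 0" if "\<bar>y - x'\<bar> < h" for y
    proof -
      have "y \<in> {b-h..<b+2*h}" using that x'(1) by auto
      then show ?thesis by (simp add: g_def Gdef)
    qed
    show "(\<integral>\<^sup>+y\<in>{x'-r<..<x'+r}. ennreal (g y) \<partial>lborel) \<le> ennreal (\<Lambda> * V * (2 * r))" if "0 < r" for r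
    proof -
      have "(\<integral>\<^sup>+y\<in>{x'-r<..<x'+r}. ennreal (g y) \<partial>lborel)
        \<le> (\<integral>\<^sup>+y\<in>{x'-r<..<x'+r}. ennreal ((cmod (loc f a l y))\<^sup>2) \<partial>lborel)"
        by (intro nn_integral_mono) (auto simp: g_def Gdef indicator_def)
      also have "\<dots> \<le> ennreal (\<Lambda> * V * ((x' + r) - (x' - r)))"
        unfolding V_def using x'(2) that by (intro E2) auto
      finally show ?thesis by simp
    qed
  qed (use h \<Lambda> V0 R in \<open>auto simp: g_def\<close>)
  \<comment> \<open>The tail was estimated about \<open>x'\<close>, but the oscillation bound is
    centred at the midpoint. Outside the triple the distance to \<open>x'\<close> is at most
    \<open>4/3\<close> of the distance to the midpoint, and \<open>16/9\<close> is below 2.\<close>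
  have T': "(\<integral>\<^sup>+y. ennreal ((cmod (G y))\<^sup>2 / (y - (b + h/2))\<^sup>2) \<partial>lborel) \<le> ennreal (16 * \<Lambda> * V / h)"
  proof -
    have "(\<integral>\<^sup>+y. ennreal ((cmod (G y))\<^sup>2 / (y - (b + h/2))\<^sup>2) \<partial>lborel) \<le> (\<integral>\<^sup>+y. 2 * ennreal (g y / (y - x')\<^sup>2) \<partial>lborel)"
    proof (intro nn_integral_mono)
      fix y
      have "(cmod (G y))\<^sup>2 / (y - (b + h/2))\<^sup>2 \<le> 2 * (g y / (y - x')\<^sup>2)"
      proof (cases "y \<in> {b-h..<b+2*h}")
        case True then show ?thesis by (simp add: Gdef g_def)
      next
        case False
        define d e where "d = y - (b + h/2)" and "e = y - x'"
        have d: "3/2 * h \<le> \<bar>d\<bar>" using False h by (auto simp: d_def)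
        have "\<bar>e\<bar> \<le> \<bar>d\<bar> + h/2" using x'(1) by (auto simp: d_def e_def)
        also have "\<dots> \<le> 4/3 * \<bar>d\<bar>" using d h by simp
        finally have ed: "\<bar>e\<bar> \<le> 4/3 * \<bar>d\<bar>" .
        then have "\<bar>e\<bar>\<^sup>2 \<le> (4/3 * \<bar>d\<bar>)\<^sup>2" by (intro power_mono) auto
        then have "e\<^sup>2 \<le> 16/9 * d\<^sup>2" by (simp add: power_mult_distrib power_divide)
        then have ed2: "e\<^sup>2 \<le> 2 * d\<^sup>2" using zero_le_power2[of d] by linarith
        have d0: "d \<noteq> 0" using d h by auto
        have e0: "e \<noteq> 0" using False x'(1) h by (auto simp: e_def)
        have "1 / d\<^sup>2 \<le> 2 / e\<^sup>2" using ed2 d0 e0 by (simp add: divide_simps)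
        then have "g y * (1 / d\<^sup>2) \<le> g y * (2 / e\<^sup>2)" by (intro mult_left_mono) (auto simp: g_def)
        then show ?thesis by (simp add: g_def d_def e_def mult.commute)
      qed
      then have "ennreal ((cmod (G y))\<^sup>2 / (y - (b + h/2))\<^sup>2) \<le> ennreal (2 * (g y / (y - x')\<^sup>2))" by (rule ennreal_leI)
      also have "\<dots> = 2 * ennreal (g y / (y - x')\<^sup>2)" by (subst ennreal_mult) (auto simp: g_def)
      finally show "ennreal ((cmod (G y))\<^sup>2 / (y - (b + h/2))\<^sup>2) \<le> 2 * ennreal (g y / (y - x')\<^sup>2)" .
    qed
    also have "\<dots> = 2 * (\<integral>\<^sup>+y. ennreal (g y / (y - x')\<^sup>2) \<partial>lborel)" by (intro nn_integral_cmult) measurable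
    also have "\<dots> \<le> 2 * ennreal (8 * (\<Lambda> * V) / h)" by (intro mult_left_mono T) auto
    also have "\<dots> = ennreal (16 * \<Lambda> * V / h)"
      using \<Lambda> V0 h ennreal_mult[of 2 "8 * (\<Lambda> * V) / h"] by (simp add: mult.assoc)
    finally show ?thesis .
  qed
  have sq: "sqrt (c * V) \<le> d * sqrt V" if "c \<le> d\<^sup>2" "0 \<le> d" for c d
    using that V0 by (metis abs_of_nonneg mult_right_mono real_sqrt_abs real_sqrt_le_mono real_sqrt_mult real_sqrt_ge_zero)
  have \<Lambda>sq: "\<Lambda> \<le> \<Lambda>\<^sup>2" using \<Lambda> by (simp add: power2_eq_square)
  have "N G x \<le> N G x' + sqrt (A * h * (16 * \<Lambda> * V / h))"
    using G h T' x x' \<Lambda> V0 by (intro N_osc[where a=b]) (auto simp: Gdef)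
  also have "A * h * (16 * \<Lambda> * V / h) = (16 * (A * \<Lambda>)) * V" using h by simp
  also have "sqrt \<dots> \<le> (4 * \<Lambda>) * sqrt V"
  proof (rule sq)
    have "A * \<Lambda> \<le> \<Lambda> * \<Lambda>" using \<Lambda> A0 by (intro mult_right_mono) auto
    then show "16 * (A * \<Lambda>) \<le> (4 * \<Lambda>)\<^sup>2" by (simp add: power2_eq_square)
  qed (use \<Lambda> in auto)
  finally have 1: "N G x \<le> N G x' + 4 * \<Lambda> * sqrt V" by simp
  have "N G x' \<le> N (loc f a l) x' + N (loc f b h) x'"
    unfolding G_def by (intro N_diff nice_loc f)
  moreover have "N (loc f a l) x' \<le> \<Lambda> * sqrt V"
    using E1[OF x'(2)] sq[OF \<Lambda>sq] \<Lambda> by (simp add: V_def)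
  moreover have "N (loc f b h) x' \<le> 2 * \<Lambda> * sqrt V"
  proof -
    have "(N (loc f b h) x')\<^sup>2 \<le> \<Lambda> * W" using x'(3) by (simp add: E3_def)
    also have "\<dots> \<le> \<Lambda> * (4 * \<Lambda> * V)" using WV \<Lambda> by (intro mult_left_mono) auto
    also have "\<dots> = (4 * \<Lambda>\<^sup>2) * V" by (simp add: power2_eq_square)
    finally have "N (loc f b h) x' \<le> sqrt ((4 * \<Lambda>\<^sup>2) * V)" by (rule real_le_rsqrt)
    also have "\<dots> \<le> (2 * \<Lambda>) * sqrt V" using \<Lambda> by (intro sq) (auto simp: power_mult_distrib)
    finally show ?thesis .
  qed
  ultimately have 2: "N G x \<le> 7 * \<Lambda> * sqrt V" using 1 by simp
  have "N (loc f a l) x = N (\<lambda>y. loc f b h y + G y) x" by (simp add: G_def)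
  also have "\<dots> \<le> N (loc f b h) x + N G x" by (intro N_add nice_loc f G)
  finally show ?thesis using 2 by (simp add: V_def)
qed

text \<open>Each interval carries its portion \<open>E\<close> with it, because the intervals
  themselves are nested and only these portions are disjoint.\<close>

definition is_sparse :: "(real \<times> real \<times> real set) set \<Rightarrow> real \<Rightarrow> real \<Rightarrow> bool" where
  "is_sparse S a l \<longleftrightarrow> finite S \<and> disjoint_family_on (\<lambda>(b,h,E). E) S \<and>
     (\<forall>(b,h,E)\<in>S. 0 < h \<and> h \<le> l \<and> E \<in> sets borel \<and> E \<subseteq> {b..<b+h} \<and> {b..<b+h} \<subseteq> {a..<a+l}
        \<and> ennreal (h/2) \<le> emeasure lborel E)"

text \<open>One generation of the recursion. The selected intervals cover at most half of the given
  one: each is shorter than four times its part of \<open>E\<close>, and \<open>E\<close> has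
  measure at most \<open>l/8\<close>. What they leave uncovered is therefore an admissible portion
  for the sparse family.\<close>

lemma stopping_step:
  assumes f: "nice_fun f" and l: "0 < l"
  obtains P :: "(real \<times> real) set" where "finite P" "disjoint_family_on (\<lambda>(b,h). {b..<b+h}) P"
    "\<And>b h. (b,h) \<in> P \<Longrightarrow> 0 < h \<and> h \<le> l/2 \<and> {b..<b+h} \<subseteq> {a..<a+l}"
    "ennreal (l/2) \<le> emeasure lborel ({a..<a+l} - (\<Union>(b,h)\<in>P. {b..<b+h}))"
    "\<And>b h x. (b,h) \<in> P \<Longrightarrow> x \<in> {b..<b+h} \<Longrightarrow> N (loc f a l) x \<le> N (loc f b h) x + 7 * \<Lambda> * sqrt (sqavg f a l)"
    "\<And>x. x \<in> {a..<a+l} \<Longrightarrow> x \<notin> (\<Union>(b,h)\<in>P. {b..<b+h}) \<Longrightarrow>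
       \<exists>b. N (loc f a l) x \<le> N (loc f b (l/2^n)) x + 7 * \<Lambda> * sqrt (sqavg f a l)"
proof -
  obtain E where E[measurable]: "E \<in> sets borel" and Em: "emeasure lborel E \<le> ennreal (l / 8)"
    and E1: "\<And>x. x \<notin> E \<Longrightarrow> N (loc f a l) x \<le> sqrt (\<Lambda> * sqavg f a l)"
    and E2: "\<And>x u v. x \<notin> E \<Longrightarrow> u < x \<Longrightarrow> x < v \<Longrightarrow>
       (\<integral>\<^sup>+y\<in>{u<..<v}. ennreal ((cmod (loc f a l y))\<^sup>2) \<partial>lborel) \<le> ennreal (\<Lambda> * sqavg f a l * (v - u))"
    by (rule exceptional_set[OF f l, of a]) (rule that; assumption)
  have Efin: "E \<in> fmeasurable lborel" using Em by (intro fmeasurableI) (auto simp: le_less_trans)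
  have Emm: "measure lborel E \<le> l/8"
    using Em l Efin by (simp add: emeasure_eq_measure2 ennreal_le_iff)
  have "measure lborel ({a..<a+l} \<inter> E) \<le> measure lborel E"
    by (intro measure_mono_fmeasurable Efin) auto
  then have "measure lborel ({a..<a+l} \<inter> E) \<le> l / 4" using Emm l by simp
  from stopping_intervals[OF E l this, of n] obtain P where P: "finite P" "disjoint_family_on (\<lambda>(b,h). {b..<b+h}) P"
    and P1: "\<And>b h. (b,h) \<in> P \<Longrightarrow> 0 < h \<and> h \<le> l/2 \<and> {b..<b+h} \<subseteq> {a..<a+l} \<and>
          h/4 < measure lborel ({b..<b+h} \<inter> E) \<and> measure lborel ({b..<b+h} \<inter> E) \<le> h/2"
    and P2: "\<And>x. x \<in> {a..<a+l} \<Longrightarrow> x \<in> (\<Union>(b,h)\<in>P. {b..<b+h}) \<or>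
          (\<exists>b. x \<in> {b..<b + l/2^n} \<and> {b..<b + l/2^n} \<subseteq> {a..<a+l} \<and>
             measure lborel ({b..<b + l/2^n} \<inter> E) \<le> (l/2^n)/2)" by blast
  show ?thesis
  proof (rule that[OF P])
    define I where "I = (\<lambda>(b::real,h::real). {b..<b+h})"
    have dI: "disjoint_family_on (\<lambda>z. I z \<inter> E) P"
      using P(2) unfolding I_def disjoint_family_on_def by blast
    have [measurable]: "I z \<in> sets borel" for z by (auto simp: I_def split: prod.split)
    have IE: "I z \<inter> E \<in> fmeasurable lborel" for z using fmeasurable_Int_fmeasurable[OF Efin, of "I z"] by (simp add: Int_commute)
    have 1: "measure lborel (I z) \<le> 4 * measure lborel (I z \<inter> E)" if "z \<in> P" for z
      using P1[of "fst z" "snd z"] that by (auto simp: I_def split: prod.split)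
    have If: "I z \<in> fmeasurable lborel" for z by (auto simp: I_def fmeasurable_Ico split: prod.split)
    have "measure lborel (\<Union>z\<in>P. I z) \<le> (\<Sum>z\<in>P. measure lborel (I z))"
      using P(1) If by (intro measure_UNION_le) auto
    also have "\<dots> \<le> 4 * (\<Sum>z\<in>P. measure lborel (I z \<inter> E))"
      unfolding sum_distrib_left using 1 by (intro sum_mono) auto
    also have "(\<Sum>z\<in>P. measure lborel (I z \<inter> E)) = measure lborel (\<Union>z\<in>P. I z \<inter> E)"
      using IE P(1) dI by (intro measure_finite_Union[symmetric]) (auto dest: fmeasurableD2)
    also have "\<dots> \<le> measure lborel E"
      using P(1) IE by (intro measure_mono_fmeasurable Efin) auto
    finally have U: "measure lborel (\<Union>z\<in>P. I z) \<le> l/2" using Emm by simp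
    have Us: "(\<Union>z\<in>P. I z) \<subseteq> {a..<a+l}" using P1 by (force simp: I_def)
    have Ufin: "(\<Union>z\<in>P. I z) \<in> fmeasurable lborel" using P(1) If by (intro fmeasurable.finite_UN) auto
    have "measure lborel ({a..<a+l} - (\<Union>z\<in>P. I z)) = l - measure lborel (\<Union>z\<in>P. I z)"
      using l Us Ufin by (subst measurable_measure_Diff) (auto simp: fmeasurable_Ico)
    then have "l/2 \<le> measure lborel ({a..<a+l} - (\<Union>z\<in>P. I z))" using U by simp
    moreover have "{a..<a+l} - (\<Union>z\<in>P. I z) \<in> fmeasurable lborel" using Ufin fmeasurable_Ico by (intro fmeasurable_Diff) auto
    ultimately show "ennreal (l/2) \<le> emeasure lborel ({a..<a+l} - (\<Union>(b,h)\<in>P. {b..<b+h}))"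
      using l by (simp add: I_def emeasure_eq_measure2)
    show "0 < h \<and> h \<le> l/2 \<and> {b..<b+h} \<subseteq> {a..<a+l}" if "(b,h) \<in> P" for b h using P1[OF that] by blast
    show "N (loc f a l) x \<le> N (loc f b h) x + 7 * \<Lambda> * sqrt (sqavg f a l)"
      if "(b,h) \<in> P" "x \<in> {b..<b+h}" for b h x
      using P1[OF that(1)] that(2) by (intro descend[OF f l E E1 E2]) auto
    show "\<exists>b. N (loc f a l) x \<le> N (loc f b (l/2^n)) x + 7 * \<Lambda> * sqrt (sqavg f a l)"
      if x: "x \<in> {a..<a+l}" "x \<notin> (\<Union>(b,h)\<in>P. {b..<b+h})" for x
    proof -
      obtain b where b: "x \<in> {b..<b + l/2^n}" "{b..<b + l/2^n} \<subseteq> {a..<a+l}"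
             "measure lborel ({b..<b + l/2^n} \<inter> E) \<le> (l/2^n)/2" using P2[OF x(1)] x(2) by blast
      have "N (loc f a l) x \<le> N (loc f b (l/2^n)) x + 7 * \<Lambda> * sqrt (sqavg f a l)"
        using b l by (intro descend[OF f l E E1 E2]) auto
      then show ?thesis by blast
    qed
  qed
qed

lemma N_small_interval:
  assumes f: "nice_fun f" and R: "\<And>y. cmod (f y) \<le> R" and h: "0 < h" "h \<le> s"
  shows "N (loc f b h) x \<le> \<kappa> * (R * (3 * s))"
proof (rule N_bound[OF nice_loc[OF f]])
  have R0: "0 \<le> R" using R[of 0] norm_ge_zero order_trans by blast
  have "(\<integral>\<^sup>+y. ennreal (cmod (loc f b h y)) \<partial>lborel) \<le> (\<integral>\<^sup>+y. ennreal R * indicator {b-h..<b+2*h} y \<partial>lborel)"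
    using R by (intro nn_integral_mono) (auto simp: loc_def indicator_def intro!: ennreal_leI)
  also have "\<dots> = ennreal (R * (3 * h))" using R0 h by (simp add: nn_integral_cmult_indicator ennreal_mult)
  also have "\<dots> \<le> ennreal (R * (3 * s))" using R0 h by (intro ennreal_leI mult_left_mono) auto
  finally show "(\<integral>\<^sup>+y. ennreal (cmod (loc f b h y)) \<partial>lborel) \<le> ennreal (R * (3 * s))" .
  show "0 \<le> R * (3 * s)" using R0 h by simp
qed

text \<open>Induction on the number of halvings that lead from \<open>l\<close> down to the scale
  \<open>s\<close>. A selected child is at most half as long, so it falls under the induction
  hypothesis; points outside all children are reached by \<open>Suc n\<close> bisections and settled
  by the crude bound. The children are disjoint, so a point follows one branch only and the additive
  error is paid once instead of accumulating.\<close>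

lemma sparse_domination_aux:
  assumes f: "nice_fun f" and R: "\<And>y. cmod (f y) \<le> R" and s: "0 < s"
  shows "0 < l \<Longrightarrow> l \<le> 2^n * s \<Longrightarrow> \<exists>S. is_sparse S a l \<and> (\<forall>x\<in>{a..<a+l}.
    N (loc f a l) x \<le> 7 * \<Lambda> * (\<Sum>(b,h,E)\<in>S. sqrt (sqavg f b h) * indicator {b..<b+h} x) + \<kappa> * (R * (3 * s)))"
proof (induction n arbitrary: a l)
  case 0
  have "is_sparse {} a l" by (simp add: is_sparse_def disjoint_family_on_def)
  then show ?case using N_small_interval[OF f R 0(1)] 0(2) by (intro exI[of _ "{}"]) auto
next
  case (Suc n)
  note l = Suc.prems(1)
  define \<epsilon> where "\<epsilon> = \<kappa> * (R * (3 * s))"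
  obtain P where P: "finite P" "disjoint_family_on (\<lambda>(b,h). {b..<b+h}) P"
    and P1: "\<And>b h. (b,h) \<in> P \<Longrightarrow> 0 < h \<and> h \<le> l/2 \<and> {b..<b+h} \<subseteq> {a..<a+l}"
    and P2: "ennreal (l/2) \<le> emeasure lborel ({a..<a+l} - (\<Union>(b,h)\<in>P. {b..<b+h}))"
    and P3: "\<And>b h x. (b,h) \<in> P \<Longrightarrow> x \<in> {b..<b+h} \<Longrightarrow> N (loc f a l) x \<le> N (loc f b h) x + 7 * \<Lambda> * sqrt (sqavg f a l)"
    and P4: "\<And>x. x \<in> {a..<a+l} \<Longrightarrow> x \<notin> (\<Union>(b,h)\<in>P. {b..<b+h}) \<Longrightarrow>
       \<exists>b. N (loc f a l) x \<le> N (loc f b (l/2^Suc n)) x + 7 * \<Lambda> * sqrt (sqavg f a l)"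
    by (rule stopping_step[OF f l, of a "Suc n"]) (rule that; assumption)
  have "\<forall>z\<in>P. \<exists>S. is_sparse S (fst z) (snd z) \<and> (\<forall>x\<in>{fst z..<fst z+snd z}.
    N (loc f (fst z) (snd z)) x \<le> 7 * \<Lambda> * (\<Sum>(b,h,E)\<in>S. sqrt (sqavg f b h) * indicator {b..<b+h} x) + \<epsilon>)"
  proof
    fix z assume "z \<in> P"
    then have "0 < snd z" "snd z \<le> l/2" using P1[of "fst z" "snd z"] by auto
    moreover have "l/2 \<le> 2^n * s" using Suc.prems(2) by simp
    ultimately show "\<exists>S. is_sparse S (fst z) (snd z) \<and> (\<forall>x\<in>{fst z..<fst z+snd z}.
    N (loc f (fst z) (snd z)) x \<le> 7 * \<Lambda> * (\<Sum>(b,h,E)\<in>S. sqrt (sqavg f b h) * indicator {b..<b+h} x) + \<epsilon>)"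
      unfolding \<epsilon>_def by (intro Suc.IH) auto
  qed
  from bchoice[OF this] obtain S where SS: "\<forall>z\<in>P. is_sparse (S z) (fst z) (snd z) \<and> (\<forall>x\<in>{fst z..<fst z+snd z}.
    N (loc f (fst z) (snd z)) x \<le> 7 * \<Lambda> * (\<Sum>(b,h,E)\<in>S z. sqrt (sqavg f b h) * indicator {b..<b+h} x) + \<epsilon>)"
    by blast
  then have S: "\<And>z. z \<in> P \<Longrightarrow> is_sparse (S z) (fst z) (snd z)"
    and S1: "\<And>z x. z \<in> P \<Longrightarrow> x \<in> {fst z..<fst z+snd z} \<Longrightarrow>
    N (loc f (fst z) (snd z)) x \<le> 7 * \<Lambda> * (\<Sum>(b,h,E)\<in>S z. sqrt (sqavg f b h) * indicator {b..<b+h} x) + \<epsilon>"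
    by blast+
  define I where "I = (\<lambda>(b::real,h::real). {b..<b+h})"
  define E0 where "E0 = {a..<a+l} - (\<Union>z\<in>P. I z)"
  define t0 where "t0 = (a, l, E0)"
  define S' where "S' = insert t0 (\<Union>z\<in>P. S z)"
  have Sz: "0 < h \<and> h \<le> snd z \<and> E \<in> sets borel \<and> E \<subseteq> {b..<b+h} \<and> {b..<b+h} \<subseteq> I z \<and> ennreal (h/2) \<le> emeasure lborel E"
    if "z \<in> P" "(b,h,E) \<in> S z" for z b h E
    using S[OF that(1)] that(2) unfolding is_sparse_def I_def by (cases z) auto
  have Iz: "I z \<subseteq> {a..<a+l}" "snd z \<le> l/2" if "z \<in> P" for z
    using P1[of "fst z" "snd z"] that by (auto simp: I_def split: prod.split)
  have fin: "finite S'" unfolding S'_def using P(1) S by (auto simp: is_sparse_def)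
  \<comment> \<open>Members of the children's families have length at most \<open>l/2\<close>, hence
    the new top interval is not among them and its term can be split off the sum.\<close>
  have notin: "t0 \<notin> S z" if "z \<in> P" for z
    using Sz[OF that, of a l E0] Iz[OF that] l by (auto simp: t0_def)
  have Eborel: "E0 \<in> sets borel" unfolding E0_def I_def using P(1) by (auto intro!: sets.finite_UN)
  have disj: "disjoint_family_on (\<lambda>(b,h,E). E) S'"
    unfolding disjoint_family_on_def
  proof (intro ballI impI)
    define C where "C = (\<lambda>(b::real,h::real,E::real set). E)"
    have sub: "C t \<subseteq> I z" if "z \<in> P" "t \<in> S z" for t z
      using Sz[OF that(1), of "fst t" "fst (snd t)" "snd (snd t)"] that(2) by (auto simp: C_def split: prod.splits)
    have C0: "C t0 \<inter> I z = {}" if "z \<in> P" for z using that by (auto simp: C_def t0_def E0_def)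
    have dz: "I z \<inter> I z' = {}" if "z \<in> P" "z' \<in> P" "z \<noteq> z'" for z z'
      using P(2) that unfolding disjoint_family_on_def I_def by blast
    have same: "C t \<inter> C t' = {}" if "z \<in> P" "t \<in> S z" "t' \<in> S z" "t \<noteq> t'" for t t' z
    proof -
      have "disjoint_family_on C (S z)" using S[OF that(1)] by (simp add: is_sparse_def C_def)
      then show ?thesis using that(2-4) by (rule disjoint_family_onD)
    qed
    fix t t' assume t: "t \<in> S'" "t' \<in> S'" "t \<noteq> t'"
    have "C t \<inter> C t' = {}"
    proof (cases "t = t0 \<or> t' = t0")
      case True
      moreover have "t = t0 \<or> (\<exists>z\<in>P. t \<in> S z)" "t' = t0 \<or> (\<exists>z\<in>P. t' \<in> S z)"
        using t(1,2) unfolding S'_def by blast+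
      ultimately have "(\<exists>z\<in>P. t = t0 \<and> t' \<in> S z) \<or> (\<exists>z\<in>P. t' = t0 \<and> t \<in> S z)"
        using t(3) by metis
      then show ?thesis
      proof (elim disjE bexE conjE)
        fix z assume "z \<in> P" "t = t0" "t' \<in> S z"
        with C0[of z] sub[of z t'] show ?thesis by blast
      next
        fix z assume "z \<in> P" "t' = t0" "t \<in> S z"
        with C0[of z] sub[of z t] show ?thesis by blast
      qed
    next
      case False
      then obtain z z' where z: "z \<in> P" "t \<in> S z" "z' \<in> P" "t' \<in> S z'" using t unfolding S'_def by auto
      show ?thesis
      proof (cases "z = z'")
        case True then show ?thesis using same[of z t t'] z t by auto
      next
        case False
        then show ?thesis using dz[OF z(1,3)] sub[OF z(1,2)] sub[OF z(3,4)] by blast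
      qed
    qed
    then show "(case t of (b, h, E) \<Rightarrow> E) \<inter> (case t' of (b, h, E) \<Rightarrow> E) = {}" by (simp add: C_def)
  qed
  have sp: "is_sparse S' a l"
    unfolding is_sparse_def
  proof (intro conjI fin disj ballI)
    fix t assume "t \<in> S'"
    then consider "t = t0" | z where "z \<in> P" "t \<in> S z" unfolding S'_def by auto
    then show "case t of (b,h,E) \<Rightarrow> 0 < h \<and> h \<le> l \<and> E \<in> sets borel \<and> E \<subseteq> {b..<b+h} \<and> {b..<b+h} \<subseteq> {a..<a+l}
        \<and> ennreal (h/2) \<le> emeasure lborel E"
    proof cases
      case 1
      then show ?thesis using l P2 Eborel by (auto simp: t0_def E0_def I_def)
    next
      case 2
      obtain b h E where t: "t = (b,h,E)" by (cases t)
      have "{b..<b+h} \<subseteq> {a..<a+l}"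
        using Sz[OF 2(1), of b h E] Iz(1)[OF 2(1)] 2(2) unfolding t by (meson subset_trans)
      then show ?thesis using Sz[OF 2(1), of b h E] Iz(2)[OF 2(1)] 2(2) l unfolding t by auto
    qed
  qed
  define \<phi> where "\<phi> x = (\<lambda>(b,h,E::real set). sqrt (sqavg f b h) * indicator {b..<b+h} x)" for x :: real
  have \<phi>0: "0 \<le> \<phi> x t" if "t \<in> S'" for x t
    using sp that unfolding is_sparse_def \<phi>_def by (auto simp: sqavg_nonneg split: prod.splits)
  have \<phi>t0: "\<phi> x t0 = sqrt (sqavg f a l)" if "x \<in> {a..<a+l}" for x using that by (simp add: \<phi>_def t0_def)
  have "N (loc f a l) x \<le> 7 * \<Lambda> * (\<Sum>t\<in>S'. \<phi> x t) + \<epsilon>" if x: "x \<in> {a..<a+l}" for x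
  proof (cases "x \<in> (\<Union>(b,h)\<in>P. {b..<b+h})")
    case True
    then obtain z where z: "z \<in> P" "x \<in> {fst z..<fst z + snd z}" by auto
    have "N (loc f a l) x \<le> N (loc f (fst z) (snd z)) x + 7 * \<Lambda> * sqrt (sqavg f a l)"
      using z by (intro P3) auto
    also have "N (loc f (fst z) (snd z)) x \<le> 7 * \<Lambda> * (\<Sum>t\<in>S z. \<phi> x t) + \<epsilon>"
      using S1[OF z] by (simp add: \<phi>_def)
    finally have "N (loc f a l) x \<le> 7 * \<Lambda> * (\<phi> x t0 + (\<Sum>t\<in>S z. \<phi> x t)) + \<epsilon>"
      unfolding \<phi>t0[OF x] by (simp add: distrib_left)
    also have "\<phi> x t0 + (\<Sum>t\<in>S z. \<phi> x t) = (\<Sum>t\<in>insert t0 (S z). \<phi> x t)"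
      using notin[OF z(1)] S[OF z(1)] by (subst sum.insert) (auto simp: is_sparse_def)
    also have "\<dots> \<le> (\<Sum>t\<in>S'. \<phi> x t)"
      using z(1) \<phi>0 fin by (intro sum_mono2) (auto simp: S'_def)
    finally show ?thesis using \<Lambda> by (simp add: mult_left_mono)
  next
    case False
    then obtain b where "N (loc f a l) x \<le> N (loc f b (l/2^Suc n)) x + 7 * \<Lambda> * sqrt (sqavg f a l)"
      using P4[OF x] by blast
    moreover have "N (loc f b (l/2^Suc n)) x \<le> \<epsilon>"
      unfolding \<epsilon>_def using l Suc.prems(2) by (intro N_small_interval f R) (auto simp: divide_simps mult_ac)
    moreover have "\<phi> x t0 \<le> (\<Sum>t\<in>S'. \<phi> x t)"
      using \<phi>0 fin by (intro member_le_sum) (auto simp: S'_def)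
    then have "7 * \<Lambda> * \<phi> x t0 \<le> 7 * \<Lambda> * (\<Sum>t\<in>S'. \<phi> x t)" using \<Lambda> by (intro mult_left_mono) auto
    ultimately show ?thesis unfolding \<phi>t0[OF x] by simp
  qed
  then show ?case using sp by (intro exI[of _ S']) (auto simp: \<phi>_def \<epsilon>_def)
qed

lemma sparse_domination:
  assumes f: "nice_fun f" and l: "0 < l" and \<epsilon>: "0 < \<epsilon>"
  obtains S where "is_sparse S a l" "\<And>x. x \<in> {a..<a+l} \<Longrightarrow>
    N (loc f a l) x \<le> 7 * \<Lambda> * (\<Sum>(b,h,E)\<in>S. sqrt (sqavg f b h) * indicator {b..<b+h} x) + \<epsilon>"
proof -
  obtain R where R: "0 \<le> R" "\<And>y. cmod (f y) \<le> R" by (rule nice_funE[OF f]) (rule that; assumption)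
  \<comment> \<open>The \<open>+ 1\<close> keeps the denominator positive when
    \<open>\<kappa> * R\<close> vanishes.\<close>
  define s where "s = \<epsilon> / (3 * \<kappa> * R + 1)"
  have d: "0 < 3 * \<kappa> * R + 1" using \<kappa>0 R by (simp add: add_nonneg_pos)
  have s: "0 < s" using \<epsilon> d by (simp add: s_def)
  have "\<kappa> * (R * (3 * s)) \<le> (3 * \<kappa> * R + 1) * s" using s by (simp add: distrib_right)
  also have "\<dots> = \<epsilon>" using d by (simp add: s_def)
  finally have e: "\<kappa> * (R * (3 * s)) \<le> \<epsilon>" .
  obtain n where "l / s < 2 ^ n" using real_arch_pow[of 2] by auto
  then have "l \<le> 2^n * s" using s by (simp add: divide_simps)
  from sparse_domination_aux[OF f R(2) s l this, of a] obtain S where S: "is_sparse S a l"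
    "\<And>x. x\<in>{a..<a+l} \<Longrightarrow>
    N (loc f a l) x \<le> 7 * \<Lambda> * (\<Sum>(b,h,E)\<in>S. sqrt (sqavg f b h) * indicator {b..<b+h} x) + \<kappa> * (R * (3 * s))"
    by blast
  show ?thesis using S(2) e by (intro that[OF S(1)]) (meson add_left_mono order_trans)
qed

end

section \<open>The Fourier transform and Bessel's inequality\<close>

lemma borel_measurable_cis [measurable (raw)]:
  "g \<in> borel_measurable M \<Longrightarrow> (\<lambda>x. cis (g x)) \<in> borel_measurable M"
  unfolding cis_conv_exp by measurable

lemma borel_measurable_cnj [measurable (raw)]:
  "g \<in> borel_measurable M \<Longrightarrow> (\<lambda>x. cnj (g x)) \<in> borel_measurable M"
  by (rule borel_measurable_continuous_on[where f=cnj]) (auto intro!: continuous_intros)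

lemma nice_fun_cnj: "nice_fun F \<Longrightarrow> nice_fun (\<lambda>x. cnj (F x))"
  by (auto simp: nice_fun_def intro!: borel_measurable_cnj)

lemma integrable_nice_fun:
  assumes F: "nice_fun F"
  shows "integrable lborel F"
proof -
  note [measurable] = nice_fun_measurable[OF F]
  have "(\<integral>\<^sup>+x. ennreal (norm (F x)) \<partial>lborel) < \<infinity>" using nice_fun_nn_integral[OF F, of 1] by simp
  then show ?thesis by (intro integrableI_bounded) auto
qed

text \<open>The form of Fubini's theorem used throughout: two integrable factors, one in each
  variable, coupled by a bounded kernel, which is mostly a phase.\<close>

lemma Fubini_kernel:
  fixes a b :: "real \<Rightarrow> complex" and k :: "real \<Rightarrow> real \<Rightarrow> complex"
  assumes a: "integrable lborel a" and b: "integrable lborel b"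
    and k[measurable]: "case_prod k \<in> borel_measurable (lborel \<Otimes>\<^sub>M lborel)" and k1: "\<And>x y. cmod (k x y) \<le> C"
  shows "(LINT x|lborel. a x * (LINT y|lborel. b y * k x y)) = (LINT y|lborel. b y * (LINT x|lborel. a x * k x y))"
proof -
  have C0: "0 \<le> C" using k1[of 0 0] norm_ge_zero order_trans by blast
  have [measurable]: "a \<in> borel_measurable borel" "b \<in> borel_measurable borel"
    using a b by (auto dest: borel_measurable_integrable)

  have "integrable (lborel \<Otimes>\<^sub>M lborel) (\<lambda>(x, y). a x * b y * k x y)"
  proof (intro integrableI_bounded)
    have "(\<integral>\<^sup>+z. ennreal (norm (case z of (x, y) \<Rightarrow> a x * b y * k x y)) \<partial>(lborel \<Otimes>\<^sub>M lborel))
      \<le> (\<integral>\<^sup>+z. ennreal C * (ennreal (norm (a (fst z))) * ennreal (norm (b (snd z)))) \<partial>(lborel \<Otimes>\<^sub>M lborel))"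
    proof (intro nn_integral_mono)
      fix z :: "real \<times> real"
      have "norm (a (fst z)) * norm (b (snd z)) * norm (k (fst z) (snd z)) \<le> norm (a (fst z)) * norm (b (snd z)) * C"
        by (intro mult_left_mono k1) auto
      then show "ennreal (norm (case z of (x, y) \<Rightarrow> a x * b y * k x y))
        \<le> ennreal C * (ennreal (norm (a (fst z))) * ennreal (norm (b (snd z))))"
        using C0 by (simp add: case_prod_unfold norm_mult ennreal_mult[symmetric] mult_ac ennreal_leI)
    qed
    also have "\<dots> = ennreal C * ((\<integral>\<^sup>+x. ennreal (norm (a x)) \<partial>lborel) * (\<integral>\<^sup>+y. ennreal (norm (b y)) \<partial>lborel))"
    proof -
      have "(\<integral>\<^sup>+z. ennreal (norm (a (fst z))) * ennreal (norm (b (snd z))) \<partial>(lborel \<Otimes>\<^sub>M lborel))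
        = (\<integral>\<^sup>+x. \<integral>\<^sup>+y. ennreal (norm (a x)) * ennreal (norm (b y)) \<partial>lborel \<partial>lborel)"
        by (subst lborel.nn_integral_fst[symmetric]) auto
      also have "\<dots> = (\<integral>\<^sup>+x. ennreal (norm (a x)) \<partial>lborel) * (\<integral>\<^sup>+y. ennreal (norm (b y)) \<partial>lborel)"
        by (simp add: nn_integral_cmult nn_integral_multc)
      finally show ?thesis by (subst nn_integral_cmult) auto
    qed
    also have "\<dots> < \<infinity>"
      using a b by (auto simp: integrable_iff_bounded ennreal_mult_less_top)
    finally show "(\<integral>\<^sup>+z. ennreal (norm (case z of (x, y) \<Rightarrow> a x * b y * k x y)) \<partial>(lborel \<Otimes>\<^sub>M lborel)) < \<infinity>" .
  qed measurable
  from lborel_pair.Fubini_integral[OF this]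
  have "(LINT y|lborel. LINT x|lborel. a x * b y * k x y) = (LINT x|lborel. LINT y|lborel. a x * b y * k x y)" .
  moreover have "(LINT y|lborel. a x * b y * k x y) = a x * (LINT y|lborel. b y * k x y)" for x
    by (simp only: mult.assoc integral_mult_right_zero)
  moreover have "(LINT x|lborel. a x * b y * k x y) = b y * (LINT x|lborel. a x * k x y)" for y
    by (simp only: mult.assoc mult.left_commute[of _ "b y"] integral_mult_right_zero)
  ultimately show ?thesis by simp
qed

section \<open>Bessel's inequality by Gaussian regularisation\<close>

definition ft :: "(real \<Rightarrow> complex) \<Rightarrow> real \<Rightarrow> complex" where
  "ft F \<xi> = (LINT y|lborel. F y * cis (- (2 * pi * y * \<xi>)))"

lemma ft_measurable [measurable]:
  assumes [measurable]: "F \<in> borel_measurable borel"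
  shows "ft F \<in> borel_measurable borel"
  unfolding ft_def by measurable

lemma cmod_ft_le: "integrable lborel F \<Longrightarrow> cmod (ft F \<xi>) \<le> (LINT y|lborel. cmod (F y))"
  unfolding ft_def by (rule order_trans[OF integral_norm_bound]) (simp add: norm_mult)

text \<open>A rescaling of the characteristic function of the standard normal distribution.\<close>

lemma gaussian_ft:
  assumes s: "0 < s"
  shows "(LINT \<xi>|lborel. complex_of_real (exp (- (s * \<xi>)\<^sup>2 / 2)) * cis (u * \<xi>))
      = complex_of_real (sqrt (2 * pi) / s * exp (- (u / s)\<^sup>2 / 2))"
    and "integrable lborel (\<lambda>\<xi>. exp (- (s * \<xi>)\<^sup>2 / 2))"
    and "(\<integral>\<^sup>+\<xi>. ennreal (exp (- (s * \<xi>)\<^sup>2 / 2)) \<partial>lborel) = ennreal (sqrt (2 * pi) / s)"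
proof -
  have 1: "(LINT x|lborel. complex_of_real (std_normal_density x) * cis (t * x)) = complex_of_real (exp (- t\<^sup>2 / 2))" for t
  proof -
    have "complex_of_real (exp (- t\<^sup>2 / 2)) = (CLINT x|std_normal_distribution. iexp (t * x))"
      using char_std_normal_distribution unfolding char_def by metis
    also have "\<dots> = (LINT x|lborel. std_normal_density x *\<^sub>R iexp (t * x))"
      by (rule integral_density) auto
    finally show ?thesis by (simp add: scaleR_conv_of_real cis_conv_exp)
  qed
  have e: "exp (- (s * x)\<^sup>2 / 2) = sqrt (2 * pi) * std_normal_density (0 + s * x)" for x
    by (simp add: std_normal_density_def)
  have i: "integrable lborel std_normal_density" by (rule integrable_normal_density) simp
  show "integrable lborel (\<lambda>\<xi>. exp (- (s * \<xi>)\<^sup>2 / 2))"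
    unfolding e using s by (intro integrable_mult_right lborel_integrable_real_affine i) auto
  have "complex_of_real (exp (- (u/s)\<^sup>2 / 2)) = \<bar>s\<bar> *\<^sub>R (LINT x|lborel. complex_of_real (std_normal_density (0 + s * x)) * cis (u/s * (0 + s * x)))"
    unfolding 1[symmetric] using s by (intro lborel_integral_real_affine) auto
  also have "\<dots> = s * (LINT x|lborel. complex_of_real (std_normal_density (0 + s * x)) * cis (u * x))"
    using s by (simp add: scaleR_conv_of_real)
  finally have 2: "complex_of_real (exp (- (u/s)\<^sup>2 / 2)) = s * (LINT x|lborel. complex_of_real (std_normal_density (0 + s * x)) * cis (u * x))" .
  have "(LINT \<xi>|lborel. complex_of_real (exp (- (s * \<xi>)\<^sup>2 / 2)) * cis (u * \<xi>))
    = sqrt (2 * pi) * (LINT x|lborel. complex_of_real (std_normal_density (0 + s * x)) * cis (u * x))"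
    unfolding e by (simp only: of_real_mult mult.assoc integral_mult_right_zero)
  also have "\<dots> = complex_of_real (sqrt (2 * pi) / s * exp (- (u / s)\<^sup>2 / 2))"
    unfolding of_real_mult 2 using s by simp
  finally show "(LINT \<xi>|lborel. complex_of_real (exp (- (s * \<xi>)\<^sup>2 / 2)) * cis (u * \<xi>))
      = complex_of_real (sqrt (2 * pi) / s * exp (- (u / s)\<^sup>2 / 2))" .
  have "1 = ennreal \<bar>s\<bar> * (\<integral>\<^sup>+x. ennreal (std_normal_density (0 + s * x)) \<partial>lborel)"
    using nn_integral_real_affine[of "\<lambda>x. ennreal (std_normal_density x)" s 0] s
      nn_integral_eq_integral[OF i] integral_normal_density[of 1 0] by simp
  then have "ennreal (1/s) * 1 = ennreal (1/s) * (ennreal s * (\<integral>\<^sup>+x. ennreal (std_normal_density (0 + s * x)) \<partial>lborel))"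
    using s by simp
  also have "\<dots> = (\<integral>\<^sup>+x. ennreal (std_normal_density (0 + s * x)) \<partial>lborel)"
    using s by (simp add: mult.assoc[symmetric] ennreal_mult[symmetric])
  finally have 3: "(\<integral>\<^sup>+x. ennreal (std_normal_density (0 + s * x)) \<partial>lborel) = ennreal (1/s)" by simp
  have "(\<integral>\<^sup>+\<xi>. ennreal (exp (- (s * \<xi>)\<^sup>2 / 2)) \<partial>lborel) = ennreal (sqrt (2 * pi)) * (\<integral>\<^sup>+x. ennreal (std_normal_density (0 + s * x)) \<partial>lborel)"
    unfolding e by (subst nn_integral_cmult[symmetric]) (auto simp: ennreal_mult)
  then show "(\<integral>\<^sup>+\<xi>. ennreal (exp (- (s * \<xi>)\<^sup>2 / 2)) \<partial>lborel) = ennreal (sqrt (2 * pi) / s)"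
    unfolding 3 using s by (simp add: ennreal_mult[symmetric])
qed

text \<open>Damping by a Gaussian in frequency makes the integral absolutely convergent. Fubini
  turns it into a quadratic form in \<open>F\<close> with kernel \<open>\<Psi> (z - y)\<close>,
  where \<open>\<Psi>\<close> is nonnegative of integral 1, and such a form is bounded by the square
  norm of \<open>F\<close>. Fatou's lemma removes the damping along
  \<open>s = 1 / (n + 1)\<close>.\<close>

theorem bessel_ft:
  assumes F: "nice_fun F"
  shows "(\<integral>\<^sup>+\<xi>. ennreal ((cmod (ft F \<xi>))\<^sup>2) \<partial>lborel) \<le> (\<integral>\<^sup>+y. ennreal ((cmod (F y))\<^sup>2) \<partial>lborel)"
proof -
  note [measurable] = nice_fun_measurable[OF F]
  define L where "L = (\<integral>\<^sup>+y. ennreal ((cmod (F y))\<^sup>2) \<partial>lborel)"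
  have intF: "integrable lborel F" by (rule integrable_nice_fun[OF F])
  have intcF: "integrable lborel (\<lambda>y. cnj (F y))" using intF by simp
  obtain K where K: "\<And>\<xi>. cmod (ft F \<xi>) \<le> K" using cmod_ft_le[OF intF] by blast
  have main: "(\<integral>\<^sup>+\<xi>. ennreal (exp (- (s * \<xi>)\<^sup>2 / 2) * (cmod (ft F \<xi>))\<^sup>2) \<partial>lborel) \<le> L" if s: "0 < s" for s
  proof -
    define \<gamma> where "\<gamma> \<xi> = exp (- (s * \<xi>)\<^sup>2 / 2)" for \<xi>
    have [measurable]: "\<gamma> \<in> borel_measurable borel" unfolding \<gamma>_def by measurable
    have int\<gamma>: "integrable lborel (\<lambda>\<xi>. complex_of_real (\<gamma> \<xi>))" unfolding \<gamma>_def using gaussian_ft(2)[OF s] by simp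
    define \<Psi> where "\<Psi> u = sqrt (2 * pi) / s * exp (- (2 * pi / s * u)\<^sup>2 / 2)" for u
    have \<Psi>0: "0 \<le> \<Psi> u" for u using s by (simp add: \<Psi>_def)
    have [measurable]: "\<Psi> \<in> borel_measurable borel" unfolding \<Psi>_def by measurable
    have \<Psi>eq: "(LINT \<xi>|lborel. complex_of_real (\<gamma> \<xi>) * cis (2 * pi * u * \<xi>)) = complex_of_real (\<Psi> u)" for u
      using gaussian_ft(1)[OF s, of "2 * pi * u"] by (simp add: \<gamma>_def \<Psi>_def)
    have \<Psi>int: "(\<integral>\<^sup>+u. ennreal (\<Psi> u) \<partial>lborel) = 1"
    proof -
      have "(\<integral>\<^sup>+u. ennreal (\<Psi> u) \<partial>lborel) = ennreal (sqrt (2 * pi) / s) * (\<integral>\<^sup>+u. ennreal (exp (- (2 * pi / s * u)\<^sup>2 / 2)) \<partial>lborel)"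
      proof -
        have "ennreal (\<Psi> u) = ennreal (sqrt (2 * pi) / s) * ennreal (exp (- (2 * pi / s * u)\<^sup>2 / 2))" for u
          unfolding \<Psi>_def using s by (intro ennreal_mult) auto
        then show ?thesis by (simp only:) (intro nn_integral_cmult, measurable)
      qed
      also have "\<dots> = ennreal (sqrt (2 * pi) / s) * ennreal (sqrt (2 * pi) / (2 * pi / s))"
        using gaussian_ft(3)[of "2 * pi / s"] s by simp
      also have "\<dots> = ennreal 1" using s by (subst ennreal_mult[symmetric]) (auto simp: field_simps)
      finally show ?thesis by simp
    qed
    have "(\<integral>\<^sup>+\<xi>. ennreal (\<gamma> \<xi> * (cmod (ft F \<xi>))\<^sup>2) \<partial>lborel) = ennreal (LINT \<xi>|lborel. \<gamma> \<xi> * (cmod (ft F \<xi>))\<^sup>2)"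
    proof (rule nn_integral_eq_integral)
      have "integrable lborel (\<lambda>\<xi>. \<gamma> \<xi> * K\<^sup>2)" unfolding \<gamma>_def using gaussian_ft(2)[OF s] by simp
      then show "integrable lborel (\<lambda>\<xi>. \<gamma> \<xi> * (cmod (ft F \<xi>))\<^sup>2)"
        by (rule Bochner_Integration.integrable_bound)
          (auto simp: \<gamma>_def abs_mult intro!: mult_left_mono power_mono K)
    qed (auto simp: \<gamma>_def)
    also have "(LINT \<xi>|lborel. \<gamma> \<xi> * (cmod (ft F \<xi>))\<^sup>2) = cmod (LINT \<xi>|lborel. complex_of_real (\<gamma> \<xi> * (cmod (ft F \<xi>))\<^sup>2))"
      by (simp only: integral_complex_of_real norm_of_real) (auto simp: \<gamma>_def intro!: abs_of_nonneg[symmetric] integral_nonneg_AE)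
    also have "(LINT \<xi>|lborel. complex_of_real (\<gamma> \<xi> * (cmod (ft F \<xi>))\<^sup>2))
      = (LINT \<xi>|lborel. (complex_of_real (\<gamma> \<xi>) * cnj (ft F \<xi>)) * (LINT y|lborel. F y * cis (- (2 * pi * y * \<xi>))))"
      unfolding ft_def[symmetric]
      by (intro Bochner_Integration.integral_cong refl) (simp only: of_real_mult complex_norm_square mult_ac)
    also have "\<dots> = (LINT y|lborel. F y * (LINT \<xi>|lborel. (complex_of_real (\<gamma> \<xi>) * cnj (ft F \<xi>)) * cis (- (2 * pi * y * \<xi>))))"
    proof (rule Fubini_kernel[where C=1])
      have "integrable lborel (\<lambda>\<xi>. \<gamma> \<xi> * K)" unfolding \<gamma>_def using gaussian_ft(2)[OF s] by simp
      then show "integrable lborel (\<lambda>\<xi>. complex_of_real (\<gamma> \<xi>) * cnj (ft F \<xi>))"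
        by (rule Bochner_Integration.integrable_bound)
          (auto simp: \<gamma>_def norm_mult abs_mult intro!: mult_left_mono order_trans[OF K])
    qed (use intF in auto)
    also have "(\<lambda>y. LINT \<xi>|lborel. (complex_of_real (\<gamma> \<xi>) * cnj (ft F \<xi>)) * cis (- (2 * pi * y * \<xi>)))
      = (\<lambda>y. LINT z|lborel. cnj (F z) * complex_of_real (\<Psi> (z - y)))"
    proof
      fix y
      have "(LINT \<xi>|lborel. (complex_of_real (\<gamma> \<xi>) * cnj (ft F \<xi>)) * cis (- (2 * pi * y * \<xi>)))
        = (LINT \<xi>|lborel. complex_of_real (\<gamma> \<xi>) * (LINT z|lborel. cnj (F z) * cis (2 * pi * (z - y) * \<xi>)))"
      proof (intro Bochner_Integration.integral_cong refl)
        fix \<xi>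
        have "cnj (ft F \<xi>) = (LINT z|lborel. cnj (F z) * cis (2 * pi * z * \<xi>))"
        proof -
          have "(LINT z|lborel. cnj (F z * cis (- (2 * pi * z * \<xi>)))) = cnj (ft F \<xi>)"
            unfolding ft_def by (rule Bochner_Integration.integral_cnj)
          then show ?thesis by (simp add: cis_cnj)
        qed
        then have "cnj (ft F \<xi>) * cis (- (2 * pi * y * \<xi>)) = (LINT z|lborel. cnj (F z) * cis (2 * pi * z * \<xi>) * cis (- (2 * pi * y * \<xi>)))"
          by simp
        also have "\<dots> = (LINT z|lborel. cnj (F z) * cis (2 * pi * (z - y) * \<xi>))"
          by (simp only: mult.assoc cis_mult) (simp add: algebra_simps)
        finally show "(complex_of_real (\<gamma> \<xi>) * cnj (ft F \<xi>)) * cis (- (2 * pi * y * \<xi>))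
          = complex_of_real (\<gamma> \<xi>) * (LINT z|lborel. cnj (F z) * cis (2 * pi * (z - y) * \<xi>))" by (simp only: mult.assoc)
      qed
      also have "\<dots> = (LINT z|lborel. cnj (F z) * (LINT \<xi>|lborel. complex_of_real (\<gamma> \<xi>) * cis (2 * pi * (z - y) * \<xi>)))"
        by (rule Fubini_kernel[where C=1]) (use intcF int\<gamma> in auto)
      finally show "(LINT \<xi>|lborel. (complex_of_real (\<gamma> \<xi>) * cnj (ft F \<xi>)) * cis (- (2 * pi * y * \<xi>)))
        = (LINT z|lborel. cnj (F z) * complex_of_real (\<Psi> (z - y)))" by (simp only: \<Psi>eq)
    qed
    finally have E: "(\<integral>\<^sup>+\<xi>. ennreal (\<gamma> \<xi> * (cmod (ft F \<xi>))\<^sup>2) \<partial>lborel)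
      = ennreal (cmod (LINT y|lborel. F y * (LINT z|lborel. cnj (F z) * complex_of_real (\<Psi> (z - y)))))" .
    have pb: "\<Psi> u \<le> sqrt (2 * pi) / s" for u using s unfolding \<Psi>_def by (intro mult_left_le) auto
    have iz: "integrable lborel (\<lambda>z. cnj (F z) * complex_of_real (\<Psi> (z - y)))" for y
      using \<Psi>0 pb by (intro integrable_nice_fun nice_fun_mult[OF nice_fun_cnj[OF F], where c="sqrt (2 * pi) / s"]) auto
    define KK where "KK = (LINT z|lborel. cmod (F z) * (sqrt (2 * pi) / s))"
    have KK: "cmod (LINT z|lborel. cnj (F z) * complex_of_real (\<Psi> (z - y))) \<le> KK" for y
      unfolding KK_def
    proof (rule order_trans[OF integral_norm_bound], rule Bochner_Integration.integral_mono)
      show "integrable lborel (\<lambda>z. cmod (cnj (F z) * complex_of_real (\<Psi> (z - y))))" by (intro integrable_norm iz)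
      show "integrable lborel (\<lambda>z. cmod (F z) * (sqrt (2 * pi) / s))" using intF by (intro integrable_mult_left integrable_norm)
      show "cmod (cnj (F x) * complex_of_real (\<Psi> (x - y))) \<le> cmod (F x) * (sqrt (2 * pi) / s)" for x
        using \<Psi>0[of "x - y"] pb[of "x - y"] unfolding norm_mult by (intro mult_mono) auto
    qed
    note E
    also have "ennreal (cmod (LINT y|lborel. F y * (LINT z|lborel. cnj (F z) * complex_of_real (\<Psi> (z - y)))))
      \<le> (\<integral>\<^sup>+y. \<integral>\<^sup>+z. ennreal (cmod (F y) * cmod (F z) * \<Psi> (z - y)) \<partial>lborel \<partial>lborel)"
    proof (rule order_trans[OF integral_norm_bound_ennreal])
      show "(\<integral>\<^sup>+y. ennreal (cmod (F y * (LINT z|lborel. cnj (F z) * complex_of_real (\<Psi> (z - y))))) \<partial>lborel)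
        \<le> (\<integral>\<^sup>+y. \<integral>\<^sup>+z. ennreal (cmod (F y) * cmod (F z) * \<Psi> (z - y)) \<partial>lborel \<partial>lborel)"
      proof (intro nn_integral_mono)
        fix y

        have "ennreal (cmod (F y * (LINT z|lborel. cnj (F z) * complex_of_real (\<Psi> (z - y)))))
          = ennreal (cmod (F y)) * ennreal (cmod (LINT z|lborel. cnj (F z) * complex_of_real (\<Psi> (z - y))))"
          by (simp add: norm_mult ennreal_mult)
        also have "\<dots> \<le> ennreal (cmod (F y)) * (\<integral>\<^sup>+z. ennreal (cmod (cnj (F z) * complex_of_real (\<Psi> (z - y)))) \<partial>lborel)"
          by (intro mult_left_mono integral_norm_bound_ennreal iz) auto
        also have "\<dots> = (\<integral>\<^sup>+z. ennreal (cmod (F y) * cmod (F z) * \<Psi> (z - y)) \<partial>lborel)"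
          by (subst nn_integral_cmult[symmetric]) (auto simp: norm_mult ennreal_mult[symmetric] \<Psi>0 mult.assoc)
        finally show "ennreal (cmod (F y * (LINT z|lborel. cnj (F z) * complex_of_real (\<Psi> (z - y)))))
          \<le> (\<integral>\<^sup>+z. ennreal (cmod (F y) * cmod (F z) * \<Psi> (z - y)) \<partial>lborel)" .
      qed
      show "integrable lborel (\<lambda>y. F y * (LINT z|lborel. cnj (F z) * complex_of_real (\<Psi> (z - y))))"
        by (intro integrable_nice_fun nice_fun_mult[OF F, where c=KK] KK) measurable
    qed
    \<comment> \<open>The product of the two moduli is split by the inequality of arithmetic and
      geometric means. In each half the variable on which the square does not depend integrates the
      kernel to 1.\<close>
    also have "\<dots> \<le> (\<integral>\<^sup>+y. \<integral>\<^sup>+z. ennreal ((cmod (F y))\<^sup>2 / 2) * ennreal (\<Psi> (z - y)) + ennreal ((cmod (F z))\<^sup>2 / 2) * ennreal (\<Psi> (z - y)) \<partial>lborel \<partial>lborel)"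
    proof (intro nn_integral_mono)
      fix y z
      have "cmod (F y) * cmod (F z) \<le> (cmod (F y))\<^sup>2 / 2 + (cmod (F z))\<^sup>2 / 2"
        using sum_squares_bound[of "cmod (F y)" "cmod (F z)"] by simp
      then have "cmod (F y) * cmod (F z) * \<Psi> (z - y) \<le> ((cmod (F y))\<^sup>2 / 2 + (cmod (F z))\<^sup>2 / 2) * \<Psi> (z - y)"
        using \<Psi>0 by (intro mult_right_mono) auto
      then have "ennreal (cmod (F y) * cmod (F z) * \<Psi> (z - y)) \<le> ennreal (((cmod (F y))\<^sup>2 / 2 + (cmod (F z))\<^sup>2 / 2) * \<Psi> (z - y))"
        by (rule ennreal_leI)
      also have "\<dots> = ennreal ((cmod (F y))\<^sup>2 / 2) * ennreal (\<Psi> (z - y)) + ennreal ((cmod (F z))\<^sup>2 / 2) * ennreal (\<Psi> (z - y))"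
        using \<Psi>0[of "z - y"] by (simp add: distrib_right ennreal_mult[symmetric] ennreal_plus)
      finally show "ennreal (cmod (F y) * cmod (F z) * \<Psi> (z - y))
        \<le> ennreal ((cmod (F y))\<^sup>2 / 2) * ennreal (\<Psi> (z - y)) + ennreal ((cmod (F z))\<^sup>2 / 2) * ennreal (\<Psi> (z - y))" .
    qed
    also have "\<dots> = (\<integral>\<^sup>+y. \<integral>\<^sup>+z. ennreal ((cmod (F y))\<^sup>2 / 2) * ennreal (\<Psi> (z - y)) \<partial>lborel \<partial>lborel)
       + (\<integral>\<^sup>+y. \<integral>\<^sup>+z. ennreal ((cmod (F z))\<^sup>2 / 2) * ennreal (\<Psi> (z - y)) \<partial>lborel \<partial>lborel)"
      by (simp add: nn_integral_add)
    also have "(\<integral>\<^sup>+y. \<integral>\<^sup>+z. ennreal ((cmod (F z))\<^sup>2 / 2) * ennreal (\<Psi> (z - y)) \<partial>lborel \<partial>lborel)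
       = (\<integral>\<^sup>+z. \<integral>\<^sup>+y. ennreal ((cmod (F z))\<^sup>2 / 2) * ennreal (\<Psi> (z - y)) \<partial>lborel \<partial>lborel)"
      by (rule lborel_pair.Fubini') measurable
    also have "\<dots> = (\<integral>\<^sup>+z. ennreal ((cmod (F z))\<^sup>2 / 2) \<partial>lborel)"
    proof (intro nn_integral_cong)
      fix z
      have "(\<integral>\<^sup>+y. ennreal (\<Psi> (z - y)) \<partial>lborel) = 1"
        using nn_integral_real_affine[of "\<lambda>u. ennreal (\<Psi> u)" "-1" z] \<Psi>int by simp
      then show "(\<integral>\<^sup>+y. ennreal ((cmod (F z))\<^sup>2 / 2) * ennreal (\<Psi> (z - y)) \<partial>lborel) = ennreal ((cmod (F z))\<^sup>2 / 2)"
        by (simp add: nn_integral_cmult)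
    qed
    also have "(\<integral>\<^sup>+y. \<integral>\<^sup>+z. ennreal ((cmod (F y))\<^sup>2 / 2) * ennreal (\<Psi> (z - y)) \<partial>lborel \<partial>lborel)
       = (\<integral>\<^sup>+y. ennreal ((cmod (F y))\<^sup>2 / 2) \<partial>lborel)"
    proof (intro nn_integral_cong)
      fix y
      have "(\<integral>\<^sup>+z. ennreal (\<Psi> (z - y)) \<partial>lborel) = 1"
        using nn_integral_real_affine[of "\<lambda>u. ennreal (\<Psi> u)" "1" "-y"] \<Psi>int by simp
      then show "(\<integral>\<^sup>+z. ennreal ((cmod (F y))\<^sup>2 / 2) * ennreal (\<Psi> (z - y)) \<partial>lborel) = ennreal ((cmod (F y))\<^sup>2 / 2)"
        by (simp add: nn_integral_cmult)
    qed
    also have "(\<integral>\<^sup>+y. ennreal ((cmod (F y))\<^sup>2 / 2) \<partial>lborel) + (\<integral>\<^sup>+y. ennreal ((cmod (F y))\<^sup>2 / 2) \<partial>lborel) = L"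
      unfolding L_def by (subst nn_integral_add[symmetric]) (auto simp: ennreal_plus[symmetric] simp del: ennreal_plus)
    finally show ?thesis by (simp add: \<gamma>_def)
  qed
  have "(\<integral>\<^sup>+\<xi>. ennreal ((cmod (ft F \<xi>))\<^sup>2) \<partial>lborel)
    = (\<integral>\<^sup>+\<xi>. liminf (\<lambda>n. ennreal (exp (- ((1 / real (Suc n)) * \<xi>)\<^sup>2 / 2) * (cmod (ft F \<xi>))\<^sup>2)) \<partial>lborel)"
  proof (intro nn_integral_cong)
    fix \<xi>
    have "(\<lambda>n. 1 / real (Suc n)) \<longlonglongrightarrow> 0" by (rule LIMSEQ_Suc) (rule lim_1_over_n)
    then have "(\<lambda>n. exp (- ((1 / real (Suc n)) * \<xi>)\<^sup>2 / 2) * (cmod (ft F \<xi>))\<^sup>2) \<longlonglongrightarrow> exp (- (0 * \<xi>)\<^sup>2 / 2) * (cmod (ft F \<xi>))\<^sup>2"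
      by (intro tendsto_intros) auto
    then have "(\<lambda>n. ennreal (exp (- ((1 / real (Suc n)) * \<xi>)\<^sup>2 / 2) * (cmod (ft F \<xi>))\<^sup>2)) \<longlonglongrightarrow> ennreal ((cmod (ft F \<xi>))\<^sup>2)"
      by (intro tendsto_ennrealI) simp
    from lim_imp_Liminf[OF _ this]
    show "ennreal ((cmod (ft F \<xi>))\<^sup>2) = liminf (\<lambda>n. ennreal (exp (- ((1 / real (Suc n)) * \<xi>)\<^sup>2 / 2) * (cmod (ft F \<xi>))\<^sup>2))" by simp
  qed
  also have "\<dots> \<le> liminf (\<lambda>n. \<integral>\<^sup>+\<xi>. ennreal (exp (- ((1 / real (Suc n)) * \<xi>)\<^sup>2 / 2) * (cmod (ft F \<xi>))\<^sup>2) \<partial>lborel)"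
    by (intro nn_integral_liminf) auto
  also have "\<dots> \<le> L"
  proof -
    have "liminf (\<lambda>n. \<integral>\<^sup>+\<xi>. ennreal (exp (- ((1 / real (Suc n)) * \<xi>)\<^sup>2 / 2) * (cmod (ft F \<xi>))\<^sup>2) \<partial>lborel) \<le> liminf (\<lambda>n. L)"
      by (intro Liminf_mono always_eventually allI main) simp
    then show ?thesis by (simp only: Liminf_const[OF sequentially_bot])
  qed
  finally show ?thesis by (simp add: L_def)
qed

section \<open>The large sieve\<close>

lemma integral_FTC_Icc_complex:
  fixes G :: "real \<Rightarrow> complex"
  assumes "a \<le> b" and "\<And>x. (G has_vector_derivative g x) (at x)" and "continuous_on {a..b} g"
  shows "(LINT x|lborel. indicator {a..b} x *\<^sub>R g x) = G b - G a"
  using assms by (intro integral_FTC_atLeastAtMost) (auto intro: has_vector_derivative_at_within)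

lemma cis_has_vector_derivative:
  "((\<lambda>x. cis (u * x)) has_vector_derivative (\<i> * complex_of_real u * cis (u * x))) (at x)"
proof -
  have "((\<lambda>x. cis (u * x)) has_derivative (\<lambda>t. (u * t) *\<^sub>R (\<i> * cis (u * x)))) (at x)"
    by (intro derivative_intros)
  then show ?thesis by (simp add: has_vector_derivative_def scaleR_conv_of_real mult_ac)
qed

lemma continuous_on_cis_linear [continuous_intros]: "continuous_on A (\<lambda>x. cis (u * x))"
  unfolding cis_conv_exp by (intro continuous_intros)

lemma integrable_Icc_bounded:
  fixes g :: "real \<Rightarrow> complex"
  assumes "g \<in> borel_measurable borel" "\<And>x. x \<in> {a..b} \<Longrightarrow> cmod (g x) \<le> C"
  shows "integrable lborel (\<lambda>x. indicator {a..b} x *\<^sub>R g x)"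
proof (intro integrable_nice_fun)
  have "nice_fun (\<lambda>x. complex_of_real (indicator {a..b} x))"
    unfolding nice_fun_def by (intro conjI exI[of _ "max 1 (max \<bar>a\<bar> \<bar>b\<bar>)"]) (auto simp: indicator_def)
  from nice_fun_mult[OF this assms(1), of C] assms(2) show "nice_fun (\<lambda>x. indicator {a..b} x *\<^sub>R g x)"
    by (auto simp: scaleR_conv_of_real indicator_def split: if_splits)
qed

lemma cmod_cis_diff_le: "cmod (cis \<alpha> - cis \<beta>) \<le> \<bar>\<alpha> - \<beta>\<bar>"
proof -
  have le: "cmod (cis \<beta> - cis \<alpha>) \<le> \<beta> - \<alpha>" if "\<alpha> \<le> \<beta>" for \<alpha> \<beta>
  proof -
    have "cis \<beta> - cis \<alpha> = (LINT x|lborel. indicator {\<alpha>..\<beta>} x *\<^sub>R (\<i> * cis x))"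
      using integral_FTC_Icc_complex[OF that cis_has_vector_derivative[of 1]]
      by (simp add: continuous_on_mult continuous_on_cis_linear[of _ 1, simplified])
    also have "cmod \<dots> \<le> (LINT x|lborel. indicator {\<alpha>..\<beta>} x)"
    proof (rule Bochner_Integration.integral_norm_bound_integral)
      show "integrable lborel (\<lambda>x. indicator {\<alpha>..\<beta>} x *\<^sub>R (\<i> * cis x))"
        by (rule integrable_Icc_bounded[where C=1]) (auto simp: norm_mult)
      show "integrable lborel (indicator {\<alpha>..\<beta>} :: real \<Rightarrow> real)" by (intro integrable_real_indicator) (auto simp: emeasure_lborel_Icc_eq)
    qed (auto simp: norm_mult indicator_def)
    also have "\<dots> = \<beta> - \<alpha>" using that by simp
    finally show ?thesis .
  qed
  show ?thesis using le[of \<alpha> \<beta>] le[of \<beta> \<alpha>] by (cases "\<alpha> \<le> \<beta>") (auto simp: norm_minus_commute)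
qed

lemma cmod_integral_Icc_le:
  fixes g :: "real \<Rightarrow> complex"
  assumes [measurable]: "g \<in> borel_measurable borel" and g: "\<And>x. x \<in> {a..b} \<Longrightarrow> cmod (g x) \<le> C"
  shows "ennreal (cmod (LINT x|lborel. indicator {a..b} x *\<^sub>R g x)) \<le> (\<integral>\<^sup>+x\<in>{a..b}. ennreal (cmod (g x)) \<partial>lborel)"
proof -
  have "ennreal (cmod (LINT x|lborel. indicator {a..b} x *\<^sub>R g x)) \<le> (\<integral>\<^sup>+x. ennreal (cmod (indicator {a..b} x *\<^sub>R g x)) \<partial>lborel)"
    by (intro integral_norm_bound_ennreal integrable_Icc_bounded[OF assms]) auto
  also have "\<dots> = (\<integral>\<^sup>+x\<in>{a..b}. ennreal (cmod (g x)) \<partial>lborel)"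
    by (intro nn_integral_cong) (auto simp: indicator_def)
  finally show ?thesis .
qed

lemma nn_integral_Icc_sq_le:
  fixes g :: "real \<Rightarrow> ennreal"
  assumes [measurable]: "g \<in> borel_measurable borel" and ab: "a \<le> b"
  shows "(\<integral>\<^sup>+x\<in>{a..b}. g x \<partial>lborel)\<^sup>2 \<le> ennreal (b - a) * (\<integral>\<^sup>+x\<in>{a..b}. (g x)\<^sup>2 \<partial>lborel)"
proof -
  have "(\<integral>\<^sup>+x\<in>{a..b}. g x \<partial>lborel)\<^sup>2 = (\<integral>\<^sup>+x. indicator {a..b} x * (g x * indicator {a..b} x) \<partial>lborel)\<^sup>2"
    by (intro arg_cong[where f="\<lambda>x. x\<^sup>2"] nn_integral_cong) (auto simp: indicator_def)
  also have "\<dots> \<le> (\<integral>\<^sup>+x. (indicator {a..b} x)\<^sup>2 \<partial>lborel) * (\<integral>\<^sup>+x. (g x * indicator {a..b} x)\<^sup>2 \<partial>lborel)"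
    by (rule Cauchy_Schwarz_nn_integral) measurable
  also have "(\<integral>\<^sup>+x. (indicator {a..b} x)\<^sup>2 \<partial>lborel) = (\<integral>\<^sup>+x. indicator {a..b} x \<partial>(lborel::real measure))"
    by (intro nn_integral_cong) (auto simp: indicator_def)
  also have "\<dots> = ennreal (b - a)" using ab by simp
  also have "(\<integral>\<^sup>+x. (g x * indicator {a..b} x)\<^sup>2 \<partial>lborel) = (\<integral>\<^sup>+x\<in>{a..b}. (g x)\<^sup>2 \<partial>lborel)"
    by (intro nn_integral_cong) (auto simp: indicator_def)
  finally show ?thesis .
qed

text \<open>The factor \<open>cis (2 * pi * c * t)\<close> does not change the modulus but recentres
  the function at \<open>c\<close>, so the frequency derivative brings down \<open>y - c\<close>
  instead of \<open>y\<close>. With \<open>c\<close> the centre of a spatial interval, this is the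
  distance that matters later.\<close>

lemma ft_increment:
  assumes \<Psi>: "nice_fun \<Psi>" and st: "s \<le> t"
  shows "ennreal (cmod (ft \<Psi> t * cis (2 * pi * c * t) - ft \<Psi> s * cis (2 * pi * c * s)))
    \<le> ennreal (2 * pi) * (\<integral>\<^sup>+\<xi>\<in>{s..t}. ennreal (cmod (ft (\<lambda>y. \<Psi> y * complex_of_real (y - c)) \<xi>)) \<partial>lborel)"
proof -
  note [measurable] = nice_fun_measurable[OF \<Psi>]
  obtain R where R: "0 \<le> R" "\<And>x. cmod (\<Psi> x) \<le> R" "\<And>x. R < \<bar>x\<bar> \<Longrightarrow> \<Psi> x = 0"
    by (rule nice_funE[OF \<Psi>]) (rule that; assumption)
  define \<Theta> where "\<Theta> y = \<Psi> y * complex_of_real (y - c)" for y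
  have bd: "cmod (complex_of_real (y - c)) \<le> R + \<bar>c\<bar>" if "\<Psi> y \<noteq> 0" for y
  proof -
    have "\<bar>y\<bar> \<le> R" using R(3)[of y] that by force
    then show ?thesis unfolding norm_of_real by linarith
  qed
  have \<Theta>: "nice_fun \<Theta>" unfolding \<Theta>_def by (rule nice_fun_mult[OF \<Psi> _ bd]) auto
  note [measurable] = nice_fun_measurable[OF \<Theta>]
  have mod: "ft \<Psi> \<tau> * cis (2 * pi * c * \<tau>) = (LINT y|lborel. \<Psi> y * cis (- (2 * pi * (y - c)) * \<tau>))" for \<tau>
  proof -
    have "ft \<Psi> \<tau> * cis (2 * pi * c * \<tau>) = (LINT y|lborel. \<Psi> y * cis (- (2 * pi * y * \<tau>)) * cis (2 * pi * c * \<tau>))"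
      unfolding ft_def by simp
    also have "\<dots> = (LINT y|lborel. \<Psi> y * cis (- (2 * pi * (y - c)) * \<tau>))"
      by (simp only: mult.assoc cis_mult) (simp add: algebra_simps)
    finally show ?thesis .
  qed
  have int: "integrable lborel (\<lambda>y. \<Psi> y * cis (v y * \<tau>))" if "v \<in> borel_measurable borel" for v \<tau>
    using that by (intro integrable_nice_fun nice_fun_mult[OF \<Psi>, where c=1]) auto
  have "ft \<Psi> t * cis (2 * pi * c * t) - ft \<Psi> s * cis (2 * pi * c * s)
    = (LINT y|lborel. \<Psi> y * cis (- (2 * pi * (y - c)) * t) - \<Psi> y * cis (- (2 * pi * (y - c)) * s))"
    unfolding mod by (intro Bochner_Integration.integral_diff[symmetric] int) auto
  also have "\<dots> = (LINT y|lborel. \<Theta> y * (LINT \<xi>|lborel. complex_of_real (indicator {s..t} \<xi>) * (- (2 * pi * \<i>) * cis (- (2 * pi * (y - c)) * \<xi>))))"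
  proof (intro Bochner_Integration.integral_cong refl)
    fix y
    have "(LINT \<xi>|lborel. indicator {s..t} \<xi> *\<^sub>R (\<i> * complex_of_real (- (2 * pi * (y - c))) * cis (- (2 * pi * (y - c)) * \<xi>)))
      = cis (- (2 * pi * (y - c)) * t) - cis (- (2 * pi * (y - c)) * s)"
      by (intro integral_FTC_Icc_complex[OF st] cis_has_vector_derivative continuous_intros)
    also have "(\<lambda>\<xi>. indicator {s..t} \<xi> *\<^sub>R (\<i> * complex_of_real (- (2 * pi * (y - c))) * cis (- (2 * pi * (y - c)) * \<xi>)))
      = (\<lambda>\<xi>. complex_of_real (y - c) * (complex_of_real (indicator {s..t} \<xi>) * (- (2 * pi * \<i>) * cis (- (2 * pi * (y - c)) * \<xi>))))"
      by (simp add: fun_eq_iff scaleR_conv_of_real algebra_simps)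
    finally have "complex_of_real (y - c) * (LINT \<xi>|lborel. complex_of_real (indicator {s..t} \<xi>) * (- (2 * pi * \<i>) * cis (- (2 * pi * (y - c)) * \<xi>)))
      = cis (- (2 * pi * (y - c)) * t) - cis (- (2 * pi * (y - c)) * s)" by (simp only: integral_mult_right_zero)
    then show "\<Psi> y * cis (- (2 * pi * (y - c)) * t) - \<Psi> y * cis (- (2 * pi * (y - c)) * s)
      = \<Theta> y * (LINT \<xi>|lborel. complex_of_real (indicator {s..t} \<xi>) * (- (2 * pi * \<i>) * cis (- (2 * pi * (y - c)) * \<xi>)))"
      unfolding \<Theta>_def mult.assoc by (simp only: right_diff_distrib)
  qed
  also have "\<dots> = (LINT \<xi>|lborel. complex_of_real (indicator {s..t} \<xi>) * (LINT y|lborel. \<Theta> y * (- (2 * pi * \<i>) * cis (- (2 * pi * (y - c)) * \<xi>))))"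
  proof (rule Fubini_kernel[where C="2 * pi"])
    show "integrable lborel (\<lambda>\<xi>. complex_of_real (indicator {s..t} \<xi>))"
      using integrable_Icc_bounded[of "\<lambda>_. 1" s t 1] by (simp add: scaleR_conv_of_real)
  qed (auto simp: norm_mult intro!: integrable_nice_fun \<Theta>)
  also have "\<dots> = (LINT \<xi>|lborel. indicator {s..t} \<xi> *\<^sub>R (- (2 * pi * \<i>) * (ft \<Theta> \<xi> * cis (2 * pi * c * \<xi>))))"
  proof (intro Bochner_Integration.integral_cong refl)
    fix \<xi>
    have "ft \<Theta> \<xi> * cis (2 * pi * c * \<xi>) = (LINT y|lborel. \<Theta> y * cis (- (2 * pi * y * \<xi>)) * cis (2 * pi * c * \<xi>))"
      unfolding ft_def by simp
    also have "\<dots> = (LINT y|lborel. \<Theta> y * cis (- (2 * pi * (y - c)) * \<xi>))"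
      by (simp only: mult.assoc cis_mult) (simp add: algebra_simps)
    finally have "- (2 * pi * \<i>) * (ft \<Theta> \<xi> * cis (2 * pi * c * \<xi>)) = (LINT y|lborel. - (2 * pi * \<i>) * (\<Theta> y * cis (- (2 * pi * (y - c)) * \<xi>)))"
      by (simp only: integral_mult_right_zero)
    also have "\<dots> = (LINT y|lborel. \<Theta> y * (- (2 * pi * \<i>) * cis (- (2 * pi * (y - c)) * \<xi>)))"
      by (simp only: mult_ac)
    finally show "complex_of_real (indicator {s..t} \<xi>) * (LINT y|lborel. \<Theta> y * (- (2 * pi * \<i>) * cis (- (2 * pi * (y - c)) * \<xi>)))
      = indicator {s..t} \<xi> *\<^sub>R (- (2 * pi * \<i>) * (ft \<Theta> \<xi> * cis (2 * pi * c * \<xi>)))"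
      by (simp only: scaleR_conv_of_real)
  qed
  finally have eq: "ft \<Psi> t * cis (2 * pi * c * t) - ft \<Psi> s * cis (2 * pi * c * s)
    = (LINT \<xi>|lborel. indicator {s..t} \<xi> *\<^sub>R (- (2 * pi * \<i>) * (ft \<Theta> \<xi> * cis (2 * pi * c * \<xi>))))" .
  have "ennreal (cmod (ft \<Psi> t * cis (2 * pi * c * t) - ft \<Psi> s * cis (2 * pi * c * s)))
    \<le> (\<integral>\<^sup>+\<xi>\<in>{s..t}. ennreal (cmod (- (2 * pi * \<i>) * (ft \<Theta> \<xi> * cis (2 * pi * c * \<xi>)))) \<partial>lborel)"
    unfolding eq
    by (rule cmod_integral_Icc_le[where C="2 * pi * (LINT y|lborel. cmod (\<Theta> y))"])
      (auto simp: norm_mult intro!: cmod_ft_le integrable_nice_fun \<Theta>)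
  also have "\<dots> = (\<integral>\<^sup>+\<xi>. ennreal (2 * pi) * (ennreal (cmod (ft \<Theta> \<xi>)) * indicator {s..t} \<xi>) \<partial>lborel)"
    by (intro nn_integral_cong) (auto simp: norm_mult ennreal_mult indicator_def)
  also have "\<dots> = ennreal (2 * pi) * (\<integral>\<^sup>+\<xi>\<in>{s..t}. ennreal (cmod (ft \<Theta> \<xi>)) \<partial>lborel)"
    by (intro nn_integral_cmult) measurable
  finally have "ennreal (cmod (ft \<Psi> t * cis (2 * pi * c * t) - ft \<Psi> s * cis (2 * pi * c * s)))
    \<le> ennreal (2 * pi) * (\<integral>\<^sup>+\<xi>\<in>{s..t}. ennreal (cmod (ft \<Theta> \<xi>)) \<partial>lborel)" .
  moreover have "(\<lambda>y. \<Psi> y * complex_of_real (y - c)) = \<Theta>" by (simp add: \<Theta>_def fun_eq_iff)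
  ultimately show ?thesis by (simp only:)
qed

text \<open>Gallagher's argument for the large sieve: the value at \<open>t\<close> is compared with
  the value at \<open>\<xi>\<close> through the increment, the increment is squared with the
  Cauchy-Schwarz inequality, and the result is averaged over \<open>\<xi>\<close> in a window of
  length \<open>1/l\<close>.\<close>

lemma large_sieve_point:
  assumes \<Psi>: "nice_fun \<Psi>" and l: "0 < l" and t: "t \<in> {s..s + 1/l}"
  shows "ennreal ((cmod (ft \<Psi> t))\<^sup>2) \<le> ennreal (2 * l) * (\<integral>\<^sup>+\<xi>\<in>{s..s+1/l}. ennreal ((cmod (ft \<Psi> \<xi>))\<^sup>2) \<partial>lborel)
    + ennreal (80 / l) * (\<integral>\<^sup>+\<xi>\<in>{s..s+1/l}. ennreal ((cmod (ft (\<lambda>y. \<Psi> y * complex_of_real (y - c)) \<xi>))\<^sup>2) \<partial>lborel)"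
proof -
  note [measurable] = nice_fun_measurable[OF \<Psi>]
  define \<Theta> where "\<Theta> y = \<Psi> y * complex_of_real (y - c)" for y
  have [measurable]: "\<Theta> \<in> borel_measurable borel" unfolding \<Theta>_def by measurable
  define W where "W = {s..s+1/l}"
  have [measurable]: "W \<in> sets borel" by (simp add: W_def)
  define X where "X = (\<integral>\<^sup>+\<xi>\<in>W. ennreal (cmod (ft \<Theta> \<xi>)) \<partial>lborel)"
  define Y where "Y = (\<integral>\<^sup>+\<xi>\<in>W. ennreal ((cmod (ft \<Theta> \<xi>))\<^sup>2) \<partial>lborel)"
  have XY: "X\<^sup>2 \<le> ennreal (1/l) * Y"
    using nn_integral_Icc_sq_le[of "\<lambda>\<xi>. ennreal (cmod (ft \<Theta> \<xi>))" s "s+1/l"] l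
    by (simp add: X_def Y_def W_def ennreal_power)
  have inc: "ennreal (cmod (ft \<Psi> t)) \<le> ennreal (cmod (ft \<Psi> \<xi>)) + ennreal (2 * pi) * X" if \<xi>: "\<xi> \<in> W" for \<xi>
  proof -
    define G where "G \<tau> = ft \<Psi> \<tau> * cis (2 * pi * c * \<tau>)" for \<tau>
    have cm: "cmod (G \<tau>) = cmod (ft \<Psi> \<tau>)" for \<tau> by (simp add: G_def norm_mult)
    have sub: "(\<integral>\<^sup>+\<xi>\<in>{u..v}. ennreal (cmod (ft \<Theta> \<xi>)) \<partial>lborel) \<le> X" if "u \<in> W" "v \<in> W" for u v
      unfolding X_def using that by (intro nn_integral_mono) (auto simp: W_def indicator_def)
    have "ennreal (cmod (G t - G \<xi>)) \<le> ennreal (2 * pi) * X"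
    proof (cases "\<xi> \<le> t")
      case True
      have "ennreal (cmod (G t - G \<xi>)) \<le> ennreal (2 * pi) * (\<integral>\<^sup>+\<xi>\<in>{\<xi>..t}. ennreal (cmod (ft \<Theta> \<xi>)) \<partial>lborel)"
        unfolding G_def \<Theta>_def by (rule ft_increment[OF \<Psi> True])
      also have "\<dots> \<le> ennreal (2 * pi) * X" using \<xi> t by (intro mult_left_mono sub) (auto simp: W_def)
      finally show ?thesis .
    next
      case False
      then have le: "t \<le> \<xi>" by simp
      have "ennreal (cmod (G t - G \<xi>)) = ennreal (cmod (G \<xi> - G t))" by (simp add: norm_minus_commute)
      also have "\<dots> \<le> ennreal (2 * pi) * (\<integral>\<^sup>+\<xi>\<in>{t..\<xi>}. ennreal (cmod (ft \<Theta> \<xi>)) \<partial>lborel)"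
        unfolding G_def \<Theta>_def by (rule ft_increment[OF \<Psi> le])
      also have "\<dots> \<le> ennreal (2 * pi) * X" using \<xi> t by (intro mult_left_mono sub) (auto simp: W_def)
      finally show ?thesis .
    qed
    moreover have "cmod (G t) \<le> cmod (G \<xi>) + cmod (G t - G \<xi>)" by (metis add.commute norm_triangle_sub)
    then have "ennreal (cmod (G t)) \<le> ennreal (cmod (G \<xi>)) + ennreal (cmod (G t - G \<xi>))"
      by (simp add: ennreal_plus[symmetric] ennreal_leI del: ennreal_plus)
    ultimately show ?thesis unfolding cm by (meson add_left_mono order_trans)
  qed
  have sq: "(a + b)\<^sup>2 \<le> 2 * a\<^sup>2 + 2 * b\<^sup>2" if afin: "a < \<infinity>" for a b :: ennreal
  proof (cases "b = \<infinity>")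
    case False
    then obtain a' b' where "a = ennreal a'" "b = ennreal b'" "0 \<le> a'" "0 \<le> b'"
      using afin by (cases a; cases b) auto
    moreover have "(a' + b')\<^sup>2 \<le> 2 * a'\<^sup>2 + 2 * b'\<^sup>2" using sum_squares_bound[of a' b'] by (simp add: power2_sum)
    then have "ennreal ((a' + b')\<^sup>2) \<le> ennreal (2 * a'\<^sup>2 + 2 * b'\<^sup>2)" by (rule ennreal_leI)
    moreover have "ennreal (2 * a'\<^sup>2 + 2 * b'\<^sup>2) = 2 * ennreal (a'\<^sup>2) + 2 * ennreal (b'\<^sup>2)" by (simp add: ennreal_mult)
    ultimately show ?thesis
      by (simp add: ennreal_power ennreal_plus[symmetric] del: ennreal_plus)
  qed (simp add: ennreal_mult_top power2_eq_square)
  define T where "T = ennreal ((cmod (ft \<Psi> t))\<^sup>2)"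
  have pw: "T \<le> 2 * ennreal ((cmod (ft \<Psi> \<xi>))\<^sup>2) + ennreal (80 / l) * Y" if "\<xi> \<in> W" for \<xi>
  proof -
    have "T = (ennreal (cmod (ft \<Psi> t)))\<^sup>2" by (simp add: T_def ennreal_power)
    also have "\<dots> \<le> (ennreal (cmod (ft \<Psi> \<xi>)) + ennreal (2 * pi) * X)\<^sup>2" by (intro power_mono inc that) auto
    also have "\<dots> \<le> 2 * (ennreal (cmod (ft \<Psi> \<xi>)))\<^sup>2 + 2 * (ennreal (2 * pi) * X)\<^sup>2" by (rule sq) simp
    also have "2 * (ennreal (2 * pi) * X)\<^sup>2 = ennreal (2 * (2 * pi)\<^sup>2) * X\<^sup>2"
      by (simp add: power_mult_distrib ennreal_mult ennreal_power mult.assoc)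
    also have "\<dots> \<le> ennreal (2 * (2 * pi)\<^sup>2) * (ennreal (1/l) * Y)" by (intro mult_left_mono XY) auto
    also have "\<dots> = ennreal (2 * (2 * pi)\<^sup>2 / l) * Y" using l by (simp add: mult.assoc[symmetric] ennreal_mult[symmetric])
    \<comment> \<open>Squaring the increment produces \<open>2 * (2 * pi)\<^sup>2\<close>, which is
      slightly below 80.\<close>
    also have "\<dots> \<le> ennreal (80 / l) * Y"
    proof (intro mult_right_mono ennreal_leI divide_right_mono)
      have "pi\<^sup>2 \<le> (3.15::real)\<^sup>2" using pi_approx(2) by (intro power_mono) (auto simp: )
      then show "2 * (2 * pi)\<^sup>2 \<le> 80" by (simp add: power2_eq_square)
    qed (use l in auto)
    finally show ?thesis by (simp add: ennreal_power add_left_mono)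
  qed
  have "T * emeasure lborel W = (\<integral>\<^sup>+\<xi>. T * indicator W \<xi> \<partial>lborel)" by (simp add: nn_integral_cmult_indicator)
  also have "\<dots> \<le> (\<integral>\<^sup>+\<xi>. 2 * (ennreal ((cmod (ft \<Psi> \<xi>))\<^sup>2) * indicator W \<xi>) + (ennreal (80 / l) * Y) * indicator W \<xi> \<partial>lborel)"
    using pw by (intro nn_integral_mono) (auto simp: indicator_def)
  also have "\<dots> = 2 * (\<integral>\<^sup>+\<xi>\<in>W. ennreal ((cmod (ft \<Psi> \<xi>))\<^sup>2) \<partial>lborel) + (ennreal (80 / l) * Y) * emeasure lborel W"
    by (simp add: nn_integral_add nn_integral_cmult nn_integral_cmult_indicator)
  finally have "ennreal l * (T * emeasure lborel W)
    \<le> ennreal l * (2 * (\<integral>\<^sup>+\<xi>\<in>W. ennreal ((cmod (ft \<Psi> \<xi>))\<^sup>2) \<partial>lborel) + (ennreal (80 / l) * Y) * emeasure lborel W)"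
    by (intro mult_left_mono) auto
  moreover have em: "ennreal l * (Z * emeasure lborel W) = Z" for Z
  proof -
    have "ennreal l * (Z * emeasure lborel W) = Z * (ennreal l * ennreal (1/l))" using l by (simp add: W_def mult_ac)
    also have "ennreal l * ennreal (1/l) = 1" using l by (simp add: ennreal_mult[symmetric])
    finally show ?thesis by simp
  qed
  moreover have "ennreal l * 2 = ennreal (2 * l)" using l by (simp add: ennreal_mult mult.commute)
  moreover have "(\<lambda>y. \<Psi> y * complex_of_real (y - c)) = \<Theta>" by (simp add: \<Theta>_def fun_eq_iff)
  ultimately show ?thesis
    by (simp only: T_def W_def Y_def distrib_left em) (simp only: mult.assoc[symmetric])
qed

section \<open>Linear ramp multipliers\<close>

text \<open>The inverse Fourier transform of the ramp that jumps to 1 at frequency 0 and decreases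
  linearly to 0 at \<open>h\<close>.\<close>

definition lker :: "real \<Rightarrow> real \<Rightarrow> complex" where
  "lker h z = (LINT \<xi>|lborel. indicator {0..h} \<xi> *\<^sub>R (complex_of_real (1 - \<xi>/h) * cis (2 * pi * z * \<xi>)))"

text \<open>The multiplier with symbol \<open>(b - \<xi>) / (b - a)\<close> on \<open>[a, b]\<close>, conjugated with the modulation
  by \<open>a\<close>; after this modulation its kernel is a Calderon--Zygmund kernel.\<close>

definition lop :: "real \<Rightarrow> real \<Rightarrow> (real \<Rightarrow> complex) \<Rightarrow> real \<Rightarrow> complex" where
  "lop a b F x = (LINT \<xi>|lborel. indicator {0..b-a} \<xi> *\<^sub>R (complex_of_real (1 - \<xi>/(b-a)) * cis (2 * pi * x * \<xi>) * ft F (a + \<xi>)))"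

lemma nn_integral_shift_Icc:
  fixes g :: "real \<Rightarrow> ennreal"
  assumes [measurable]: "g \<in> borel_measurable borel"
  shows "(\<integral>\<^sup>+\<xi>\<in>{0..b-a}. g (a + \<xi>) \<partial>lborel) = (\<integral>\<^sup>+\<xi>\<in>{a..b}. g \<xi> \<partial>lborel)"
proof -
  have "(\<integral>\<^sup>+\<xi>. g \<xi> * indicator {a..b} \<xi> \<partial>lborel) = (\<integral>\<^sup>+\<xi>. g (a + 1 * \<xi>) * indicator {a..b} (a + 1 * \<xi>) \<partial>lborel)"
    by (subst nn_integral_real_affine[where c=1 and t=a]) auto
  also have "\<dots> = (\<integral>\<^sup>+\<xi>\<in>{0..b-a}. g (a + \<xi>) \<partial>lborel)"
    by (intro nn_integral_cong) (auto simp: indicator_def)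
  finally show ?thesis by simp
qed

lemma lop_integrand_nice:
  assumes F: "nice_fun F" and ab: "a < b"
  shows "nice_fun (\<lambda>\<xi>. indicator {0..b-a} \<xi> *\<^sub>R (complex_of_real (1 - \<xi>/(b-a)) * ft F (a + \<xi>)))"
proof -
  note [measurable] = nice_fun_measurable[OF F]
  define K where "K = (LINT y|lborel. cmod (F y))"
  have K: "cmod (ft F \<xi>) \<le> K" for \<xi> unfolding K_def by (rule cmod_ft_le[OF integrable_nice_fun[OF F]])
  have K0: "0 \<le> K" using K[of 0] norm_ge_zero order_trans by blast
  have "cmod (indicator {0..b-a} \<xi> *\<^sub>R (complex_of_real (1 - \<xi>/(b-a)) * ft F (a + \<xi>))) \<le> K" for \<xi>
  proof (cases "\<xi> \<in> {0..b-a}")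
    case True
    then have "\<bar>1 - \<xi>/(b-a)\<bar> \<le> 1" using ab by (auto simp: abs_le_iff field_simps)
    then have "\<bar>1 - \<xi>/(b-a)\<bar> * cmod (ft F (a + \<xi>)) \<le> 1 * K" by (intro mult_mono K) auto
    then show ?thesis using True by (simp add: norm_mult del: of_real_diff of_real_divide)
  qed (use K0 in auto)
  then show ?thesis unfolding nice_fun_def using K0
    by (intro conjI exI[of _ "max K (b - a)"]) (auto simp: indicator_def le_max_iff_disj)
qed

lemma lop_eq_ft:
  "lop a b F x = ft (\<lambda>\<xi>. indicator {0..b-a} \<xi> *\<^sub>R (complex_of_real (1 - \<xi>/(b-a)) * ft F (a + \<xi>))) (- x)"
  unfolding lop_def ft_def[of _ "-x"]
  by (intro Bochner_Integration.integral_cong refl) (simp add: mult_ac)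

lemma lop_measurable [measurable]:
  assumes [measurable]: "F \<in> borel_measurable borel"
  shows "lop a b F \<in> borel_measurable borel"
  unfolding lop_def by measurable

text \<open>By \<open>lop_eq_ft\<close> the operator is, up to reflection, the Fourier transform of
  a function dominated by the restriction of \<open>ft F\<close> to \<open>[a, b]\<close>, so
  Bessel's inequality applies on the frequency side.\<close>

lemma lop_L2:
  assumes F: "nice_fun F" and ab: "a < b"
  shows "(\<integral>\<^sup>+x. ennreal ((cmod (lop a b F x))\<^sup>2) \<partial>lborel) \<le> (\<integral>\<^sup>+\<xi>\<in>{a..b}. ennreal ((cmod (ft F \<xi>))\<^sup>2) \<partial>lborel)"
proof -
  note [measurable] = nice_fun_measurable[OF F]
  define G where "G \<xi> = indicator {0..b-a} \<xi> *\<^sub>R (complex_of_real (1 - \<xi>/(b-a)) * ft F (a + \<xi>))" for \<xi>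
  have G: "nice_fun G" unfolding G_def by (rule lop_integrand_nice[OF F ab])
  note [measurable] = nice_fun_measurable[OF G]
  have "lop a b F x = ft G (- x)" for x unfolding G_def by (rule lop_eq_ft)
  then have "(\<integral>\<^sup>+x. ennreal ((cmod (lop a b F x))\<^sup>2) \<partial>lborel) = (\<integral>\<^sup>+x. ennreal ((cmod (ft G (0 + (-1) * x)))\<^sup>2) \<partial>lborel)" by simp
  also have "\<dots> = (\<integral>\<^sup>+x. ennreal ((cmod (ft G x))\<^sup>2) \<partial>lborel)"
    by (subst nn_integral_real_affine[where c="-1" and t=0 and f="\<lambda>x. ennreal ((cmod (ft G x))\<^sup>2)"]) auto
  also have "\<dots> \<le> (\<integral>\<^sup>+x. ennreal ((cmod (G x))\<^sup>2) \<partial>lborel)" by (rule bessel_ft[OF G])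
  also have "\<dots> \<le> (\<integral>\<^sup>+\<xi>\<in>{0..b-a}. ennreal ((cmod (ft F (a + \<xi>)))\<^sup>2) \<partial>lborel)"
  proof (intro nn_integral_mono)
    fix \<xi>
    show "ennreal ((cmod (G \<xi>))\<^sup>2) \<le> ennreal ((cmod (ft F (a + \<xi>)))\<^sup>2) * indicator {0..b-a} \<xi>"
    proof (cases "\<xi> \<in> {0..b-a}")
      case True
      then have "\<bar>1 - \<xi>/(b-a)\<bar> \<le> 1" using ab by (auto simp: abs_le_iff field_simps)
      then have "\<bar>1 - \<xi>/(b-a)\<bar> * cmod (ft F (a + \<xi>)) \<le> 1 * cmod (ft F (a + \<xi>))" by (intro mult_right_mono) auto
      then have "cmod (G \<xi>) \<le> cmod (ft F (a + \<xi>))" using True by (simp add: G_def norm_mult del: of_real_diff of_real_divide)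
      then show ?thesis using True by (simp add: ennreal_leI power_mono)
    qed (simp add: G_def)
  qed
  also have "\<dots> = (\<integral>\<^sup>+\<xi>\<in>{a..b}. ennreal ((cmod (ft F \<xi>))\<^sup>2) \<partial>lborel)"
    by (rule nn_integral_shift_Icc) measurable
  finally show ?thesis .
qed

lemma lop_kernel:
  assumes F: "nice_fun F" and ab: "a < b"
  shows "lop a b F x = (LINT y|lborel. F y * (cis (- (2 * pi * a * y)) * lker (b - a) (x - y)))"
proof -
  define m where "m \<xi> = complex_of_real (indicator {0..b-a} \<xi> * (1 - \<xi>/(b-a)))" for \<xi>
  have m: "integrable lborel m"
  proof -
    have "integrable lborel (\<lambda>x. indicator {0..b-a} x *\<^sub>R complex_of_real (1 - x/(b-a)))"
    proof (rule integrable_Icc_bounded[where C=1])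
      fix x assume "x \<in> {0..b-a}"
      then have "\<bar>1 - x/(b-a)\<bar> \<le> 1" using ab by (auto simp: abs_le_iff field_simps)
      then show "cmod (complex_of_real (1 - x/(b-a))) \<le> 1" unfolding norm_of_real .
    qed simp
    then show ?thesis by (simp add: m_def[abs_def] scaleR_conv_of_real)
  qed
  have "lop a b F x = (LINT \<xi>|lborel. m \<xi> * (LINT y|lborel. F y * (cis (2 * pi * x * \<xi>) * cis (- (2 * pi * y * (a + \<xi>))))))"
    unfolding lop_def ft_def
  proof (intro Bochner_Integration.integral_cong refl)
    fix \<xi>
    have "cis (2 * pi * x * \<xi>) * (LINT y|lborel. F y * cis (- (2 * pi * y * (a + \<xi>))))
      = (LINT y|lborel. F y * (cis (2 * pi * x * \<xi>) * cis (- (2 * pi * y * (a + \<xi>)))))"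
      by (simp only: integral_mult_right_zero[symmetric] mult.left_commute)
    then show "indicator {0..b-a} \<xi> *\<^sub>R (complex_of_real (1 - \<xi>/(b-a)) * cis (2 * pi * x * \<xi>) * (LINT y|lborel. F y * cis (- (2 * pi * y * (a + \<xi>)))))
      = m \<xi> * (LINT y|lborel. F y * (cis (2 * pi * x * \<xi>) * cis (- (2 * pi * y * (a + \<xi>)))))"
      unfolding m_def scaleR_conv_of_real of_real_mult by (simp only: mult.assoc)
  qed
  also have "\<dots> = (LINT y|lborel. F y * (LINT \<xi>|lborel. m \<xi> * (cis (2 * pi * x * \<xi>) * cis (- (2 * pi * y * (a + \<xi>))))))"
    by (rule Fubini_kernel[where C=1]) (use m integrable_nice_fun[OF F] in \<open>auto simp: norm_mult\<close>)
  also have "\<dots> = (LINT y|lborel. F y * (cis (- (2 * pi * a * y)) * lker (b - a) (x - y)))"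
  proof (intro Bochner_Integration.integral_cong refl arg_cong[where f="(*) _"])
    fix y
    have "(LINT \<xi>|lborel. m \<xi> * (cis (2 * pi * x * \<xi>) * cis (- (2 * pi * y * (a + \<xi>)))))
      = (LINT \<xi>|lborel. cis (- (2 * pi * a * y)) * (indicator {0..b-a} \<xi> *\<^sub>R (complex_of_real (1 - \<xi>/(b-a)) * cis (2 * pi * (x - y) * \<xi>))))"
    proof (intro Bochner_Integration.integral_cong refl)
      fix \<xi>
      have "cis (2 * pi * x * \<xi>) * cis (- (2 * pi * y * (a + \<xi>))) = cis (- (2 * pi * a * y)) * cis (2 * pi * (x - y) * \<xi>)"
        unfolding cis_mult by (rule arg_cong[where f=cis]) (simp add: algebra_simps)
      then show "m \<xi> * (cis (2 * pi * x * \<xi>) * cis (- (2 * pi * y * (a + \<xi>))))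
        = cis (- (2 * pi * a * y)) * (indicator {0..b-a} \<xi> *\<^sub>R (complex_of_real (1 - \<xi>/(b-a)) * cis (2 * pi * (x - y) * \<xi>)))"
        unfolding m_def scaleR_conv_of_real of_real_mult by (simp only: mult_ac)
    qed
    then show "(LINT \<xi>|lborel. m \<xi> * (cis (2 * pi * x * \<xi>) * cis (- (2 * pi * y * (a + \<xi>)))))
      = cis (- (2 * pi * a * y)) * lker (b - a) (x - y)"
      unfolding lker_def by (simp only: integral_mult_right_zero)
  qed
  finally show ?thesis .
qed

lemma continuous_on_ramp [continuous_intros]: "continuous_on A (\<lambda>\<xi>::real. complex_of_real (1 - \<xi>/h))"
  unfolding divide_inverse
  by (intro continuous_on_of_real continuous_on_diff continuous_on_mult continuous_on_const continuous_on_id)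

text \<open>Two integrations by parts, collected in the antiderivative \<open>G\<close>. Only the
  jump at 0 leaves a term of order \<open>1/z\<close>, and that term does not oscillate; the
  frequency \<open>h\<close> appears first at order \<open>1 / (h * z\<^sup>2)\<close> because the
  ramp vanishes there.\<close>

lemma lker_formula:
  assumes h: "0 < h" and z: "z \<noteq> 0"
  shows "lker h z = \<i> / (2 * pi * z) - (cis (2 * pi * h * z) - 1) / (4 * pi\<^sup>2 * h * z\<^sup>2)"
proof -
  define v where "v = complex_of_real (2 * pi * z)"
  have v0: "v \<noteq> 0" using z by (simp add: v_def)
  have hc: "complex_of_real h \<noteq> 0" using h by simp
  define G where "G \<xi> = complex_of_real (1 - \<xi>/h) * (cis (2 * pi * z * \<xi>) * (1 / (\<i> * v))) - cis (2 * pi * z * \<xi>) * (1 / (h * v\<^sup>2))" for \<xi>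
  have "(LINT \<xi>|lborel. indicator {0..h} \<xi> *\<^sub>R (complex_of_real (1 - \<xi>/h) * cis (2 * pi * z * \<xi>))) = G h - G 0"
  proof (intro integral_FTC_Icc_complex)
    fix \<xi> :: real
    have "(G has_vector_derivative (complex_of_real (1 - \<xi>/h) * (\<i> * v * cis (2 * pi * z * \<xi>) * (1 / (\<i> * v)))
       + complex_of_real (- (1/h)) * (cis (2 * pi * z * \<xi>) * (1 / (\<i> * v))) - (\<i> * v * cis (2 * pi * z * \<xi>)) * (1 / (h * v\<^sup>2)))) (at \<xi>)"
      unfolding G_def v_def
      by (intro has_vector_derivative_diff has_vector_derivative_mult has_vector_derivative_mult_left cis_has_vector_derivative has_vector_derivative_of_real)
        (use h in \<open>auto intro!: derivative_eq_intros simp: has_real_derivative_iff_has_vector_derivative[symmetric]\<close>)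
    also have "(complex_of_real (1 - \<xi>/h) * (\<i> * v * cis (2 * pi * z * \<xi>) * (1 / (\<i> * v)))
       + complex_of_real (- (1/h)) * (cis (2 * pi * z * \<xi>) * (1 / (\<i> * v))) - (\<i> * v * cis (2 * pi * z * \<xi>)) * (1 / (h * v\<^sup>2)))
      = complex_of_real (1 - \<xi>/h) * cis (2 * pi * z * \<xi>)"
      using v0 hc by (simp add: field_simps power2_eq_square del: of_real_diff)
    finally show "(G has_vector_derivative complex_of_real (1 - \<xi>/h) * cis (2 * pi * z * \<xi>)) (at \<xi>)" .
    show "continuous_on {0..h} (\<lambda>\<xi>. complex_of_real (1 - \<xi>/h) * cis (2 * pi * z * \<xi>))"
      by (intro continuous_intros)
  qed (use h in simp)
  also have "G h - G 0 = \<i> / v - (cis (2 * pi * h * z) - 1) / (h * v\<^sup>2)"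
    using v0 hc h by (simp add: G_def field_simps power2_eq_square)
  finally show ?thesis unfolding lker_def by (simp add: v_def power2_eq_square mult_ac)
qed

text \<open>Intervals shorter than the reciprocal scale: one integration by parts in frequency trades
  \<open>F\<close> for \<open>F / (y - c)\<close>.\<close>

lemma lop_diff_short:
  assumes \<Phi>: "nice_fun \<Phi>" and ab: "a < b" and l: "0 < l" and x: "\<bar>x - c\<bar> \<le> l/2" "\<bar>x' - c\<bar> \<le> l/2"
    and F: "nice_fun F" "\<And>y. F y = \<Phi> y * complex_of_real (y - c)"
  shows "ennreal ((cmod (lop a b F x - lop a b F x'))\<^sup>2)
    \<le> ennreal (4 * l\<^sup>2 * (b - a)) * (\<integral>\<^sup>+\<xi>\<in>{a..b}. ennreal ((cmod (ft \<Phi> \<xi>))\<^sup>2) \<partial>lborel)"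
proof -
  note [measurable] = nice_fun_measurable[OF \<Phi>] nice_fun_measurable[OF F(1)]
  define h where "h = b - a"
  have h: "0 < h" using ab by (simp add: h_def)
  \<comment> \<open>Phases relative to the centre \<open>c\<close>; both points are within
    \<open>l/2\<close> of it, so the phases are at most \<open>pi * l\<close>.\<close>
  define u u' where "u = 2 * pi * (x - c)" and "u' = 2 * pi * (x' - c)"
  define n where "n \<xi> = complex_of_real (1 - \<xi>/h) * (cis (u * \<xi>) - cis (u' * \<xi>))" for \<xi>
  define n' where "n' \<xi> = complex_of_real (1 - \<xi>/h) * (\<i> * u * cis (u * \<xi>) - \<i> * u' * cis (u' * \<xi>))
    + complex_of_real (- (1/h)) * (cis (u * \<xi>) - cis (u' * \<xi>))" for \<xi>
  have [measurable]: "n \<in> borel_measurable borel" "n' \<in> borel_measurable borel" unfolding n_def n'_def by measurable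
  have nd: "(n has_vector_derivative n' \<xi>) (at \<xi>)" for \<xi>
    unfolding n_def n'_def
    by (intro has_vector_derivative_diff has_vector_derivative_mult cis_has_vector_derivative has_vector_derivative_of_real)
      (use h in \<open>auto intro!: derivative_eq_intros simp: has_real_derivative_iff_has_vector_derivative[symmetric]\<close>)
  have nc: "continuous_on A n'" "continuous_on A n" for A
    unfolding n'_def n_def by (intro continuous_intros)+
  \<comment> \<open>No boundary terms will arise: at 0 the two exponentials agree, and at
    \<open>h\<close> the ramp vanishes.\<close>
  have n0: "n 0 = 0" "n h = 0" using h by (auto simp: n_def)
  have ub: "\<bar>u\<bar> \<le> pi * l" "\<bar>u'\<bar> \<le> pi * l"
    using x by (auto simp: u_def u'_def abs_mult)
  have uu: "\<bar>u - u'\<bar> \<le> 2 * pi * l" using ub by linarith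
  \<comment> \<open>One half comes from differentiating the exponentials, the other from
    differentiating the ramp. Its slope \<open>1/h\<close> is compensated by the phase difference,
    which on \<open>[0, h]\<close> is at most \<open>h * (2 * pi * l)\<close>; the bound is
    therefore uniform in \<open>h\<close>.\<close>
  have n'b: "cmod (n' \<xi>) \<le> 4 * pi * l" if \<xi>: "\<xi> \<in> {0..h}" for \<xi>
  proof -
    have 1: "\<bar>1 - \<xi>/h\<bar> \<le> 1" using \<xi> h by (auto simp: abs_le_iff field_simps)
    have "cmod (n' \<xi>) \<le> \<bar>1 - \<xi>/h\<bar> * (\<bar>u\<bar> + \<bar>u'\<bar>) + 1/h * cmod (cis (u * \<xi>) - cis (u' * \<xi>))"
    proof -
      have "cmod (\<i> * u * cis (u * \<xi>) - \<i> * u' * cis (u' * \<xi>)) \<le> \<bar>u\<bar> + \<bar>u'\<bar>"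
        by (rule order_trans[OF norm_triangle_ineq4]) (simp add: norm_mult)
      then have "\<bar>1 - \<xi>/h\<bar> * cmod (\<i> * u * cis (u * \<xi>) - \<i> * u' * cis (u' * \<xi>)) \<le> \<bar>1 - \<xi>/h\<bar> * (\<bar>u\<bar> + \<bar>u'\<bar>)"
        by (intro mult_left_mono) auto
      moreover have "cmod (n' \<xi>) \<le> \<bar>1 - \<xi>/h\<bar> * cmod (\<i> * u * cis (u * \<xi>) - \<i> * u' * cis (u' * \<xi>)) + \<bar>- (1/h)\<bar> * cmod (cis (u * \<xi>) - cis (u' * \<xi>))"
        unfolding n'_def by (rule order_trans[OF norm_triangle_ineq]) (simp only: norm_mult norm_of_real order_refl)
      ultimately show ?thesis using h by simp
    qed
    also have "\<dots> \<le> 1 * (2 * pi * l) + 1/h * (h * (2 * pi * l))"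
    proof (intro add_mono mult_mono)
      have "cmod (cis (u * \<xi>) - cis (u' * \<xi>)) \<le> \<bar>u * \<xi> - u' * \<xi>\<bar>" by (rule cmod_cis_diff_le)
      also have "\<dots> = \<xi> * \<bar>u - u'\<bar>" using \<xi> by (simp add: abs_mult left_diff_distrib[symmetric])
      also have "\<dots> \<le> h * (2 * pi * l)" using \<xi> uu by (intro mult_mono) auto
      finally show "cmod (cis (u * \<xi>) - cis (u' * \<xi>)) \<le> h * (2 * pi * l)" .
    qed (use 1 ub h l in auto)
    finally show ?thesis using h by simp
  qed
  have cis_eq: "cis (2 * pi * x * \<xi>) - cis (2 * pi * x' * \<xi>) = cis (2 * pi * c * \<xi>) * (cis (u * \<xi>) - cis (u' * \<xi>))" for \<xi>
    unfolding right_diff_distrib cis_mult u_def u'_def by (intro arg_cong2[where f="(-)"] arg_cong[where f=cis]) (simp_all add: algebra_simps)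
  define I :: "real \<Rightarrow> complex" where "I \<xi> = complex_of_real (indicator {0..h} \<xi>)" for \<xi>
  have [measurable]: "I \<in> borel_measurable borel" unfolding I_def by measurable
  have int1: "integrable lborel (\<lambda>\<xi>. indicator {0..b-a} \<xi> *\<^sub>R (complex_of_real (1 - \<xi>/(b-a)) * cis (2 * pi * x * \<xi>) * ft F (a + \<xi>)))" for x
  proof -
    have "integrable lborel (\<lambda>\<xi>. (indicator {0..b-a} \<xi> *\<^sub>R (complex_of_real (1 - \<xi>/(b-a)) * ft F (a + \<xi>))) * cis (2 * pi * x * \<xi>))"
      by (intro integrable_nice_fun nice_fun_mult[OF lop_integrand_nice[OF F(1) ab], where c=1]) auto
    then show ?thesis by (simp add: mult_ac)
  qed
  have nb: "cmod (n \<xi>) \<le> 2" if "\<xi> \<in> {0..h}" for \<xi>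
  proof -
    have 1: "\<bar>1 - \<xi>/h\<bar> \<le> 1" using that h by (auto simp: abs_le_iff field_simps)
    have "cmod (cis (u * \<xi>) - cis (u' * \<xi>)) \<le> 2" by (rule order_trans[OF norm_triangle_ineq4]) simp
    then have "\<bar>1 - \<xi>/h\<bar> * cmod (cis (u * \<xi>) - cis (u' * \<xi>)) \<le> 1 * 2" using 1 by (intro mult_mono) auto
    then show ?thesis by (simp only: n_def norm_mult norm_of_real)
  qed
  have In: "integrable lborel (\<lambda>\<xi>. I \<xi> * n \<xi>)" "integrable lborel (\<lambda>\<xi>. I \<xi> * n' \<xi>)"
    using integrable_Icc_bounded[of n 0 h 2] integrable_Icc_bounded[of n' 0 h "4 * pi * l"] nb n'b
    by (simp_all add: I_def scaleR_conv_of_real)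
  have "lop a b F x - lop a b F x' = (LINT \<xi>|lborel. indicator {0..b-a} \<xi> *\<^sub>R (complex_of_real (1 - \<xi>/(b-a)) * cis (2 * pi * x * \<xi>) * ft F (a + \<xi>))
      - indicator {0..b-a} \<xi> *\<^sub>R (complex_of_real (1 - \<xi>/(b-a)) * cis (2 * pi * x' * \<xi>) * ft F (a + \<xi>)))"
    unfolding lop_def by (intro Bochner_Integration.integral_diff[symmetric] int1)
  also have "\<dots> = (LINT \<xi>|lborel. (I \<xi> * n \<xi>) * (LINT y|lborel. F y * cis (2 * pi * c * \<xi> - 2 * pi * y * (a + \<xi>))))"
  proof (intro Bochner_Integration.integral_cong refl)
    fix \<xi>
    have e1: "cis (2 * pi * c * \<xi>) * ft F (a + \<xi>) = (LINT y|lborel. F y * cis (2 * pi * c * \<xi> - 2 * pi * y * (a + \<xi>)))"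
    proof -
      have "cis (2 * pi * c * \<xi>) * ft F (a + \<xi>) = (LINT y|lborel. cis (2 * pi * c * \<xi>) * (F y * cis (- (2 * pi * y * (a + \<xi>)))))"
        unfolding ft_def by (simp only: integral_mult_right_zero)
      also have "\<dots> = (LINT y|lborel. F y * cis (2 * pi * c * \<xi> - 2 * pi * y * (a + \<xi>)))"
        by (simp only: mult.left_commute[of "cis _"] cis_mult) simp
      finally show ?thesis .
    qed
    have e2: "indicator {0..b-a} \<xi> *\<^sub>R (complex_of_real (1 - \<xi>/(b-a)) * cis (2 * pi * x * \<xi>) * ft F (a + \<xi>))
      - indicator {0..b-a} \<xi> *\<^sub>R (complex_of_real (1 - \<xi>/(b-a)) * cis (2 * pi * x' * \<xi>) * ft F (a + \<xi>))
      = I \<xi> * (complex_of_real (1 - \<xi>/h) * (cis (2 * pi * x * \<xi>) - cis (2 * pi * x' * \<xi>)) * ft F (a + \<xi>))"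
      by (simp add: I_def h_def scaleR_conv_of_real right_diff_distrib left_diff_distrib del: of_real_diff)
    show "indicator {0..b-a} \<xi> *\<^sub>R (complex_of_real (1 - \<xi>/(b-a)) * cis (2 * pi * x * \<xi>) * ft F (a + \<xi>))
      - indicator {0..b-a} \<xi> *\<^sub>R (complex_of_real (1 - \<xi>/(b-a)) * cis (2 * pi * x' * \<xi>) * ft F (a + \<xi>))
      = (I \<xi> * n \<xi>) * (LINT y|lborel. F y * cis (2 * pi * c * \<xi> - 2 * pi * y * (a + \<xi>)))"
      unfolding e2 cis_eq n_def e1[symmetric] by (simp only: mult_ac)
  qed
  also have "\<dots> = (LINT y|lborel. F y * (LINT \<xi>|lborel. (I \<xi> * n \<xi>) * cis (2 * pi * c * \<xi> - 2 * pi * y * (a + \<xi>))))"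
    by (rule Fubini_kernel[where C=1]) (use In integrable_nice_fun[OF F(1)] in auto)
  \<comment> \<open>The factor \<open>y - c\<close> in \<open>F\<close> is, up to a constant, what
    the frequency derivative of the phase brings down. Integrating by parts removes it and puts the
    derivative on \<open>n\<close>.\<close>
  also have "\<dots> = (LINT y|lborel. \<Phi> y * (LINT \<xi>|lborel. (I \<xi> * n' \<xi>) * (1 / (2 * pi * \<i>) * cis (2 * pi * c * \<xi> - 2 * pi * y * (a + \<xi>)))))"
  proof (intro Bochner_Integration.integral_cong refl)
    fix y
    define v where "v = - (2 * pi * (y - c))"
    have ph: "cis (2 * pi * c * \<xi> - 2 * pi * y * (a + \<xi>)) = cis (- (2 * pi * a * y)) * cis (v * \<xi>)" for \<xi>
      unfolding cis_mult v_def by (rule arg_cong[where f=cis]) (simp add: algebra_simps)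
    have bnd: "integrable lborel (\<lambda>\<xi>. indicator {0..h} \<xi> *\<^sub>R (n' \<xi> * cis (v * \<xi>)))" "integrable lborel (\<lambda>\<xi>. indicator {0..h} \<xi> *\<^sub>R (n \<xi> * (\<i> * v * cis (v * \<xi>))))"
    proof -
      show "integrable lborel (\<lambda>\<xi>. indicator {0..h} \<xi> *\<^sub>R (n' \<xi> * cis (v * \<xi>)))"
        using n'b by (intro integrable_Icc_bounded[where C="4 * pi * l"]) (auto simp: norm_mult)
      have "cmod (n \<xi> * (\<i> * v * cis (v * \<xi>))) \<le> 2 * \<bar>v\<bar>" if "\<xi> \<in> {0..h}" for \<xi>
        using nb[OF that] by (simp add: norm_mult mult_right_mono)
      then show "integrable lborel (\<lambda>\<xi>. indicator {0..h} \<xi> *\<^sub>R (n \<xi> * (\<i> * v * cis (v * \<xi>))))"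
        by (intro integrable_Icc_bounded) auto
    qed
    have "(LINT \<xi>|lborel. indicator {0..h} \<xi> *\<^sub>R (n \<xi> * (\<i> * v * cis (v * \<xi>)) + n' \<xi> * cis (v * \<xi>)))
      = n h * cis (v * h) - n 0 * cis (v * 0)"
      using h by (intro integral_FTC_Icc_complex has_vector_derivative_mult nd cis_has_vector_derivative continuous_intros nc) auto
    then have "(LINT \<xi>|lborel. indicator {0..h} \<xi> *\<^sub>R (n \<xi> * (\<i> * v * cis (v * \<xi>)))) + (LINT \<xi>|lborel. indicator {0..h} \<xi> *\<^sub>R (n' \<xi> * cis (v * \<xi>))) = 0"
      using bnd n0 by (simp add: scaleR_add_right)
    moreover have "(LINT \<xi>|lborel. indicator {0..h} \<xi> *\<^sub>R (n \<xi> * (\<i> * v * cis (v * \<xi>)))) = \<i> * v * (LINT \<xi>|lborel. (I \<xi> * n \<xi>) * cis (v * \<xi>))"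
      unfolding I_def scaleR_conv_of_real by (simp only: integral_mult_right_zero[symmetric] mult_ac)
    moreover have "(LINT \<xi>|lborel. indicator {0..h} \<xi> *\<^sub>R (n' \<xi> * cis (v * \<xi>))) = (LINT \<xi>|lborel. (I \<xi> * n' \<xi>) * cis (v * \<xi>))"
      unfolding I_def scaleR_conv_of_real by (simp only: mult_ac)
    ultimately have parts: "\<i> * v * (LINT \<xi>|lborel. (I \<xi> * n \<xi>) * cis (v * \<xi>)) + (LINT \<xi>|lborel. (I \<xi> * n' \<xi>) * cis (v * \<xi>)) = 0" by simp
    define A1 A2 where "A1 = (LINT \<xi>|lborel. (I \<xi> * n \<xi>) * cis (v * \<xi>))" and "A2 = (LINT \<xi>|lborel. (I \<xi> * n' \<xi>) * cis (v * \<xi>))"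
    have "complex_of_real (y - c) * A1 = 1 / (2 * pi * \<i>) * A2"
    proof -
      have "A2 = 2 * pi * \<i> * (complex_of_real (y - c) * A1)"
        using parts[folded A1_def A2_def] by (simp add: v_def add_eq_0_iff algebra_simps)
      then show ?thesis by simp
    qed
    moreover have "(LINT \<xi>|lborel. (I \<xi> * n \<xi>) * cis (2 * pi * c * \<xi> - 2 * pi * y * (a + \<xi>))) = cis (- (2 * pi * a * y)) * A1"
      unfolding ph A1_def by (simp only: integral_mult_right_zero[symmetric] mult.left_commute)
    moreover have "(LINT \<xi>|lborel. (I \<xi> * n' \<xi>) * (1 / (2 * pi * \<i>) * cis (2 * pi * c * \<xi> - 2 * pi * y * (a + \<xi>)))) = cis (- (2 * pi * a * y)) * (1 / (2 * pi * \<i>) * A2)"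
      unfolding ph A2_def by (simp only: integral_mult_right_zero[symmetric] mult_ac)
    ultimately show "F y * (LINT \<xi>|lborel. (I \<xi> * n \<xi>) * cis (2 * pi * c * \<xi> - 2 * pi * y * (a + \<xi>)))
      = \<Phi> y * (LINT \<xi>|lborel. (I \<xi> * n' \<xi>) * (1 / (2 * pi * \<i>) * cis (2 * pi * c * \<xi> - 2 * pi * y * (a + \<xi>))))"
      unfolding F(2) by (metis mult.assoc mult.left_commute)
  qed
  also have "\<dots> = (LINT \<xi>|lborel. (I \<xi> * n' \<xi>) * (LINT y|lborel. \<Phi> y * (1 / (2 * pi * \<i>) * cis (2 * pi * c * \<xi> - 2 * pi * y * (a + \<xi>)))))"
    by (rule Fubini_kernel[where C="1 / (2 * pi)"]) (use In integrable_nice_fun[OF \<Phi>] in \<open>auto simp: norm_mult norm_divide\<close>)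
  also have "\<dots> = (LINT \<xi>|lborel. indicator {0..b-a} \<xi> *\<^sub>R (n' \<xi> * (1 / (2 * pi * \<i>) * cis (2 * pi * c * \<xi>) * ft \<Phi> (a + \<xi>))))"
  proof (intro Bochner_Integration.integral_cong refl)
    fix \<xi>
    have "1 / (2 * pi * \<i>) * cis (2 * pi * c * \<xi>) * ft \<Phi> (a + \<xi>) = (LINT y|lborel. 1 / (2 * pi * \<i>) * cis (2 * pi * c * \<xi>) * (\<Phi> y * cis (- (2 * pi * y * (a + \<xi>)))))"
      unfolding ft_def by (simp only: integral_mult_right_zero)
    also have "\<dots> = (LINT y|lborel. \<Phi> y * (1 / (2 * pi * \<i>) * cis (2 * pi * c * \<xi> - 2 * pi * y * (a + \<xi>))))"
    proof (intro Bochner_Integration.integral_cong refl)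
      fix y
      have "cis (2 * pi * c * \<xi> - 2 * pi * y * (a + \<xi>)) = cis (2 * pi * c * \<xi>) * cis (- (2 * pi * y * (a + \<xi>)))"
        by (simp add: cis_mult)
      then show "1 / (2 * pi * \<i>) * cis (2 * pi * c * \<xi>) * (\<Phi> y * cis (- (2 * pi * y * (a + \<xi>))))
        = \<Phi> y * (1 / (2 * pi * \<i>) * cis (2 * pi * c * \<xi> - 2 * pi * y * (a + \<xi>)))" by (simp only: mult_ac)
    qed
    finally show "(I \<xi> * n' \<xi>) * (LINT y|lborel. \<Phi> y * (1 / (2 * pi * \<i>) * cis (2 * pi * c * \<xi> - 2 * pi * y * (a + \<xi>))))
      = indicator {0..b-a} \<xi> *\<^sub>R (n' \<xi> * (1 / (2 * pi * \<i>) * cis (2 * pi * c * \<xi>) * ft \<Phi> (a + \<xi>)))"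
      by (simp only: I_def h_def scaleR_conv_of_real mult.assoc)
  qed
  finally have eq: "lop a b F x - lop a b F x' = (LINT \<xi>|lborel. indicator {0..b-a} \<xi> *\<^sub>R (n' \<xi> * (1 / (2 * pi * \<i>) * cis (2 * pi * c * \<xi>) * ft \<Phi> (a + \<xi>))))" .
  define K where "K = (LINT y|lborel. cmod (\<Phi> y))"
  have K: "cmod (ft \<Phi> \<xi>) \<le> K" for \<xi> unfolding K_def by (rule cmod_ft_le[OF integrable_nice_fun[OF \<Phi>]])
  have pw: "cmod (n' \<xi> * (1 / (2 * pi * \<i>) * cis (2 * pi * c * \<xi>) * ft \<Phi> (a + \<xi>))) \<le> 2 * l * cmod (ft \<Phi> (a + \<xi>))" if "\<xi> \<in> {0..b-a}" for \<xi>
  proof -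
    have "cmod (n' \<xi> * (1 / (2 * pi * \<i>) * cis (2 * pi * c * \<xi>) * ft \<Phi> (a + \<xi>))) = cmod (n' \<xi>) * (cmod (ft \<Phi> (a + \<xi>)) / (2 * pi))"
      by (simp add: norm_mult norm_divide)
    also have "\<dots> \<le> (4 * pi * l) * (cmod (ft \<Phi> (a + \<xi>)) / (2 * pi))"
      using n'b[of \<xi>] that by (intro mult_right_mono) (auto simp: h_def)
    finally show ?thesis by simp
  qed
  have "ennreal (cmod (lop a b F x - lop a b F x')) \<le> (\<integral>\<^sup>+\<xi>\<in>{0..b-a}. ennreal (cmod (n' \<xi> * (1 / (2 * pi * \<i>) * cis (2 * pi * c * \<xi>) * ft \<Phi> (a + \<xi>)))) \<partial>lborel)"
    unfolding eq
  proof (rule cmod_integral_Icc_le[where C="2 * l * K"])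
    fix \<xi> assume "\<xi> \<in> {0..b-a}"
    show "cmod (n' \<xi> * (1 / (2 * pi * \<i>) * cis (2 * pi * c * \<xi>) * ft \<Phi> (a + \<xi>))) \<le> 2 * l * K"
      by (rule order_trans[OF pw[OF \<open>\<xi> \<in> {0..b-a}\<close>]]) (use l in \<open>intro mult_left_mono K; simp\<close>)
  qed measurable
  also have "\<dots> \<le> (\<integral>\<^sup>+\<xi>. ennreal (2 * l) * (ennreal (cmod (ft \<Phi> (a + \<xi>))) * indicator {0..b-a} \<xi>) \<partial>lborel)"
  proof (intro nn_integral_mono)
    fix \<xi>
    show "ennreal (cmod (n' \<xi> * (1 / (2 * pi * \<i>) * cis (2 * pi * c * \<xi>) * ft \<Phi> (a + \<xi>)))) * indicator {0..b-a} \<xi>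
      \<le> ennreal (2 * l) * (ennreal (cmod (ft \<Phi> (a + \<xi>))) * indicator {0..b-a} \<xi>)"
    proof (cases "\<xi> \<in> {0..b-a}")
      case True
      from ennreal_leI[OF pw[OF True]] show ?thesis using True l by (simp add: ennreal_mult)
    qed simp
  qed
  also have "\<dots> = ennreal (2 * l) * (\<integral>\<^sup>+\<xi>\<in>{0..b-a}. ennreal (cmod (ft \<Phi> (a + \<xi>))) \<partial>lborel)"
    by (intro nn_integral_cmult) measurable
  also have "(\<integral>\<^sup>+\<xi>\<in>{0..b-a}. ennreal (cmod (ft \<Phi> (a + \<xi>))) \<partial>lborel) = (\<integral>\<^sup>+\<xi>\<in>{a..b}. ennreal (cmod (ft \<Phi> \<xi>)) \<partial>lborel)"
    by (rule nn_integral_shift_Icc) measurable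
  finally have D: "ennreal (cmod (lop a b F x - lop a b F x')) \<le> ennreal (2 * l) * (\<integral>\<^sup>+\<xi>\<in>{a..b}. ennreal (cmod (ft \<Phi> \<xi>)) \<partial>lborel)" .
  have "ennreal ((cmod (lop a b F x - lop a b F x'))\<^sup>2) = (ennreal (cmod (lop a b F x - lop a b F x')))\<^sup>2" by (simp add: ennreal_power)
  also have "\<dots> \<le> (ennreal (2 * l) * (\<integral>\<^sup>+\<xi>\<in>{a..b}. ennreal (cmod (ft \<Phi> \<xi>)) \<partial>lborel))\<^sup>2" by (intro power_mono D) auto
  also have "\<dots> = ennreal (4 * l\<^sup>2) * (\<integral>\<^sup>+\<xi>\<in>{a..b}. ennreal (cmod (ft \<Phi> \<xi>)) \<partial>lborel)\<^sup>2"
    using l by (simp add: power_mult_distrib ennreal_power)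
  also have "\<dots> \<le> ennreal (4 * l\<^sup>2) * (ennreal (b - a) * (\<integral>\<^sup>+\<xi>\<in>{a..b}. (ennreal (cmod (ft \<Phi> \<xi>)))\<^sup>2 \<partial>lborel))"
    using ab by (intro mult_left_mono nn_integral_Icc_sq_le) auto
  also have "\<dots> = ennreal (4 * l\<^sup>2 * (b - a)) * (\<integral>\<^sup>+\<xi>\<in>{a..b}. ennreal ((cmod (ft \<Phi> \<xi>))\<^sup>2) \<partial>lborel)"
    using ab l by (subst ennreal_mult) (auto simp: ennreal_power mult.assoc)
  finally show ?thesis .
qed

section \<open>Linearity and crude bounds for the ramp operators\<close>

lemma ft_add: "integrable lborel F \<Longrightarrow> integrable lborel G \<Longrightarrow> ft (\<lambda>y. F y + G y) \<xi> = ft F \<xi> + ft G \<xi>"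
proof -
  have i: "integrable lborel (\<lambda>y. F y * cis (- (2 * pi * y * \<xi>)))" if "integrable lborel F" for F
  proof -
    have [measurable]: "F \<in> borel_measurable borel" using that by (auto dest: borel_measurable_integrable)
    show ?thesis using that by (rule Bochner_Integration.integrable_bound) (auto simp: norm_mult)
  qed
  assume "integrable lborel F" "integrable lborel G"
  then show ?thesis unfolding ft_def by (simp add: distrib_right i)
qed

lemma ft_diff: "integrable lborel F \<Longrightarrow> integrable lborel G \<Longrightarrow> ft (\<lambda>y. F y - G y) \<xi> = ft F \<xi> - ft G \<xi>"
proof -
  have i: "integrable lborel (\<lambda>y. F y * cis (- (2 * pi * y * \<xi>)))" if "integrable lborel F" for F
  proof -
    have [measurable]: "F \<in> borel_measurable borel" using that by (auto dest: borel_measurable_integrable)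
    show ?thesis using that by (rule Bochner_Integration.integrable_bound) (auto simp: norm_mult)
  qed
  assume "integrable lborel F" "integrable lborel G"
  then show ?thesis unfolding ft_def by (simp add: left_diff_distrib i)
qed

lemma lop_integrable:
  assumes F: "nice_fun F" and ab: "a < b"
  shows "integrable lborel (\<lambda>\<xi>. indicator {0..b-a} \<xi> *\<^sub>R (complex_of_real (1 - \<xi>/(b-a)) * cis (2 * pi * x * \<xi>) * ft F (a + \<xi>)))"
proof -
  have "integrable lborel (\<lambda>\<xi>. (indicator {0..b-a} \<xi> *\<^sub>R (complex_of_real (1 - \<xi>/(b-a)) * ft F (a + \<xi>))) * cis (2 * pi * x * \<xi>))"
    by (intro integrable_nice_fun nice_fun_mult[OF lop_integrand_nice[OF F ab], where c=1]) auto
  then show ?thesis by (simp add: mult_ac)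
qed

lemma lop_add:
  assumes "nice_fun F" "nice_fun G" "a < b"
  shows "lop a b (\<lambda>y. F y + G y) x = lop a b F x + lop a b G x"
  using lop_integrable[OF assms(1,3), of x] lop_integrable[OF assms(2,3), of x] assms
  unfolding lop_def by (simp add: ft_add integrable_nice_fun distrib_left scaleR_add_right)

lemma lop_diff:
  assumes "nice_fun F" "nice_fun G" "a < b"
  shows "lop a b (\<lambda>y. F y - G y) x = lop a b F x - lop a b G x"
  using lop_integrable[OF assms(1,3), of x] lop_integrable[OF assms(2,3), of x] assms
  unfolding lop_def by (simp add: ft_diff integrable_nice_fun right_diff_distrib scaleR_diff_right)

lemma lop_bound:
  assumes F: "nice_fun F" and ab: "a < b" and T: "(\<integral>\<^sup>+y. ennreal (cmod (F y)) \<partial>lborel) \<le> ennreal T" "0 \<le> T"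
  shows "cmod (lop a b F x) \<le> (b - a) * T"
proof -
  note [measurable] = nice_fun_measurable[OF F]
  have "ennreal (LINT y|lborel. cmod (F y)) \<le> ennreal T"
    using T(1) nn_integral_eq_integral[of lborel "\<lambda>y. cmod (F y)"] integrable_nice_fun[OF F] by simp
  then have K: "cmod (ft F \<xi>) \<le> T" for \<xi>
    using cmod_ft_le[OF integrable_nice_fun[OF F], of \<xi>] T(2) by (simp add: ennreal_le_iff)
  have pw: "cmod (complex_of_real (1 - \<xi>/(b-a)) * cis (2 * pi * x * \<xi>) * ft F (a + \<xi>)) \<le> T" if "\<xi> \<in> {0..b-a}" for \<xi>
  proof -
    have "\<bar>1 - \<xi>/(b-a)\<bar> \<le> 1" using that ab by (auto simp: abs_le_iff field_simps)
    then have "\<bar>1 - \<xi>/(b-a)\<bar> * cmod (ft F (a + \<xi>)) \<le> 1 * T" by (intro mult_mono K) auto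
    then show ?thesis by (simp add: norm_mult del: of_real_diff of_real_divide)
  qed
  have "ennreal (cmod (lop a b F x)) \<le> (\<integral>\<^sup>+\<xi>\<in>{0..b-a}. ennreal (cmod (complex_of_real (1 - \<xi>/(b-a)) * cis (2 * pi * x * \<xi>) * ft F (a + \<xi>))) \<partial>lborel)"
    unfolding lop_def by (rule cmod_integral_Icc_le[where C=T]) (use pw in auto)
  also have "\<dots> \<le> (\<integral>\<^sup>+\<xi>. ennreal T * indicator {0..b-a} \<xi> \<partial>lborel)"
    using pw by (intro nn_integral_mono) (auto simp: indicator_def intro!: ennreal_leI)
  also have "\<dots> = ennreal ((b - a) * T)"
    using ab T(2) by (simp add: nn_integral_cmult_indicator ennreal_mult mult.commute)
  finally show ?thesis using ab T(2) by (simp add: ennreal_le_iff)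
qed

section \<open>Long frequency intervals and their endpoints\<close>

text \<open>Away from the singularity \<open>lker_formula\<close> can be inserted termwise. Each
  term then is a Fourier transform of \<open>F\<close> divided by a power of \<open>x - y\<close>,
  evaluated at \<open>a\<close> or at \<open>b\<close>, and single values of this kind are what the
  large sieve bounds.\<close>

lemma lop_far_formula:
  assumes F: "nice_fun F" and ab: "a < b" and r: "0 < r" and far: "\<And>y. \<bar>y - x\<bar> < r \<Longrightarrow> F y = 0"
  shows "lop a b F x = \<i> / (2 * pi) * ft (\<lambda>y. F y * complex_of_real (1 / (x - y))) a
    - 1 / (4 * pi\<^sup>2 * (b - a)) * (cis (2 * pi * (b - a) * x) * ft (\<lambda>y. F y * complex_of_real (1 / (x - y)\<^sup>2)) b
        - ft (\<lambda>y. F y * complex_of_real (1 / (x - y)\<^sup>2)) a)"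
proof -
  note [measurable] = nice_fun_measurable[OF F]
  have sep: "r \<le> \<bar>x - y\<bar>" if "F y \<noteq> 0" for y using far[of y] that by (metis abs_minus_commute not_le)
  have n1: "nice_fun (\<lambda>y. F y * complex_of_real (1 / (x - y)))"
  proof (rule nice_fun_mult[OF F, where c="1/r"])
    show "cmod (complex_of_real (1 / (x - y))) \<le> 1 / r" if "F y \<noteq> 0" for y
      unfolding norm_of_real abs_divide using sep[OF that] r by (intro frac_le) auto
  qed measurable
  have n2: "nice_fun (\<lambda>y. F y * complex_of_real (1 / (x - y)\<^sup>2))"
  proof (rule nice_fun_mult[OF F, where c="1/r\<^sup>2"])
    show "cmod (complex_of_real (1 / (x - y)\<^sup>2)) \<le> 1 / r\<^sup>2" if "F y \<noteq> 0" for y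
    proof -
      have "r\<^sup>2 \<le> \<bar>x - y\<bar>\<^sup>2" using sep[OF that] r by (intro power_mono) auto
      then show ?thesis unfolding norm_of_real abs_divide using r by (intro frac_le) auto
    qed
  qed measurable
  define h where "h = b - a"
  have h: "0 < h" using ab by (simp add: h_def)
  define F1 F2 where "F1 y = F y * complex_of_real (1 / (x - y))" and "F2 y = F y * complex_of_real (1 / (x - y)\<^sup>2)" for y
  have i: "integrable lborel (\<lambda>y. F1 y * cis (- (2 * pi * y * \<tau>)))" "integrable lborel (\<lambda>y. F2 y * cis (- (2 * pi * y * \<tau>)))" for \<tau>
    using nice_fun_mult[OF n1, of "\<lambda>y. cis (- (2 * pi * y * \<tau>))" 1] nice_fun_mult[OF n2, of "\<lambda>y. cis (- (2 * pi * y * \<tau>))" 1]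
    by (auto intro!: integrable_nice_fun simp: F1_def F2_def)
  have "lop a b F x = (LINT y|lborel. F y * (cis (- (2 * pi * a * y)) * lker h (x - y)))"
    unfolding h_def by (rule lop_kernel[OF F ab])
  also have "\<dots> = (LINT y|lborel. \<i> / (2 * pi) * (F1 y * cis (- (2 * pi * y * a)))
      - 1 / (4 * pi\<^sup>2 * h) * (cis (2 * pi * h * x) * (F2 y * cis (- (2 * pi * y * b))) - F2 y * cis (- (2 * pi * y * a))))"
  proof (intro Bochner_Integration.integral_cong refl)
    fix y
    show "F y * (cis (- (2 * pi * a * y)) * lker h (x - y)) = \<i> / (2 * pi) * (F1 y * cis (- (2 * pi * y * a)))
      - 1 / (4 * pi\<^sup>2 * h) * (cis (2 * pi * h * x) * (F2 y * cis (- (2 * pi * y * b))) - F2 y * cis (- (2 * pi * y * a)))"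
    proof (cases "F y = 0")
      case True then show ?thesis by (simp add: F1_def F2_def)
    next
      case False
      then have z: "x - y \<noteq> 0" using sep[of y] r by auto
      define e where "e = cis (- (2 * pi * y * a))"
      have e': "cis (2 * pi * h * x) * cis (- (2 * pi * y * b)) = e * cis (2 * pi * h * (x - y))"
        unfolding e_def cis_mult h_def by (rule arg_cong[where f=cis]) (simp add: algebra_simps)
      have "F y * (cis (- (2 * pi * a * y)) * lker h (x - y))
        = F y * (e * (\<i> / (2 * pi * (x - y)) - (cis (2 * pi * h * (x - y)) - 1) / (4 * pi\<^sup>2 * h * (x - y)\<^sup>2)))"
        unfolding lker_formula[OF h z] e_def by (simp add: mult_ac)
      also have "\<dots> = \<i> / (2 * pi) * (F1 y * e) - 1 / (4 * pi\<^sup>2 * h) * (F2 y * (e * cis (2 * pi * h * (x - y))) - F2 y * e)"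
        using z h by (simp add: F1_def F2_def divide_simps) (simp add: algebra_simps)
      also have "\<dots> = \<i> / (2 * pi) * (F1 y * e) - 1 / (4 * pi\<^sup>2 * h) * (cis (2 * pi * h * x) * (F2 y * cis (- (2 * pi * y * b))) - F2 y * e)"
        unfolding e'[symmetric] by (simp only: mult.left_commute)
      finally show ?thesis by (simp only: e_def)
    qed
  qed
  also have "\<dots> = \<i> / (2 * pi) * ft F1 a - 1 / (4 * pi\<^sup>2 * h) * (cis (2 * pi * h * x) * ft F2 b - ft F2 a)"
    unfolding ft_def using i by (simp del: times_divide_eq_left)
  finally show ?thesis unfolding F1_def F2_def h_def by simp
qed

text \<open>The right side of \<open>large_sieve_point\<close> with its window widened to
  \<open>[a, b]\<close>; in this form it can be summed over intervals of bounded overlap.\<close>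

definition sieve :: "real \<Rightarrow> real \<Rightarrow> real \<Rightarrow> real \<Rightarrow> (real \<Rightarrow> complex) \<Rightarrow> ennreal" where
  "sieve a b l c \<Psi> = ennreal (2 * l) * (\<integral>\<^sup>+\<xi>\<in>{a..b}. ennreal ((cmod (ft \<Psi> \<xi>))\<^sup>2) \<partial>lborel)
    + ennreal (80 / l) * (\<integral>\<^sup>+\<xi>\<in>{a..b}. ennreal ((cmod (ft (\<lambda>y. \<Psi> y * complex_of_real (y - c)) \<xi>))\<^sup>2) \<partial>lborel)"

text \<open>An interval of length at least \<open>1/l\<close> contains a window of that length
  starting at \<open>a\<close> and one ending at \<open>b\<close>.\<close>

lemma sieve_endpoints:
  assumes \<Psi>: "nice_fun \<Psi>" and l: "0 < l" "1/l \<le> b - a"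
  shows "ennreal ((cmod (ft \<Psi> a))\<^sup>2) \<le> sieve a b l c \<Psi>" "ennreal ((cmod (ft \<Psi> b))\<^sup>2) \<le> sieve a b l c \<Psi>"
proof -
  have le: "(\<integral>\<^sup>+\<xi>\<in>{s..s+1/l}. g \<xi> \<partial>lborel) \<le> (\<integral>\<^sup>+\<xi>\<in>{a..b}. g \<xi> \<partial>lborel)" if "a \<le> s" "s + 1/l \<le> b" for s and g :: "real \<Rightarrow> ennreal"
    using that by (intro nn_integral_mono) (auto simp: indicator_def)
  have a: "a \<in> {a..a+1/l}" "a \<le> a" "a + 1/l \<le> b" and b: "b \<in> {b-1/l..(b-1/l)+1/l}" "a \<le> b - 1/l" "(b-1/l)+1/l \<le> b" using l by auto
  show "ennreal ((cmod (ft \<Psi> a))\<^sup>2) \<le> sieve a b l c \<Psi>"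
    unfolding sieve_def by (rule order_trans[OF large_sieve_point[OF \<Psi> l(1) a(1), of c]]) (intro add_mono mult_left_mono le a; simp)
  show "ennreal ((cmod (ft \<Psi> b))\<^sup>2) \<le> sieve a b l c \<Psi>"
    unfolding sieve_def by (rule order_trans[OF large_sieve_point[OF \<Psi> l(1) b(1), of c]]) (intro add_mono mult_left_mono le b; simp)
qed

text \<open>Intervals longer than the reciprocal scale: the kernel splits into pure frequencies at the two
  endpoints, which are well separated and hence controlled by the large sieve.\<close>

lemma lop_diff_long:
  assumes F: "nice_fun F" and ab: "a < b" and l: "0 < l" "1/l \<le> b - a"
    and far: "\<And>y. \<bar>y - c\<bar> < 3/2 * l \<Longrightarrow> F y = 0" and x: "\<bar>x - c\<bar> \<le> l/2" "\<bar>x' - c\<bar> \<le> l/2"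
    and \<Psi>0: "\<Psi>0 = (\<lambda>y. F y * complex_of_real (1 / (x - y) - 1 / (x' - y)))" "nice_fun \<Psi>0"
    and \<Psi>1: "\<Psi>1 = (\<lambda>y. F y * complex_of_real (1 / (x - y)\<^sup>2))" "nice_fun \<Psi>1"
    and \<Psi>2: "\<Psi>2 = (\<lambda>y. F y * complex_of_real (1 / (x' - y)\<^sup>2))" "nice_fun \<Psi>2"
  shows "ennreal ((cmod (lop a b F x - lop a b F x'))\<^sup>2)
    \<le> 5 * (sieve a b l c \<Psi>0 + ennreal (2 * l\<^sup>2) * sieve a b l c \<Psi>1 + ennreal (2 * l\<^sup>2) * sieve a b l c \<Psi>2)"
proof -
  note [measurable] = nice_fun_measurable[OF F]
  have farx: "F y = 0" if "\<bar>y - x\<bar> < l" for y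
    by (rule far) (use that x(1) in linarith)
  have farx': "F y = 0" if "\<bar>y - x'\<bar> < l" for y
    by (rule far) (use that x(2) in linarith)
  have n1: "nice_fun (\<lambda>y. F y * complex_of_real (1 / (z - y)))" if "\<And>y. \<bar>y - z\<bar> < l \<Longrightarrow> F y = 0" for z
  proof (rule nice_fun_mult[OF F, where c="1/l"])
    fix y assume "F y \<noteq> 0"
    then have "l \<le> \<bar>z - y\<bar>" using that[of y] by (metis abs_minus_commute not_le)
    then show "cmod (complex_of_real (1 / (z - y))) \<le> 1 / l"
      unfolding norm_of_real abs_divide using l by (intro frac_le) auto
  qed measurable
  have \<Psi>0ft: "ft \<Psi>0 a = ft (\<lambda>y. F y * complex_of_real (1 / (x - y))) a - ft (\<lambda>y. F y * complex_of_real (1 / (x' - y))) a"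
  proof -
    have "\<Psi>0 = (\<lambda>y. F y * complex_of_real (1 / (x - y)) - F y * complex_of_real (1 / (x' - y)))"
      unfolding \<Psi>0 by (simp add: fun_eq_iff right_diff_distrib)
    then show ?thesis
      by (simp only:) (intro ft_diff integrable_nice_fun n1 farx farx'; assumption)
  qed
  \<comment> \<open>The coefficient of the second order terms. It is at most \<open>l\<close>
    because the interval is at least \<open>1/l\<close> long, so these terms can be estimated one by
    one, without using cancellation between \<open>x\<close> and \<open>x'\<close>.\<close>
  define k where "k = 1 / (4 * pi\<^sup>2 * (b - a))"
  have k: "0 \<le> k" "k \<le> l"
  proof -
    show "0 \<le> k" using ab by (simp add: k_def)
    have "1 \<le> pi\<^sup>2" using pi_gt3 by (intro one_le_power) auto
    then have "1 \<le> 4 * pi\<^sup>2" by linarith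
    then have "1 * (b - a) \<le> 4 * pi\<^sup>2 * (b - a)" using ab by (intro mult_right_mono) auto
    then have "k \<le> 1 / (b - a)" unfolding k_def using ab by (intro frac_le) auto
    also have "\<dots> \<le> l" using l ab by (simp add: divide_simps mult.commute)
    finally show "k \<le> l" .
  qed
  have kc: "1 / (4 * pi\<^sup>2 * (b - a)) = complex_of_real k" by (simp add: k_def)
  have D: "lop a b F x - lop a b F x' = \<i> / (2 * pi) * ft \<Psi>0 a
    - k * (cis (2 * pi * (b - a) * x) * ft \<Psi>1 b - ft \<Psi>1 a) + k * (cis (2 * pi * (b - a) * x') * ft \<Psi>2 b - ft \<Psi>2 a)"
  proof -
    have "lop a b F x = \<i> / (2 * pi) * ft (\<lambda>y. F y * complex_of_real (1 / (x - y))) a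
      - k * (cis (2 * pi * (b - a) * x) * ft \<Psi>1 b - ft \<Psi>1 a)"
      unfolding kc[symmetric] \<Psi>1(1) by (rule lop_far_formula[OF F ab l(1)], rule farx)
    moreover have "lop a b F x' = \<i> / (2 * pi) * ft (\<lambda>y. F y * complex_of_real (1 / (x' - y))) a
      - k * (cis (2 * pi * (b - a) * x') * ft \<Psi>2 b - ft \<Psi>2 a)"
      unfolding kc[symmetric] \<Psi>2(1) by (rule lop_far_formula[OF F ab l(1)], rule farx')
    ultimately show ?thesis unfolding \<Psi>0ft right_diff_distrib[of "\<i> / (2 * pi)"] by simp
  qed
  have "cmod (lop a b F x - lop a b F x') \<le> cmod (ft \<Psi>0 a) + l * cmod (ft \<Psi>1 b) + l * cmod (ft \<Psi>1 a) + l * cmod (ft \<Psi>2 b) + l * cmod (ft \<Psi>2 a)"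
  proof -
    have kk: "cmod (k * (cis u * A - A')) \<le> l * cmod A + l * cmod A'" for u A A'
    proof -
      have "cmod (cis u * A - A') \<le> cmod A + cmod A'" by (rule order_trans[OF norm_triangle_ineq4]) (simp add: norm_mult)
      then have "k * cmod (cis u * A - A') \<le> l * (cmod A + cmod A')" using k by (intro mult_mono) auto
      then show ?thesis using k by (simp add: norm_mult distrib_left)
    qed
    have i: "cmod (\<i> / (2 * pi) * ft \<Psi>0 a) \<le> cmod (ft \<Psi>0 a)"
    proof -
      have "cmod (ft \<Psi>0 a) \<le> cmod (ft \<Psi>0 a) * (2 * pi)" using pi_gt3 mult_left_mono[of 1 "2 * pi" "cmod (ft \<Psi>0 a)"] by simp
      then show ?thesis by (simp add: norm_mult norm_divide divide_simps)
    qed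
    show ?thesis
      unfolding D
      using norm_triangle_ineq[of "\<i> / (2 * pi) * ft \<Psi>0 a - k * (cis (2 * pi * (b - a) * x) * ft \<Psi>1 b - ft \<Psi>1 a)" "k * (cis (2 * pi * (b - a) * x') * ft \<Psi>2 b - ft \<Psi>2 a)"]
        norm_triangle_ineq4[of "\<i> / (2 * pi) * ft \<Psi>0 a" "k * (cis (2 * pi * (b - a) * x) * ft \<Psi>1 b - ft \<Psi>1 a)"]
        kk[of "2 * pi * (b - a) * x" "ft \<Psi>1 b" "ft \<Psi>1 a"] kk[of "2 * pi * (b - a) * x'" "ft \<Psi>2 b" "ft \<Psi>2 a"] i
      by linarith
  qed
  then have "(cmod (lop a b F x - lop a b F x'))\<^sup>2 \<le> (cmod (ft \<Psi>0 a) + l * cmod (ft \<Psi>1 b) + l * cmod (ft \<Psi>1 a) + l * cmod (ft \<Psi>2 b) + l * cmod (ft \<Psi>2 a))\<^sup>2"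
    by (intro power_mono) auto
  also have "\<dots> \<le> 5 * ((cmod (ft \<Psi>0 a))\<^sup>2 + (l * cmod (ft \<Psi>1 b))\<^sup>2 + (l * cmod (ft \<Psi>1 a))\<^sup>2 + (l * cmod (ft \<Psi>2 b))\<^sup>2 + (l * cmod (ft \<Psi>2 a))\<^sup>2)"
  proof -
    have "(p + q + r + s + t)\<^sup>2 \<le> 5 * (p\<^sup>2 + q\<^sup>2 + r\<^sup>2 + s\<^sup>2 + t\<^sup>2)" for p q r s t :: real
    proof -
      have "0 \<le> (p - q)\<^sup>2 + (p - r)\<^sup>2 + (p - s)\<^sup>2 + (p - t)\<^sup>2 + (q - r)\<^sup>2 + (q - s)\<^sup>2 + (q - t)\<^sup>2 + (r - s)\<^sup>2 + (r - t)\<^sup>2 + (s - t)\<^sup>2"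
        by (intro add_nonneg_nonneg) auto
      then show ?thesis by (simp add: power2_eq_square algebra_simps)
    qed
    then show ?thesis .
  qed
  also have "\<dots> = 5 * ((cmod (ft \<Psi>0 a))\<^sup>2 + l\<^sup>2 * ((cmod (ft \<Psi>1 b))\<^sup>2 + (cmod (ft \<Psi>1 a))\<^sup>2) + l\<^sup>2 * ((cmod (ft \<Psi>2 b))\<^sup>2 + (cmod (ft \<Psi>2 a))\<^sup>2))"
    by (simp add: power_mult_distrib distrib_left)
  finally have "ennreal ((cmod (lop a b F x - lop a b F x'))\<^sup>2)
    \<le> ennreal (5 * ((cmod (ft \<Psi>0 a))\<^sup>2 + l\<^sup>2 * ((cmod (ft \<Psi>1 b))\<^sup>2 + (cmod (ft \<Psi>1 a))\<^sup>2) + l\<^sup>2 * ((cmod (ft \<Psi>2 b))\<^sup>2 + (cmod (ft \<Psi>2 a))\<^sup>2)))"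
    by (rule ennreal_leI)
  also have "\<dots> = 5 * (ennreal ((cmod (ft \<Psi>0 a))\<^sup>2) + ennreal (l\<^sup>2) * (ennreal ((cmod (ft \<Psi>1 b))\<^sup>2) + ennreal ((cmod (ft \<Psi>1 a))\<^sup>2))
      + ennreal (l\<^sup>2) * (ennreal ((cmod (ft \<Psi>2 b))\<^sup>2) + ennreal ((cmod (ft \<Psi>2 a))\<^sup>2)))"
    by (simp add: ennreal_mult)
  also have "\<dots> \<le> 5 * (sieve a b l c \<Psi>0 + ennreal (l\<^sup>2) * (sieve a b l c \<Psi>1 + sieve a b l c \<Psi>1) + ennreal (l\<^sup>2) * (sieve a b l c \<Psi>2 + sieve a b l c \<Psi>2))"
    by (intro mult_left_mono add_mono sieve_endpoints l \<Psi>0(2) \<Psi>1(2) \<Psi>2(2)) auto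
  also have "\<dots> = 5 * (sieve a b l c \<Psi>0 + ennreal (2 * l\<^sup>2) * sieve a b l c \<Psi>1 + ennreal (2 * l\<^sup>2) * sieve a b l c \<Psi>2)"
  proof -
    have "ennreal (l\<^sup>2) * (z + z) = ennreal (2 * l\<^sup>2) * z" for z
      using ennreal_mult[of 2 "l\<^sup>2"] by (simp add: mult_2[symmetric] mult_ac)
    then show ?thesis by simp
  qed
  finally show ?thesis .
qed

section \<open>Summation over frequency intervals of bounded overlap\<close>

text \<open>The finitely many endpoints form a null set, so the overlap bound for the open intervals
  serves the closed ones.\<close>

lemma sum_nn_integral_overlap:
  fixes a b :: "'k \<Rightarrow> real" and g :: "real \<Rightarrow> ennreal"
  assumes fin: "finite K" and B: "\<And>\<xi>. (\<Sum>k\<in>K. indicator {a k<..<b k} \<xi>) \<le> (B::real)"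
    and [measurable]: "g \<in> borel_measurable borel"
  shows "(\<Sum>k\<in>K. \<integral>\<^sup>+\<xi>\<in>{a k..b k}. g \<xi> \<partial>lborel) \<le> ennreal B * (\<integral>\<^sup>+\<xi>. g \<xi> \<partial>lborel)"
proof -
  have "(\<Sum>k\<in>K. \<integral>\<^sup>+\<xi>\<in>{a k..b k}. g \<xi> \<partial>lborel) = (\<integral>\<^sup>+\<xi>. (\<Sum>k\<in>K. g \<xi> * indicator {a k..b k} \<xi>) \<partial>lborel)"
    by (subst nn_integral_sum) auto
  also have "\<dots> \<le> (\<integral>\<^sup>+\<xi>. ennreal B * g \<xi> \<partial>lborel)"
  proof (rule nn_integral_mono_AE)
    have "finite (a ` K \<union> b ` K)" using fin by simp
    then have "AE \<xi> in lborel. \<xi> \<notin> a ` K \<union> b ` K"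
      by (intro AE_not_in finite_imp_null_set_lborel)
    then show "AE \<xi> in lborel. (\<Sum>k\<in>K. g \<xi> * indicator {a k..b k} \<xi>) \<le> ennreal B * g \<xi>"
    proof eventually_elim
      case (elim \<xi>)
      have "(\<Sum>k\<in>K. g \<xi> * indicator {a k..b k} \<xi>) = (\<Sum>k\<in>K. g \<xi> * ennreal (indicator {a k<..<b k} \<xi>))"
        using elim by (intro sum.cong refl) (auto simp: indicator_def)
      also have "\<dots> = g \<xi> * ennreal (\<Sum>k\<in>K. indicator {a k<..<b k} \<xi>)"
        by (simp add: sum_distrib_left[symmetric] sum_ennreal)
      also have "\<dots> \<le> g \<xi> * ennreal B" by (intro mult_left_mono ennreal_leI B) auto
      finally show ?case by (simp add: mult.commute)
    qed
  qed
  also have "\<dots> = ennreal B * (\<integral>\<^sup>+\<xi>. g \<xi> \<partial>lborel)" by (intro nn_integral_cmult) measurable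
  finally show ?thesis .
qed

text \<open>Overlap and Bessel's inequality for both integrals in \<open>sieve\<close>. Since
  \<open>\<Psi>\<close> lives at distance at least \<open>l\<close> from \<open>c\<close>, its
  square norm is at most \<open>1 / l\<^sup>2\<close> times that of \<open>\<Theta>\<close>, and the
  coefficients 2 and 80 add up to 82.\<close>

lemma sum_sieve:
  fixes a b :: "'k \<Rightarrow> real"
  assumes fin: "finite K" and B: "\<And>\<xi>. (\<Sum>k\<in>K. indicator {a k<..<b k} \<xi>) \<le> (B::real)"
    and \<Psi>: "nice_fun \<Psi>" and l: "0 < l" and far: "\<And>y. \<Psi> y \<noteq> 0 \<Longrightarrow> l \<le> \<bar>y - c\<bar>"
    and T: "(\<integral>\<^sup>+y. ennreal ((cmod (\<Psi> y * complex_of_real (y - c)))\<^sup>2) \<partial>lborel) \<le> ennreal T"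
  shows "(\<Sum>k\<in>K. sieve (a k) (b k) l c \<Psi>) \<le> ennreal B * (ennreal (82 / l) * ennreal T)"
proof -
  note [measurable] = nice_fun_measurable[OF \<Psi>]
  define \<Theta> where "\<Theta> y = \<Psi> y * complex_of_real (y - c)" for y
  obtain R where R: "0 \<le> R" "\<And>x. cmod (\<Psi> x) \<le> R" "\<And>x. R < \<bar>x\<bar> \<Longrightarrow> \<Psi> x = 0"
    by (rule nice_funE[OF \<Psi>]) (rule that; assumption)
  have bd: "cmod (complex_of_real (y - c)) \<le> R + \<bar>c\<bar>" if "\<Psi> y \<noteq> 0" for y
  proof -
    have "\<bar>y\<bar> \<le> R" using R(3)[of y] that by force
    then show ?thesis unfolding norm_of_real by linarith
  qed
  have \<Theta>: "nice_fun \<Theta>" unfolding \<Theta>_def by (rule nice_fun_mult[OF \<Psi> _ bd]) auto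
  note [measurable] = nice_fun_measurable[OF \<Theta>]
  have \<Theta>eq: "(\<lambda>y. \<Psi> y * complex_of_real (y - c)) = \<Theta>" by (simp add: \<Theta>_def fun_eq_iff)
  have T1: "(\<integral>\<^sup>+\<xi>. ennreal ((cmod (ft \<Theta> \<xi>))\<^sup>2) \<partial>lborel) \<le> ennreal T"
    using order_trans[OF bessel_ft[OF \<Theta>]] T by (simp add: \<Theta>_def)
  have "(\<integral>\<^sup>+\<xi>. ennreal ((cmod (ft \<Psi> \<xi>))\<^sup>2) \<partial>lborel) \<le> (\<integral>\<^sup>+y. ennreal ((cmod (\<Psi> y))\<^sup>2) \<partial>lborel)"
    by (rule bessel_ft[OF \<Psi>])
  also have "\<dots> \<le> (\<integral>\<^sup>+y. ennreal (1 / l\<^sup>2) * ennreal ((cmod (\<Theta> y))\<^sup>2) \<partial>lborel)"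
  proof (intro nn_integral_mono)
    fix y
    show "ennreal ((cmod (\<Psi> y))\<^sup>2) \<le> ennreal (1 / l\<^sup>2) * ennreal ((cmod (\<Theta> y))\<^sup>2)"
    proof (cases "\<Psi> y = 0")
      case False
      have "l\<^sup>2 \<le> \<bar>y - c\<bar>\<^sup>2" using far[OF False] l by (intro power_mono) auto
      then have "(cmod (\<Psi> y))\<^sup>2 * l\<^sup>2 \<le> (cmod (\<Psi> y))\<^sup>2 * \<bar>y - c\<bar>\<^sup>2" by (intro mult_left_mono) auto
      also have "\<dots> = (cmod (\<Theta> y))\<^sup>2" by (simp only: \<Theta>_def norm_mult norm_of_real power_mult_distrib)
      finally have "(cmod (\<Psi> y))\<^sup>2 \<le> 1 / l\<^sup>2 * (cmod (\<Theta> y))\<^sup>2" using l by (simp add: field_simps)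
      then show ?thesis by (subst ennreal_mult[symmetric]) (auto intro: ennreal_leI)
    qed simp
  qed
  also have "\<dots> = ennreal (1 / l\<^sup>2) * (\<integral>\<^sup>+y. ennreal ((cmod (\<Theta> y))\<^sup>2) \<partial>lborel)" by (intro nn_integral_cmult) measurable
  also have "\<dots> \<le> ennreal (1 / l\<^sup>2) * ennreal T" using T by (intro mult_left_mono) (auto simp: \<Theta>_def)
  finally have T2: "(\<integral>\<^sup>+\<xi>. ennreal ((cmod (ft \<Psi> \<xi>))\<^sup>2) \<partial>lborel) \<le> ennreal (1 / l\<^sup>2) * ennreal T" .
  have "(\<Sum>k\<in>K. sieve (a k) (b k) l c \<Psi>)
    = ennreal (2 * l) * (\<Sum>k\<in>K. \<integral>\<^sup>+\<xi>\<in>{a k..b k}. ennreal ((cmod (ft \<Psi> \<xi>))\<^sup>2) \<partial>lborel)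
    + ennreal (80 / l) * (\<Sum>k\<in>K. \<integral>\<^sup>+\<xi>\<in>{a k..b k}. ennreal ((cmod (ft \<Theta> \<xi>))\<^sup>2) \<partial>lborel)"
    unfolding sieve_def \<Theta>eq by (simp add: sum.distrib sum_distrib_left)
  also have "\<dots> \<le> ennreal (2 * l) * (ennreal B * (ennreal (1 / l\<^sup>2) * ennreal T)) + ennreal (80 / l) * (ennreal B * ennreal T)"
    by (intro add_mono mult_left_mono order_trans[OF sum_nn_integral_overlap[OF fin B]] T1 T2) auto
  also have "\<dots> = ennreal B * ((ennreal (2 * l) * ennreal (1 / l\<^sup>2) + ennreal (80 / l)) * ennreal T)"
    by (simp add: distrib_left distrib_right mult_ac)
  also have "ennreal (2 * l) * ennreal (1 / l\<^sup>2) + ennreal (80 / l) = ennreal (82 / l)"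
    using l by (subst ennreal_mult[symmetric], simp, simp, subst ennreal_plus[symmetric]) (auto simp: field_simps power2_eq_square)
  finally show ?thesis .
qed

text \<open>Each interval is charged with the sum of the short and the long estimate, so the family
  need not be divided by length before summing. The constant is
  \<open>4 + 5 * (82 * 6 + 2 * (2 * 82 * 6))\<close>, where 4 belongs to the short case.\<close>

lemma lop_oscillation:
  fixes a b :: "'k \<Rightarrow> real"
  assumes fin: "finite K" and ab: "\<And>k. k \<in> K \<Longrightarrow> a k < b k"
    and B: "\<And>\<xi>. (\<Sum>k\<in>K. indicator {a k<..<b k} \<xi>) \<le> (B::real)" and B0: "0 \<le> B"
    and F: "nice_fun F" and l: "0 < l" and far: "\<And>y. \<bar>y - c\<bar> < 3/2 * l \<Longrightarrow> F y = 0"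
    and x: "\<bar>x - c\<bar> \<le> l/2" "\<bar>x' - c\<bar> \<le> l/2"
    and T: "(\<integral>\<^sup>+y. ennreal ((cmod (F y))\<^sup>2 / (y - c)\<^sup>2) \<partial>lborel) \<le> ennreal T" "0 \<le> T"
  shows "(\<Sum>k\<in>K. (cmod (lop (a k) (b k) F x - lop (a k) (b k) F x'))\<^sup>2) \<le> 12304 * B * l * T"
proof -
  note [measurable] = nice_fun_measurable[OF F]
  define \<Phi> where "\<Phi> y = F y * complex_of_real (1 / (y - c))" for y
  define \<Psi>0 where "\<Psi>0 = (\<lambda>y. F y * complex_of_real (1 / (x - y) - 1 / (x' - y)))"
  define \<Psi>1 where "\<Psi>1 = (\<lambda>y. F y * complex_of_real (1 / (x - y)\<^sup>2))"
  define \<Psi>2 where "\<Psi>2 = (\<lambda>y. F y * complex_of_real (1 / (x' - y)\<^sup>2))"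
  have sepc: "3/2 * l \<le> \<bar>y - c\<bar>" if "F y \<noteq> 0" for y using far[of y] that not_le by blast
  have sep: "2/3 * \<bar>y - c\<bar> \<le> \<bar>z - y\<bar>" "l \<le> \<bar>z - y\<bar>" if "F y \<noteq> 0" "\<bar>z - c\<bar> \<le> l/2" for y z
  proof -
    have "\<bar>y - c\<bar> \<le> \<bar>z - y\<bar> + \<bar>z - c\<bar>" by linarith
    then show "2/3 * \<bar>y - c\<bar> \<le> \<bar>z - y\<bar>" "l \<le> \<bar>z - y\<bar>" using sepc[OF that(1)] that(2) by simp_all
  qed
  \<comment> \<open>A source at distance at least \<open>3/2 * l\<close> from the centre is seen
    from \<open>x\<close> and \<open>x'\<close> at no less than \<open>2/3\<close> of that distance,
    hence the \<open>9/4\<close>. Its square is below the 6 in \<open>TT\<close>.\<close>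
  have b1: "\<bar>1 / (x - y) - 1 / (x' - y)\<bar> * \<bar>y - c\<bar> \<le> 9/4 * l / \<bar>y - c\<bar>" if "F y \<noteq> 0" for y
  proof -
    have n: "x - y \<noteq> 0" "x' - y \<noteq> 0" "0 < \<bar>y - c\<bar>" using sep(2)[OF that x(1)] sep(2)[OF that x(2)] sepc[OF that] l by auto
    have "1 / (x - y) - 1 / (x' - y) = (x' - x) / ((x - y) * (x' - y))" using n by (simp add: field_simps)
    then have "\<bar>1 / (x - y) - 1 / (x' - y)\<bar> = \<bar>x' - x\<bar> / (\<bar>x - y\<bar> * \<bar>x' - y\<bar>)" by (simp add: abs_mult)
    also have "\<dots> \<le> l / ((2/3 * \<bar>y - c\<bar>) * (2/3 * \<bar>y - c\<bar>))"
    proof (intro frac_le mult_mono)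
      show "\<bar>x' - x\<bar> \<le> l" using x by linarith
      have "0 < (y - c) * (y - c)" using n(3) by (metis abs_zero less_irrefl not_real_square_gt_zero)
      then show "0 < (2/3 * \<bar>y - c\<bar>) * (2/3 * \<bar>y - c\<bar>)" by simp
    qed (use n l sep(1)[OF that x(1)] sep(1)[OF that x(2)] in auto)
    also have "\<dots> = 9/4 * l / \<bar>y - c\<bar> / \<bar>y - c\<bar>" using n by (simp add: mult.assoc)
    finally show ?thesis using n(3) by (simp add: pos_le_divide_eq)
  qed
  have b2: "\<bar>1 / (z - y)\<^sup>2\<bar> * \<bar>y - c\<bar> \<le> 9/4 / \<bar>y - c\<bar>" if "F y \<noteq> 0" "\<bar>z - c\<bar> \<le> l/2" for y z
  proof -
    have n: "z - y \<noteq> 0" "0 < \<bar>y - c\<bar>" using sep(2)[OF that] sepc[OF that(1)] l by auto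
    have "(2/3 * \<bar>y - c\<bar>)\<^sup>2 \<le> \<bar>z - y\<bar>\<^sup>2" using sep(1)[OF that] by (intro power_mono) auto
    then have "1 / \<bar>z - y\<bar>\<^sup>2 \<le> 1 / (2/3 * \<bar>y - c\<bar>)\<^sup>2" using n by (intro frac_le) auto
    also have "\<dots> = 9/4 / \<bar>y - c\<bar> / \<bar>y - c\<bar>" using n by (simp add: power2_eq_square)
    finally show ?thesis using n(2) by (simp add: pos_le_divide_eq mult_ac)
  qed
  have nice\<Phi>: "nice_fun \<Phi>" unfolding \<Phi>_def
  proof (rule nice_fun_mult[OF F, where c="1/l"])
    fix y assume "F y \<noteq> 0"
    then have "l \<le> \<bar>y - c\<bar>" using sepc[of y] l by linarith
    then show "cmod (complex_of_real (1 / (y - c))) \<le> 1 / l"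
      unfolding norm_of_real abs_divide using l by (intro frac_le) auto
  qed measurable
  have ninv: "\<bar>1 / (z - y)\<bar> \<le> 1 / l" if "F y \<noteq> 0" "\<bar>z - c\<bar> \<le> l/2" for y z
    unfolding abs_divide using l sep(2)[OF that] by (intro frac_le) auto
  have nice0: "nice_fun \<Psi>0" unfolding \<Psi>0_def
  proof (rule nice_fun_mult[OF F, where c="2/l"])
    fix y assume "F y \<noteq> 0"
    then have "\<bar>1 / (x - y) - 1 / (x' - y)\<bar> \<le> 1/l + 1/l" using ninv[OF _ x(1), of y] ninv[OF _ x(2), of y] by linarith
    then show "cmod (complex_of_real (1 / (x - y) - 1 / (x' - y))) \<le> 2/l" unfolding norm_of_real by simp
  qed measurable
  have nsq: "cmod (complex_of_real (1 / (z - y)\<^sup>2)) \<le> (1/l)\<^sup>2" if "F y \<noteq> 0" "\<bar>z - c\<bar> \<le> l/2" for y z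
  proof -
    have "\<bar>1 / (z - y)\<bar>\<^sup>2 \<le> (1/l)\<^sup>2" using ninv[OF that] by (intro power_mono) auto
    then show ?thesis unfolding norm_of_real by (simp add: power_divide)
  qed
  have nice1: "nice_fun \<Psi>1" unfolding \<Psi>1_def by (rule nice_fun_mult[OF F _ nsq[OF _ x(1)]]) auto
  have nice2: "nice_fun \<Psi>2" unfolding \<Psi>2_def by (rule nice_fun_mult[OF F _ nsq[OF _ x(2)]]) auto
  have T\<Phi>: "(\<integral>\<^sup>+\<xi>. ennreal ((cmod (ft \<Phi> \<xi>))\<^sup>2) \<partial>lborel) \<le> ennreal T"
  proof -
    have "(cmod (\<Phi> y))\<^sup>2 = (cmod (F y))\<^sup>2 / (y - c)\<^sup>2" for y
      by (simp add: \<Phi>_def norm_mult norm_divide power_mult_distrib power_divide del: of_real_diff)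
    then show ?thesis using order_trans[OF bessel_ft[OF nice\<Phi>]] T(1) by simp
  qed
  have TT: "(\<integral>\<^sup>+y. ennreal ((cmod (F y * g y * complex_of_real (y - c)))\<^sup>2) \<partial>lborel) \<le> ennreal (6 * r\<^sup>2 * T)"
    if g: "\<And>y. F y \<noteq> 0 \<Longrightarrow> cmod (g y) * \<bar>y - c\<bar> \<le> 9/4 * r / \<bar>y - c\<bar>" and r: "0 \<le> r" for g r
  proof -
    have "(\<integral>\<^sup>+y. ennreal ((cmod (F y * g y * complex_of_real (y - c)))\<^sup>2) \<partial>lborel)
      \<le> (\<integral>\<^sup>+y. ennreal (6 * r\<^sup>2) * ennreal ((cmod (F y))\<^sup>2 / (y - c)\<^sup>2) \<partial>lborel)"
    proof (intro nn_integral_mono)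
      fix y
      show "ennreal ((cmod (F y * g y * complex_of_real (y - c)))\<^sup>2) \<le> ennreal (6 * r\<^sup>2) * ennreal ((cmod (F y))\<^sup>2 / (y - c)\<^sup>2)"
      proof (cases "F y = 0")
        case False
        have "(cmod (g y) * \<bar>y - c\<bar>)\<^sup>2 \<le> (9/4 * r / \<bar>y - c\<bar>)\<^sup>2" using g[OF False] by (intro power_mono) auto
        also have "\<dots> = 81/16 * r\<^sup>2 / (y - c)\<^sup>2" by (simp add: power_mult_distrib power_divide)
        also have "\<dots> \<le> 6 * r\<^sup>2 / (y - c)\<^sup>2" by (intro divide_right_mono mult_right_mono) auto
        finally have "(cmod (F y))\<^sup>2 * (cmod (g y) * \<bar>y - c\<bar>)\<^sup>2 \<le> (cmod (F y))\<^sup>2 * (6 * r\<^sup>2 / (y - c)\<^sup>2)"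
          by (intro mult_left_mono) auto
        then have "(cmod (F y * g y * complex_of_real (y - c)))\<^sup>2 \<le> 6 * r\<^sup>2 * ((cmod (F y))\<^sup>2 / (y - c)\<^sup>2)"
          unfolding norm_mult norm_of_real by (simp add: power_mult_distrib mult_ac)
        then show ?thesis by (subst ennreal_mult[symmetric]) (auto intro: ennreal_leI)
      qed simp
    qed
    also have "\<dots> = ennreal (6 * r\<^sup>2) * (\<integral>\<^sup>+y. ennreal ((cmod (F y))\<^sup>2 / (y - c)\<^sup>2) \<partial>lborel)" by (intro nn_integral_cmult) measurable
    also have "\<dots> \<le> ennreal (6 * r\<^sup>2) * ennreal T" by (intro mult_left_mono T) auto
    also have "\<dots> = ennreal (6 * r\<^sup>2 * T)" using T(2) by (subst ennreal_mult) auto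
    finally show ?thesis .
  qed
  have S0: "(\<Sum>k\<in>K. sieve (a k) (b k) l c \<Psi>0) \<le> ennreal B * (ennreal (82 / l) * ennreal (6 * l\<^sup>2 * T))"
  proof (rule sum_sieve[OF fin B nice0 l])
    show "l \<le> \<bar>y - c\<bar>" if "\<Psi>0 y \<noteq> 0" for y using that sepc[of y] l by (force simp: \<Psi>0_def)
    show "(\<integral>\<^sup>+y. ennreal ((cmod (\<Psi>0 y * complex_of_real (y - c)))\<^sup>2) \<partial>lborel) \<le> ennreal (6 * l\<^sup>2 * T)"
      unfolding \<Psi>0_def using b1 l by (intro TT) (auto simp del: of_real_diff of_real_divide simp: norm_of_real)
  qed
  have S1: "(\<Sum>k\<in>K. sieve (a k) (b k) l c \<Psi>1) \<le> ennreal B * (ennreal (82 / l) * ennreal (6 * 1\<^sup>2 * T))"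
  proof (rule sum_sieve[OF fin B nice1 l])
    show "l \<le> \<bar>y - c\<bar>" if "\<Psi>1 y \<noteq> 0" for y using that sepc[of y] l by (force simp: \<Psi>1_def)
    show "(\<integral>\<^sup>+y. ennreal ((cmod (\<Psi>1 y * complex_of_real (y - c)))\<^sup>2) \<partial>lborel) \<le> ennreal (6 * 1\<^sup>2 * T)"
      unfolding \<Psi>1_def using b2[OF _ x(1)] by (intro TT) (auto simp del: of_real_diff of_real_divide simp: norm_of_real)
  qed
  have S2: "(\<Sum>k\<in>K. sieve (a k) (b k) l c \<Psi>2) \<le> ennreal B * (ennreal (82 / l) * ennreal (6 * 1\<^sup>2 * T))"
  proof (rule sum_sieve[OF fin B nice2 l])
    show "l \<le> \<bar>y - c\<bar>" if "\<Psi>2 y \<noteq> 0" for y using that sepc[of y] l by (force simp: \<Psi>2_def)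
    show "(\<integral>\<^sup>+y. ennreal ((cmod (\<Psi>2 y * complex_of_real (y - c)))\<^sup>2) \<partial>lborel) \<le> ennreal (6 * 1\<^sup>2 * T)"
      unfolding \<Psi>2_def using b2[OF _ x(2)] by (intro TT) (auto simp del: of_real_diff of_real_divide simp: norm_of_real)
  qed
  define I where "I k = (\<integral>\<^sup>+\<xi>\<in>{a k..b k}. ennreal ((cmod (ft \<Phi> \<xi>))\<^sup>2) \<partial>lborel)" for k
  define D where "D k = (cmod (lop (a k) (b k) F x - lop (a k) (b k) F x'))\<^sup>2" for k
  have Dk: "ennreal (D k) \<le> ennreal (4 * l) * I k + 5 * (sieve (a k) (b k) l c \<Psi>0 + ennreal (2 * l\<^sup>2) * sieve (a k) (b k) l c \<Psi>1 + ennreal (2 * l\<^sup>2) * sieve (a k) (b k) l c \<Psi>2)"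
    if k: "k \<in> K" for k
  proof (cases "1/l \<le> b k - a k")
    case True
    have "ennreal (D k) \<le> 5 * (sieve (a k) (b k) l c \<Psi>0 + ennreal (2 * l\<^sup>2) * sieve (a k) (b k) l c \<Psi>1 + ennreal (2 * l\<^sup>2) * sieve (a k) (b k) l c \<Psi>2)"
      unfolding D_def by (rule lop_diff_long[OF F ab[OF k] l True far x \<Psi>0_def nice0 \<Psi>1_def nice1 \<Psi>2_def nice2])
    then show ?thesis by (metis add.commute add_increasing2 zero_le)
  next
    case False
    then have "l\<^sup>2 * (b k - a k) \<le> l\<^sup>2 * (1/l)" by (intro mult_left_mono) auto
    then have "l\<^sup>2 * (b k - a k) \<le> l" using l by (simp add: power2_eq_square)
    then have "4 * l\<^sup>2 * (b k - a k) \<le> 4 * l" by simp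
    moreover have "ennreal (D k) \<le> ennreal (4 * l\<^sup>2 * (b k - a k)) * I k"
      unfolding D_def I_def
    proof (rule lop_diff_short[OF nice\<Phi> ab[OF k] l x F])
      show "F y = \<Phi> y * complex_of_real (y - c)" for y
        using sepc[of y] l by (cases "F y = 0") (auto simp: \<Phi>_def)
    qed
    ultimately have "ennreal (D k) \<le> ennreal (4 * l) * I k"
      by (meson ennreal_leI mult_right_mono order_trans zero_le)
    then show ?thesis by (metis add_increasing2 zero_le)
  qed
  have "ennreal (\<Sum>k\<in>K. D k) = (\<Sum>k\<in>K. ennreal (D k))" by (intro sum_ennreal[symmetric]) (simp add: D_def)
  also have "\<dots> \<le> (\<Sum>k\<in>K. ennreal (4 * l) * I k + 5 * (sieve (a k) (b k) l c \<Psi>0 + ennreal (2 * l\<^sup>2) * sieve (a k) (b k) l c \<Psi>1 + ennreal (2 * l\<^sup>2) * sieve (a k) (b k) l c \<Psi>2))"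
    by (intro sum_mono Dk)
  also have "\<dots> = ennreal (4 * l) * (\<Sum>k\<in>K. I k) + 5 * ((\<Sum>k\<in>K. sieve (a k) (b k) l c \<Psi>0) + ennreal (2 * l\<^sup>2) * (\<Sum>k\<in>K. sieve (a k) (b k) l c \<Psi>1) + ennreal (2 * l\<^sup>2) * (\<Sum>k\<in>K. sieve (a k) (b k) l c \<Psi>2))"
    by (simp add: sum.distrib sum_distrib_left)
  also have "\<dots> \<le> ennreal (4 * l) * (ennreal B * ennreal T) + 5 * (ennreal B * (ennreal (82 / l) * ennreal (6 * l\<^sup>2 * T))
      + ennreal (2 * l\<^sup>2) * (ennreal B * (ennreal (82 / l) * ennreal (6 * 1\<^sup>2 * T))) + ennreal (2 * l\<^sup>2) * (ennreal B * (ennreal (82 / l) * ennreal (6 * 1\<^sup>2 * T))))"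
  proof (intro add_mono mult_left_mono S0 S1 S2)
    have [measurable]: "\<Phi> \<in> borel_measurable borel" by (rule nice_fun_measurable[OF nice\<Phi>])
    have "(\<Sum>k\<in>K. I k) \<le> ennreal B * (\<integral>\<^sup>+\<xi>. ennreal ((cmod (ft \<Phi> \<xi>))\<^sup>2) \<partial>lborel)"
      unfolding I_def by (rule sum_nn_integral_overlap[OF fin B]) measurable
    also have "\<dots> \<le> ennreal B * ennreal T" by (intro mult_left_mono T\<Phi>) auto
    finally show "(\<Sum>k\<in>K. I k) \<le> ennreal B * ennreal T" .
  qed auto
  also have "\<dots> = ennreal (4 * l * (B * T) + 5 * (B * (82 / l * (6 * l\<^sup>2 * T)) + 2 * l\<^sup>2 * (B * (82 / l * (6 * 1\<^sup>2 * T))) + 2 * l\<^sup>2 * (B * (82 / l * (6 * 1\<^sup>2 * T)))))"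
  proof -
    have m: "ennreal u * ennreal v = ennreal (u * v)" if "0 \<le> u" "0 \<le> v" for u v using that by (simp add: ennreal_mult)
    have p: "ennreal u + ennreal v = ennreal (u + v)" if "0 \<le> u" "0 \<le> v" for u v using that by simp
    have 5: "5 * ennreal u = ennreal (5 * u)" if "0 \<le> u" for u using that ennreal_mult[of 5 u] by simp
    have nn: "0 \<le> 82 / l * (6 * l\<^sup>2 * T)" "0 \<le> 82 / l * (6 * 1\<^sup>2 * T)" "0 \<le> B * T" using l T(2) B0 by auto
    show ?thesis using l T(2) B0 nn by (simp only: m p 5 mult_nonneg_nonneg add_nonneg_nonneg zero_le_power2 zero_le_numeral less_imp_le divide_nonneg_nonneg)
  qed
  also have "4 * l * (B * T) + 5 * (B * (82 / l * (6 * l\<^sup>2 * T)) + 2 * l\<^sup>2 * (B * (82 / l * (6 * 1\<^sup>2 * T))) + 2 * l\<^sup>2 * (B * (82 / l * (6 * 1\<^sup>2 * T)))) = 12304 * B * l * T"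
    using l by (simp add: power2_eq_square)
  finally show ?thesis unfolding D_def using l T(2) B0 by (subst (asm) ennreal_le_iff) auto
qed

definition lsq :: "'k set \<Rightarrow> ('k \<Rightarrow> real) \<Rightarrow> ('k \<Rightarrow> real) \<Rightarrow> (real \<Rightarrow> complex) \<Rightarrow> real \<Rightarrow> real" where
  "lsq K a b F x = L2_set (\<lambda>k. cmod (lop (a k) (b k) F x)) K"

text \<open>The parameter \<open>\<kappa>\<close> is the total length of the frequency intervals. It
  is finite but not bounded in terms of \<open>B\<close>, which is harmless because it only fixes
  the scale at which the recursion stops.\<close>

lemma lsq_sparse_operator:
  fixes a b :: "'k \<Rightarrow> real"
  assumes fin: "finite K" and ab: "\<And>k. k \<in> K \<Longrightarrow> a k < b k"
    and B: "\<And>\<xi>. (\<Sum>k\<in>K. indicator {a k<..<b k} \<xi>) \<le> (B::real)" and B0: "0 < B"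
  shows "sparse_operator (lsq K a b) (12304 * B) (\<Sum>k\<in>K. b k - a k)"
proof
  show "0 < 12304 * B" using B0 by simp
  show "0 \<le> (\<Sum>k\<in>K. b k - a k)" using ab by (intro sum_nonneg) (auto simp: less_imp_le)
  show "lsq K a b F \<in> borel_measurable borel" if "nice_fun F" for F
  proof -
    note [measurable] = nice_fun_measurable[OF that]
    show ?thesis unfolding lsq_def L2_set_def by measurable
  qed
  show "0 \<le> lsq K a b F x" for F x by (simp add: lsq_def)
  show "lsq K a b F x \<le> (\<Sum>k\<in>K. b k - a k) * T"
    if "nice_fun F" "(\<integral>\<^sup>+y. ennreal (cmod (F y)) \<partial>lborel) \<le> ennreal T" "0 \<le> T" for F T x
  proof -
    have "lsq K a b F x \<le> (\<Sum>k\<in>K. cmod (lop (a k) (b k) F x))" unfolding lsq_def by (intro L2_set_le_sum) auto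
    also have "\<dots> \<le> (\<Sum>k\<in>K. (b k - a k) * T)" by (intro sum_mono lop_bound that ab)
    finally show ?thesis by (simp add: sum_distrib_right)
  qed
  have tri: "L2_set (\<lambda>k. cmod (u k)) K \<le> L2_set (\<lambda>k. cmod (v k)) K + L2_set (\<lambda>k. cmod (w k)) K"
    if "\<And>k. k \<in> K \<Longrightarrow> cmod (u k) \<le> cmod (v k) + cmod (w k)" for u v w :: "'k \<Rightarrow> complex"
    by (rule order_trans[OF L2_set_mono L2_set_triangle_ineq]) (use that in auto)
  show "lsq K a b (\<lambda>y. F y + G y) x \<le> lsq K a b F x + lsq K a b G x" if "nice_fun F" "nice_fun G" for F G x
    unfolding lsq_def by (rule tri) (simp add: lop_add that ab norm_triangle_ineq)
  show "lsq K a b (\<lambda>y. F y - G y) x \<le> lsq K a b F x + lsq K a b G x" if "nice_fun F" "nice_fun G" for F G x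
    unfolding lsq_def by (rule tri) (simp add: lop_diff that ab norm_triangle_ineq4)
  show "(\<integral>\<^sup>+x. ennreal ((lsq K a b F x)\<^sup>2) \<partial>lborel) \<le> ennreal (12304 * B) * (\<integral>\<^sup>+y. ennreal ((cmod (F y))\<^sup>2) \<partial>lborel)"
    if F: "nice_fun F" for F
  proof -
    note [measurable] = nice_fun_measurable[OF F]
    have "(\<integral>\<^sup>+x. ennreal ((lsq K a b F x)\<^sup>2) \<partial>lborel) = (\<integral>\<^sup>+x. (\<Sum>k\<in>K. ennreal ((cmod (lop (a k) (b k) F x))\<^sup>2)) \<partial>lborel)"
      unfolding lsq_def L2_set_def by (intro nn_integral_cong) (simp add: sum_nonneg sum_ennreal)
    also have "\<dots> = (\<Sum>k\<in>K. \<integral>\<^sup>+x. ennreal ((cmod (lop (a k) (b k) F x))\<^sup>2) \<partial>lborel)"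
      by (intro nn_integral_sum) measurable
    also have "\<dots> \<le> (\<Sum>k\<in>K. \<integral>\<^sup>+\<xi>\<in>{a k..b k}. ennreal ((cmod (ft F \<xi>))\<^sup>2) \<partial>lborel)"
      by (intro sum_mono lop_L2 F ab)
    also have "\<dots> \<le> ennreal B * (\<integral>\<^sup>+\<xi>. ennreal ((cmod (ft F \<xi>))\<^sup>2) \<partial>lborel)"
      by (rule sum_nn_integral_overlap[OF fin B]) measurable
    also have "\<dots> \<le> ennreal (12304 * B) * (\<integral>\<^sup>+y. ennreal ((cmod (F y))\<^sup>2) \<partial>lborel)"
      using B0 by (intro mult_mono ennreal_leI bessel_ft F) auto
    finally show ?thesis .
  qed
  show "lsq K a b F x \<le> lsq K a b F x' + sqrt (12304 * B * l * T)"
    if F: "nice_fun F" and l: "0 < l" and far: "\<And>y. y \<in> {\<alpha>-l..<\<alpha>+2*l} \<Longrightarrow> F y = 0" and x: "x \<in> {\<alpha>..<\<alpha>+l}" "x' \<in> {\<alpha>..<\<alpha>+l}"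
      and T: "0 \<le> T" "(\<integral>\<^sup>+y. ennreal ((cmod (F y))\<^sup>2 / (y - (\<alpha> + l/2))\<^sup>2) \<partial>lborel) \<le> ennreal T" for F l \<alpha> x x' T
  proof -
    have "(\<Sum>k\<in>K. (cmod (lop (a k) (b k) F x - lop (a k) (b k) F x'))\<^sup>2) \<le> 12304 * B * l * T"
    proof (rule lop_oscillation[OF fin ab B _ F l _ _ _ T(2,1)])
      fix y assume "\<bar>y - (\<alpha> + l/2)\<bar> < 3/2 * l"
      then have "y - (\<alpha> + l/2) < 3/2 * l" "- (y - (\<alpha> + l/2)) < 3/2 * l" by linarith+
      then have "y \<in> {\<alpha>-l..<\<alpha>+2*l}" by simp
      then show "F y = 0" by (rule far)
    next
      show "\<bar>x - (\<alpha> + l/2)\<bar> \<le> l/2" "\<bar>x' - (\<alpha> + l/2)\<bar> \<le> l/2" using x by (auto simp: abs_le_iff field_simps)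
    qed (use B0 in auto)
    then have "L2_set (\<lambda>k. cmod (lop (a k) (b k) F x - lop (a k) (b k) F x')) K \<le> sqrt (12304 * B * l * T)"
      unfolding L2_set_def by (rule real_sqrt_le_mono)
    moreover have "lsq K a b F x \<le> lsq K a b F x' + L2_set (\<lambda>k. cmod (lop (a k) (b k) F x - lop (a k) (b k) F x')) K"
      unfolding lsq_def by (rule tri) (metis norm_triangle_sub)
    ultimately show ?thesis by linarith
  qed
qed

section \<open>The weighted bound for square functions\<close>

text \<open>Sparse domination on \<open>[-r, r)\<close> with an additive error, integration against
  \<open>w\<close>, and then \<open>r\<close> to infinity by monotone convergence. The error may
  depend on \<open>r\<close> and on the mass of \<open>w\<close>, since it is removed before
  \<open>r\<close> varies.\<close>

lemma weighted_lsq_bound: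
  fixes q p B :: real
  assumes q: "1 < q" and p: "p = 2 * q" and B0: "0 < B"
  shows "\<exists>C\<ge>0. \<forall>(K::'k set) a b f (w::real\<Rightarrow>real) A.
     finite K \<longrightarrow> (\<forall>k\<in>K. a k < b k) \<longrightarrow> (\<forall>\<xi>. (\<Sum>k\<in>K. indicator {a k<..<b k} \<xi>) \<le> B) \<longrightarrow> nice_fun f \<longrightarrow>
     w \<in> borel_measurable borel \<longrightarrow> (\<forall>x. 0 < w x) \<longrightarrow>
     (\<forall>u v. u < v \<longrightarrow> (\<exists>\<mu> \<nu>. 0 \<le> \<mu> \<and> 0 \<le> \<nu> \<and> (\<integral>\<^sup>+x\<in>{u..v}. ennreal (w x) \<partial>lborel) = ennreal \<mu> \<and>
        (\<integral>\<^sup>+x\<in>{u..v}. ennreal (w x powr (-1/(q-1))) \<partial>lborel) = ennreal \<nu> \<and>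
        \<mu> * \<nu> powr (q-1) \<le> A * (v - u) powr q)) \<longrightarrow>
     (\<integral>\<^sup>+x. ennreal (lsq K a b f x powr p) * ennreal (w x) \<partial>lborel)
       \<le> ennreal (C * A powr (p * max (1 / (p - 2)) 1)) * (\<integral>\<^sup>+x. ennreal (cmod (f x) powr p) * ennreal (w x) \<partial>lborel)"
proof -
  obtain C1 where C1: "0 \<le> C1" and W: "\<And>(w::real\<Rightarrow>real) (f::real\<Rightarrow>real) (I::(real \<times> real \<times> real set) set) a l v E A.
     w \<in> borel_measurable borel \<Longrightarrow> (\<forall>x. 0 < w x) \<Longrightarrow> f \<in> borel_measurable borel \<Longrightarrow> (\<forall>x. 0 \<le> f x) \<Longrightarrow>
     (\<forall>u v. u < v \<longrightarrow> (\<exists>\<mu> \<nu>. 0 \<le> \<mu> \<and> 0 \<le> \<nu> \<and> (\<integral>\<^sup>+x\<in>{u..v}. ennreal (w x) \<partial>lborel) = ennreal \<mu> \<and>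
        (\<integral>\<^sup>+x\<in>{u..v}. ennreal (w x powr (-1/(q-1))) \<partial>lborel) = ennreal \<nu> \<and>
        \<mu> * \<nu> powr (q-1) \<le> A * (v - u) powr q)) \<Longrightarrow>
     finite I \<Longrightarrow> disjoint_family_on E I \<Longrightarrow>
     (\<forall>i\<in>I. 0 < l i \<and> E i \<in> sets borel \<and> E i \<subseteq> {a i..<a i + l i} \<and> ennreal (l i / 2) \<le> emeasure lborel (E i)
        \<and> 0 \<le> v i \<and> ennreal ((v i)\<^sup>2 * (3 * l i)) = (\<integral>\<^sup>+x\<in>{a i - l i..a i + 2 * l i}. ennreal ((f x)\<^sup>2) \<partial>lborel)) \<Longrightarrow>
     (\<integral>\<^sup>+x. ennreal ((\<Sum>i\<in>I. v i * indicator {a i..<a i + l i} x) powr p) * ennreal (w x) \<partial>lborel)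
       \<le> ennreal (C1 * A powr (p * max (1 / (p - 2)) 1)) * (\<integral>\<^sup>+x. ennreal (f x powr p) * ennreal (w x) \<partial>lborel)"
    using weighted_sparse_bound[OF q p, where 'i="real \<times> real \<times> real set"] by blast
  \<comment> \<open>\<open>7 * \<Lambda>\<close> is the constant of the domination with
    \<open>A = 12304 * B\<close>; \<open>sqrt 3\<close> accounts for \<open>sqavg\<close> being
    three times the mean square required by the weighted sparse bound.\<close>
  define L where "L = 7 * (16 * (12304 * B + 2)) * sqrt 3"
  have L0: "0 \<le> L" using B0 by (simp add: L_def)
  define C where "C = 2 powr p * (L powr p * C1)"
  have p2: "2 < p" using q p by simp
  have C0: "0 \<le> C" using C1 by (simp add: C_def)
  have main: "(\<integral>\<^sup>+x. ennreal (lsq K a b f x powr p) * ennreal (w x) \<partial>lborel)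
       \<le> ennreal (C * A powr (p * max (1 / (p - 2)) 1)) * (\<integral>\<^sup>+x. ennreal (cmod (f x) powr p) * ennreal (w x) \<partial>lborel)"
    if fin: "finite K" and ab: "\<And>k. k \<in> K \<Longrightarrow> a k < b k" and B: "\<And>\<xi>. (\<Sum>k\<in>K. indicator {a k<..<b k} \<xi>) \<le> B" and f: "nice_fun f"
      and w[measurable]: "w \<in> borel_measurable borel" and w0: "\<forall>x. 0 < w x"
      and Aq: "\<forall>u v. u < v \<longrightarrow> (\<exists>\<mu> \<nu>. 0 \<le> \<mu> \<and> 0 \<le> \<nu> \<and> (\<integral>\<^sup>+x\<in>{u..v}. ennreal (w x) \<partial>lborel) = ennreal \<mu> \<and>
        (\<integral>\<^sup>+x\<in>{u..v}. ennreal (w x powr (-1/(q-1))) \<partial>lborel) = ennreal \<nu> \<and>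
        \<mu> * \<nu> powr (q-1) \<le> A * (v - u) powr q)"
    for K :: "'k set" and a b f w A
  proof -
    note [measurable] = nice_fun_measurable[OF f]
    interpret sparse_operator "lsq K a b" "12304 * B" "\<Sum>k\<in>K. b k - a k"
      by (rule lsq_sparse_operator[OF fin ab B B0])
    have [measurable]: "lsq K a b f \<in> borel_measurable borel" by (rule N_measurable[OF f])
    have L: "L = 7 * \<Lambda> * sqrt 3" by (simp add: L_def \<Lambda>_def)
    define M where "M = (\<integral>\<^sup>+x. ennreal (cmod (f x) powr p) * ennreal (w x) \<partial>lborel)"
    define Y where "Y = ennreal (C * A powr (p * max (1 / (p - 2)) 1)) * M"
    obtain R where R: "0 \<le> R" "\<And>x. cmod (f x) \<le> R" "\<And>x. R < \<bar>x\<bar> \<Longrightarrow> f x = 0"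
      by (rule nice_funE[OF f]) (rule that; assumption)
    have loc_r: "(\<integral>\<^sup>+x\<in>{-r..<r}. ennreal (lsq K a b f x powr p) * ennreal (w x) \<partial>lborel) \<le> Y"
      if r: "R < r" for r
    proof (rule ennreal_le_epsilon)
      fix e :: real assume e: "0 < e"
      have r0: "0 < 2 * r" using r R(1) by simp
      \<comment> \<open>The support of \<open>f\<close> lies inside \<open>[-r, r)\<close>, so the
        localization at the top of the recursion is \<open>f\<close> itself.\<close>
      have locf: "loc f (-r) (2 * r) = f"
      proof
        fix x
        show "loc f (-r) (2 * r) x = f x"
          using R(3)[of x] r R(1) by (cases "R < \<bar>x\<bar>") (auto simp: loc_def indicator_def)
      qed
      obtain \<mu> \<nu> where \<mu>: "(\<integral>\<^sup>+x\<in>{-r..r}. ennreal (w x) \<partial>lborel) = ennreal \<mu>" "0 \<le> \<mu>"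
        using Aq[rule_format, of "-r" r] r0 by auto
      \<comment> \<open>Chosen so that the error, raised to the power \<open>p\<close> and
        integrated against \<open>w\<close> over \<open>[-r, r]\<close>, contributes at most
        \<open>e\<close>. The \<open>+ 1\<close> avoids division by zero.\<close>
      define \<epsilon> where "\<epsilon> = (e / (2 powr p * (\<mu> + 1))) powr (1/p)"
      have \<epsilon>: "0 < \<epsilon>" using e \<mu> by (simp add: \<epsilon>_def)
      have \<epsilon>p: "2 powr p * \<epsilon> powr p * \<mu> \<le> e"
      proof -
        have "\<epsilon> powr p = e / (2 powr p * (\<mu> + 1))" using e \<mu> p2 by (simp add: \<epsilon>_def powr_powr)
        then have "2 powr p * \<epsilon> powr p * \<mu> = e * (\<mu> / (\<mu> + 1))" by simp
        also have "\<dots> \<le> e * 1" using e \<mu> by (intro mult_left_mono) auto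
        finally show ?thesis by simp
      qed
      obtain S where S: "is_sparse S (-r) (2 * r)" and dom: "\<And>x. x \<in> {-r..<-r+2*r} \<Longrightarrow>
          lsq K a b (loc f (-r) (2 * r)) x \<le> 7 * \<Lambda> * (\<Sum>(b,h,E)\<in>S. sqrt (sqavg f b h) * indicator {b..<b+h} x) + \<epsilon>"
        using sparse_domination[OF f r0 \<epsilon>, of "-r"] by blast
      define v where "v = (\<lambda>(b,h,E::real set). sqrt (sqavg f b h / 3))"
      define al where "al = (\<lambda>(b::real,h::real,E::real set). b)"
      define ll where "ll = (\<lambda>(b::real,h::real,E::real set). h)"
      define EE where "EE = (\<lambda>(b::real,h::real,E::real set). E)"
      define Sum where "Sum x = (\<Sum>i\<in>S. v i * indicator {al i..<al i + ll i} x)" for x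
      have prem: "\<forall>i\<in>S. 0 < ll i \<and> EE i \<in> sets borel \<and> EE i \<subseteq> {al i..<al i + ll i} \<and> ennreal (ll i / 2) \<le> emeasure lborel (EE i)
        \<and> 0 \<le> v i \<and> ennreal ((v i)\<^sup>2 * (3 * ll i)) = (\<integral>\<^sup>+x\<in>{al i - ll i..al i + 2 * ll i}. ennreal ((cmod (f x))\<^sup>2) \<partial>lborel)"
      proof
        fix i assume iS: "i \<in> S"
        obtain c h E where i: "i = (c,h,E)" by (cases i)
        have s: "0 < h" "E \<in> sets borel" "E \<subseteq> {c..<c+h}" "ennreal (h/2) \<le> emeasure lborel E"
          using S iS unfolding is_sparse_def i by auto
        have v0: "0 \<le> sqavg f c h" by (rule sqavg_nonneg[OF s(1)])
        have "ennreal ((v i)\<^sup>2 * (3 * h)) = ennreal (sqavg f c h * h)" using v0 by (simp add: v_def i)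
        also have "\<dots> = (\<integral>\<^sup>+y. ennreal ((cmod (loc f c h y))\<^sup>2) \<partial>lborel)" by (rule sqavg[OF f s(1), symmetric])
        also have "\<dots> = (\<integral>\<^sup>+x\<in>{c - h..c + 2 * h}. ennreal ((cmod (f x))\<^sup>2) \<partial>lborel)"
        proof (rule nn_integral_cong_AE)
          have "AE x in lborel. x \<noteq> c + 2 * h" by (rule AE_lborel_singleton)
          then show "AE x in lborel. ennreal ((cmod (loc f c h x))\<^sup>2) = ennreal ((cmod (f x))\<^sup>2) * indicator {c - h..c + 2 * h} x"
            by eventually_elim (auto simp: loc_def indicator_def)
        qed
        finally show "0 < ll i \<and> EE i \<in> sets borel \<and> EE i \<subseteq> {al i..<al i + ll i} \<and> ennreal (ll i / 2) \<le> emeasure lborel (EE i)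
          \<and> 0 \<le> v i \<and> ennreal ((v i)\<^sup>2 * (3 * ll i)) = (\<integral>\<^sup>+x\<in>{al i - ll i..al i + 2 * ll i}. ennreal ((cmod (f x))\<^sup>2) \<partial>lborel)"
          using s v0 by (auto simp: i al_def ll_def EE_def v_def)
      qed
      have finS: "finite S" and disS: "disjoint_family_on EE S" using S by (auto simp: is_sparse_def EE_def)
      have SumW: "(\<integral>\<^sup>+x. ennreal (Sum x powr p) * ennreal (w x) \<partial>lborel) \<le> ennreal (C1 * A powr (p * max (1 / (p - 2)) 1)) * M"
        unfolding Sum_def M_def by (rule W[OF w w0 _ _ Aq finS disS prem]) auto
      have Sum0: "0 \<le> Sum x" for x unfolding Sum_def using prem by (intro sum_nonneg) auto
      have [measurable]: "Sum \<in> borel_measurable borel" unfolding Sum_def by measurable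
      have domf: "lsq K a b f x \<le> L * Sum x + \<epsilon>" if x: "x \<in> {-r..<r}" for x
      proof -
        have "(\<Sum>(b,h,E)\<in>S. sqrt (sqavg f b h) * indicator {b..<b+h} x) = sqrt 3 * Sum x"
          unfolding Sum_def sum_distrib_left
          by (intro sum.cong refl) (auto simp: v_def al_def ll_def real_sqrt_divide split: prod.split)
        then show ?thesis using dom[of x] x unfolding locf L by (simp add: mult.assoc)
      qed
      have pw: "ennreal (lsq K a b f x powr p) * ennreal (w x) * indicator {-r..<r} x
        \<le> ennreal (2 powr p * L powr p) * (ennreal (Sum x powr p) * ennreal (w x)) + ennreal (2 powr p * \<epsilon> powr p) * (ennreal (w x) * indicator {-r..r} x)" for x
      proof (cases "x \<in> {-r..<r}")
        case True
        have "lsq K a b f x powr p \<le> (2 * max (L * Sum x) \<epsilon>) powr p"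
          using domf[OF True] N_nonneg[of f x] p2 by (intro powr_mono2) auto
        also have "\<dots> \<le> 2 powr p * ((L * Sum x) powr p + \<epsilon> powr p)"
          using L0 Sum0[of x] \<epsilon> by (simp add: powr_mult max_def)
        also have "\<dots> = 2 powr p * L powr p * Sum x powr p + 2 powr p * \<epsilon> powr p"
          using L0 Sum0[of x] by (simp add: powr_mult distrib_left)
        finally have "lsq K a b f x powr p * w x \<le> (2 powr p * L powr p * Sum x powr p + 2 powr p * \<epsilon> powr p) * w x"
          using w0 by (intro mult_right_mono) (auto simp: less_imp_le)
        then have "ennreal (lsq K a b f x powr p * w x) \<le> ennreal (2 powr p * L powr p * (Sum x powr p * w x) + 2 powr p * \<epsilon> powr p * w x)"
          by (intro ennreal_leI) (simp add: algebra_simps)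
        then show ?thesis using True w0[rule_format, of x] by (simp add: ennreal_mult less_imp_le)
      qed simp
      have "(\<integral>\<^sup>+x\<in>{-r..<r}. ennreal (lsq K a b f x powr p) * ennreal (w x) \<partial>lborel)
        \<le> (\<integral>\<^sup>+x. ennreal (2 powr p * L powr p) * (ennreal (Sum x powr p) * ennreal (w x)) + ennreal (2 powr p * \<epsilon> powr p) * (ennreal (w x) * indicator {-r..r} x) \<partial>lborel)"
        by (intro nn_integral_mono pw)
      also have "\<dots> = ennreal (2 powr p * L powr p) * (\<integral>\<^sup>+x. ennreal (Sum x powr p) * ennreal (w x) \<partial>lborel) + ennreal (2 powr p * \<epsilon> powr p) * ennreal \<mu>"
        unfolding \<mu>(1)[symmetric] by (subst nn_integral_add) (auto simp: nn_integral_cmult)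
      also have "\<dots> \<le> ennreal (2 powr p * L powr p) * (ennreal (C1 * A powr (p * max (1 / (p - 2)) 1)) * M) + ennreal e"
        using SumW \<epsilon>p \<mu>(2) by (intro add_mono mult_left_mono) (auto simp: ennreal_mult[symmetric] intro!: ennreal_leI)
      also have "ennreal (2 powr p * L powr p) * (ennreal (C1 * A powr (p * max (1 / (p - 2)) 1)) * M) = Y"
        unfolding Y_def C_def using C1 by (simp add: ennreal_mult[symmetric] mult.assoc[symmetric])
      finally show "(\<integral>\<^sup>+x\<in>{-r..<r}. ennreal (lsq K a b f x powr p) * ennreal (w x) \<partial>lborel) \<le> Y + ennreal e" .
    qed
    define G where "G x = ennreal (lsq K a b f x powr p) * ennreal (w x)" for x
    have [measurable]: "G \<in> borel_measurable borel" unfolding G_def by measurable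
    define rr where "rr n = R + 1 + real n" for n :: nat
    have "(\<integral>\<^sup>+x. G x \<partial>lborel) = (\<integral>\<^sup>+x. (SUP n. G x * indicator {-rr n..<rr n} x) \<partial>lborel)"
    proof (intro nn_integral_cong)
      fix x
      obtain n :: nat where n: "\<bar>x\<bar> \<le> real n" using real_arch_simple by blast
      have "G x = G x * indicator {-rr n..<rr n} x" using n R(1) by (auto simp: rr_def indicator_def abs_le_iff)
      also have "\<dots> \<le> (SUP n. G x * indicator {-rr n..<rr n} x)" by (intro SUP_upper) auto
      finally have "G x \<le> (SUP n. G x * indicator {-rr n..<rr n} x)" .
      moreover have "(SUP n. G x * indicator {-rr n..<rr n} x) \<le> G x"
        by (intro SUP_least) (auto simp: indicator_def)
      ultimately show "G x = (SUP n. G x * indicator {-rr n..<rr n} x)" by (rule antisym)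
    qed
    also have "\<dots> = (SUP n. \<integral>\<^sup>+x\<in>{-rr n..<rr n}. G x \<partial>lborel)"
      by (intro nn_integral_monotone_convergence_SUP) (auto simp: incseq_def le_fun_def indicator_def rr_def)
    also have "\<dots> \<le> Y"
    proof (intro SUP_least)
      fix n show "(\<integral>\<^sup>+x\<in>{-rr n..<rr n}. G x \<partial>lborel) \<le> Y"
        unfolding G_def by (rule loc_r) (simp add: rr_def)
    qed
    finally show ?thesis by (simp add: G_def Y_def M_def)
  qed
  show ?thesis
    by (intro exI[of _ C] conjI C0 allI impI) (rule main; blast)
qed

section \<open>Frequency pieces as Fourier integrals\<close>

lemma inv_fourier_indicator:
  "inv_fourier (indicator \<omega>) x = (LINT \<xi>|lborel. complex_of_real (indicator \<omega> \<xi>) * cis (2 * pi * x * \<xi>))"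
  unfolding inv_fourier_def cis_conv_exp
  by (intro Bochner_Integration.integral_cong refl) (simp add: indicator_def mult_ac)

lemma nice_fun_indicator_bounded:
  assumes "\<omega> \<in> sets borel" "bounded \<omega>"
  shows "nice_fun (\<lambda>\<xi>. complex_of_real (indicator \<omega> \<xi>))"
proof -
  obtain R where R: "\<And>\<xi>. \<xi> \<in> \<omega> \<Longrightarrow> \<bar>\<xi>\<bar> \<le> R" using assms(2) by (auto simp: bounded_real)
  have [measurable]: "\<omega> \<in> sets borel" by fact
  have "complex_of_real (indicator \<omega> x) = 0" if "max 1 R < \<bar>x\<bar>" for x
    using R[of x] that by (auto simp: indicator_def)
  moreover have "cmod (complex_of_real (indicator \<omega> x)) \<le> max 1 R" for x
    by (auto simp: indicator_def le_max_iff_disj)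
  moreover have "0 \<le> max 1 R" by simp
  moreover have "(\<lambda>\<xi>. complex_of_real (indicator \<omega> \<xi>)) \<in> borel_measurable borel" by measurable
  ultimately show ?thesis unfolding nice_fun_def by blast
qed

lemma fconv_frequency:
  assumes f: "nice_fun f" and \<omega>: "\<omega> \<in> sets borel" "bounded \<omega>"
  shows "fconv f (inv_fourier (indicator \<omega>)) x
    = (LINT \<xi>|lborel. complex_of_real (indicator \<omega> \<xi>) * (cis (2 * pi * x * \<xi>) * ft f \<xi>))"
proof -
  note [measurable] = nice_fun_measurable[OF f] \<omega>(1)
  define k where "k z = inv_fourier (indicator \<omega>) z" for z
  have "fconv f k x = (LINT y|lborel. f (x - y) * k y)" by (simp add: fconv_def)
  also have "\<dots> = (LINT y|lborel. f y * k (x - y))"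
    using lborel_integral_real_affine[where c="-1" and t=x and f="\<lambda>y. f (x - y) * k y"] by simp
  also have "\<dots> = (LINT y|lborel. f y * (LINT \<xi>|lborel. complex_of_real (indicator \<omega> \<xi>) * cis (2 * pi * (x - y) * \<xi>)))"
    unfolding k_def inv_fourier_indicator by simp
  also have "\<dots> = (LINT \<xi>|lborel. complex_of_real (indicator \<omega> \<xi>) * (LINT y|lborel. f y * cis (2 * pi * (x - y) * \<xi>)))"
    by (rule Fubini_kernel[where C=1])
      (use integrable_nice_fun[OF f] integrable_nice_fun[OF nice_fun_indicator_bounded[OF \<omega>]] in auto)
  also have "(\<lambda>\<xi>. LINT y|lborel. f y * cis (2 * pi * (x - y) * \<xi>)) = (\<lambda>\<xi>. cis (2 * pi * x * \<xi>) * ft f \<xi>)"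
  proof
    fix \<xi>
    have "cis (2 * pi * x * \<xi>) * ft f \<xi> = (LINT y|lborel. cis (2 * pi * x * \<xi>) * (f y * cis (- (2 * pi * y * \<xi>))))"
      unfolding ft_def by (simp only: integral_mult_right_zero)
    also have "\<dots> = (LINT y|lborel. f y * cis (2 * pi * (x - y) * \<xi>))"
      by (simp only: mult.left_commute[of "cis _"] cis_mult) (simp add: algebra_simps)
    finally show "(LINT y|lborel. f y * cis (2 * pi * (x - y) * \<xi>)) = cis (2 * pi * x * \<xi>) * ft f \<xi>" by simp
  qed
  finally show ?thesis by (simp only: k_def[abs_def])
qed

text \<open>All derivatives vanish outside a common ball: its complement is open, so a derivative of
  a function vanishing there is zero there as well.\<close>

lemma test_functionE:
  assumes "test_function f"
  obtains D R where "D 0 = f" "\<And>n x. (D n has_vector_derivative D (Suc n) x) (at x)"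
    "\<And>n x. R < \<bar>x\<bar> \<Longrightarrow> D n x = (0::complex)" "0 \<le> R"
proof -
  obtain D where D: "D 0 = f" "\<And>n x. (D n has_vector_derivative D (Suc n) x) (at x)" and b: "bounded {x. f x \<noteq> 0}"
    using assms unfolding test_function_def by blast
  obtain R0 where R0: "\<And>x. f x \<noteq> 0 \<Longrightarrow> \<bar>x\<bar> \<le> R0" using b by (auto simp: bounded_real)
  define R where "R = max R0 0"
  have z: "D n x = 0" if "R < \<bar>x\<bar>" for n x
    using that
  proof (induction n arbitrary: x)
    case 0
    then show ?case using R0[of x] D(1) by (auto simp: R_def)
  next
    case (Suc n)
    have op: "open {x::real. R < \<bar>x\<bar>}" by (intro open_Collect_less continuous_intros)
    have "((\<lambda>_. 0) has_vector_derivative D (Suc n) x) (at x)"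
      by (rule has_vector_derivative_transform_within_open[OF D(2)[of n x] op]) (use Suc in auto)
    then show ?case using vector_derivative_unique_at has_vector_derivative_const by blast
  qed
  show ?thesis by (rule that[of D R]) (use D z in \<open>auto simp: R_def\<close>)
qed

lemma nice_fun_test:
  assumes D: "\<And>x. (f has_vector_derivative f' x) (at x)" and R: "\<And>x. R < \<bar>x\<bar> \<Longrightarrow> f x = (0::complex)"
  shows "nice_fun f"
proof -
  have c: "continuous_on UNIV f"
    using D by (auto simp: continuous_on_eq_continuous_at intro: has_vector_derivative_continuous)
  then have m: "f \<in> borel_measurable borel" by (rule borel_measurable_continuous_onI)
  have "compact (f ` {-R..R})" by (rule compact_continuous_image) (auto intro: continuous_on_subset[OF c])
  then have "bounded (f ` {-R..R})" by (rule compact_imp_bounded)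
  then obtain M where "\<forall>y\<in>f ` {-R..R}. cmod y \<le> M" unfolding bounded_iff by blast
  then have M: "\<And>x. x \<in> {-R..R} \<Longrightarrow> cmod (f x) \<le> M" by auto
  define M' where "M' = max (max M R) 0"
  have "cmod (f x) \<le> M' \<and> (M' < \<bar>x\<bar> \<longrightarrow> f x = 0)" for x
  proof (cases "R < \<bar>x\<bar>")
    case False
    then have "x \<in> {-R..R}" by auto
    then show ?thesis using M[of x] False by (auto simp: M'_def)
  qed (simp add: R M'_def)
  then show ?thesis unfolding nice_fun_def using m by (intro conjI exI[of _ M']) (auto simp: M'_def)
qed

lemma ft_derivative:
  assumes D: "\<And>x. (f has_vector_derivative f' x) (at x)" and D': "\<And>x. (f' has_vector_derivative f'' x) (at x)"
    and R: "\<And>x. R < \<bar>x\<bar> \<Longrightarrow> f x = (0::complex)" "\<And>x. R < \<bar>x\<bar> \<Longrightarrow> f' x = 0"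
  shows "ft f' \<xi> = 2 * pi * \<i> * \<xi> * ft f \<xi>"
proof -
  define v where "v = - (2 * pi * \<xi>)"
  define r where "r = max R 0 + 1"
  have nf: "nice_fun f" "nice_fun f'" using nice_fun_test[OF D R(1)] nice_fun_test[OF D' R(2)] by auto
  have i: "integrable lborel (\<lambda>y. f y * cis (v * y))" "integrable lborel (\<lambda>y. f' y * cis (v * y))"
    using nice_fun_mult[OF nf(1), of "\<lambda>y. cis (v * y)" 1] nice_fun_mult[OF nf(2), of "\<lambda>y. cis (v * y)" 1]
    by (auto intro: integrable_nice_fun)
  have c: "continuous_on A f" "continuous_on A f'" for A
    using D D' by (auto simp: continuous_on_eq_continuous_within intro: has_vector_derivative_continuous has_vector_derivative_at_within)
  have "(LINT y|lborel. indicator {-r..r} y *\<^sub>R (f y * (\<i> * v * cis (v * y)) + f' y * cis (v * y)))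
    = f r * cis (v * r) - f (-r) * cis (v * (-r))"
    by (intro integral_FTC_Icc_complex has_vector_derivative_mult D cis_has_vector_derivative continuous_intros c) (simp add: r_def)
  also have "\<dots> = 0" using R(1)[of r] R(1)[of "-r"] by (simp add: r_def)
  also have "(\<lambda>y. indicator {-r..r} y *\<^sub>R (f y * (\<i> * v * cis (v * y)) + f' y * cis (v * y)))
    = (\<lambda>y. (\<i> * v) * (f y * cis (v * y)) + f' y * cis (v * y))"
  proof
    fix y
    show "indicator {-r..r} y *\<^sub>R (f y * (\<i> * v * cis (v * y)) + f' y * cis (v * y)) = (\<i> * v) * (f y * cis (v * y)) + f' y * cis (v * y)"
    proof (cases "R < \<bar>y\<bar>")
      case False
      then have "y \<in> {-r..r}" by (auto simp: r_def)
      then show ?thesis by (simp add: mult_ac)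
    qed (use R in simp)
  qed
  finally have "(\<i> * v) * (LINT y|lborel. f y * cis (v * y)) + (LINT y|lborel. f' y * cis (v * y)) = 0"
    using i by simp
  moreover have "(LINT y|lborel. g y * cis (v * y)) = ft g \<xi>" for g
    unfolding ft_def v_def by (intro Bochner_Integration.integral_cong refl) (simp add: mult_ac)
  ultimately show ?thesis by (simp add: v_def add_eq_0_iff mult_ac)
qed

lemma nice_fun_of_test: "test_function f \<Longrightarrow> nice_fun f"
  by (erule test_functionE) (metis nice_fun_test)

text \<open>Two derivatives give decay of order \<open>1 / (1 + \<xi>\<^sup>2)\<close>.
  Integrability of the transform is what identifies the limit of truncations for an unbounded
  interval with an absolutely convergent integral.\<close>

lemma integrable_ft_test:
  assumes "test_function f"
  shows "integrable lborel (ft f)"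
proof -
  obtain D R where D: "D 0 = f" "\<And>n x. (D n has_vector_derivative D (Suc n) x) (at x)"
    "\<And>n x. R < \<bar>x\<bar> \<Longrightarrow> D n x = (0::complex)" by (rule test_functionE[OF assms]) (rule that; assumption)
  have n: "nice_fun (D m)" for m by (rule nice_fun_test[OF D(2,3)])
  define K where "K m = (LINT y|lborel. cmod (D m y))" for m
  have K: "cmod (ft (D m) \<xi>) \<le> K m" for m \<xi> unfolding K_def by (rule cmod_ft_le[OF integrable_nice_fun[OF n]])
  have step: "ft (D (Suc m)) \<xi> = 2 * pi * \<i> * \<xi> * ft (D m) \<xi>" for m \<xi>
    by (rule ft_derivative[OF D(2) D(2) D(3) D(3)])
  have bd: "cmod (ft f \<xi>) \<le> (K 0 + K 2) * inverse (1 + \<xi>\<^sup>2)" for \<xi>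
  proof -
    have "ft (D 2) \<xi> = (2 * pi * \<i> * \<xi>) * ((2 * pi * \<i> * \<xi>) * ft f \<xi>)"
      using step[of 1 \<xi>] step[of 0 \<xi>] D(1) by (simp add: numeral_2_eq_2)
    then have "cmod (ft (D 2) \<xi>) = (2 * pi * \<bar>\<xi>\<bar>) * ((2 * pi * \<bar>\<xi>\<bar>) * cmod (ft f \<xi>))"
      by (simp add: norm_mult)
    then have "(2 * pi)\<^sup>2 * (\<xi>\<^sup>2 * cmod (ft f \<xi>)) \<le> K 2" using K[of 2 \<xi>] by (simp add: power2_eq_square mult_ac)
    moreover have "1 * (\<xi>\<^sup>2 * cmod (ft f \<xi>)) \<le> (2 * pi)\<^sup>2 * (\<xi>\<^sup>2 * cmod (ft f \<xi>))"
      using pi_gt3 by (intro mult_right_mono one_le_power) auto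
    ultimately have "(1 + \<xi>\<^sup>2) * cmod (ft f \<xi>) \<le> K 0 + K 2"
      using K[of 0 \<xi>] D(1) by (simp add: distrib_right)
    then show ?thesis by (simp add: divide_inverse[symmetric] pos_le_divide_eq add_pos_nonneg mult.commute)
  qed
  have [measurable]: "f \<in> borel_measurable borel" using n[of 0] D(1) by (simp add: nice_fun_measurable)
  have "integrable lborel (\<lambda>\<xi>::real. inverse (1 + \<xi>\<^sup>2))"
    using integrable_inverse_1_plus_square by (simp add: set_integrable_def)
  then have "integrable lborel (\<lambda>\<xi>. (K 0 + K 2) * inverse (1 + \<xi>\<^sup>2))" by simp
  then show ?thesis
    by (rule Bochner_Integration.integrable_bound) (use bd in \<open>auto intro!: order_trans[OF bd] abs_ge_self\<close>)
qed

text \<open>For test functions this is \<open>freq_piece\<close> in a form without limits. It is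
  also defined by an absolutely convergent integral for any nice function and bounded
  interval.\<close>

definition piece :: "real set \<Rightarrow> (real \<Rightarrow> complex) \<Rightarrow> real \<Rightarrow> complex" where
  "piece \<omega> f x = (LINT \<xi>|lborel. complex_of_real (indicator \<omega> \<xi>) * (cis (2 * pi * x * \<xi>) * ft f \<xi>))"

lemma piece_measurable [measurable]:
  assumes [measurable]: "f \<in> borel_measurable borel" "\<omega> \<in> sets borel"
  shows "piece \<omega> f \<in> borel_measurable borel"
  unfolding piece_def by measurable

lemma piece_tendsto:
  assumes f: "test_function f" and \<omega>: "\<omega> \<in> sets borel"
  shows "(\<lambda>n. piece (\<omega> \<inter> {- real n..real n}) f x) \<longlonglongrightarrow> piece \<omega> f x"
  unfolding piece_def
proof (rule integral_dominated_convergence)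
  note [measurable] = nice_fun_measurable[OF nice_fun_of_test[OF f]] \<omega>
  show "integrable lborel (\<lambda>\<xi>. cmod (ft f \<xi>))" using integrable_ft_test[OF f] by simp
  show "AE \<xi> in lborel. (\<lambda>n. complex_of_real (indicator (\<omega> \<inter> {- real n..real n}) \<xi>) * (cis (2 * pi * x * \<xi>) * ft f \<xi>))
    \<longlonglongrightarrow> complex_of_real (indicator \<omega> \<xi>) * (cis (2 * pi * x * \<xi>) * ft f \<xi>)"
  proof (rule AE_I2)
    fix \<xi> :: real
    obtain N :: nat where N: "\<bar>\<xi>\<bar> \<le> real N" using real_arch_simple by blast
    have "\<forall>\<^sub>F n in sequentially. complex_of_real (indicator (\<omega> \<inter> {- real n..real n}) \<xi>) * (cis (2 * pi * x * \<xi>) * ft f \<xi>)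
      = complex_of_real (indicator \<omega> \<xi>) * (cis (2 * pi * x * \<xi>) * ft f \<xi>)"
      using eventually_ge_at_top[of N]
    proof eventually_elim
      case (elim n)
      then have "\<xi> \<in> {- real n..real n}" using N by auto
      then show ?case by (simp add: indicator_def)
    qed
    then show "(\<lambda>n. complex_of_real (indicator (\<omega> \<inter> {- real n..real n}) \<xi>) * (cis (2 * pi * x * \<xi>) * ft f \<xi>))
      \<longlonglongrightarrow> complex_of_real (indicator \<omega> \<xi>) * (cis (2 * pi * x * \<xi>) * ft f \<xi>)" by (rule tendsto_eventually)
  qed
  show "AE \<xi> in lborel. cmod (complex_of_real (indicator (\<omega> \<inter> {- real n..real n}) \<xi>) * (cis (2 * pi * x * \<xi>) * ft f \<xi>)) \<le> cmod (ft f \<xi>)" for n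
    by (intro AE_I2) (simp add: norm_mult indicator_def)
  show "(\<lambda>\<xi>. complex_of_real (indicator \<omega> \<xi>) * (cis (2 * pi * x * \<xi>) * ft f \<xi>)) \<in> borel_measurable lborel" by measurable
  show "(\<lambda>\<xi>. complex_of_real (indicator (\<omega> \<inter> {- real n..real n}) \<xi>) * (cis (2 * pi * x * \<xi>) * ft f \<xi>)) \<in> borel_measurable lborel" for n
    by measurable
qed

lemma freq_piece_eq_piece:
  assumes f: "test_function f" and \<omega>: "\<omega> \<in> sets borel"
  shows "freq_piece \<omega> f x = piece \<omega> f x"
proof -
  have "fconv f (inv_fourier (indicator (\<omega> \<inter> {- real n..real n}))) x = piece (\<omega> \<inter> {- real n..real n}) f x" for n
    unfolding piece_def using \<omega> by (intro fconv_frequency nice_fun_of_test f) (auto intro: bounded_subset[OF bounded_closed_interval])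
  then show ?thesis unfolding freq_piece_def using limI[OF piece_tendsto[OF f \<omega>]] by simp
qed

text \<open>Splitting the indicator of \<open>[a, b]\<close> into two linear ramps; the second one becomes a ramp of the
  first kind after complex conjugation.\<close>

lemma piece_le_lop:
  assumes f: "nice_fun f" and ab: "a < b" and \<omega>: "{a<..<b} \<subseteq> \<omega>" "\<omega> \<subseteq> {a..b}"
  shows "cmod (piece \<omega> f x) \<le> cmod (lop a b f x) + cmod (lop (-b) (-a) (\<lambda>y. cnj (f y)) x)"
proof -
  note [measurable] = nice_fun_measurable[OF f]
  define h where "h = b - a"
  have h: "0 < h" using ab by (simp add: h_def)
  define E where "E \<xi> = cis (2 * pi * x * \<xi>) * ft f \<xi>" for \<xi>
  define g1 where "g1 \<xi> = indicator {a..b} \<xi> *\<^sub>R (complex_of_real ((b - \<xi>) / h) * E \<xi>)" for \<xi>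
  define g2 where "g2 \<xi> = indicator {a..b} \<xi> *\<^sub>R (complex_of_real ((\<xi> - a) / h) * E \<xi>)" for \<xi>
  define K where "K = (LINT y|lborel. cmod (f y))"
  have K: "cmod (E \<xi>) \<le> K" for \<xi> using cmod_ft_le[OF integrable_nice_fun[OF f]] by (simp add: E_def K_def norm_mult)
  have K0: "0 \<le> K" using K[of 0] norm_ge_zero order_trans by blast
  have [measurable]: "E \<in> borel_measurable borel" unfolding E_def by measurable
  have ramp: "cmod (complex_of_real t * E \<xi>) \<le> K" if "0 \<le> t" "t \<le> 1" for t \<xi>
    using mult_mono[OF that(2) K[of \<xi>]] that(1) K0 by (simp add: norm_mult)
  have i1: "integrable lborel g1" unfolding g1_def
    using h by (intro integrable_Icc_bounded[where C=K] ramp) (auto simp: h_def divide_simps)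
  have i2: "integrable lborel g2" unfolding g2_def
    using h by (intro integrable_Icc_bounded[where C=K] ramp) (auto simp: h_def divide_simps)
  have p1: "cis (2 * pi * a * x) * lop a b f x = (LINT \<xi>|lborel. g1 \<xi>)"
  proof -
    have "(LINT \<xi>|lborel. g1 \<xi>) = (LINT \<xi>|lborel. g1 (a + 1 * \<xi>))"
      using lborel_integral_real_affine[where c=1 and t=a and f=g1] by simp
    also have "(\<lambda>\<xi>. g1 (a + 1 * \<xi>)) = (\<lambda>\<xi>. cis (2 * pi * a * x) * (indicator {0..b-a} \<xi> *\<^sub>R (complex_of_real (1 - \<xi>/(b-a)) * cis (2 * pi * x * \<xi>) * ft f (a + \<xi>))))"
    proof
      fix \<xi>
      have "(b - (a + \<xi>)) / h = 1 - \<xi> / (b - a)" using h by (simp add: h_def field_simps)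
      moreover have "cis (2 * pi * x * (a + \<xi>)) = cis (2 * pi * a * x) * cis (2 * pi * x * \<xi>)" by (simp add: cis_mult algebra_simps)
      moreover have "indicator {a..b} (a + 1 * \<xi>) = (indicator {0..b-a} \<xi> :: real)" by (auto simp: indicator_def)
      ultimately show "g1 (a + 1 * \<xi>) = cis (2 * pi * a * x) * (indicator {0..b-a} \<xi> *\<^sub>R (complex_of_real (1 - \<xi>/(b-a)) * cis (2 * pi * x * \<xi>) * ft f (a + \<xi>)))"
        unfolding g1_def E_def scaleR_conv_of_real mult_1 by (simp only: mult_ac)
    qed
    finally show ?thesis unfolding lop_def by (simp only: integral_mult_right_zero)
  qed
  have ftc: "ft (\<lambda>y. cnj (f y)) \<tau> = cnj (ft f (- \<tau>))" for \<tau>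
    unfolding ft_def Bochner_Integration.integral_cnj[symmetric] by (simp add: cis_cnj)
  \<comment> \<open>Substituting \<open>b - \<xi>\<close> turns the ramp rising towards
    \<open>b\<close> into a falling one. The frequencies then run backwards from \<open>b\<close>,
    and conjugation restores the forward direction, at the price of the reflected interval
    \<open>[-b, -a]\<close> and the conjugate of \<open>f\<close>.\<close>
  have p2: "cis (2 * pi * b * x) * cnj (lop (-b) (-a) (\<lambda>y. cnj (f y)) x) = (LINT \<xi>|lborel. g2 \<xi>)"
  proof -
    have "(LINT \<xi>|lborel. g2 \<xi>) = (LINT \<xi>|lborel. g2 (b + (-1) * \<xi>))"
      using lborel_integral_real_affine[where c="-1" and t=b and f=g2] by simp
    also have "(\<lambda>\<xi>. g2 (b + (-1) * \<xi>)) = (\<lambda>\<xi>. cis (2 * pi * b * x) * cnj (indicator {0..-a-(-b)} \<xi> *\<^sub>R (complex_of_real (1 - \<xi>/(-a-(-b))) * cis (2 * pi * x * \<xi>) * ft (\<lambda>y. cnj (f y)) (-b + \<xi>))))"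
    proof
      fix \<xi>
      have "(b + (-1) * \<xi> - a) / h = 1 - \<xi>/(-a-(-b))" using h by (simp add: h_def field_simps)
      moreover have "cis (2 * pi * x * (b + (-1) * \<xi>)) = cis (2 * pi * b * x) * cnj (cis (2 * pi * x * \<xi>))"
        by (simp add: cis_cnj cis_mult algebra_simps)
      moreover have "ft f (b + (-1) * \<xi>) = cnj (ft (\<lambda>y. cnj (f y)) (-b + \<xi>))" by (simp add: ftc)
      moreover have "indicator {a..b} (b + (-1) * \<xi>) = (indicator {0..-a-(-b)} \<xi> :: real)" by (auto simp: indicator_def)
      ultimately show "g2 (b + (-1) * \<xi>) = cis (2 * pi * b * x) * cnj (indicator {0..-a-(-b)} \<xi> *\<^sub>R (complex_of_real (1 - \<xi>/(-a-(-b))) * cis (2 * pi * x * \<xi>) * ft (\<lambda>y. cnj (f y)) (-b + \<xi>)))"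
        unfolding g2_def E_def scaleR_conv_of_real complex_cnj_mult complex_cnj_complex_of_real by (simp only: mult_ac)
    qed
    finally show ?thesis unfolding lop_def
      by (simp only: integral_mult_right_zero Bochner_Integration.integral_cnj)
  qed
  have "piece \<omega> f x = (LINT \<xi>|lborel. g1 \<xi> + g2 \<xi>)"
    unfolding piece_def
  proof (rule integral_cong_AE)
    have "\<omega> = {a<..<b} \<union> (\<omega> \<inter> {a,b})" using \<omega> by fastforce
    moreover have "finite (\<omega> \<inter> {a,b})" by simp
    then have "\<omega> \<inter> {a,b} \<in> sets borel" by (rule borel_closed[OF finite_imp_closed])
    ultimately have [measurable]: "\<omega> \<in> sets borel" by (metis borel_open open_greaterThanLessThan sets.Un)
    show "(\<lambda>\<xi>. complex_of_real (indicator \<omega> \<xi>) * (cis (2 * pi * x * \<xi>) * ft f \<xi>)) \<in> borel_measurable lborel" by measurable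
    have "AE \<xi> in lborel. \<xi> \<noteq> a" "AE \<xi> in lborel. \<xi> \<noteq> b" by (rule AE_lborel_singleton)+
    then show "AE \<xi> in lborel. complex_of_real (indicator \<omega> \<xi>) * (cis (2 * pi * x * \<xi>) * ft f \<xi>) = g1 \<xi> + g2 \<xi>"
    proof eventually_elim
      case (elim \<xi>)
      then have "indicator \<omega> \<xi> = (indicator {a..b} \<xi> :: real)" using \<omega> by (auto simp: indicator_def)
      moreover have "(b - \<xi>) / h + (\<xi> - a) / h = 1" using h by (simp add: h_def add_divide_distrib[symmetric])
      then have "complex_of_real ((b - \<xi>) / h) * E \<xi> + complex_of_real ((\<xi> - a) / h) * E \<xi> = E \<xi>"
        by (metis distrib_right mult_1 of_real_1 of_real_add)
      ultimately show ?case unfolding g1_def g2_def E_def[symmetric] scaleR_conv_of_real by (simp only: distrib_left[symmetric])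
    qed
  qed (use i1 i2 in auto)
  also have "\<dots> = cis (2 * pi * a * x) * lop a b f x + cis (2 * pi * b * x) * cnj (lop (-b) (-a) (\<lambda>y. cnj (f y)) x)"
    using i1 i2 by (simp add: p1 p2)
  finally show ?thesis using norm_triangle_ineq[of "cis (2 * pi * a * x) * lop a b f x" "cis (2 * pi * b * x) * cnj (lop (-b) (-a) (\<lambda>y. cnj (f y)) x)"]
    by (simp add: norm_mult)
qed

section \<open>Extended powers and a normal form for weights\<close>

lemma epowr_ennreal: "0 \<le> t \<Longrightarrow> 0 < a \<Longrightarrow> ennreal t epowr a = ennreal (t powr a)"
  by (auto simp: epowr_def)

lemma epowr_mono:
  assumes "0 < a" "x \<le> y"
  shows "x epowr a \<le> y epowr a"
proof (cases "y = \<infinity>")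
  case True then show ?thesis using assms by (auto simp: epowr_def)
next
  case False
  then obtain s t where "x = ennreal s" "y = ennreal t" "0 \<le> s" "0 \<le> t" using assms(2)
    by (cases x; cases y) (auto simp: top_unique)
  then show ?thesis using assms by (auto simp: epowr_ennreal intro!: ennreal_leI powr_mono2)
qed

lemma epowr_epowr:
  assumes "0 < a" "0 < b"
  shows "(x epowr a) epowr b = x epowr (a * b)"
proof (cases "x = \<infinity>")
  case True
  have "\<not> a * b < 0" using assms by (simp add: not_less)
  with True show ?thesis using assms by (simp add: epowr_def)
next
  case False
  then obtain s where "x = ennreal s" "0 \<le> s" by (cases x) auto
  then show ?thesis using assms by (simp add: epowr_ennreal powr_powr)
qed

lemma epowr_one: "x epowr 1 = x"
  by (cases x) (auto simp: epowr_def)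

text \<open>Continuity from below of a positive power, obtained from monotonicity alone by moving
  the bound to the other side with the inverse power \<open>1/a\<close>.\<close>

lemma epowr_SUP_le:
  assumes a: "0 < a" and le: "\<And>n. f n epowr a \<le> s"
  shows "(SUP n. f n) epowr a \<le> s"
proof -
  have "f n \<le> s epowr (1/a)" for n
  proof -
    have "f n = (f n epowr a) epowr (1/a)" using a by (simp add: epowr_epowr epowr_one)
    also have "\<dots> \<le> s epowr (1/a)" using a le by (intro epowr_mono) auto
    finally show ?thesis .
  qed
  then have "(SUP n. f n) \<le> s epowr (1/a)" by (intro SUP_least) auto
  then have "(SUP n. f n) epowr a \<le> (s epowr (1/a)) epowr a" using a by (intro epowr_mono)
  also have "\<dots> = s" using a by (simp add: epowr_epowr epowr_one)
  finally show ?thesis .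
qed

text \<open>Positivity of \<open>\<mu>\<close> matters because of the convention
  \<open>0 * \<infinity> = 0\<close>: only with positive mass does a finite characteristic force the
  dual integral to be finite.\<close>

lemma Aq_const_interval:
  assumes q: "1 < q" and uv: "u < v" and A: "Aq_const q w = ennreal A" "0 \<le> A"
    and \<mu>: "(\<integral>\<^sup>+x\<in>{u..v}. ennreal (w x) \<partial>lborel) = ennreal \<mu>" "0 < \<mu>"
  obtains \<nu> where "0 \<le> \<nu>" "(\<integral>\<^sup>+x\<in>{u..v}. ennreal (w x) epowr (1 - conj_exponent q) \<partial>lborel) = ennreal \<nu>"
    "\<mu> * \<nu> powr (q - 1) \<le> A * (v - u) powr q"
proof -
  define S where "S = (\<integral>\<^sup>+x\<in>{u..v}. ennreal (w x) epowr (1 - conj_exponent q) \<partial>lborel)"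
  have em: "emeasure lebesgue {u..v} = ennreal (v - u)" using uv by simp
  have "average {u..v} (\<lambda>x. ennreal (w x)) * average {u..v} (\<lambda>x. ennreal (w x) epowr (1 - conj_exponent q)) epowr (q - 1) \<le> Aq_const q w"
    unfolding Aq_const_def using uv by (intro SUP_upper) (auto simp: em is_interval_cc)
  then have le: "ennreal \<mu> / ennreal (v - u) * (S / ennreal (v - u)) epowr (q - 1) \<le> ennreal A"
    unfolding average_def nn_integral_completion em S_def[symmetric] \<mu>(1) A(1) .
  have "ennreal \<mu> / ennreal (v - u) = ennreal (\<mu> / (v - u))" using \<mu>(2) uv by (simp add: divide_ennreal)
  note le = le[unfolded this]
  have "S \<noteq> \<infinity>"
  proof
    assume "S = \<infinity>"
    then have "(S / ennreal (v - u)) epowr (q - 1) = \<infinity>" using uv q by (simp add: ennreal_top_divide epowr_def)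
    then show False using le \<mu>(2) uv by (simp add: ennreal_mult_top top_unique)
  qed
  then obtain \<nu> where \<nu>: "S = ennreal \<nu>" "0 \<le> \<nu>" by (cases S) auto
  have "(S / ennreal (v - u)) epowr (q - 1) = ennreal ((\<nu> / (v - u)) powr (q - 1))"
    using \<nu> uv q by (simp add: divide_ennreal epowr_ennreal)
  then have "ennreal (\<mu> / (v - u)) * ennreal ((\<nu> / (v - u)) powr (q - 1)) \<le> ennreal A"
    using le by simp
  then have "ennreal (\<mu> / (v - u) * (\<nu> / (v - u)) powr (q - 1)) \<le> ennreal A"
    by (subst ennreal_mult) (use \<mu>(2) uv in auto)
  then have "\<mu> / (v - u) * (\<nu> / (v - u)) powr (q - 1) \<le> A" using A(2) by (simp add: ennreal_le_iff)
  then have "(\<mu> / (v - u) * (\<nu> / (v - u)) powr (q - 1)) * (v - u) powr q \<le> A * (v - u) powr q"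
    by (intro mult_right_mono) auto
  also have "(\<mu> / (v - u) * (\<nu> / (v - u)) powr (q - 1)) * (v - u) powr q = \<mu> * \<nu> powr (q - 1)"
  proof -
    have "(v - u) powr q = (v - u) * (v - u) powr (q - 1)" using powr_add[of "v - u" 1 "q - 1"] uv by simp
    then show ?thesis using uv \<nu>(2) by (simp add: powr_divide)
  qed
  finally show ?thesis using that[OF \<nu>(2)] \<nu>(1) S_def by simp
qed

text \<open>Replaces the weight by an everywhere positive Borel function equal to it almost
  everywhere, so that real powers can be used. On large intervals the weight has positive mass,
  hence its dual power is integrable there and in particular finite almost everywhere, which
  confines the zeros to a null set. From then on the \<open>A_q\<close> inequality holds in real
  numbers on every interval.\<close>

lemma weight_normal_form:
  assumes q: "1 < q" and w: "w \<in> A_class q" and nz: "\<not> (AE x in lborel. w x = 0)"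
  obtains w' A where "w' \<in> borel_measurable borel" "\<And>x. 0 < w' x" "AE x in lborel. w x = w' x"
    "0 < A" "Aq_const q w = ennreal A"
    "\<And>u v. u < v \<Longrightarrow> (\<exists>\<mu> \<nu>. 0 \<le> \<mu> \<and> 0 \<le> \<nu> \<and> (\<integral>\<^sup>+x\<in>{u..v}. ennreal (w' x) \<partial>lborel) = ennreal \<mu> \<and>
        (\<integral>\<^sup>+x\<in>{u..v}. ennreal (w' x powr (-1/(q-1))) \<partial>lborel) = ennreal \<nu> \<and>
        \<mu> * \<nu> powr (q-1) \<le> A * (v - u) powr q)"
proof -
  have w0: "0 \<le> w x" for x using w by (simp add: A_class_def is_weight_def)
  have wint: "w absolutely_integrable_on {a..b}" for a b using w by (simp add: A_class_def is_weight_def)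
  obtain A where A: "Aq_const q w = ennreal A" "0 \<le> A"
    using w unfolding A_class_def by (cases "Aq_const q w") auto
  have fin: "(\<integral>\<^sup>+x\<in>{a..b}. ennreal (w x) \<partial>lborel) < \<infinity>" for a b
  proof -
    have "integrable lebesgue (\<lambda>x. indicator {a..b} x *\<^sub>R w x)" using wint by (simp add: set_integrable_def)
    then have "(\<integral>\<^sup>+x. ennreal (norm (indicator {a..b} x *\<^sub>R w x)) \<partial>lebesgue) < \<infinity>" by (simp add: integrable_iff_bounded)
    also have "(\<integral>\<^sup>+x. ennreal (norm (indicator {a..b} x *\<^sub>R w x)) \<partial>lebesgue) = (\<integral>\<^sup>+x\<in>{a..b}. ennreal (w x) \<partial>lborel)"
      unfolding nn_integral_completion using w0 by (intro nn_integral_cong) (auto simp: indicator_def)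
    finally show ?thesis .
  qed
  have wmeas: "w \<in> borel_measurable lebesgue"
  proof -
    have "(\<lambda>x. indicator {- real n..real n} x *\<^sub>R w x) \<in> borel_measurable lebesgue" for n
      using wint[of "- real n" "real n"] by (auto simp: set_integrable_def dest: borel_measurable_integrable)
    moreover have "(\<lambda>n. indicator {- real n..real n} x *\<^sub>R w x) \<longlonglongrightarrow> w x" for x
    proof -
      obtain N :: nat where N: "\<bar>x\<bar> \<le> real N" using real_arch_simple by blast
      have "\<forall>\<^sub>F n in sequentially. indicator {- real n..real n} x *\<^sub>R w x = w x"
        using eventually_ge_at_top[of N]
      proof eventually_elim
        case (elim n)
        then have "x \<in> {- real n..real n}" using N by auto
        then show ?case by simp
      qed
      then show ?thesis by (rule tendsto_eventually)
    qed
    ultimately show ?thesis by (rule borel_measurable_LIMSEQ_metric)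
  qed
  then obtain w1 where w1: "w1 \<in> borel_measurable lborel" "AE x in lborel. w x = w1 x"
    using completion_ex_borel_measurable_real by blast
  then have [measurable]: "w1 \<in> borel_measurable borel" by simp
  define I where "I n = (\<integral>\<^sup>+x\<in>{- real n..real n}. ennreal (w x) \<partial>lborel)" for n
  have Ieq: "I n = (\<integral>\<^sup>+x\<in>{- real n..real n}. ennreal (w1 x) \<partial>lborel)" for n
    unfolding I_def using w1(2) by (intro nn_integral_cong_AE) (auto elim: eventually_mono)
  have "\<exists>n. 0 < I n"
  proof (rule ccontr)
    assume "\<not> ?thesis"
    then have "I n = 0" for n by simp
    then have "AE x in lborel. ennreal (w1 x) * indicator {- real n..real n} x = 0" for n
      using Ieq[of n] by (subst nn_integral_0_iff_AE[symmetric]) auto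
    then have "AE x in lborel. \<forall>n. ennreal (w1 x) * indicator {- real n..real n} x = 0"
      by (intro AE_all_countable[THEN iffD2] allI)
    with w1(2) have "AE x in lborel. w x = 0"
    proof eventually_elim
      case (elim x)
      obtain N :: nat where N: "\<bar>x\<bar> \<le> real N" using real_arch_simple by blast
      then have "x \<in> {- real N..real N}" by auto
      with elim(2)[rule_format, of N] have "ennreal (w1 x) = 0" by simp
      then show ?case using elim(1) w0[of x] by (simp add: ennreal_eq_0_iff)
    qed
    with nz show False by simp
  qed
  then obtain n0 where n0: "0 < I n0" by blast
  have Ipos: "0 < I n" if "n0 \<le> n" for n
  proof -
    have "I n0 \<le> I n" unfolding I_def using that by (intro nn_integral_mono) (auto simp: indicator_def)
    then show ?thesis using n0 by simp
  qed
  have ce: "1 - conj_exponent q = -1/(q-1)" "1 - conj_exponent q < 0"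
    using q by (auto simp: conj_exponent_def field_simps)
  \<comment> \<open>A zero of \<open>w1\<close> makes the dual power infinite, so integrability of
    the latter leaves only a null set of zeros in the interval. Starting at \<open>n0\<close>
    guarantees positive mass, and the \<open>+ 1\<close> makes the interval nondegenerate.\<close>
  have "AE x in lborel. x \<in> {- real (n0+n+1)..real (n0+n+1)} \<longrightarrow> w1 x \<noteq> 0" for n
  proof -
    define N where "N = n0 + n + 1"
    obtain \<mu> where \<mu>: "I N = ennreal \<mu>" "0 < \<mu>"
      using Ipos[of N] fin[of "- real N" "real N"] unfolding I_def N_def by (cases "I N") (auto simp: I_def N_def)
    obtain \<nu> where \<nu>: "(\<integral>\<^sup>+x\<in>{- real N..real N}. ennreal (w x) epowr (1 - conj_exponent q) \<partial>lborel) = ennreal \<nu>"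
      by (rule Aq_const_interval[OF q _ A \<mu>[unfolded I_def]]) (auto simp: N_def)
    have "(\<integral>\<^sup>+x\<in>{- real N..real N}. ennreal (w x) epowr (1 - conj_exponent q) \<partial>lborel)
      = (\<integral>\<^sup>+x\<in>{- real N..real N}. ennreal (w1 x) epowr (1 - conj_exponent q) \<partial>lborel)"
      using w1(2) by (intro nn_integral_cong_AE) (auto elim: eventually_mono)
    then have "(\<integral>\<^sup>+x\<in>{- real N..real N}. ennreal (w1 x) epowr (1 - conj_exponent q) \<partial>lborel) \<noteq> \<infinity>"
      using \<nu> by (metis ennreal_neq_top infinity_ennreal_def)
    then have "AE x in lborel. ennreal (w1 x) epowr (1 - conj_exponent q) * indicator {- real N..real N} x \<noteq> \<infinity>"
      by (intro nn_integral_PInf_AE) (auto simp: epowr_def)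
    then show ?thesis unfolding N_def[symmetric]
      by eventually_elim (use ce(2) in \<open>auto simp: epowr_def\<close>)
  qed
  then have "AE x in lborel. \<forall>n. x \<in> {- real (n0+n+1)..real (n0+n+1)} \<longrightarrow> w1 x \<noteq> 0"
    by (intro AE_all_countable[THEN iffD2] allI)
  then have w1nz: "AE x in lborel. w1 x \<noteq> 0"
  proof eventually_elim
    case (elim x)
    obtain N :: nat where N: "\<bar>x\<bar> \<le> real N" using real_arch_simple by blast
    then have "x \<in> {- real (n0+N+1)..real (n0+N+1)}" by auto
    then show ?case using elim by blast
  qed
  define w' where "w' x = (if 0 < w1 x then w1 x else 1)" for x
  have [measurable]: "w' \<in> borel_measurable borel" unfolding w'_def by measurable
  have w'0: "0 < w' x" for x by (simp add: w'_def)
  have ww': "AE x in lborel. w x = w' x"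
    using w1(2) w1nz
  proof eventually_elim
    case (elim x)
    then show ?case using w0[of x] by (auto simp: w'_def)
  qed
  have ap: "\<exists>\<mu> \<nu>. 0 < \<mu> \<and> 0 < \<nu> \<and> (\<integral>\<^sup>+x\<in>{u..v}. ennreal (w' x) \<partial>lborel) = ennreal \<mu> \<and>
        (\<integral>\<^sup>+x\<in>{u..v}. ennreal (w' x powr (-1/(q-1))) \<partial>lborel) = ennreal \<nu> \<and>
        \<mu> * \<nu> powr (q-1) \<le> A * (v - u) powr q" if uv: "u < v" for u v
  proof -
    have pos: "0 < (\<integral>\<^sup>+x\<in>{u..v}. ennreal (g x) \<partial>lborel)" if [measurable]: "g \<in> borel_measurable borel" and g0: "\<And>x. 0 < g x" for g :: "real \<Rightarrow> real"
    proof (rule ccontr)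
      assume "\<not> ?thesis"
      then have "AE x in lborel. ennreal (g x) * indicator {u..v} x = 0"
        by (subst nn_integral_0_iff_AE[symmetric]) auto
      then have "AE x in lborel. x \<notin> {u..v}"
      proof eventually_elim
        case (elim x)
        moreover have "ennreal (g x) \<noteq> 0" using g0[of x] by (simp add: ennreal_eq_0_iff not_le)
        ultimately show ?case by (auto simp: indicator_def split: if_splits)
      qed
      then have "emeasure lborel {u..v} = 0" by (subst (asm) AE_iff_measurable[of "{u..v}"]) auto
      then show False using uv by simp
    qed
    have e1: "(\<integral>\<^sup>+x\<in>{u..v}. ennreal (w x) \<partial>lborel) = (\<integral>\<^sup>+x\<in>{u..v}. ennreal (w' x) \<partial>lborel)"
      using ww' by (intro nn_integral_cong_AE) (auto elim: eventually_mono)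
    have e2: "(\<integral>\<^sup>+x\<in>{u..v}. ennreal (w x) epowr (1 - conj_exponent q) \<partial>lborel) = (\<integral>\<^sup>+x\<in>{u..v}. ennreal (w' x powr (-1/(q-1))) \<partial>lborel)"
    proof (rule nn_integral_cong_AE)
      show "AE x in lborel. ennreal (w x) epowr (1 - conj_exponent q) * indicator {u..v} x = ennreal (w' x powr (-1/(q-1))) * indicator {u..v} x"
        using ww'
      proof eventually_elim
        case (elim x)
        have "ennreal (w' x) epowr (1 - conj_exponent q) = ennreal (w' x powr (-1/(q-1)))"
          unfolding ce(1)[symmetric] using w'0[of x] ce(2) by (simp add: epowr_def ennreal_eq_0_iff not_le less_imp_le)
        then show ?case using elim by simp
      qed
    qed
    obtain \<mu> where \<mu>: "(\<integral>\<^sup>+x\<in>{u..v}. ennreal (w x) \<partial>lborel) = ennreal \<mu>" "0 < \<mu>"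
      using pos[of w'] w'0 fin[of u v] unfolding e1 by (cases "\<integral>\<^sup>+x\<in>{u..v}. ennreal (w' x) \<partial>lborel") auto
    obtain \<nu> where \<nu>: "0 \<le> \<nu>" "(\<integral>\<^sup>+x\<in>{u..v}. ennreal (w x) epowr (1 - conj_exponent q) \<partial>lborel) = ennreal \<nu>"
      "\<mu> * \<nu> powr (q - 1) \<le> A * (v - u) powr q"
      by (rule Aq_const_interval[OF q uv A \<mu>]) (rule that; assumption)
    have "0 < w' x powr (-1/(q-1))" for x using w'0[of x] by simp
    then have "0 < ennreal \<nu>" using pos[of "\<lambda>x. w' x powr (-1/(q-1))"] \<nu>(2) unfolding e2 by auto
    then show ?thesis using \<mu> \<nu> e1 e2 by (intro exI[of _ \<mu>] exI[of _ \<nu>]) auto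
  qed
  have "0 < A"
  proof -
    obtain \<mu> \<nu> where m: "0 < \<mu>" "0 < \<nu>" "\<mu> * \<nu> powr (q-1) \<le> A * (1 - 0) powr q" using ap[of 0 1] by auto
    have "0 < \<mu> * \<nu> powr (q-1)" using m by (intro mult_pos_pos) auto
    also have "\<dots> \<le> A" using m(3) by simp
    finally show ?thesis .
  qed
  show ?thesis
  proof (rule that[OF _ w'0 ww' \<open>0 < A\<close> A(1)])
    show "w' \<in> borel_measurable borel" by measurable
    show "\<exists>\<mu> \<nu>. 0 \<le> \<mu> \<and> 0 \<le> \<nu> \<and> (\<integral>\<^sup>+x\<in>{u..v}. ennreal (w' x) \<partial>lborel) = ennreal \<mu> \<and>
        (\<integral>\<^sup>+x\<in>{u..v}. ennreal (w' x powr (-1/(q-1))) \<partial>lborel) = ennreal \<nu> \<and>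
        \<mu> * \<nu> powr (q-1) \<le> A * (v - u) powr q" if "u < v" for u v
      using ap[OF that] by (meson less_imp_le)
  qed
qed

section \<open>From finite bounded families to the square function\<close>

definition fsq :: "int set \<Rightarrow> (int \<Rightarrow> real set) \<Rightarrow> (real \<Rightarrow> complex) \<Rightarrow> real \<Rightarrow> real" where
  "fsq K \<Omega> f x = (\<Sum>k\<in>K. (cmod (piece (\<Omega> k) f x))\<^sup>2)"

lemma fsq_nonneg: "0 \<le> fsq K \<Omega> f x" by (simp add: fsq_def sum_nonneg)

lemma fsq_measurable [measurable]:
  assumes [measurable]: "f \<in> borel_measurable borel" and \<Omega>: "\<And>k. k \<in> K \<Longrightarrow> \<Omega> k \<in> sets borel"
  shows "fsq K \<Omega> f \<in> borel_measurable borel"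
  unfolding fsq_def
proof (rule borel_measurable_sum)
  fix k assume k: "k \<in> K"
  note [measurable] = \<Omega>[OF k]
  show "(\<lambda>x. (cmod (piece (\<Omega> k) f x))\<^sup>2) \<in> borel_measurable borel" by measurable
qed

lemma bounded_interval_cases:
  fixes \<omega> :: "real set"
  assumes "is_interval \<omega>" "bounded \<omega>"
  obtains (thin) c where "\<omega> \<subseteq> {c}" | (fat) a b where "a < b" "{a<..<b} \<subseteq> \<omega>" "\<omega> \<subseteq> {a..b}"
proof (cases "\<omega> = {}")
  case True then show ?thesis by (intro thin[of 0]) auto
next
  case False
  define a b where "a = Inf \<omega>" and "b = Sup \<omega>"
  have bb: "bdd_below \<omega>" "bdd_above \<omega>" using assms(2) bounded_imp_bdd_below bounded_imp_bdd_above by auto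
  have sub: "\<omega> \<subseteq> {a..b}" using bb by (auto simp: a_def b_def intro: cInf_lower cSup_upper)
  show ?thesis
  proof (cases "a < b")
    case True
    have "{a<..<b} \<subseteq> \<omega>"
    proof
      fix x assume x: "x \<in> {a<..<b}"
      obtain y where y: "y \<in> \<omega>" "y < x" using x False bb by (auto simp: a_def cInf_less_iff)
      obtain z where z: "z \<in> \<omega>" "x < z" using x False bb by (auto simp: b_def less_cSup_iff)
      show "x \<in> \<omega>" by (rule mem_is_interval_1_I[OF assms(1) y(1) z(1)]) (use y z in auto)
    qed
    then show ?thesis using sub True by (intro fat[of a b]) auto
  next
    case False
    then have "\<omega> \<subseteq> {a}" using sub by force
    then show ?thesis by (rule thin)
  qed
qed

lemma piece_thin:
  assumes "\<omega> \<subseteq> {c}"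
  shows "piece \<omega> f x = 0"
proof -
  have "(LINT \<xi>|lborel. complex_of_real (indicator \<omega> \<xi>) * (cis (2 * pi * x * \<xi>) * ft f \<xi>)) = (LINT \<xi>|lborel. indicator {c} \<xi> *\<^sub>R (complex_of_real (indicator \<omega> c) * (cis (2 * pi * x * c) * ft f c)))"
    using assms by (intro Bochner_Integration.integral_cong refl) (auto simp: indicator_def)
  also have "\<dots> = 0" by simp
  finally show ?thesis by (simp add: piece_def)
qed

text \<open>Intervals of at most one point contribute nothing and are discarded; the others are
  given genuine endpoints. The two ramps of each piece form two families, and the second consists of
  the reflected intervals acting on the conjugate of \<open>f\<close>, so the same weighted bound
  will serve both.\<close>

lemma finite_square_function_le:
  assumes fin: "finite K" and \<Omega>: "\<And>k. k \<in> K \<Longrightarrow> is_interval (\<Omega> k)" "\<And>k. k \<in> K \<Longrightarrow> bounded (\<Omega> k)" and f: "nice_fun f"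
    and ov: "\<And>\<xi>. (\<Sum>k\<in>K. indicator (\<Omega> k) \<xi>) \<le> (B::real)"
  obtains K' :: "int set" and a b :: "int \<Rightarrow> real" where "finite K'" "\<And>k. k \<in> K' \<Longrightarrow> a k < b k" "\<And>\<xi>. (\<Sum>k\<in>K'. indicator {a k<..<b k} \<xi>) \<le> B"
    "\<And>x. sqrt (fsq K \<Omega> f x) \<le> lsq K' a b f x + lsq K' (\<lambda>k. - b k) (\<lambda>k. - a k) (\<lambda>y. cnj (f y)) x"
proof -
  define K' where "K' = {k\<in>K. \<exists>a b. a < b \<and> {a<..<b} \<subseteq> \<Omega> k \<and> \<Omega> k \<subseteq> {a..b}}"
  have "\<forall>k\<in>K'. \<exists>ab. fst ab < snd ab \<and> {fst ab<..<snd ab} \<subseteq> \<Omega> k \<and> \<Omega> k \<subseteq> {fst ab..snd ab}"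
    unfolding K'_def by auto
  from bchoice[OF this] obtain ab where ab: "\<forall>k\<in>K'. fst (ab k) < snd (ab k) \<and> {fst (ab k)<..<snd (ab k)} \<subseteq> \<Omega> k \<and> \<Omega> k \<subseteq> {fst (ab k)..snd (ab k)}" by blast
  define a b where "a k = fst (ab k)" and "b k = snd (ab k)" for k
  have ab: "a k < b k" "{a k<..<b k} \<subseteq> \<Omega> k" "\<Omega> k \<subseteq> {a k..b k}" if "k \<in> K'" for k
    using ab that by (auto simp: a_def b_def)
  have K'K: "K' \<subseteq> K" "finite K'" using fin by (auto simp: K'_def)
  show ?thesis
  proof (rule that[OF K'K(2) ab(1)])
    fix \<xi>
    have "(\<Sum>k\<in>K'. indicator {a k<..<b k} \<xi> :: real) \<le> (\<Sum>k\<in>K'. indicator (\<Omega> k) \<xi>)"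
      by (intro sum_mono indicator_leI) (use ab(2) in blast)
    also have "\<dots> \<le> (\<Sum>k\<in>K. indicator (\<Omega> k) \<xi>)" using K'K fin by (intro sum_mono2) auto
    also have "\<dots> \<le> B" by (rule ov)
    finally show "(\<Sum>k\<in>K'. indicator {a k<..<b k} \<xi>) \<le> B" .
  next
    fix x
    have "fsq K \<Omega> f x = fsq K' \<Omega> f x"
      unfolding fsq_def
    proof (rule sum.mono_neutral_right[OF fin K'K(1)], rule ballI)
      fix k assume k: "k \<in> K - K'"
      then have "is_interval (\<Omega> k)" "bounded (\<Omega> k)" using \<Omega> by auto
      then show "(cmod (piece (\<Omega> k) f x))\<^sup>2 = 0"
      proof (cases rule: bounded_interval_cases)
        case (thin c) then show ?thesis by (simp add: piece_thin)
      next
        case (fat a b) then show ?thesis using k by (auto simp: K'_def)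
      qed
    qed
    then have "sqrt (fsq K \<Omega> f x) = L2_set (\<lambda>k. cmod (piece (\<Omega> k) f x)) K'" by (simp add: fsq_def L2_set_def)
    also have "\<dots> \<le> L2_set (\<lambda>k. cmod (lop (a k) (b k) f x) + cmod (lop (- b k) (- a k) (\<lambda>y. cnj (f y)) x)) K'"
      by (intro L2_set_mono piece_le_lop f ab) auto
    also have "\<dots> \<le> lsq K' a b f x + lsq K' (\<lambda>k. - b k) (\<lambda>k. - a k) (\<lambda>y. cnj (f y)) x"
      unfolding lsq_def by (rule L2_set_triangle_ineq)
    finally show "sqrt (fsq K \<Omega> f x) \<le> lsq K' a b f x + lsq K' (\<lambda>k. - b k) (\<lambda>k. - a k) (\<lambda>y. cnj (f y)) x" .
  qed
qed

lemma overlap_le_sum: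
  assumes ov: "overlap_le B \<Omega>" and "finite K"
  shows "(\<Sum>k\<in>K. indicator (\<Omega> k) \<xi>) \<le> max B 1"
proof -
  have "ennreal (\<Sum>k\<in>K. indicator (\<Omega> k) \<xi>) = (\<Sum>k\<in>K. indicator (\<Omega> k) \<xi>)"
    by (subst sum_ennreal[symmetric]) (auto simp: ennreal_indicator)
  also have "\<dots> \<le> (\<Sum>\<^sub>\<infinity>k\<in>UNIV. indicator (\<Omega> k) \<xi>)"
    by (subst nonneg_infsum_complete, simp, rule SUP_upper) (use assms(2) in auto)
  also have "\<dots> \<le> ennreal B" using ov unfolding overlap_le_def by blast
  also have "\<dots> \<le> ennreal (max B 1)" by (intro ennreal_leI) simp
  finally show ?thesis by (simp add: ennreal_le_iff)
qed

text \<open>The sum over all integers is a supremum over finite sets. The ranges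
  \<open>{- int N..int N}\<close> are cofinal among these, which gives an increasing sequence fit
  for monotone convergence.\<close>

lemma square_function_le_SUP:
  assumes p: "0 < p" and f: "test_function f" and \<Omega>: "\<And>k. is_interval (\<Omega> k)"
  shows "square_function \<Omega> f x epowr p \<le> (SUP N::nat. ennreal (fsq {- int N..int N} \<Omega> f x powr (p/2)))"
proof -
  define g where "g k = ennreal ((cmod (freq_piece (\<Omega> k) f x))\<^sup>2)" for k
  have bor: "\<Omega> k \<in> sets borel" for k by (rule real_interval_borel_measurable[OF \<Omega>])
  have part: "(\<Sum>k\<in>{- int N..int N}. g k) = ennreal (fsq {- int N..int N} \<Omega> f x)" for N
    unfolding g_def fsq_def freq_piece_eq_piece[OF f bor] by (intro sum_ennreal) auto
  have "(\<Sum>\<^sub>\<infinity>k\<in>UNIV. g k) = (SUP F\<in>{F. finite F \<and> F \<subseteq> UNIV}. sum g F)" by (rule nonneg_infsum_complete) simp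
  also have "\<dots> \<le> (SUP N::nat. ennreal (fsq {- int N..int N} \<Omega> f x))"
  proof (rule SUP_least)
    fix F :: "int set" assume F: "F \<in> {F. finite F \<and> F \<subseteq> UNIV}"
    obtain N :: nat where N: "F \<subseteq> {- int N..int N}"
    proof -
      have "finite ((\<lambda>k. nat \<bar>k\<bar>) ` F)" using F by simp
      then obtain N where "\<forall>n\<in>(\<lambda>k. nat \<bar>k\<bar>) ` F. n \<le> N" using finite_nat_set_iff_bounded_le by auto
      then have "F \<subseteq> {- int N..int N}" by force
      then show ?thesis by (rule that)
    qed
    have "sum g F \<le> sum g {- int N..int N}" using N by (intro sum_mono2) auto
    also have "\<dots> \<le> (SUP N::nat. ennreal (fsq {- int N..int N} \<Omega> f x))" unfolding part by (intro SUP_upper) auto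
    finally show "sum g F \<le> (SUP N::nat. ennreal (fsq {- int N..int N} \<Omega> f x))" .
  qed
  finally have le: "(\<Sum>\<^sub>\<infinity>k\<in>UNIV. g k) \<le> (SUP N::nat. ennreal (fsq {- int N..int N} \<Omega> f x))" .
  have "square_function \<Omega> f x epowr p = (\<Sum>\<^sub>\<infinity>k\<in>UNIV. g k) epowr (p/2)"
    using p by (simp add: square_function_def g_def epowr_epowr)
  also have "\<dots> \<le> (SUP N::nat. ennreal (fsq {- int N..int N} \<Omega> f x)) epowr (p/2)" using p le by (intro epowr_mono) auto
  also have "\<dots> \<le> (SUP N::nat. ennreal (fsq {- int N..int N} \<Omega> f x powr (p/2)))"
  proof (rule epowr_SUP_le)
    show "ennreal (fsq {- int n..int n} \<Omega> f x) epowr (p/2) \<le> (SUP N::nat. ennreal (fsq {- int N..int N} \<Omega> f x powr (p/2)))" for n :: nat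
      using p by (subst epowr_ennreal) (auto simp: fsq_nonneg intro!: SUP_upper)
  qed (use p in simp)
  finally show ?thesis .
qed

text \<open>The bound for finitely many bounded intervals carries a constant that depends on
  \<open>p\<close> and \<open>B\<close> only. It therefore survives first the removal of the
  frequency truncation, by Fatou's lemma, and then the growth of the index range, by monotone
  convergence.\<close>

theorem weighted_upper_bound:
  fixes p B :: real
  assumes p: "2 < p"
  shows "\<exists>C::real. \<forall>\<Omega>. interval_family \<Omega> \<longrightarrow> overlap_le B \<Omega> \<longrightarrow>
          (\<forall>w \<in> A_class (p / 2). op_norm p w (square_function \<Omega>) \<le> ennreal C * Aq_const (p / 2) w epowr (max (1 / (p - 2)) 1))"
proof -
  define q where "q = p / 2"
  have q: "1 < q" "p = 2 * q" using p by (auto simp: q_def)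
  \<comment> \<open>The sparse operator requires a positive overlap bound, while \<open>B\<close> is
    an arbitrary real number.\<close>
  define B' where "B' = max B 1"
  have B': "0 < B'" by (simp add: B'_def)
  define \<alpha> where "\<alpha> = max (1 / (p - 2)) 1"
  have \<alpha>: "0 < \<alpha>" by (simp add: \<alpha>_def)
  obtain C1 where C1: "0 \<le> C1" and W: "\<And>(K::int set) a b f (w::real\<Rightarrow>real) A.
     finite K \<Longrightarrow> (\<forall>k\<in>K. a k < b k) \<Longrightarrow> (\<forall>\<xi>. (\<Sum>k\<in>K. indicator {a k<..<b k} \<xi>) \<le> B') \<Longrightarrow> nice_fun f \<Longrightarrow>
     w \<in> borel_measurable borel \<Longrightarrow> (\<forall>x. 0 < w x) \<Longrightarrow>
     (\<forall>u v. u < v \<longrightarrow> (\<exists>\<mu> \<nu>. 0 \<le> \<mu> \<and> 0 \<le> \<nu> \<and> (\<integral>\<^sup>+x\<in>{u..v}. ennreal (w x) \<partial>lborel) = ennreal \<mu> \<and>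
        (\<integral>\<^sup>+x\<in>{u..v}. ennreal (w x powr (-1/(q-1))) \<partial>lborel) = ennreal \<nu> \<and>
        \<mu> * \<nu> powr (q-1) \<le> A * (v - u) powr q)) \<Longrightarrow>
     (\<integral>\<^sup>+x. ennreal (lsq K a b f x powr p) * ennreal (w x) \<partial>lborel)
       \<le> ennreal (C1 * A powr (p * \<alpha>)) * (\<integral>\<^sup>+x. ennreal (cmod (f x) powr p) * ennreal (w x) \<partial>lborel)"
    using weighted_lsq_bound[OF q B', where 'k=int] unfolding \<alpha>_def by blast
  define C2 where "C2 = 2 powr p * (2 * C1)"
  have C2: "0 \<le> C2" using C1 by (simp add: C2_def)
  define C where "C = C2 powr (1/p)"
  have main: "op_norm p w (square_function \<Omega>) \<le> ennreal C * Aq_const q w epowr \<alpha>"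
    if fam: "interval_family \<Omega>" and ov: "overlap_le B \<Omega>" and w: "w \<in> A_class q" for \<Omega> w
  \<comment> \<open>For the zero weight all norms vanish, so \<open>K = 0\<close> is admissible and
    the operator norm is 0.\<close>
  proof (cases "AE x in lborel. w x = 0")
    case True
    have z: "wnorm p w g = 0" for g
    proof -
      have "(\<integral>\<^sup>+x. g x epowr p * ennreal (w x) \<partial>lborel) = (\<integral>\<^sup>+x. 0 \<partial>(lborel::real measure))"
        using True by (intro nn_integral_cong_AE) (auto elim: eventually_mono)
      then show ?thesis unfolding wnorm_def nn_integral_completion using p by (simp add: epowr_def)
    qed
    have "op_norm p w (square_function \<Omega>) \<le> 0" unfolding op_norm_def by (rule Inf_lower) (simp add: z)
    then show ?thesis by simp
  next
    case False
    obtain w' A where w'[measurable]: "w' \<in> borel_measurable borel" and w'0: "\<And>x. 0 < w' x" and ww': "AE x in lborel. w x = w' x"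
      and A0: "0 < A" and A: "Aq_const q w = ennreal A"
      and Aq: "\<And>u v. u < v \<Longrightarrow> (\<exists>\<mu> \<nu>. 0 \<le> \<mu> \<and> 0 \<le> \<nu> \<and> (\<integral>\<^sup>+x\<in>{u..v}. ennreal (w' x) \<partial>lborel) = ennreal \<mu> \<and>
        (\<integral>\<^sup>+x\<in>{u..v}. ennreal (w' x powr (-1/(q-1))) \<partial>lborel) = ennreal \<nu> \<and>
        \<mu> * \<nu> powr (q-1) \<le> A * (v - u) powr q)"
      by (rule weight_normal_form[OF q(1) w False]) (rule that; assumption)
    have wn: "wnorm p w g = (\<integral>\<^sup>+x. g x epowr p * ennreal (w' x) \<partial>lborel) epowr (1/p)" for g
    proof -
      have "(\<integral>\<^sup>+x. g x epowr p * ennreal (w x) \<partial>lborel) = (\<integral>\<^sup>+x. g x epowr p * ennreal (w' x) \<partial>lborel)"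
        using ww' by (intro nn_integral_cong_AE) (auto elim: eventually_mono)
      then show ?thesis unfolding wnorm_def nn_integral_completion by simp
    qed
    have int: "is_interval (\<Omega> k)" for k using fam by (simp add: interval_family_def)
    have bor[measurable]: "\<Omega> k \<in> sets borel" for k by (rule real_interval_borel_measurable[OF int])
    have "wnorm p w (square_function \<Omega> f) \<le> ennreal C * Aq_const q w epowr \<alpha> * wnorm p w (\<lambda>x. ennreal (cmod (f x)))"
      if f: "test_function f" for f
    proof -
      have nf: "nice_fun f" by (rule nice_fun_of_test[OF f])
      note [measurable] = nice_fun_measurable[OF nf]
      define M where "M = (\<integral>\<^sup>+x. ennreal (cmod (f x) powr p) * ennreal (w' x) \<partial>lborel)"
      define Y where "Y = ennreal (C2 * A powr (p * \<alpha>)) * M"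
      have fin_bound: "(\<integral>\<^sup>+x. ennreal (fsq K \<Omega>' f x powr (p/2)) * ennreal (w' x) \<partial>lborel) \<le> Y"
        if K: "finite K" and \<Omega>': "\<And>k. is_interval (\<Omega>' k)" "\<And>k. bounded (\<Omega>' k)" "\<And>k. \<Omega>' k \<subseteq> \<Omega> k" for K \<Omega>'
      proof -
        have ov': "(\<Sum>k\<in>K. indicator (\<Omega>' k) \<xi>) \<le> B'" for \<xi>
        proof -
          have "(\<Sum>k\<in>K. indicator (\<Omega>' k) \<xi> :: real) \<le> (\<Sum>k\<in>K. indicator (\<Omega> k) \<xi>)"
            using \<Omega>'(3) by (intro sum_mono) (auto simp: indicator_def)
          also have "\<dots> \<le> B'" unfolding B'_def by (rule overlap_le_sum[OF ov K])
          finally show ?thesis .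
        qed
        obtain K' :: "int set" and a b :: "int \<Rightarrow> real" where K': "finite K'" "\<And>k. k \<in> K' \<Longrightarrow> a k < b k" "\<And>\<xi>. (\<Sum>k\<in>K'. indicator {a k<..<b k} \<xi>) \<le> B'"
          "\<And>x. sqrt (fsq K \<Omega>' f x) \<le> lsq K' a b f x + lsq K' (\<lambda>k. - b k) (\<lambda>k. - a k) (\<lambda>y. cnj (f y)) x"
          by (rule finite_square_function_le[OF K \<Omega>'(1,2) nf ov']) (rule that; assumption)
        have ncf: "nice_fun (\<lambda>y. cnj (f y))" by (rule nice_fun_cnj[OF nf])
        have K'': "(\<Sum>k\<in>K'. indicator {- b k<..<- a k} \<xi>) \<le> B'" for \<xi>
        proof -
          have "indicator {- b k<..<- a k} \<xi> = (indicator {a k<..<b k} (- \<xi>) :: real)" for k by (auto simp: indicator_def)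
          then show ?thesis using K'(3)[of "- \<xi>"] by simp
        qed
        define L1 where "L1 x = lsq K' a b f x" for x
        define L2 where "L2 x = lsq K' (\<lambda>k. - b k) (\<lambda>k. - a k) (\<lambda>y. cnj (f y)) x" for x
        have L0: "0 \<le> L1 x" "0 \<le> L2 x" for x by (simp_all add: L1_def L2_def lsq_def)
        have [measurable]: "L1 \<in> borel_measurable borel" "L2 \<in> borel_measurable borel"
          unfolding L1_def L2_def lsq_def L2_set_def by measurable
        have "(\<integral>\<^sup>+x. ennreal (fsq K \<Omega>' f x powr (p/2)) * ennreal (w' x) \<partial>lborel)
          \<le> (\<integral>\<^sup>+x. ennreal (2 powr p) * (ennreal (L1 x powr p) * ennreal (w' x) + ennreal (L2 x powr p) * ennreal (w' x)) \<partial>lborel)"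
        proof (intro nn_integral_mono)
          fix x
          have "fsq K \<Omega>' f x powr (p/2) = sqrt (fsq K \<Omega>' f x) powr p"
            using fsq_nonneg[of K \<Omega>' f x] by (simp add: powr_half_sqrt[symmetric] powr_powr)
          also have "\<dots> \<le> (2 * max (L1 x) (L2 x)) powr p"
            using K'(4)[of x] p fsq_nonneg[of K \<Omega>' f x] by (intro powr_mono2) (auto simp: L1_def L2_def)
          also have "\<dots> \<le> 2 powr p * (L1 x powr p + L2 x powr p)"
            using L0[of x] by (simp add: powr_mult max_def)
          finally have "ennreal (fsq K \<Omega>' f x powr (p/2)) \<le> ennreal (2 powr p * (L1 x powr p + L2 x powr p))" by (rule ennreal_leI)
          then have "ennreal (fsq K \<Omega>' f x powr (p/2)) * ennreal (w' x) \<le> ennreal (2 powr p * (L1 x powr p + L2 x powr p)) * ennreal (w' x)"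
            by (rule mult_right_mono) simp
          also have "\<dots> = ennreal (2 powr p) * (ennreal (L1 x powr p) * ennreal (w' x) + ennreal (L2 x powr p) * ennreal (w' x))"
            by (subst ennreal_mult) (auto simp: ennreal_plus distrib_right mult.assoc)
          finally show "ennreal (fsq K \<Omega>' f x powr (p/2)) * ennreal (w' x)
            \<le> ennreal (2 powr p) * (ennreal (L1 x powr p) * ennreal (w' x) + ennreal (L2 x powr p) * ennreal (w' x))" .
        qed
        also have "\<dots> = ennreal (2 powr p) * ((\<integral>\<^sup>+x. ennreal (L1 x powr p) * ennreal (w' x) \<partial>lborel) + (\<integral>\<^sup>+x. ennreal (L2 x powr p) * ennreal (w' x) \<partial>lborel))"
          by (subst nn_integral_cmult) (auto simp: nn_integral_add)
        also have "\<dots> \<le> ennreal (2 powr p) * (ennreal (C1 * A powr (p * \<alpha>)) * M + ennreal (C1 * A powr (p * \<alpha>)) * M)"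
        proof (intro mult_left_mono add_mono)
          show "(\<integral>\<^sup>+x. ennreal (L1 x powr p) * ennreal (w' x) \<partial>lborel) \<le> ennreal (C1 * A powr (p * \<alpha>)) * M"
            unfolding L1_def M_def using K' nf w' w'0 Aq by (intro W) auto
          have "(\<integral>\<^sup>+x. ennreal (L2 x powr p) * ennreal (w' x) \<partial>lborel)
            \<le> ennreal (C1 * A powr (p * \<alpha>)) * (\<integral>\<^sup>+x. ennreal (cmod (cnj (f x)) powr p) * ennreal (w' x) \<partial>lborel)"
            unfolding L2_def using K'(1,2) K'' ncf w' w'0 Aq by (intro W) auto
          then show "(\<integral>\<^sup>+x. ennreal (L2 x powr p) * ennreal (w' x) \<partial>lborel) \<le> ennreal (C1 * A powr (p * \<alpha>)) * M"
            by (simp add: M_def)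
        qed simp
        also have "\<dots> = Y"
        proof -
          have "ennreal (C2 * A powr (p * \<alpha>)) = ennreal (2 powr p) * (ennreal (C1 * A powr (p * \<alpha>)) + ennreal (C1 * A powr (p * \<alpha>)))"
            using C1 by (simp add: C2_def ennreal_mult[symmetric] ennreal_plus[symmetric] mult.assoc del: ennreal_plus)
          then show ?thesis by (simp add: Y_def distrib_right mult.assoc)
        qed
        finally show ?thesis .
      qed
      \<comment> \<open>Truncation to \<open>[-n, n]\<close> only shrinks the intervals, so the
        overlap bound and the constant are the same for every \<open>n\<close>.\<close>
      have NN: "(\<integral>\<^sup>+x. ennreal (fsq {- int N..int N} \<Omega> f x powr (p/2)) * ennreal (w' x) \<partial>lborel) \<le> Y" for N
      proof -
        define \<Omega>n where "\<Omega>n n k = \<Omega> k \<inter> {- real n..real n}" for n k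
        have [measurable]: "\<Omega>n n k \<in> sets borel" for n k unfolding \<Omega>n_def by measurable
        have "(\<integral>\<^sup>+x. ennreal (fsq {- int N..int N} \<Omega> f x powr (p/2)) * ennreal (w' x) \<partial>lborel)
          = (\<integral>\<^sup>+x. liminf (\<lambda>n. ennreal (fsq {- int N..int N} (\<Omega>n n) f x powr (p/2)) * ennreal (w' x)) \<partial>lborel)"
        proof (intro nn_integral_cong)
          fix x
          have "(\<lambda>n. fsq {- int N..int N} (\<Omega>n n) f x) \<longlonglongrightarrow> fsq {- int N..int N} \<Omega> f x"
            unfolding fsq_def \<Omega>n_def by (intro tendsto_sum tendsto_power tendsto_norm piece_tendsto f bor)
          then have "(\<lambda>n. fsq {- int N..int N} (\<Omega>n n) f x powr (p/2) * w' x) \<longlonglongrightarrow> fsq {- int N..int N} \<Omega> f x powr (p/2) * w' x"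
            using p by (intro tendsto_mult tendsto_const tendsto_powr') (auto simp: fsq_nonneg)
          then have "(\<lambda>n. ennreal (fsq {- int N..int N} (\<Omega>n n) f x powr (p/2) * w' x)) \<longlonglongrightarrow> ennreal (fsq {- int N..int N} \<Omega> f x powr (p/2) * w' x)"
            by (rule tendsto_ennrealI)
          then have "(\<lambda>n. ennreal (fsq {- int N..int N} (\<Omega>n n) f x powr (p/2)) * ennreal (w' x)) \<longlonglongrightarrow> ennreal (fsq {- int N..int N} \<Omega> f x powr (p/2)) * ennreal (w' x)"
            using w'0[of x] by (simp add: ennreal_mult less_imp_le)
          from lim_imp_Liminf[OF _ this]
          show "ennreal (fsq {- int N..int N} \<Omega> f x powr (p/2)) * ennreal (w' x) = liminf (\<lambda>n. ennreal (fsq {- int N..int N} (\<Omega>n n) f x powr (p/2)) * ennreal (w' x))"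
            by simp
        qed
        also have "\<dots> \<le> liminf (\<lambda>n. \<integral>\<^sup>+x. ennreal (fsq {- int N..int N} (\<Omega>n n) f x powr (p/2)) * ennreal (w' x) \<partial>lborel)"
          by (intro nn_integral_liminf) measurable
        also have "\<dots> \<le> liminf (\<lambda>n. Y)"
        proof (intro Liminf_mono always_eventually allI fin_bound)
          show "is_interval (\<Omega>n n k)" for n k unfolding \<Omega>n_def by (intro is_interval_Int int is_interval_cc)
          show "bounded (\<Omega>n n k)" for n k unfolding \<Omega>n_def by (rule bounded_subset[OF bounded_closed_interval]) auto
        qed (auto simp: \<Omega>n_def)
        also have "\<dots> = Y" by (rule Liminf_const) simp
        finally show ?thesis .
      qed
      have "(\<integral>\<^sup>+x. square_function \<Omega> f x epowr p * ennreal (w' x) \<partial>lborel)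
        \<le> (\<integral>\<^sup>+x. (SUP N::nat. ennreal (fsq {- int N..int N} \<Omega> f x powr (p/2)) * ennreal (w' x)) \<partial>lborel)"
      proof (intro nn_integral_mono)
        fix x
        have "square_function \<Omega> f x epowr p * ennreal (w' x) \<le> (SUP N::nat. ennreal (fsq {- int N..int N} \<Omega> f x powr (p/2))) * ennreal (w' x)"
          using p by (intro mult_right_mono square_function_le_SUP f int) auto
        also have "\<dots> = (SUP N::nat. ennreal (fsq {- int N..int N} \<Omega> f x powr (p/2)) * ennreal (w' x))"
          by (simp add: SUP_mult_right_ennreal)
        finally show "square_function \<Omega> f x epowr p * ennreal (w' x) \<le> (SUP N::nat. ennreal (fsq {- int N..int N} \<Omega> f x powr (p/2)) * ennreal (w' x))" .
      qed
      also have "\<dots> = (SUP N::nat. \<integral>\<^sup>+x. ennreal (fsq {- int N..int N} \<Omega> f x powr (p/2)) * ennreal (w' x) \<partial>lborel)"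
      proof (rule nn_integral_monotone_convergence_SUP)
        show "incseq (\<lambda>N x. ennreal (fsq {- int N..int N} \<Omega> f x powr (p/2)) * ennreal (w' x))"
          unfolding incseq_def le_fun_def
        proof (intro allI impI mult_right_mono ennreal_leI powr_mono2)
          fix m n :: nat and x assume "m \<le> n"
          then show "fsq {- int m..int m} \<Omega> f x \<le> fsq {- int n..int n} \<Omega> f x"
            unfolding fsq_def by (intro sum_mono2) auto
        qed (use p fsq_nonneg in auto)
      qed measurable
      also have "\<dots> \<le> Y" using NN by (intro SUP_least)
      finally have le: "(\<integral>\<^sup>+x. square_function \<Omega> f x epowr p * ennreal (w' x) \<partial>lborel) \<le> Y" .
      \<comment> \<open>Finiteness allows the passage to real numbers, where the power
        \<open>1/p\<close> is distributed over the product.\<close>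
      have Mfin: "M < \<infinity>"
      proof -
        obtain R where R: "0 \<le> R" "\<And>x. cmod (f x) \<le> R" "\<And>x. R < \<bar>x\<bar> \<Longrightarrow> f x = 0"
          by (rule nice_funE[OF nf]) (rule that; assumption)
        obtain \<mu> where \<mu>: "(\<integral>\<^sup>+x\<in>{-(R+1)..R+1}. ennreal (w' x) \<partial>lborel) = ennreal \<mu>"
          using Aq[of "-(R+1)" "R+1"] R(1) by auto
        have "M \<le> (\<integral>\<^sup>+x. ennreal (R powr p) * (ennreal (w' x) * indicator {-(R+1)..R+1} x) \<partial>lborel)"
          unfolding M_def
        proof (intro nn_integral_mono)
          fix x
          show "ennreal (cmod (f x) powr p) * ennreal (w' x) \<le> ennreal (R powr p) * (ennreal (w' x) * indicator {-(R+1)..R+1} x)"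
          proof (cases "R < \<bar>x\<bar>")
            case True then show ?thesis using R(3) p by simp
          next
            case False
            then have "x \<in> {-(R+1)..R+1}" by auto
            moreover have "cmod (f x) powr p \<le> R powr p" using R(2)[of x] p by (intro powr_mono2) auto
            ultimately show ?thesis by (simp add: mult_right_mono ennreal_leI)
          qed
        qed
        also have "\<dots> = ennreal (R powr p) * ennreal \<mu>" unfolding \<mu>[symmetric] by (rule nn_integral_cmult) measurable
        also have "\<dots> < \<infinity>" by (simp add: ennreal_mult_less_top)
        finally show ?thesis .
      qed
      then obtain m where m: "M = ennreal m" "0 \<le> m" by (cases M) auto
      have "wnorm p w (square_function \<Omega> f) \<le> Y epowr (1/p)"
        unfolding wn using p le by (intro epowr_mono) auto
      also have "Y = ennreal (C2 * A powr (p * \<alpha>) * m)" using C2 m by (simp add: Y_def ennreal_mult)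
      also have "\<dots> epowr (1/p) = ennreal ((C2 * A powr (p * \<alpha>) * m) powr (1/p))" using C2 m p by (intro epowr_ennreal) auto
      also have "(C2 * A powr (p * \<alpha>) * m) powr (1/p) = C * A powr \<alpha> * m powr (1/p)"
        using C2 m(2) p by (simp add: powr_mult powr_powr C_def)
      also have "ennreal \<dots> = ennreal C * (ennreal A epowr \<alpha>) * (ennreal m epowr (1/p))"
        using A0 \<alpha> m(2) p by (simp add: epowr_ennreal ennreal_mult C_def)
      also have "ennreal m epowr (1/p) = wnorm p w (\<lambda>x. ennreal (cmod (f x)))"
        unfolding wn m(1)[symmetric] M_def using p by (simp add: epowr_ennreal)
      finally show ?thesis by (simp add: A)
    qed
    then show ?thesis unfolding op_norm_def by (intro Inf_lower) auto
  qed
  show ?thesis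
    using main unfolding q_def \<alpha>_def by (intro exI[of _ C]) blast
qed

section \<open>Sharpness for power weights\<close>

text \<open>A smooth bump on \<open>(0, N)\<close>. Its derivatives stay in the linear span of the functions
  \<open>bump N a b\<close>, which gives all derivatives at once.\<close>

definition bump :: "real \<Rightarrow> nat \<Rightarrow> nat \<Rightarrow> real \<Rightarrow> real" where
  "bump N a b x = (if 0 < x \<and> x < N then exp (- 1/x - 1/(N - x)) / (x ^ a * (N - x) ^ b) else 0)"

inductive_set bump_span :: "real \<Rightarrow> (real \<Rightarrow> real) set" for N where
  base: "bump N a b \<in> bump_span N"
| add: "g \<in> bump_span N \<Longrightarrow> h \<in> bump_span N \<Longrightarrow> (\<lambda>x. g x + h x) \<in> bump_span N"
| scale: "g \<in> bump_span N \<Longrightarrow> (\<lambda>x. c * g x) \<in> bump_span N"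

text \<open>A single term of the exponential series at \<open>1/x\<close>.\<close>

lemma exp_neg_inverse_le:
  fixes x :: real
  assumes "0 < x"
  shows "exp (- 1/x) / x ^ n \<le> fact n"
proof -
  have s: "summable (\<lambda>k. (1/x) ^ k /\<^sub>R fact k)" by (rule summable_exp_generic)
  have "(\<Sum>k\<in>{n}. (1/x) ^ k /\<^sub>R fact k) \<le> (\<Sum>k. (1/x) ^ k /\<^sub>R fact k)"
    using assms by (intro sum_le_suminf s) auto
  then have "(1/x) ^ n / fact n \<le> exp (1/x)" by (simp add: exp_def divide_inverse mult.commute)
  then have "(1/x) ^ n \<le> exp (1/x) * fact n" by (simp only: pos_divide_le_eq[OF fact_gt_zero])
  then have "(1/x) ^ n * exp (- (1/x)) \<le> exp (1/x) * fact n * exp (- (1/x))" by (intro mult_right_mono) auto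
  also have "exp (1/x) * fact n * exp (- (1/x)) = fact n" by (simp add: exp_minus)
  finally show ?thesis by (simp add: power_divide)
qed

text \<open>Quadratic flatness at both ends of the support. The two spare powers come from applying
  \<open>exp_neg_inverse_le\<close> with exponent raised by 2, and they suffice to make the
  derivative vanish at \<open>0\<close> and at \<open>N\<close>.\<close>

lemma bump_bounds:
  "\<bar>bump N a b x\<bar> \<le> fact (a + 2) * fact b * x\<^sup>2"
  "\<bar>bump N a b x\<bar> \<le> fact a * fact (b + 2) * (x - N)\<^sup>2"
proof -
  have split: "bump N a b x = (exp (- 1/x) / x ^ a) * (exp (- 1/(N - x)) / (N - x) ^ b)" if "0 < x" "x < N"
    using that by (simp add: bump_def exp_add[symmetric])
  show "\<bar>bump N a b x\<bar> \<le> fact (a + 2) * fact b * x\<^sup>2"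
  proof (cases "0 < x \<and> x < N")
    case True
    have "exp (- 1/x) / x ^ a = exp (- 1/x) / x ^ (a + 2) * x\<^sup>2" using True by (simp add: power_add power2_eq_square)
    also have "\<dots> \<le> fact (a + 2) * x\<^sup>2" using True by (intro mult_right_mono exp_neg_inverse_le) auto
    finally have "(exp (- 1/x) / x ^ a) * (exp (- 1/(N - x)) / (N - x) ^ b) \<le> (fact (a + 2) * x\<^sup>2) * fact b"
      using True by (intro mult_mono exp_neg_inverse_le) auto
    moreover have "0 \<le> bump N a b x" using True by (simp add: bump_def)
    ultimately show ?thesis using split True by (simp add: mult_ac)
  qed (auto simp: bump_def)
  show "\<bar>bump N a b x\<bar> \<le> fact a * fact (b + 2) * (x - N)\<^sup>2"
  proof (cases "0 < x \<and> x < N")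
    case True
    have "exp (- 1/(N - x)) / (N - x) ^ b = exp (- 1/(N - x)) / (N - x) ^ (b + 2) * (N - x)\<^sup>2" using True by (simp add: power_add power2_eq_square)
    also have "\<dots> \<le> fact (b + 2) * (N - x)\<^sup>2" using True by (intro mult_right_mono exp_neg_inverse_le) auto
    finally have "(exp (- 1/x) / x ^ a) * (exp (- 1/(N - x)) / (N - x) ^ b) \<le> fact a * (fact (b + 2) * (N - x)\<^sup>2)"
      using True by (intro mult_mono exp_neg_inverse_le) auto
    moreover have "0 \<le> bump N a b x" using True by (simp add: bump_def)
    ultimately show ?thesis using split True by (simp add: mult_ac power2_commute)
  qed (auto simp: bump_def)
qed

lemma derivative_0_of_quadratic_bound:
  fixes g :: "real \<Rightarrow> real"
  assumes "\<And>y. \<bar>g y\<bar> \<le> K * (y - x)\<^sup>2"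
  shows "(g has_real_derivative 0) (at x)"
proof -
  have g0: "g x = 0" using assms[of x] by simp
  have "((\<lambda>h. (g (x + h) - g x) / h) \<longlongrightarrow> 0) (at 0)"
  proof (rule Lim_null_comparison)
    show "\<forall>\<^sub>F h in at 0. norm ((g (x + h) - g x) / h) \<le> K * \<bar>h\<bar>"
    proof (rule eventually_at_filter[THEN iffD2], intro always_eventually allI impI)
      fix h :: real assume h: "h \<noteq> 0"
      have "\<bar>g (x + h)\<bar> \<le> K * h\<^sup>2" using assms[of "x + h"] by simp
      then have "\<bar>g (x + h)\<bar> / \<bar>h\<bar> \<le> K * h\<^sup>2 / \<bar>h\<bar>" by (intro divide_right_mono) auto
      also have "\<dots> = K * \<bar>h\<bar>" using h by (simp add: power2_eq_square field_simps)
      finally show "norm ((g (x + h) - g x) / h) \<le> K * \<bar>h\<bar>" by (simp add: g0)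
    qed
    have "((\<lambda>h. K * \<bar>h\<bar>) \<longlongrightarrow> K * \<bar>0\<bar>) (at (0::real))" by (intro tendsto_intros)
    then show "((\<lambda>h. K * \<bar>h\<bar>) \<longlongrightarrow> 0) (at (0::real))" by simp
  qed
  then show ?thesis by (simp add: DERIV_def)
qed

lemma bump_derivative:
  "(bump N a b has_real_derivative bump N (a+2) b x + (-1) * bump N a (b+2) x + (- real a) * bump N (a+1) b x + real b * bump N a (b+1) x) (at x)"
proof -
  consider "x < 0 \<or> N < x" | "0 < x" "x < N" | "x = 0" | "x = N" by linarith
  then show ?thesis
  proof cases
    case 1
    have "open ({..<0} \<union> {N<..})" by auto
    then have "((\<lambda>_. 0) has_real_derivative 0) (at x) \<longleftrightarrow> (bump N a b has_real_derivative 0) (at x)"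
      using 1 by (intro DERIV_cong_ev eventually_nhds_in_open[THEN eventually_mono]) (auto simp: bump_def)
    then show ?thesis using 1 by (auto simp: bump_def)
  next
    case 2
    define y where "y = N - x"
    have y: "0 < y" using 2 by (simp add: y_def)
    define e where "e = exp (- 1/x - 1/(N - x))"
    have "((\<lambda>x. exp (- 1/x - 1/(N - x)) * (inverse x ^ a * inverse (N - x) ^ b)) has_real_derivative
      e * (1 / x\<^sup>2 - 1 / y\<^sup>2) * (inverse x ^ a * inverse y ^ b)
      + e * (real a * inverse x ^ (a - 1) * (- (1 / x\<^sup>2)) * inverse y ^ b + inverse x ^ a * (real b * inverse y ^ (b - 1) * (1 / y\<^sup>2)))) (at x)"
    proof -
      have d1: "((\<lambda>x. exp (- 1/x - 1/(N - x))) has_real_derivative e * (1 / x\<^sup>2 - 1 / y\<^sup>2)) (at x)"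
      proof -
        have "((\<lambda>x. - 1/x - 1/(N - x)) has_real_derivative (1 / x\<^sup>2 - 1 / y\<^sup>2)) (at x)"
          using 2 y unfolding y_def by (auto intro!: derivative_eq_intros simp: power2_eq_square)
        from DERIV_chain2[OF DERIV_exp this] show ?thesis by (simp add: e_def)
      qed
      have i1: "((\<lambda>x. inverse x) has_real_derivative (- (1 / x\<^sup>2))) (at x)"
        using 2 by (auto intro!: derivative_eq_intros simp: power2_eq_square divide_inverse)
      have i2: "((\<lambda>x. inverse (N - x)) has_real_derivative (1 / y\<^sup>2)) (at x)"
        using y unfolding y_def by (auto intro!: derivative_eq_intros simp: power2_eq_square divide_inverse)
      have d2: "((\<lambda>x. inverse x ^ a) has_real_derivative real a * inverse x ^ (a - 1) * (- (1 / x\<^sup>2))) (at x)"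
        using DERIV_power[OF i1, of a] by (simp add: mult_ac)
      have d3: "((\<lambda>x. inverse (N - x) ^ b) has_real_derivative real b * inverse y ^ (b - 1) * (1 / y\<^sup>2)) (at x)"
        using DERIV_power[OF i2, of b] by (simp add: y_def mult_ac)
      show ?thesis
        by (rule DERIV_cong[OF DERIV_mult[OF d1 DERIV_mult[OF d2 d3]]]) (simp add: e_def y_def algebra_simps)
    qed
    also have "e * (1 / x\<^sup>2 - 1 / y\<^sup>2) * (inverse x ^ a * inverse y ^ b)
      + e * (real a * inverse x ^ (a - 1) * (- (1 / x\<^sup>2)) * inverse y ^ b + inverse x ^ a * (real b * inverse y ^ (b - 1) * (1 / y\<^sup>2)))
      = bump N (a+2) b x + (-1) * bump N a (b+2) x + (- real a) * bump N (a+1) b x + real b * bump N a (b+1) x"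
    proof -
      have 1: "real a * inverse x ^ (a - 1) * (1 / x\<^sup>2) = real a * inverse x ^ (a + 1)"
        using 2 by (cases a) (auto simp: power2_eq_square field_simps)
      have 3: "real b * inverse y ^ (b - 1) * (1 / y\<^sup>2) = real b * inverse y ^ (b + 1)"
        using y by (cases b) (auto simp: power2_eq_square field_simps)
      have B: "bump N c d x = e * (inverse x ^ c * inverse y ^ d)" for c d
        using 2 by (simp add: bump_def e_def y_def divide_inverse power_inverse)
      have 4: "1 / x\<^sup>2 * inverse x ^ a = inverse x ^ (a + 2)" "1 / y\<^sup>2 * inverse y ^ b = inverse y ^ (b + 2)"
        by (simp_all add: power_add power2_eq_square divide_inverse)
      have "e * (1 / x\<^sup>2 - 1 / y\<^sup>2) * (inverse x ^ a * inverse y ^ b)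
        = e * (1 / x\<^sup>2 * inverse x ^ a * inverse y ^ b) - e * (inverse x ^ a * (1 / y\<^sup>2 * inverse y ^ b))"
        by (simp add: algebra_simps)
      moreover have "real a * inverse x ^ (a - 1) * (- (1 / x\<^sup>2)) * inverse y ^ b = - (real a * inverse x ^ (a + 1) * inverse y ^ b)"
        unfolding 1[symmetric] by simp
      ultimately show ?thesis unfolding B 3 4 by (simp add: algebra_simps)
    qed
    finally have D: "((\<lambda>x. exp (- 1/x - 1/(N - x)) * (inverse x ^ a * inverse (N - x) ^ b)) has_real_derivative
      bump N (a+2) b x + (-1) * bump N a (b+2) x + (- real a) * bump N (a+1) b x + real b * bump N a (b+1) x) (at x)" .
    have "\<forall>\<^sub>F z in nhds x. z \<in> {0<..<N}" using 2 by (intro eventually_nhds_in_open) auto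
    then have "\<forall>\<^sub>F z in nhds x. exp (- 1/z - 1/(N - z)) * (inverse z ^ a * inverse (N - z) ^ b) = bump N a b z"
      by eventually_elim (simp add: bump_def divide_inverse power_inverse)
    then show ?thesis using D by (subst (asm) DERIV_cong_ev[OF refl _ refl]) auto
  next
    case 3
    have "(bump N a b has_real_derivative 0) (at x)"
      by (rule derivative_0_of_quadratic_bound[where K="fact (a + 2) * fact b"]) (use bump_bounds(1) 3 in auto)
    then show ?thesis using 3 by (simp add: bump_def)
  next
    case 4
    have "(bump N a b has_real_derivative 0) (at x)"
      by (rule derivative_0_of_quadratic_bound[where K="fact a * fact (b + 2)"]) (use bump_bounds(2) 4 in auto)
    then show ?thesis using 4 by (simp add: bump_def)
  qed
qed

lemma bump_span_derivative:
  "g \<in> bump_span N \<Longrightarrow> \<exists>g'\<in>bump_span N. \<forall>x. (g has_real_derivative g' x) (at x)"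
proof (induction rule: bump_span.induct)
  case (base a b)
  show ?case
    by (intro bexI[of _ "\<lambda>x. bump N (a+2) b x + (-1) * bump N a (b+2) x + (- real a) * bump N (a+1) b x + real b * bump N a (b+1) x"]
        allI bump_derivative bump_span.intros)
next
  case (add g h)
  then obtain g' h' where "g' \<in> bump_span N" "h' \<in> bump_span N" "\<forall>x. (g has_real_derivative g' x) (at x)" "\<forall>x. (h has_real_derivative h' x) (at x)" by blast
  then show ?case by (intro bexI[of _ "\<lambda>x. g' x + h' x"]) (auto intro: DERIV_add bump_span.add)
next
  case (scale g c)
  then obtain g' where "g' \<in> bump_span N" "\<forall>x. (g has_real_derivative g' x) (at x)" by blast
  then show ?case by (intro bexI[of _ "\<lambda>x. c * g' x"]) (auto intro: DERIV_cmult bump_span.scale)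
qed

text \<open>A sequence of successive derivatives is chosen within the span, which is closed under
  differentiation.\<close>

lemma test_function_bump: "test_function (\<lambda>x. complex_of_real (bump N 0 0 x))"
proof -
  define P where "P g g' \<longleftrightarrow> g' \<in> bump_span N \<and> (\<forall>x. (g has_real_derivative g' x) (at x))" for g g'
  define next_fun where "next_fun g = (SOME g'. P g g')" for g
  have "P g (next_fun g)" if "g \<in> bump_span N" for g
  proof -
    have "\<exists>g'. P g g'" using bump_span_derivative[OF that] unfolding P_def by blast
    then show ?thesis unfolding next_fun_def by (rule someI_ex)
  qed
  then have nx: "next_fun g \<in> bump_span N \<and> (\<forall>x. (g has_real_derivative next_fun g x) (at x))" if "g \<in> bump_span N" for g
    using that unfolding P_def by blast
  define D where "D n = (next_fun ^^ n) (bump N 0 0)" for n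
  have Din: "D n \<in> bump_span N" for n
    by (induction n) (auto simp: D_def nx bump_span.base)
  have "(D n has_real_derivative D (Suc n) x) (at x)" for n x
    using nx[OF Din[of n]] by (simp add: D_def)
  then have "((\<lambda>x. complex_of_real (D n x)) has_vector_derivative complex_of_real (D (Suc n) x)) (at x)" for n x
    by (intro has_vector_derivative_of_real) (simp add: has_real_derivative_iff_has_vector_derivative)
  moreover have "(\<lambda>x. complex_of_real (D 0 x)) = (\<lambda>x. complex_of_real (bump N 0 0 x))" by (simp add: D_def)
  moreover have "bounded {x. complex_of_real (bump N 0 0 x) \<noteq> 0}"
    by (rule bounded_subset[of "{0..N}"]) (auto simp: bump_def split: if_splits)
  ultimately show ?thesis unfolding test_function_def
    by (intro conjI exI[of _ "\<lambda>n x. complex_of_real (D n x)"]) auto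
qed

section \<open>Power weights and their characteristic\<close>

text \<open>For \<open>1 \<le> \<bar>x\<bar> \<le> exp (1 / \<delta>)\<close> this differs from
  \<open>1 / \<bar>x\<bar>\<close> by a factor of at most \<open>exp 1\<close>. Up to that distance
  the weight therefore accumulates a mass of order \<open>1 / \<delta>\<close>, the same order as
  the logarithm that the kernel produces.\<close>

definition pw :: "real \<Rightarrow> real \<Rightarrow> real" where "pw \<delta> x = \<bar>x\<bar> powr (\<delta> - 1)"

lemma pw_measurable [measurable]: "pw \<delta> \<in> borel_measurable borel" unfolding pw_def[abs_def] by measurable

lemma pw_nonneg: "0 \<le> pw \<delta> x" by (simp add: pw_def)

lemma nn_integral_pw:
  assumes "0 < \<delta>" "0 \<le> m"
  shows "(\<integral>\<^sup>+x\<in>{0..m}. ennreal (pw \<delta> x) \<partial>lborel) = ennreal (m powr \<delta> / \<delta>)"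
    and "(\<integral>\<^sup>+x\<in>{-m..m}. ennreal (pw \<delta> x) \<partial>lborel) \<le> ennreal (2 * (m powr \<delta> / \<delta>))"
proof -
  show 1: "(\<integral>\<^sup>+x\<in>{0..m}. ennreal (pw \<delta> x) \<partial>lborel) = ennreal (m powr \<delta> / \<delta>)"
  proof -
    have "(\<integral>\<^sup>+x\<in>{0..m}. ennreal (pw \<delta> x) \<partial>lborel) = (\<integral>\<^sup>+x\<in>{0..m}. ennreal (x powr (\<delta> - 1)) \<partial>lborel)"
      by (intro nn_integral_cong) (auto simp: pw_def indicator_def)
    then show ?thesis using nn_integral_powr_from_0[of m "\<delta> - 1"] assms by simp
  qed
  have "(\<integral>\<^sup>+x\<in>{-m..m}. ennreal (pw \<delta> x) \<partial>lborel)
    \<le> (\<integral>\<^sup>+x. ennreal (pw \<delta> x) * indicator {0..m} x + ennreal (pw \<delta> (- x)) * indicator {0..m} (- x) \<partial>lborel)"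
    by (intro nn_integral_mono) (auto simp: indicator_def pw_def)
  also have "\<dots> = (\<integral>\<^sup>+x\<in>{0..m}. ennreal (pw \<delta> x) \<partial>lborel) + (\<integral>\<^sup>+x. ennreal (pw \<delta> (- x)) * indicator {0..m} (- x) \<partial>lborel)"
    by (rule nn_integral_add) measurable
  also have "(\<integral>\<^sup>+x. ennreal (pw \<delta> (- x)) * indicator {0..m} (- x) \<partial>lborel) = (\<integral>\<^sup>+x\<in>{0..m}. ennreal (pw \<delta> x) \<partial>lborel)"
    using nn_integral_real_affine[of "\<lambda>x. ennreal (pw \<delta> x) * indicator {0..m} x" "-1" 0] by simp
  finally have 2: "(\<integral>\<^sup>+x\<in>{-m..m}. ennreal (pw \<delta> x) \<partial>lborel) \<le> ennreal (m powr \<delta> / \<delta>) + ennreal (m powr \<delta> / \<delta>)"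
    by (simp only: 1)
  have "ennreal (m powr \<delta> / \<delta>) + ennreal (m powr \<delta> / \<delta>) = ennreal (2 * (m powr \<delta> / \<delta>))"
    using assms by (subst ennreal_plus[symmetric]) auto
  with 2 show "(\<integral>\<^sup>+x\<in>{-m..m}. ennreal (pw \<delta> x) \<partial>lborel) \<le> ennreal (2 * (m powr \<delta> / \<delta>))" by (simp only:)
qed

text \<open>Either the interval is long compared with its farthest point and may be replaced by the
  symmetric \<open>[-m, m]\<close>, or it stays at distance at least \<open>m/2\<close> from the
  origin, where the weight is comparable to \<open>m powr (\<delta> - 1)\<close>. Only the first
  case really produces the factor \<open>1 / \<delta>\<close>.\<close>

lemma pw_Q_bound:
  assumes \<delta>: "0 < \<delta>" "\<delta> < 1" and Q: "Q \<in> sets borel" "{a<..<b} \<subseteq> Q" "Q \<subseteq> {a..b}" "a < b" and m: "m = max \<bar>a\<bar> \<bar>b\<bar>"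
  shows "(\<integral>\<^sup>+x\<in>Q. ennreal (pw \<delta> x) \<partial>lborel) \<le> ennreal (4 / \<delta> * (b - a) * m powr (\<delta> - 1))"
proof (cases "m \<le> 2 * (b - a)")
  case True
  have m0: "0 < m" using Q(4) by (auto simp: m)
  have "(\<integral>\<^sup>+x\<in>Q. ennreal (pw \<delta> x) \<partial>lborel) \<le> (\<integral>\<^sup>+x\<in>{-m..m}. ennreal (pw \<delta> x) \<partial>lborel)"
  proof (intro nn_integral_mono)
    fix x
    have "x \<in> {-m..m}" if "x \<in> Q" using that Q(3) by (force simp: m)
    then show "ennreal (pw \<delta> x) * indicator Q x \<le> ennreal (pw \<delta> x) * indicator {-m..m} x" by (auto simp: indicator_def)
  qed
  also have "\<dots> \<le> ennreal (2 * (m powr \<delta> / \<delta>))" using nn_integral_pw(2)[of \<delta> m] \<delta> m0 by simp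
  also have "\<dots> \<le> ennreal (4 / \<delta> * (b - a) * m powr (\<delta> - 1))"
  proof (rule ennreal_leI)
    have "m powr \<delta> = m * m powr (\<delta> - 1)" using powr_add[of m 1 "\<delta> - 1"] m0 by simp
    also have "\<dots> \<le> 2 * (b - a) * m powr (\<delta> - 1)" using True by (intro mult_right_mono) auto
    finally have "2 / \<delta> * m powr \<delta> \<le> 2 / \<delta> * (2 * (b - a) * m powr (\<delta> - 1))" using \<delta> by (intro mult_left_mono) auto
    then show "2 * (m powr \<delta> / \<delta>) \<le> 4 / \<delta> * (b - a) * m powr (\<delta> - 1)" by (simp add: field_simps)
  qed
  finally show ?thesis .
next
  case False
  have m0: "0 < m" using Q(4) by (auto simp: m)
  have far: "m / 2 \<le> \<bar>x\<bar>" if "x \<in> Q" for x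
  proof -
    have x: "a \<le> x" "x \<le> b" using that Q(3) by auto
    show ?thesis
    proof (cases "\<bar>a\<bar> \<le> \<bar>b\<bar>")
      case True
      then have "m = \<bar>b\<bar>" by (simp add: m)
      moreover have "\<bar>b\<bar> \<le> \<bar>x\<bar> + (b - a)" using x by linarith
      ultimately show ?thesis using False by simp
    next
      case F: False
      then have "m = \<bar>a\<bar>" by (simp add: m)
      moreover have "\<bar>a\<bar> \<le> \<bar>x\<bar> + (b - a)" using x by linarith
      ultimately show ?thesis using False by simp
    qed
  qed
  have pw2: "pw \<delta> x \<le> 4 / \<delta> * m powr (\<delta> - 1)" if "x \<in> Q" for x
  proof -
    have "pw \<delta> x \<le> (m / 2) powr (\<delta> - 1)"
      unfolding pw_def using far[OF that] m0 \<delta> by (intro powr_mono2') auto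
    also have "\<dots> = 2 powr (1 - \<delta>) * m powr (\<delta> - 1)" using m0 by (simp add: powr_divide powr_diff)
    also have "\<dots> \<le> 4 / \<delta> * m powr (\<delta> - 1)"
    proof (intro mult_right_mono)
      have "2 powr (1 - \<delta>) \<le> 2 powr (1::real)" using \<delta> by (intro powr_mono) auto
      also have "\<dots> \<le> 4 / \<delta>" using \<delta> by (simp add: field_simps)
      finally show "2 powr (1 - \<delta>) \<le> 4 / \<delta>" .
    qed simp
    finally show ?thesis .
  qed
  have "(\<integral>\<^sup>+x\<in>Q. ennreal (pw \<delta> x) \<partial>lborel) \<le> (\<integral>\<^sup>+x. ennreal (4 / \<delta> * m powr (\<delta> - 1)) * indicator {a..b} x \<partial>lborel)"
  proof (intro nn_integral_mono)
    fix x show "ennreal (pw \<delta> x) * indicator Q x \<le> ennreal (4 / \<delta> * m powr (\<delta> - 1)) * indicator {a..b} x"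
      using pw2[of x] Q(3) by (cases "x \<in> Q") (auto intro!: ennreal_leI)
  qed
  also have "\<dots> = ennreal (4 / \<delta> * (b - a) * m powr (\<delta> - 1))"
  proof -
    have "(\<integral>\<^sup>+x. ennreal (4 / \<delta> * m powr (\<delta> - 1)) * indicator {a..b} x \<partial>lborel) = ennreal (4 / \<delta> * m powr (\<delta> - 1)) * ennreal (b - a)"
      using Q(4) by (subst nn_integral_cmult_indicator) auto
    also have "\<dots> = ennreal (4 / \<delta> * m powr (\<delta> - 1) * (b - a))" using Q(4) \<delta> by (subst ennreal_mult) auto
    finally show ?thesis by (simp only: mult_ac)
  qed
  finally show ?thesis .
qed

lemma finite_measure_interval_bounded:
  fixes Q :: "real set"
  assumes "is_interval Q" "emeasure lborel Q < \<infinity>"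
  shows "bounded Q"
proof (cases "Q = {}")
  case False
  then obtain x where x: "x \<in> Q" by auto
  obtain e where e: "emeasure lborel Q = ennreal e" "0 \<le> e" using assms(2) by (cases "emeasure lborel Q") auto
  have [measurable]: "Q \<in> sets borel" by (rule real_interval_borel_measurable[OF assms(1)])
  have "\<bar>y - x\<bar> \<le> e" if y: "y \<in> Q" for y
  proof -
    have "{min x y..max x y} \<subseteq> Q"
    proof
      fix z assume "z \<in> {min x y..max x y}"
      then show "z \<in> Q" using mem_is_interval_1_I[OF assms(1) x y, of z] mem_is_interval_1_I[OF assms(1) y x, of z]
        by (auto simp: min_def max_def split: if_splits)
    qed
    then have "emeasure lborel {min x y..max x y} \<le> emeasure lborel Q" by (intro emeasure_mono) auto
    then have "ennreal (max x y - min x y) \<le> ennreal e" using e by simp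
    then show ?thesis using e(2) by (simp add: ennreal_le_iff max_def min_def abs_if split: if_splits)
  qed
  then show ?thesis unfolding bounded_def by (intro exI[of _ x] exI[of _ e]) (auto simp: dist_real_def abs_minus_commute)
qed simp

lemma epowr_pos: "0 < s \<Longrightarrow> t \<noteq> 0 \<Longrightarrow> ennreal s epowr t = ennreal (s powr t)"
  by (simp add: epowr_def ennreal_eq_0_iff not_le less_imp_le)

lemma pw_dual:
  assumes q: "1 < q" and \<delta>: "\<delta> < 1" and x: "x \<noteq> 0"
  shows "ennreal (pw \<delta> x) epowr (1 - conj_exponent q) = ennreal (\<bar>x\<bar> powr ((1 - \<delta>) / (q - 1)))"
proof -
  have ce: "1 - conj_exponent q = -1/(q-1)" using q by (simp add: conj_exponent_def field_simps)
  have n: "-1/(q-1) \<noteq> 0" using q by simp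
  have e: "(\<delta> - 1) * (-1/(q-1)) = (1 - \<delta>) / (q - 1)" using q by (simp add: field_simps)
  have "pw \<delta> x powr (-1/(q-1)) = \<bar>x\<bar> powr ((\<delta> - 1) * (-1/(q-1)))" unfolding pw_def by (rule powr_powr)
  then have p: "pw \<delta> x powr (-1/(q-1)) = \<bar>x\<bar> powr ((1 - \<delta>) / (q - 1))" unfolding e .
  have "0 < pw \<delta> x" using x by (simp add: pw_def)
  from epowr_pos[OF this n] show ?thesis unfolding ce p .
qed

text \<open>The dual weight is a positive power of \<open>\<bar>x\<bar>\<close>, so its mean is at
  most its value at \<open>m\<close>. Raised to \<open>q - 1\<close> this is
  \<open>m powr (1 - \<delta>)\<close>, which cancels the power of \<open>m\<close> in the mean of
  the weight, so the bound does not depend on the interval.\<close>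

lemma Aq_pw_le:
  assumes q: "1 < q" and \<delta>: "0 < \<delta>" "\<delta> < 1"
  shows "Aq_const q (pw \<delta>) \<le> ennreal (4 / \<delta>)"
  unfolding Aq_const_def
proof (rule SUP_least)
  fix Q :: "real set" assume "Q \<in> {Q. is_interval Q \<and> 0 < emeasure lebesgue Q \<and> emeasure lebesgue Q < \<infinity>}"
  then have Q: "is_interval Q" "0 < emeasure lebesgue Q" "emeasure lebesgue Q < \<infinity>" by auto
  have [measurable]: "Q \<in> sets borel" by (rule real_interval_borel_measurable[OF Q(1)])
  have em: "emeasure lebesgue Q = emeasure lborel Q" by simp
  have "bounded Q" using Q by (intro finite_measure_interval_bounded) (auto simp: em)
  with Q(1) show "average Q (\<lambda>x. ennreal (pw \<delta> x)) * average Q (\<lambda>x. ennreal (pw \<delta> x) epowr (1 - conj_exponent q)) epowr (q - 1) \<le> ennreal (4 / \<delta>)"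
  proof (cases rule: bounded_interval_cases)
    case (thin c)
    then have "emeasure lborel Q \<le> emeasure lborel {c}" by (intro emeasure_mono) auto
    then show ?thesis using Q(2) em by simp
  next
    case (fat a b)
    define m where "m = max \<bar>a\<bar> \<bar>b\<bar>"
    have m0: "0 < m" using fat(1) by (auto simp: m_def)
    have "emeasure lborel Q = ennreal (b - a)"
    proof (rule antisym)
      have "emeasure lborel Q \<le> emeasure lborel {a..b}" using fat by (intro emeasure_mono) auto
      then show "emeasure lborel Q \<le> ennreal (b - a)" using fat(1) by simp
      have "emeasure lborel {a<..<b} \<le> emeasure lborel Q" using fat by (intro emeasure_mono) auto
      then show "ennreal (b - a) \<le> emeasure lborel Q" using fat(1) by simp
    qed
    note em = em[unfolded this]
    have ba: "0 < b - a" using fat by simp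
    have 1: "average Q (\<lambda>x. ennreal (pw \<delta> x)) \<le> ennreal (4 / \<delta> * m powr (\<delta> - 1))"
    proof -
      have "average Q (\<lambda>x. ennreal (pw \<delta> x)) \<le> ennreal (4 / \<delta> * (b - a) * m powr (\<delta> - 1)) / ennreal (b - a)"
        unfolding average_def nn_integral_completion em
        by (intro divide_right_mono_ennreal pw_Q_bound \<delta> fat m_def) measurable
      also have "\<dots> = ennreal (4 / \<delta> * (b - a) * m powr (\<delta> - 1) / (b - a))" using ba \<delta> by (intro divide_ennreal) auto
      also have "4 / \<delta> * (b - a) * m powr (\<delta> - 1) / (b - a) = 4 / \<delta> * m powr (\<delta> - 1)"
      proof -
        have "c * e * X / e = c * X" if "e \<noteq> 0" for c e X :: real using that by simp
        then show ?thesis using ba by (metis less_irrefl)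
      qed
      finally show ?thesis .
    qed
    define s where "s = (1 - \<delta>) / (q - 1)"
    have s0: "0 < s" using q \<delta> by (simp add: s_def)
    have "(\<integral>\<^sup>+x\<in>Q. ennreal (pw \<delta> x) epowr (1 - conj_exponent q) \<partial>lborel) \<le> (\<integral>\<^sup>+x. ennreal (m powr s) * indicator {a..b} x \<partial>lborel)"
    proof (rule nn_integral_mono_AE)
      have "AE x in lborel. x \<noteq> (0::real)" by (rule AE_lborel_singleton)
      then show "AE x in lborel. ennreal (pw \<delta> x) epowr (1 - conj_exponent q) * indicator Q x \<le> ennreal (m powr s) * indicator {a..b} x"
      proof eventually_elim
        case (elim x)
        show ?case
        proof (cases "x \<in> Q")
          case True
          then have "x \<in> {a..b}" using fat by auto
          then have "\<bar>x\<bar> \<le> m" by (auto simp: m_def)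
          then have "\<bar>x\<bar> powr s \<le> m powr s" using s0 by (intro powr_mono2) auto
          then show ?thesis using True \<open>x \<in> {a..b}\<close> by (simp add: pw_dual[OF q \<delta>(2) elim] s_def[symmetric] ennreal_leI)
        qed simp
      qed
    qed
    also have "\<dots> = ennreal (m powr s * (b - a))" using ba by (simp add: nn_integral_cmult_indicator ennreal_mult)
    finally have "average Q (\<lambda>x. ennreal (pw \<delta> x) epowr (1 - conj_exponent q)) \<le> ennreal (m powr s * (b - a)) / ennreal (b - a)"
      unfolding average_def nn_integral_completion em by (rule divide_right_mono_ennreal)
    also have "\<dots> = ennreal (m powr s)" using ba by (simp add: divide_ennreal)
    finally have "average Q (\<lambda>x. ennreal (pw \<delta> x) epowr (1 - conj_exponent q)) epowr (q - 1) \<le> ennreal (m powr s) epowr (q - 1)"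
      using q by (intro epowr_mono) auto
    also have "\<dots> = ennreal (m powr (1 - \<delta>))" using q by (simp add: epowr_ennreal powr_powr s_def)
    finally have 2: "average Q (\<lambda>x. ennreal (pw \<delta> x) epowr (1 - conj_exponent q)) epowr (q - 1) \<le> ennreal (m powr (1 - \<delta>))" .
    have "average Q (\<lambda>x. ennreal (pw \<delta> x)) * average Q (\<lambda>x. ennreal (pw \<delta> x) epowr (1 - conj_exponent q)) epowr (q - 1)
      \<le> ennreal (4 / \<delta> * m powr (\<delta> - 1)) * ennreal (m powr (1 - \<delta>))" by (intro mult_mono 1 2) auto
    also have "\<dots> = ennreal (4 / \<delta> * (m powr (\<delta> - 1) * m powr (1 - \<delta>)))" using \<delta> by (simp add: ennreal_mult[symmetric] mult.assoc)
    also have "m powr (\<delta> - 1) * m powr (1 - \<delta>) = 1" using m0 by (simp add: powr_add[symmetric])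
    finally show ?thesis by simp
  qed
qed

text \<open>Serves negative \<open>\<beta>\<close>, where bounding the power from above takes a
  lower bound for the characteristic. An interval away from the origin provides one uniformly in
  \<open>\<delta>\<close>.\<close>

lemma Aq_pw_ge:
  assumes q: "1 < q" and \<delta>: "0 < \<delta>" "\<delta> < 1"
  shows "ennreal (1/2) \<le> Aq_const q (pw \<delta>)"
proof -
  have em: "emeasure lebesgue {1..2::real} = 1" by simp
  have d1: "x / 1 = x" for x :: ennreal by (simp add: divide_ennreal_def)
  have a1: "ennreal (1/2) \<le> average {1..2} (\<lambda>x. ennreal (pw \<delta> x))"
  proof -
    have "ennreal (1/2) = (\<integral>\<^sup>+x. ennreal (1/2) * indicator {1..2::real} x \<partial>lborel)" by (subst nn_integral_cmult_indicator) auto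
    also have "\<dots> \<le> (\<integral>\<^sup>+x\<in>{1..2}. ennreal (pw \<delta> x) \<partial>lborel)"
    proof (intro nn_integral_mono)
      fix x :: real
      have "1/2 \<le> pw \<delta> x" if "x \<in> {1..2}"
      proof -
        have "(1/2::real) = 2 powr (-1)" by (simp add: powr_minus_divide)
        also have "\<dots> \<le> 2 powr (\<delta> - 1)" using \<delta> by (intro powr_mono) auto
        also have "\<dots> \<le> \<bar>x\<bar> powr (\<delta> - 1)" using that \<delta> by (intro powr_mono2') auto
        finally show ?thesis by (simp add: pw_def)
      qed
      then show "ennreal (1/2) * indicator {1..2} x \<le> ennreal (pw \<delta> x) * indicator {1..2} x"
        by (cases "x \<in> {1..2}") (use ennreal_leI[of "1/2" "pw \<delta> x"] in \<open>auto simp: indicator_def\<close>)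
    qed
    finally show ?thesis unfolding average_def nn_integral_completion em d1 .
  qed
  have a2: "1 \<le> average {1..2} (\<lambda>x. ennreal (pw \<delta> x) epowr (1 - conj_exponent q))"
  proof -
    have "1 = (\<integral>\<^sup>+x. ennreal 1 * indicator {1..2::real} x \<partial>lborel)" by (subst nn_integral_cmult_indicator) auto
    also have "\<dots> \<le> (\<integral>\<^sup>+x\<in>{1..2}. ennreal (pw \<delta> x) epowr (1 - conj_exponent q) \<partial>lborel)"
    proof (intro nn_integral_mono)
      fix x :: real
      have "ennreal 1 \<le> ennreal (pw \<delta> x) epowr (1 - conj_exponent q)" if "x \<in> {1..2}"
        using that q \<delta> by (subst pw_dual) (auto intro!: ennreal_leI ge_one_powr_ge_zero simp del: ennreal_1)
      then show "ennreal 1 * indicator {1..2} x \<le> ennreal (pw \<delta> x) epowr (1 - conj_exponent q) * indicator {1..2} x" by (auto simp: indicator_def)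
    qed
    finally show ?thesis unfolding average_def nn_integral_completion em d1 .
  qed
  have "1 = ennreal 1 epowr (q - 1)" using q by (subst epowr_ennreal) auto
  also have "\<dots> \<le> average {1..2} (\<lambda>x. ennreal (pw \<delta> x) epowr (1 - conj_exponent q)) epowr (q - 1)"
    using q a2 by (intro epowr_mono) auto
  finally have "ennreal (1/2) * 1 \<le> average {1..2} (\<lambda>x. ennreal (pw \<delta> x)) * average {1..2} (\<lambda>x. ennreal (pw \<delta> x) epowr (1 - conj_exponent q)) epowr (q - 1)"
    by (intro mult_mono a1) auto
  also have "\<dots> \<le> Aq_const q (pw \<delta>)" unfolding Aq_const_def by (intro SUP_upper) (auto simp: em is_interval_cc)
  finally show ?thesis by simp
qed

lemma pw_A_class:
  assumes q: "1 < q" and \<delta>: "0 < \<delta>" "\<delta> < 1"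
  shows "pw \<delta> \<in> A_class q"
proof -
  have "pw \<delta> absolutely_integrable_on {a..b}" for a b
    unfolding set_integrable_def
  proof (rule integrableI_bounded)
    show "(\<lambda>x. indicator {a..b} x *\<^sub>R pw \<delta> x) \<in> borel_measurable lebesgue" by (rule measurable_completion) measurable
    define m where "m = max \<bar>a\<bar> \<bar>b\<bar>"
    have "(\<integral>\<^sup>+x. ennreal (norm (indicator {a..b} x *\<^sub>R pw \<delta> x)) \<partial>lebesgue) \<le> (\<integral>\<^sup>+x\<in>{-m..m}. ennreal (pw \<delta> x) \<partial>lborel)"
      unfolding nn_integral_completion
    proof (intro nn_integral_mono)
      fix x
      have "x \<in> {-m..m}" if "x \<in> {a..b}" using that by (force simp: m_def)
      then show "ennreal (norm (indicator {a..b} x *\<^sub>R pw \<delta> x)) \<le> ennreal (pw \<delta> x) * indicator {-m..m} x"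
        by (auto simp: indicator_def pw_nonneg)
    qed
    also have "\<dots> \<le> ennreal (2 * (m powr \<delta> / \<delta>))" using \<delta> by (intro nn_integral_pw) (auto simp: m_def)
    also have "\<dots> < \<infinity>" by simp
    finally show "(\<integral>\<^sup>+x. ennreal (norm (indicator {a..b} x *\<^sub>R pw \<delta> x)) \<partial>lebesgue) < \<infinity>" .
  qed
  moreover have "Aq_const q (pw \<delta>) < \<infinity>" using Aq_pw_le[OF assms] by (simp add: le_less_trans)
  ultimately show ?thesis by (simp add: A_class_def is_weight_def pw_nonneg)
qed

section \<open>Logarithmic growth for the interval \<open>[0, 1]\<close>\<close>

text \<open>The imaginary part has the sign of \<open>u\<close>, so nothing cancels when it is
  convolved with a nonnegative function lying to the right of the point of evaluation.\<close>

lemma inv_fourier_unit: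
  "u \<noteq> 0 \<Longrightarrow> Im (inv_fourier (indicator {0..1}) u) = (1 - cos (2 * pi * u)) / (2 * pi * u)"
proof -
  assume u: "u \<noteq> 0"
  define v where "v = 2 * pi * u"
  have v0: "v \<noteq> 0" using u by (simp add: v_def)
  have "inv_fourier (indicator {0..1}) u = (LINT \<xi>|lborel. indicator {0..1} \<xi> *\<^sub>R cis (v * \<xi>))"
    unfolding inv_fourier_indicator v_def by (simp add: scaleR_conv_of_real)
  also have "\<dots> = cis (v * 1) * (1 / (\<i> * v)) - cis (v * 0) * (1 / (\<i> * v))"
  proof (rule integral_FTC_Icc_complex)
    show "((\<lambda>\<xi>. cis (v * \<xi>) * (1 / (\<i> * v))) has_vector_derivative cis (v * \<xi>)) (at \<xi>)" for \<xi>
    proof -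
      have "((\<lambda>\<xi>. cis (v * \<xi>) * (1 / (\<i> * v))) has_vector_derivative (\<i> * v * cis (v * \<xi>)) * (1 / (\<i> * v))) (at \<xi>)"
        by (intro has_vector_derivative_mult_left cis_has_vector_derivative)
      then show ?thesis using v0 by simp
    qed
    show "continuous_on {0..1} (\<lambda>\<xi>. cis (v * \<xi>))" by (intro continuous_intros)
  qed simp
  also have "\<dots> = - \<i> * (cis v - 1) / v" using v0 by (simp add: field_simps)
  finally have "Im (inv_fourier (indicator {0..1}) u) = (1 - cos v) / v" by (simp add: Im_divide_of_real diff_divide_distrib)
  then show ?thesis by (simp add: v_def[symmetric])
qed

text \<open>\<open>\<Psi>\<close> is an antiderivative of a minorant. Its term
  \<open>1 / (2 * pi * u)\<close> is added so that the derivative differs from the integrand by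
  \<open>(sin (2 * pi * u) - 1) / (2 * pi * u\<^sup>2)\<close>, which is never positive.\<close>

lemma oscillating_log:
  assumes u: "0 < u1" "u1 \<le> u2"
  shows "ennreal (ln (u2 / u1) - 1 / (pi * u1)) \<le> (\<integral>\<^sup>+u\<in>{u1..u2}. ennreal ((1 - cos (2 * pi * u)) / u) \<partial>lborel)"
proof -
  define \<Psi> where "\<Psi> u = ln u - sin (2 * pi * u) / (2 * pi * u) + 1 / (2 * pi * u)" for u
  define \<psi> where "\<psi> u = (1 - cos (2 * pi * u)) / u + (sin (2 * pi * u) - 1) / (2 * pi * u\<^sup>2)" for u
  have D: "(\<Psi> has_real_derivative \<psi> x) (at x)" if "0 < x" for x
    unfolding \<Psi>_def \<psi>_def using that
    by (auto intro!: derivative_eq_intros simp: field_simps power2_eq_square)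
  have c: "continuous_on {u1..u2} \<psi>" unfolding \<psi>_def using u by (intro continuous_intros) auto
  have c2: "continuous_on {u1..u2} (\<lambda>x. (1 - cos (2 * pi * x)) / x)" using u by (intro continuous_intros) auto
  have i2: "integrable lborel (\<lambda>x. indicator {u1..u2} x *\<^sub>R ((1 - cos (2 * pi * x)) / x))"
    by (rule borel_integrable_atLeastAtMost'[OF c2, unfolded set_integrable_def])
  have "(LINT x|lborel. indicator {u1..u2} x *\<^sub>R \<psi> x) = \<Psi> u2 - \<Psi> u1"
    by (rule integral_FTC_atLeastAtMost[OF u(2) _ c])
      (use u D in \<open>auto simp: has_real_derivative_iff_has_vector_derivative[symmetric] intro: has_field_derivative_at_within\<close>)
  then have "ennreal (\<Psi> u2 - \<Psi> u1) \<le> ennreal (LINT x|lborel. indicator {u1..u2} x *\<^sub>R ((1 - cos (2 * pi * x)) / x))"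
  proof -
    have "(LINT x|lborel. indicator {u1..u2} x *\<^sub>R \<psi> x) \<le> (LINT x|lborel. indicator {u1..u2} x *\<^sub>R ((1 - cos (2 * pi * x)) / x))"
    proof (rule Bochner_Integration.integral_mono)
      show "integrable lborel (\<lambda>x. indicator {u1..u2} x *\<^sub>R \<psi> x)"
        by (rule borel_integrable_atLeastAtMost'[OF c, unfolded set_integrable_def])
      show "integrable lborel (\<lambda>x. indicator {u1..u2} x *\<^sub>R ((1 - cos (2 * pi * x)) / x))" by (rule i2)
      show "indicator {u1..u2} x *\<^sub>R \<psi> x \<le> indicator {u1..u2} x *\<^sub>R ((1 - cos (2 * pi * x)) / x)" for x
      proof -
        have "(sin (2 * pi * x) - 1) / (2 * pi * x\<^sup>2) \<le> 0" by (intro divide_nonpos_nonneg) auto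
        then show ?thesis by (auto simp: \<psi>_def indicator_def)
      qed
    qed
    with \<open>(LINT x|lborel. indicator {u1..u2} x *\<^sub>R \<psi> x) = \<Psi> u2 - \<Psi> u1\<close> show ?thesis by (intro ennreal_leI) simp
  qed
  also have "\<dots> = (\<integral>\<^sup>+x. ennreal (indicator {u1..u2} x *\<^sub>R ((1 - cos (2 * pi * x)) / x)) \<partial>lborel)"
  proof (rule nn_integral_eq_integral[symmetric])
    show "integrable lborel (\<lambda>x. indicator {u1..u2} x *\<^sub>R ((1 - cos (2 * pi * x)) / x))" by (rule i2)
    show "AE x in lborel. 0 \<le> indicator {u1..u2} x *\<^sub>R ((1 - cos (2 * pi * x)) / x)"
      using u by (intro AE_I2) (auto simp: indicator_def)
  qed
  also have "\<dots> = (\<integral>\<^sup>+u\<in>{u1..u2}. ennreal ((1 - cos (2 * pi * u)) / u) \<partial>lborel)"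
    by (intro nn_integral_cong) (auto simp: indicator_def)
  finally have 1: "ennreal (\<Psi> u2 - \<Psi> u1) \<le> (\<integral>\<^sup>+u\<in>{u1..u2}. ennreal ((1 - cos (2 * pi * u)) / u) \<partial>lborel)" .
  have "ln (u2 / u1) - 1 / (pi * u1) \<le> \<Psi> u2 - \<Psi> u1"
  proof -
    have "sin (2 * pi * u2) / (2 * pi * u2) \<le> 1 / (2 * pi * u2)" using u by (intro divide_right_mono) auto
    moreover
    have "- 1 / (2 * pi * u1) \<le> sin (2 * pi * u1) / (2 * pi * u1)" using u by (intro divide_right_mono) auto
    then have "- (1 / (2 * pi * u1)) \<le> sin (2 * pi * u1) / (2 * pi * u1)" by (simp only: minus_divide_left)
    moreover have "1 / (pi * u1) = 1 / (2 * pi * u1) + 1 / (2 * pi * u1)" using u by (simp add: field_simps)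
    moreover have "ln (u2 / u1) = ln u2 - ln u1" using u by (simp add: ln_div)
    ultimately show ?thesis unfolding \<Psi>_def by linarith
  qed
  then show ?thesis by (rule order_trans[OF ennreal_leI 1])
qed

text \<open>The modulus is bounded below by minus the imaginary part, which is the integral of the
  nonnegative \<open>g\<close>. On \<open>[1, R]\<close> both reciprocals in the exponent of the
  bump are at most 1, hence the factor \<open>exp (-2)\<close>; the logarithm is that of the ratio
  of the distances from \<open>x\<close> to \<open>R\<close> and to 1.\<close>

lemma unit_piece_lower:
  assumes R: "1 \<le> R" and x: "x \<le> -1"
  shows "ennreal (exp (-2) / (2 * pi) * (ln ((R - x) / (1 - x)) - 1 / (pi * (1 - x))))
    \<le> ennreal (cmod (freq_piece {0..1} (\<lambda>x. complex_of_real (bump (R + 1) 0 0 x)) x))"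
proof -
  define f where "f y = bump (R + 1) 0 0 y" for y
  define F where "F y = complex_of_real (f y)" for y
  have F: "test_function F" unfolding F_def f_def by (rule test_function_bump)
  have nF: "nice_fun F" by (rule nice_fun_of_test[OF F])
  note [measurable] = nice_fun_measurable[OF nF]
  have "f = (\<lambda>y. Re (F y))" by (simp add: F_def)
  then have [measurable]: "f \<in> borel_measurable borel" by simp
  define k where "k z = inv_fourier (indicator {0..1}) z" for z
  have k_eq: "k z = (LINT \<xi>|lborel. complex_of_real (indicator {0..1} \<xi>) * cis (2 * pi * z * \<xi>))" for z
    unfolding k_def by (rule inv_fourier_indicator)
  have [measurable]: "k \<in> borel_measurable borel" unfolding k_eq[abs_def] by measurable
  have kb: "cmod (k z) \<le> 1" for z
  proof -
    have "cmod (k z) \<le> (LINT \<xi>|lborel. cmod (complex_of_real (indicator {0..1} \<xi>) * cis (2 * pi * z * \<xi>)))"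
      unfolding k_eq by (rule integral_norm_bound)
    also have "\<dots> = (LINT \<xi>|lborel. indicator {0..1::real} \<xi>)" by (intro Bochner_Integration.integral_cong refl) (simp add: norm_mult)
    also have "\<dots> = 1" by simp
    finally show ?thesis .
  qed
  have int: "integrable lborel (\<lambda>y. F y * k (x - y))"
    by (intro integrable_nice_fun nice_fun_mult[OF nF, where c=1] kb) measurable
  have fp: "freq_piece {0..1} F x = (LINT y|lborel. F y * k (x - y))"
  proof -
    have "freq_piece {0..1} F x = fconv F k x" unfolding k_def[abs_def] by (rule freq_piece_bounded) simp
    also have "\<dots> = (LINT y|lborel. F y * k (x - y))"
      unfolding fconv_def using lborel_integral_real_affine[where c="-1" and t=x and f="\<lambda>y. F (x - y) * k y"] by simp
    finally show ?thesis .
  qed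
  define g where "g y = f y * ((1 - cos (2 * pi * (y - x))) / (2 * pi * (y - x)))" for y
  have fsupp: "f y = 0" if "\<not> (0 < y \<and> y < R + 1)" for y using that by (auto simp: f_def bump_def)
  have f0: "0 \<le> f y" for y by (simp add: f_def bump_def)
  have g0: "0 \<le> g y" for y
  proof (cases "0 < y")
    case True then show ?thesis using x f0[of y] unfolding g_def by (intro mult_nonneg_nonneg divide_nonneg_nonneg) auto
  qed (simp add: g_def fsupp)
  have Img: "Im (F y * k (x - y)) = - g y" for y
  proof (cases "0 < y")
    case True
    then have "x - y \<noteq> 0" using x by simp
    then have "Im (k (x - y)) = (1 - cos (2 * pi * (x - y))) / (2 * pi * (x - y))" unfolding k_def by (rule inv_fourier_unit)
    also have "\<dots> = - ((1 - cos (2 * pi * (y - x))) / (2 * pi * (y - x)))"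
    proof -
      have "cos (2 * pi * (x - y)) = cos (2 * pi * (y - x))" by (metis cos_minus minus_diff_eq mult_minus_right)
      moreover have "2 * pi * (x - y) = - (2 * pi * (y - x))" by (simp add: algebra_simps)
      ultimately show ?thesis by (simp only: minus_divide_right)
    qed
    finally have "Im (k (x - y)) = - ((1 - cos (2 * pi * (y - x))) / (2 * pi * (y - x)))" .
    then show ?thesis unfolding g_def F_def by (simp only: Im_complex_of_real Re_complex_of_real times_complex.sel mult_zero_left add_0_right mult_minus_right)
  qed (simp add: g_def F_def fsupp)
  have intg: "integrable lborel g"
  proof -
    have "integrable lborel (\<lambda>y. Im (F y * k (x - y)))" by (rule integrable_Im[OF int])
    then show ?thesis unfolding Img by simp
  qed
  have "(\<integral>\<^sup>+y. ennreal (g y) \<partial>lborel) = ennreal (LINT y|lborel. g y)" by (rule nn_integral_eq_integral[OF intg]) (simp add: g0)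
  also have "(LINT y|lborel. g y) = - Im (freq_piece {0..1} F x)"
  proof -
    have "Im (freq_piece {0..1} F x) = (LINT y|lborel. Im (F y * k (x - y)))" unfolding fp by (rule integral_Im[OF int, symmetric])
    then show ?thesis unfolding Img by simp
  qed
  also have "ennreal \<dots> \<le> ennreal (cmod (freq_piece {0..1} F x))"
    by (intro ennreal_leI) (metis abs_Im_le_cmod abs_ge_minus_self order_trans)
  finally have up: "(\<integral>\<^sup>+y. ennreal (g y) \<partial>lborel) \<le> ennreal (cmod (freq_piece {0..1} F x))" .
  define h where "h u = ennreal ((1 - cos (2 * pi * u)) / u)" for u
  have [measurable]: "h \<in> borel_measurable borel" unfolding h_def by measurable
  define c where "c = exp (-2) / (2 * pi)"
  have c0: "0 \<le> c" by (simp add: c_def)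
  have "ennreal c * ennreal (ln ((R - x) / (1 - x)) - 1 / (pi * (1 - x))) \<le> ennreal c * (\<integral>\<^sup>+u\<in>{1 - x..R - x}. h u \<partial>lborel)"
    unfolding h_def using x R by (intro mult_left_mono oscillating_log) auto
  also have "(\<integral>\<^sup>+u\<in>{1 - x..R - x}. h u \<partial>lborel) = (\<integral>\<^sup>+y. h (y - x) * indicator {1..R} y \<partial>lborel)"
  proof -
    have "(\<integral>\<^sup>+u. h u * indicator {1 - x..R - x} u \<partial>lborel) = (\<integral>\<^sup>+y. h (- x + 1 * y) * indicator {1 - x..R - x} (- x + 1 * y) \<partial>lborel)"
      by (subst nn_integral_real_affine[where c=1 and t="-x"]) auto
    also have "\<dots> = (\<integral>\<^sup>+y. h (y - x) * indicator {1..R} y \<partial>lborel)"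
      by (intro nn_integral_cong) (auto simp: indicator_def)
    finally show ?thesis .
  qed
  also have "ennreal c * (\<integral>\<^sup>+y. h (y - x) * indicator {1..R} y \<partial>lborel) = (\<integral>\<^sup>+y. ennreal c * (h (y - x) * indicator {1..R} y) \<partial>lborel)"
    by (intro nn_integral_cmult[symmetric]) measurable
  also have "\<dots> \<le> (\<integral>\<^sup>+y. ennreal (g y) \<partial>lborel)"
  proof (intro nn_integral_mono)
    fix y
    show "ennreal c * (h (y - x) * indicator {1..R} y) \<le> ennreal (g y)"
    proof (cases "y \<in> {1..R}")
      case True
      define t where "t = (1 - cos (2 * pi * (y - x))) / (y - x)"
      have t0: "0 \<le> t" using True x by (simp add: t_def)
      have "exp (-2) \<le> f y"
      proof -
        have "1/y \<le> 1" "1/(R + 1 - y) \<le> 1" using True by (auto simp: field_simps)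
        then have "-2 \<le> - 1/y - 1/(R + 1 - y)" by (simp add: minus_divide_left[symmetric])
        then have "exp (-2) \<le> exp (- 1/y - 1/(R + 1 - y))" by (simp only: exp_le_cancel_iff)
        then show ?thesis using True by (simp add: f_def bump_def)
      qed
      then have "exp (-2) * t \<le> f y * t" using t0 by (rule mult_right_mono)
      then have "exp (-2) * t / (2 * pi) \<le> f y * t / (2 * pi)" by (rule divide_right_mono) simp
      moreover have "g y = f y * t / (2 * pi)" by (simp add: g_def t_def)
      ultimately have "c * t \<le> g y" by (simp add: c_def)
      then show ?thesis using True c0 t0 by (simp add: h_def t_def[symmetric] ennreal_mult[symmetric] ennreal_leI)
    qed simp
  qed
  also note up
  finally have "ennreal c * ennreal (ln ((R - x) / (1 - x)) - 1 / (pi * (1 - x))) \<le> ennreal (cmod (freq_piece {0..1} F x))" .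
  then show ?thesis using c0 by (simp add: ennreal_mult' c_def[symmetric] F_def[abs_def] f_def[abs_def])
qed

section \<open>Norms of the extremal example and the contradiction\<close>

text \<open>The remaining indices carry the empty interval, whose piece vanishes, so the square
  function reduces to one modulus.\<close>

definition unit_family :: "int \<Rightarrow> real set" where
  "unit_family k = (if k = 0 then {0..1} else {})"

lemma interval_family_unit: "interval_family unit_family"
  by (auto simp: interval_family_def unit_family_def is_interval_cc)

lemma infsum_singleton_support:
  fixes g :: "int \<Rightarrow> ennreal"
  assumes "\<And>k. k \<noteq> 0 \<Longrightarrow> g k = 0"
  shows "(\<Sum>\<^sub>\<infinity>k\<in>UNIV. g k) = g 0"
proof -
  have "(\<Sum>\<^sub>\<infinity>k\<in>UNIV. g k) = (\<Sum>\<^sub>\<infinity>k\<in>{0}. g k)"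
    using assms by (intro infsum_cong_neutral) auto
  then show ?thesis by simp
qed

lemma overlap_le_unit:
  assumes "1 \<le> B" shows "overlap_le B unit_family"
  unfolding overlap_le_def
proof
  fix x
  have "(\<Sum>\<^sub>\<infinity>k\<in>UNIV. indicator (unit_family k) x :: ennreal) = indicator (unit_family 0) x"
    by (rule infsum_singleton_support) (simp add: unit_family_def)
  also have "\<dots> \<le> 1" by (simp add: indicator_def)
  also have "\<dots> \<le> ennreal B" using ennreal_leI[OF assms] by simp
  finally show "(\<Sum>\<^sub>\<infinity>k\<in>UNIV. indicator (unit_family k) x :: ennreal) \<le> ennreal B" .
qed

lemma square_function_unit:
  "square_function unit_family f x = ennreal (cmod (freq_piece {0..1} f x))"
proof -
  have "freq_piece {} f x = 0"
    by (subst freq_piece_bounded) (simp_all add: inv_fourier_def fconv_def)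
  then have "(\<Sum>\<^sub>\<infinity>k\<in>UNIV. ennreal ((cmod (freq_piece (unit_family k) f x))\<^sup>2)) = ennreal ((cmod (freq_piece {0..1} f x))\<^sup>2)"
    by (subst infsum_singleton_support) (simp_all add: unit_family_def)
  then show ?thesis unfolding square_function_def
    by (simp add: epowr_ennreal powr_half_sqrt)
qed

lemma op_norm_lower:
  assumes f: "test_function f" and r: "0 < r" "wnorm p w (\<lambda>x. ennreal (cmod (f x))) \<le> ennreal r"
    and n: "ennreal n \<le> wnorm p w (T f)"
  shows "ennreal (n / r) \<le> op_norm p w T"
  unfolding op_norm_def
proof (rule Inf_greatest)
  fix K assume "K \<in> {K. \<forall>f. test_function f \<longrightarrow> wnorm p w (T f) \<le> K * wnorm p w (\<lambda>x. ennreal (cmod (f x)))}"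
  then have "wnorm p w (T f) \<le> K * wnorm p w (\<lambda>x. ennreal (cmod (f x)))" using f by blast
  also have "\<dots> \<le> K * ennreal r" using r(2) by (rule mult_left_mono) simp
  finally have "ennreal n \<le> K * ennreal r" using n by (rule order_trans[rotated])
  then show "ennreal (n / r) \<le> K"
  proof (cases K)
    case (real k)
    with \<open>ennreal n \<le> K * ennreal r\<close> r(1) have "ennreal n \<le> ennreal (k * r)" by (simp add: ennreal_mult)
    then have "n \<le> k * r" using real r(1) by (simp add: ennreal_le_iff)
    then have "n / r \<le> k" using r(1) by (simp add: pos_divide_le_eq)
    then show ?thesis using real by (simp add: ennreal_leI)
  qed simp
qed

lemma nn_integral_pw_left:
  assumes "0 < \<delta>" "1 \<le> s"
  shows "ennreal ((s powr \<delta> - 1) / \<delta>) \<le> (\<integral>\<^sup>+x\<in>{-s..-1}. ennreal (pw \<delta> x) \<partial>lborel)"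
proof -
  define I where "I = (\<integral>\<^sup>+x\<in>{-s..-1}. ennreal (pw \<delta> x) \<partial>lborel)"
  have I: "I = (\<integral>\<^sup>+x\<in>{1..s}. ennreal (pw \<delta> x) \<partial>lborel)"
  proof -
    have "I = (\<integral>\<^sup>+x. ennreal (pw \<delta> (-x)) * indicator {-s..-1} (-x) \<partial>lborel)"
      unfolding I_def using nn_integral_real_affine[of "\<lambda>x. ennreal (pw \<delta> x) * indicator {-s..-1} x" "-1" 0] by simp
    also have "\<dots> = (\<integral>\<^sup>+x\<in>{1..s}. ennreal (pw \<delta> x) \<partial>lborel)"
      by (intro nn_integral_cong) (auto simp: pw_def indicator_def)
    finally show ?thesis .
  qed
  have "ennreal (s powr \<delta> / \<delta>) = (\<integral>\<^sup>+x\<in>{0..s}. ennreal (pw \<delta> x) \<partial>lborel)"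
    using assms by (simp add: nn_integral_pw)
  also have "\<dots> \<le> (\<integral>\<^sup>+x. ennreal (pw \<delta> x) * indicator {0..1} x + ennreal (pw \<delta> x) * indicator {1..s} x \<partial>lborel)"
    by (intro nn_integral_mono) (auto simp: indicator_def)
  also have "\<dots> = (\<integral>\<^sup>+x\<in>{0..1}. ennreal (pw \<delta> x) \<partial>lborel) + I"
    unfolding I by (rule nn_integral_add) measurable
  also have "(\<integral>\<^sup>+x\<in>{0..1}. ennreal (pw \<delta> x) \<partial>lborel) = ennreal (1 / \<delta>)"
    using assms nn_integral_pw(1)[of \<delta> 1] by simp
  finally have le: "ennreal (s powr \<delta> / \<delta>) \<le> ennreal (1 / \<delta>) + I" .
  have "ennreal ((s powr \<delta> - 1) / \<delta>) \<le> I"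
  proof (cases I)
    case (real i)
    then have "ennreal (1 / \<delta>) + I = ennreal (1 / \<delta> + i)" using assms by (subst ennreal_plus) auto
    with le have "ennreal (s powr \<delta> / \<delta>) \<le> ennreal (1 / \<delta> + i)" by (simp only:)
    moreover have "0 \<le> 1 / \<delta> + i" using real assms by simp
    ultimately have "s powr \<delta> / \<delta> \<le> 1 / \<delta> + i" by (simp only: ennreal_le_iff)
    then show ?thesis using real by (simp add: diff_divide_distrib ennreal_leI)
  qed simp
  then show ?thesis by (simp add: I_def)
qed

text \<open>The length \<open>R = exp (1 / \<delta>)\<close> satisfies
  \<open>R powr \<delta> = exp 1\<close>, so the weight of \<open>[0, R + 1]\<close> is at most
  \<open>2 * 3 / \<delta>\<close>.\<close>

lemma wnorm_bump_pw:
  assumes p: "1 \<le> p" and \<delta>: "0 < \<delta>" "\<delta> \<le> 1"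
  shows "wnorm p (pw \<delta>) (\<lambda>x. ennreal (cmod (complex_of_real (bump (exp (1 / \<delta>) + 1) 0 0 x)))) \<le> ennreal ((6 / \<delta>) powr (1 / p))"
proof -
  define R where "R = exp (1 / \<delta>)"
  have R: "1 \<le> R" using \<delta> by (simp add: R_def)
  have b: "0 \<le> bump (R + 1) 0 0 x" "bump (R + 1) 0 0 x \<le> indicator {0..R + 1} x" for x
  proof -
    show "0 \<le> bump (R + 1) 0 0 x" by (simp add: bump_def)
    have "exp (- 1/x - 1/(R + 1 - x)) \<le> 1" if "0 < x" "x < R + 1"
    proof -
      have "0 \<le> 1/x" "0 \<le> 1/(R + 1 - x)" using that by auto
      then have "- 1/x - 1/(R + 1 - x) \<le> 0" unfolding minus_divide_left[symmetric] by linarith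
      then show ?thesis by (simp only: exp_le_one_iff)
    qed
    then show "bump (R + 1) 0 0 x \<le> indicator {0..R + 1} x"
      by (simp add: bump_def indicator_def)
  qed
  have "(\<integral>\<^sup>+x. ennreal (bump (R + 1) 0 0 x) epowr p * ennreal (pw \<delta> x) \<partial>lebesgue)
      \<le> (\<integral>\<^sup>+x. ennreal (pw \<delta> x) * indicator {0..R + 1} x \<partial>lebesgue)"
  proof (intro nn_integral_mono)
    fix x
    have "ennreal (bump (R + 1) 0 0 x) epowr p = ennreal (bump (R + 1) 0 0 x powr p)" using b(1) p by (intro epowr_ennreal) auto
    also have "\<dots> \<le> indicator {0..R + 1} x"
    proof (cases "x \<in> {0..R + 1}")
      case True
      then have "bump (R + 1) 0 0 x powr p \<le> 1" using b[of x] p by (intro powr_le1) auto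
      then show ?thesis using True ennreal_leI[of _ 1] by simp
    next
      case False
      then have "bump (R + 1) 0 0 x = 0" using b[of x] by simp
      then show ?thesis by simp
    qed
    finally show "ennreal (bump (R + 1) 0 0 x) epowr p * ennreal (pw \<delta> x) \<le> ennreal (pw \<delta> x) * indicator {0..R + 1} x"
      by (subst mult.commute) (rule mult_left_mono, simp_all)
  qed
  also have "\<dots> = ennreal ((R + 1) powr \<delta> / \<delta>)"
    unfolding nn_integral_completion using R \<delta> by (intro nn_integral_pw) auto
  also have "\<dots> \<le> ennreal (6 / \<delta>)"
  proof (rule ennreal_leI)
    have "(R + 1) powr \<delta> \<le> (2 * R) powr \<delta>" using R \<delta> by (intro powr_mono2) auto
    also have "\<dots> = 2 powr \<delta> * R powr \<delta>" using R by (simp add: powr_mult)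
    also have "R powr \<delta> = exp 1" using \<delta> by (simp add: R_def exp_powr_real)
    also have "2 powr \<delta> * exp 1 \<le> 2 * 3"
    proof (intro mult_mono exp_le)
      show "2 powr \<delta> \<le> (2::real)" using powr_mono[of \<delta> 1 "2::real"] \<delta> by simp
    qed auto
    finally show "(R + 1) powr \<delta> / \<delta> \<le> 6 / \<delta>" using \<delta> by (intro divide_right_mono) auto
  qed
  finally have le: "(\<integral>\<^sup>+x. ennreal (bump (R + 1) 0 0 x) epowr p * ennreal (pw \<delta> x) \<partial>lebesgue) \<le> ennreal (6 / \<delta>)" .
  have "ennreal (cmod (complex_of_real (bump (R + 1) 0 0 x))) = ennreal (bump (R + 1) 0 0 x)" for x
    using b(1)[of x] by simp
  then have "wnorm p (pw \<delta>) (\<lambda>x. ennreal (cmod (complex_of_real (bump (R + 1) 0 0 x)))) \<le> ennreal (6 / \<delta>) epowr (1 / p)"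
    unfolding wnorm_def by (simp only:) (rule epowr_mono[OF _ le], use p in simp)
  also have "\<dots> = ennreal ((6 / \<delta>) powr (1 / p))" using \<delta> p by (intro epowr_pos) auto
  finally show ?thesis by (simp only: R_def)
qed

text \<open>Up to distance \<open>s\<close>, the square root of the length
  \<open>exp (1 / \<delta>)\<close>, the logarithm keeps half of its size, namely
  \<open>1 / (2 * \<delta>)\<close> minus \<open>ln 2\<close>. Half of this absorbs
  \<open>ln 2\<close> and the boundary term of at most \<open>1/4\<close>, since
  \<open>\<delta> \<le> 1/5\<close> makes \<open>1 / (4 * \<delta>)\<close> at least
  \<open>5/4\<close>.\<close>

lemma unit_piece_lower_log:
  assumes \<delta>: "0 < \<delta>" "\<delta> \<le> 1/5" and x: "- exp (1 / (2 * \<delta>)) \<le> x" "x \<le> -1"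
  shows "ennreal (exp (-2) / (8 * pi) / \<delta>) \<le> ennreal (cmod (freq_piece {0..1} (\<lambda>x. complex_of_real (bump (exp (1 / \<delta>) + 1) 0 0 x)) x))"
proof -
  define s where "s = exp (1 / (2 * \<delta>))"
  have s1: "1 \<le> s" using \<delta> by (simp add: s_def)
  have R: "exp (1 / \<delta>) = s * s" using \<delta> by (simp add: s_def exp_add[symmetric] field_simps)
  have R1: "1 \<le> exp (1 / \<delta>)" using \<delta> by simp
  have "s / 2 \<le> (exp (1 / \<delta>) - x) / (1 - x)"
  proof -
    have "s * (1 - x) \<le> s * (2 * s)" using s1 x by (intro mult_left_mono) (auto simp: s_def)
    also have "\<dots> \<le> 2 * (s * s - x)" using x by simp
    finally show ?thesis using x by (simp add: R field_simps)
  qed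
  then have "ln (s / 2) \<le> ln ((exp (1 / \<delta>) - x) / (1 - x))" using s1 by (intro ln_mono) auto
  moreover have "ln (s / 2) = 1 / (2 * \<delta>) - ln 2" using s1 by (simp add: ln_div s_def)
  moreover have "ln (2::real) \<le> 1" using ln_add_one_self_le_self[of 1] by simp
  moreover have "1 / (pi * (1 - x)) \<le> 1 / 4"
  proof -
    have "2 * 2 \<le> pi * (1 - x)" using x pi_ge_two by (intro mult_mono) auto
    then show ?thesis by (intro divide_left_mono) auto
  qed
  moreover have "5 / 4 \<le> 1 / (4 * \<delta>)" using \<delta> by (simp add: field_simps)
  moreover have "1 / (2 * \<delta>) = 1 / (4 * \<delta>) + 1 / (4 * \<delta>)" using \<delta> by (simp add: field_simps)
  ultimately have "1 / (4 * \<delta>) \<le> ln ((exp (1 / \<delta>) - x) / (1 - x)) - 1 / (pi * (1 - x))" by linarith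
  then have "exp (-2) / (2 * pi) * (1 / (4 * \<delta>)) \<le> exp (-2) / (2 * pi) * (ln ((exp (1 / \<delta>) - x) / (1 - x)) - 1 / (pi * (1 - x)))"
    by (rule mult_left_mono) simp
  then have "ennreal (exp (-2) / (8 * pi) / \<delta>) \<le> ennreal (exp (-2) / (2 * pi) * (ln ((exp (1 / \<delta>) - x) / (1 - x)) - 1 / (pi * (1 - x))))"
    by (intro ennreal_leI) simp
  also note unit_piece_lower[OF R1 x(2)]
  finally show ?thesis .
qed

text \<open>The weighted masses on the two sides of the origin, at least
  \<open>1 / (2 * \<delta>)\<close> and at most \<open>6 / \<delta>\<close>, are of the same order,
  so the growth \<open>1 / \<delta>\<close> of the transform passes to the norm. The ratio of the
  masses costs \<open>(1 / 12) powr (1 / p)\<close>, at least \<open>1 / 12\<close>, and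
  \<open>96 = 8 * 12\<close>.\<close>

lemma op_norm_unit_ge:
  assumes p: "1 \<le> p" and \<delta>: "0 < \<delta>" "\<delta> \<le> 1/5"
  shows "ennreal (exp (-2) / (96 * pi) / \<delta>) \<le> op_norm p (pw \<delta>) (square_function unit_family)"
proof -
  define c where "c = exp (-2) / (8 * pi) / \<delta>"
  have c0: "0 < c" using \<delta> by (simp add: c_def)
  define f where "f = (\<lambda>x. complex_of_real (bump (exp (1 / \<delta>) + 1) 0 0 x))"
  define s where "s = exp (1 / (2 * \<delta>))"
  have s1: "1 \<le> s" using \<delta> by (simp add: s_def)
  have "ennreal (c powr p * (1 / (2 * \<delta>))) = ennreal (c powr p) * ennreal (1 / (2 * \<delta>))" using \<delta> by (intro ennreal_mult) auto
  also have "\<dots> \<le> ennreal (c powr p) * (\<integral>\<^sup>+x\<in>{-s..-1}. ennreal (pw \<delta> x) \<partial>lborel)"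
  proof (intro mult_left_mono)
    have "s powr \<delta> = exp (1 / 2)" using \<delta> by (simp add: s_def exp_powr_real)
    then have "1 / 2 \<le> s powr \<delta> - 1" using exp_ge_add_one_self[of "1/2"] by simp
    then have "1 / 2 / \<delta> \<le> (s powr \<delta> - 1) / \<delta>" using \<delta> by (intro divide_right_mono) auto
    then have "ennreal (1 / (2 * \<delta>)) \<le> ennreal ((s powr \<delta> - 1) / \<delta>)" by (intro ennreal_leI) simp
    also note nn_integral_pw_left[OF \<delta>(1) s1]
    finally show "ennreal (1 / (2 * \<delta>)) \<le> (\<integral>\<^sup>+x\<in>{-s..-1}. ennreal (pw \<delta> x) \<partial>lborel)" .
  qed simp
  also have "\<dots> = (\<integral>\<^sup>+x. ennreal (c powr p) * (ennreal (pw \<delta> x) * indicator {-s..-1} x) \<partial>lebesgue)"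
    unfolding nn_integral_completion by (intro nn_integral_cmult[symmetric]) measurable
  also have "\<dots> \<le> (\<integral>\<^sup>+x. square_function unit_family f x epowr p * ennreal (pw \<delta> x) \<partial>lebesgue)"
  proof (intro nn_integral_mono)
    fix x
    show "ennreal (c powr p) * (ennreal (pw \<delta> x) * indicator {-s..-1} x) \<le> square_function unit_family f x epowr p * ennreal (pw \<delta> x)"
    proof (cases "x \<in> {-s..-1}")
      case True
      then have "ennreal c \<le> square_function unit_family f x"
        unfolding square_function_unit c_def f_def using \<delta> by (intro unit_piece_lower_log) (auto simp: s_def)
      then have "ennreal c epowr p \<le> square_function unit_family f x epowr p" using p by (intro epowr_mono) auto
      moreover have "ennreal c epowr p = ennreal (c powr p)" using c0 p by (intro epowr_pos) auto
      ultimately have "ennreal (c powr p) \<le> square_function unit_family f x epowr p" by (simp only:)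
      then have "ennreal (c powr p) * ennreal (pw \<delta> x) \<le> square_function unit_family f x epowr p * ennreal (pw \<delta> x)"
        by (rule mult_right_mono) simp
      then show ?thesis using True by simp
    qed simp
  qed
  finally have "ennreal (c powr p * (1 / (2 * \<delta>))) epowr (1 / p) \<le> wnorm p (pw \<delta>) (square_function unit_family f)"
    unfolding wnorm_def using p by (intro epowr_mono) auto
  moreover have "ennreal (c powr p * (1 / (2 * \<delta>))) epowr (1 / p) = ennreal ((c powr p * (1 / (2 * \<delta>))) powr (1 / p))"
    using c0 \<delta> p by (intro epowr_pos) auto
  moreover have "(c powr p * (1 / (2 * \<delta>))) powr (1 / p) = c * (1 / (2 * \<delta>)) powr (1 / p)"
  proof -
    have "(c powr p * (1 / (2 * \<delta>))) powr (1 / p) = (c powr p) powr (1 / p) * (1 / (2 * \<delta>)) powr (1 / p)"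
      using \<delta> by (intro powr_mult)
    moreover have "(c powr p) powr (1 / p) = c" using c0 p by (simp add: powr_powr)
    ultimately show ?thesis by (simp only:)
  qed
  ultimately have n: "ennreal (c * (1 / (2 * \<delta>)) powr (1 / p)) \<le> wnorm p (pw \<delta>) (square_function unit_family f)" by (simp only:)
  have "ennreal (c * (1 / (2 * \<delta>)) powr (1 / p) / (6 / \<delta>) powr (1 / p)) \<le> op_norm p (pw \<delta>) (square_function unit_family)"
  proof (rule op_norm_lower[where f=f])
    show "test_function f" unfolding f_def by (rule test_function_bump)
    show "0 < (6 / \<delta>) powr (1 / p)" using \<delta> by simp
    show "wnorm p (pw \<delta>) (\<lambda>x. ennreal (cmod (f x))) \<le> ennreal ((6 / \<delta>) powr (1 / p))"
      unfolding f_def using \<delta> by (intro wnorm_bump_pw p) auto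
    show "ennreal (c * (1 / (2 * \<delta>)) powr (1 / p)) \<le> wnorm p (pw \<delta>) (square_function unit_family f)" by (rule n)
  qed
  moreover have "exp (-2) / (96 * pi) / \<delta> \<le> c * (1 / (2 * \<delta>)) powr (1 / p) / (6 / \<delta>) powr (1 / p)"
  proof -
    have "(1 / (2 * \<delta>)) powr (1 / p) / (6 / \<delta>) powr (1 / p) = (1 / 12) powr (1 / p)"
      using \<delta> by (subst powr_divide[symmetric]) (auto simp: field_simps)
    moreover have "(1 / 12) powr 1 \<le> (1 / 12 :: real) powr (1 / p)" using p by (intro powr_mono') auto
    ultimately have "1 / 12 \<le> (1 / (2 * \<delta>)) powr (1 / p) / (6 / \<delta>) powr (1 / p)" by simp
    then have "c * (1 / 12) \<le> c * ((1 / (2 * \<delta>)) powr (1 / p) / (6 / \<delta>) powr (1 / p))" using c0 by (intro mult_left_mono) auto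
    then show ?thesis by (simp add: c_def)
  qed
  ultimately show ?thesis by (meson ennreal_leI order_trans)
qed

text \<open>For positive \<open>\<beta>\<close> the power is increasing and the upper bound for the
  characteristic applies; for negative \<open>\<beta>\<close> it is decreasing and the lower bound
  gives a constant, whence \<open>max \<beta> 0\<close>.\<close>

lemma Aq_pw_epowr_le:
  assumes q: "1 < q"
  obtains M where "0 \<le> M" "\<And>\<delta>. 0 < \<delta> \<Longrightarrow> \<delta> < 1 \<Longrightarrow> Aq_const q (pw \<delta>) epowr \<beta> \<le> ennreal (M * (1 / \<delta>) powr max \<beta> 0)"
proof (cases "0 < \<beta>")
  case True
  show ?thesis
  proof (rule that[of "4 powr \<beta>"])
    fix \<delta> :: real assume \<delta>: "0 < \<delta>" "\<delta> < 1"
    have "Aq_const q (pw \<delta>) epowr \<beta> \<le> ennreal (4 / \<delta>) epowr \<beta>"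
      using True by (intro epowr_mono Aq_pw_le q \<delta>) auto
    also have "\<dots> = ennreal ((4 / \<delta>) powr \<beta>)" using \<delta> True by (intro epowr_pos) auto
    also have "(4 / \<delta>) powr \<beta> = 4 powr \<beta> * (1 / \<delta>) powr max \<beta> 0" using \<delta> True by (simp add: powr_mult[symmetric])
    finally show "Aq_const q (pw \<delta>) epowr \<beta> \<le> ennreal (4 powr \<beta> * (1 / \<delta>) powr max \<beta> 0)" .
  qed simp
next
  case False
  show ?thesis
  proof (rule that[of "(1/2) powr \<beta>"])
    fix \<delta> :: real assume \<delta>: "0 < \<delta>" "\<delta> < 1"
    have "Aq_const q (pw \<delta>) \<le> ennreal (4 / \<delta>)" by (rule Aq_pw_le[OF q \<delta>])
    then obtain A where A: "Aq_const q (pw \<delta>) = ennreal A" "0 \<le> A"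
      by (cases "Aq_const q (pw \<delta>)") (auto simp: top_unique)
    have "ennreal (1 / 2) \<le> ennreal A" using Aq_pw_ge[OF q \<delta>] by (simp only: A)
    then have A2: "1 / 2 \<le> A" using A(2) by (simp only: ennreal_le_iff)
    have "ennreal A epowr \<beta> \<le> ennreal ((1/2) powr \<beta>)"
    proof (cases "\<beta> = 0")
      case False
      then have "ennreal A epowr \<beta> = ennreal (A powr \<beta>)" using A2 by (intro epowr_pos) auto
      also have "\<dots> \<le> ennreal ((1/2) powr \<beta>)" using A2 \<open>\<not> 0 < \<beta>\<close> by (intro ennreal_leI powr_mono2') auto
      finally show ?thesis .
    qed (simp add: epowr_def)
    then show "Aq_const q (pw \<delta>) epowr \<beta> \<le> ennreal ((1/2) powr \<beta> * (1 / \<delta>) powr max \<beta> 0)" using False \<delta> by (simp add: A)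
  qed simp
qed

text \<open>With \<open>t = 1 / \<delta>\<close> the assumed estimate reads
  \<open>c * t \<le> max C 0 * (M * t powr b)\<close> with \<open>b = max \<beta> 0\<close> below 1,
  and this fails for large \<open>t\<close>.\<close>

lemma exponent_one_sharp:
  assumes p: "2 < p" and \<beta>: "\<beta> < 1" and B: "1 \<le> B"
    and bound: "\<forall>\<Omega>. interval_family \<Omega> \<longrightarrow> overlap_le B \<Omega> \<longrightarrow>
      (\<forall>w \<in> A_class (p / 2). op_norm p w (square_function \<Omega>) \<le> ennreal C * Aq_const (p / 2) w epowr \<beta>)"
  shows False
proof -
  have q: "1 < p / 2" using p by simp
  obtain M where M: "0 \<le> M" "\<And>\<delta>. 0 < \<delta> \<Longrightarrow> \<delta> < 1 \<Longrightarrow> Aq_const (p / 2) (pw \<delta>) epowr \<beta> \<le> ennreal (M * (1 / \<delta>) powr max \<beta> 0)"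
    using Aq_pw_epowr_le[OF q] by metis
  define b where "b = max \<beta> 0"
  have b: "0 < 1 - b" using \<beta> by (simp add: b_def)
  define c where "c = exp (-2) / (96 * pi)"
  have c0: "0 < c" by (simp add: c_def)
  define L where "L = max C 0 * M / c + 1"
  have L1: "1 \<le> L" using M c0 by (simp add: L_def)
  \<comment> \<open>The entry 5 ensures \<open>\<delta> \<le> 1/5\<close>; the other one makes
    \<open>t powr (1 - b)\<close> at least \<open>L\<close>, one more than the estimate
    allows.\<close>
  define t where "t = max 5 (L powr (1 / (1 - b)))"
  have t5: "5 \<le> t" by (simp add: t_def)
  have "L = (L powr (1 / (1 - b))) powr (1 - b)" using b L1 by (simp add: powr_powr)
  also have "\<dots> \<le> t powr (1 - b)" using b by (intro powr_mono2) (auto simp: t_def)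
  finally have tL: "L \<le> t powr (1 - b)" .
  define \<delta> where "\<delta> = 1 / t"
  have \<delta>: "0 < \<delta>" "\<delta> \<le> 1 / 5" "\<delta> < 1" using t5 by (auto simp: \<delta>_def field_simps)
  have "ennreal (c * t) \<le> op_norm p (pw \<delta>) (square_function unit_family)"
    using op_norm_unit_ge[of p \<delta>] p \<delta> by (simp add: c_def \<delta>_def)
  also have "\<dots> \<le> ennreal C * Aq_const (p / 2) (pw \<delta>) epowr \<beta>"
    using bound interval_family_unit overlap_le_unit[OF B] pw_A_class[OF q \<delta>(1,3)] by blast
  also have "\<dots> \<le> ennreal (max C 0) * ennreal (M * t powr b)"
    using M(2)[OF \<delta>(1,3)] by (intro mult_mono ennreal_leI) (auto simp: b_def \<delta>_def)
  also have "\<dots> = ennreal (max C 0 * (M * t powr b))" using M(1) by (intro ennreal_mult[symmetric]) auto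
  finally have "c * t \<le> max C 0 * (M * t powr b)" using M(1) by (subst (asm) ennreal_le_iff) auto
  moreover have "t = t powr (1 - b) * t powr b" using t5 by (simp add: powr_add[symmetric])
  ultimately have "c * t powr (1 - b) * t powr b \<le> max C 0 * M * t powr b" by (simp only: mult.assoc)
  then have "c * t powr (1 - b) \<le> max C 0 * M" using t5 by (subst (asm) mult_le_cancel_right_pos) auto
  then have "t powr (1 - b) \<le> max C 0 * M / c" using c0 by (simp add: field_simps)
  with tL show False by (simp add: L_def)
qed

theorem corollary1p5:
  shows
    "(\<forall>p::real. 2 < p \<longrightarrow> (\<forall>B::real. \<exists>C::real.
        \<forall>\<Omega>. interval_family \<Omega> \<longrightarrow> overlap_le B \<Omega> \<longrightarrow>
          (\<forall>w \<in> A_class (p / 2).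
             op_norm p w (square_function \<Omega>)
               \<le> ennreal C * Aq_const (p / 2) w epowr (max (1 / (p - 2)) 1))))
     \<and> (\<forall>p::real. 3 \<le> p \<longrightarrow>
          max (1 / (p - 2)) 1 = 1 \<and>
          (\<forall>\<beta>::real. \<beta> < 1 \<longrightarrow> (\<forall>B::real. 1 \<le> B \<longrightarrow>
             \<not> (\<exists>C'::real. \<forall>\<Omega>. interval_family \<Omega> \<longrightarrow> overlap_le B \<Omega> \<longrightarrow>
                  (\<forall>w \<in> A_class (p / 2).
                     op_norm p w (square_function \<Omega>)
                       \<le> ennreal C' * Aq_const (p / 2) w epowr \<beta>)))))"
proof (intro conjI allI impI)
  fix p B :: real assume "2 < p"
  then show "\<exists>C::real. \<forall>\<Omega>. interval_family \<Omega> \<longrightarrow> overlap_le B \<Omega> \<longrightarrow>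
      (\<forall>w \<in> A_class (p / 2). op_norm p w (square_function \<Omega>) \<le> ennreal C * Aq_const (p / 2) w epowr (max (1 / (p - 2)) 1))"
    by (rule weighted_upper_bound)
next
  fix p :: real assume p: "3 \<le> p"
  then show "max (1 / (p - 2)) 1 = 1" by (simp add: field_simps)
  fix \<beta> B :: real assume "\<beta> < 1" "1 \<le> B"
  note sharp = exponent_one_sharp[OF _ this]
  show "\<not> (\<exists>C'::real. \<forall>\<Omega>. interval_family \<Omega> \<longrightarrow> overlap_le B \<Omega> \<longrightarrow>
      (\<forall>w \<in> A_class (p / 2). op_norm p w (square_function \<Omega>) \<le> ennreal C' * Aq_const (p / 2) w epowr \<beta>))"
  proof
    assume "\<exists>C'::real. \<forall>\<Omega>. interval_family \<Omega> \<longrightarrow> overlap_le B \<Omega> \<longrightarrow>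
      (\<forall>w \<in> A_class (p / 2). op_norm p w (square_function \<Omega>) \<le> ennreal C' * Aq_const (p / 2) w epowr \<beta>)"
    then obtain C' where "\<forall>\<Omega>. interval_family \<Omega> \<longrightarrow> overlap_le B \<Omega> \<longrightarrow>
      (\<forall>w \<in> A_class (p / 2). op_norm p w (square_function \<Omega>) \<le> ennreal C' * Aq_const (p / 2) w epowr \<beta>)" ..
    from sharp[OF _ this] p show False by simp
  qed
qed

end
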